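(* Let $B\not\equiv0$ be a real-valued radial function on $\mathbb{R}^2$, $B(x)=B(|x|)$, with $B\in L^1(\mathbb{R}_+,(1+r)\,dr)$, and assume that its total flux satisfies $\Phi\in\mathbb{Z}$. Let $V\ge0$ satisfy $V\in L^1(\mathbb{R}^2,|\log|x||\,dx)$ and $V\in L^1(\mathbb{R}_+,L^\infty(\mathbb{S}^1))$. Then the quadratic form $$\int_{\mathbb{R}^2}\big(|(i\nabla+A)u|^2-V|u|^2\big)\,dx,\qquad u\in C_0^\infty(\mathbb{R}^2),$$ is closable, and there exists a constant $C_2=C_2(B)$, independent of $V$, such that $$N(H_B-V,0)\le C_2\big(\|V\log|x|\|_{L^1(\mathbb{R}^2)}+\|V\|_{L^1(\mathbb{R}_+,L^\infty(\mathbb{S}^1))}\big).$$ In particular, if $V(x)=V(|x|)$, then $$N(H_B-V,0)\le C_2\big(\|V\log|x|\|_{L^1(\mathbb{R}^2)}+\|V\|_{L^1(\mathbb{R}^2)}\big).$$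
   Context: In polar coordinates $(r,\theta)$, $\|V\|_{L^1(\mathbb{R}_+,L^\infty(\mathbb{S}^1))}=\int_0^\infty\tilde V(r)\,r\,dr$ with $\tilde V(r)=\operatorname{ess\,sup}_{0\le\theta\le2\pi}|V(r,\theta)|$, and $V\in L^1(\mathbb{R}_+,L^\infty(\mathbb{S}^1))$ means this is finite. The flux is $\Phi(r)=\frac1{2\pi}\int_{\{|x|\le r\}}B\,dx=\int_0^rB(t)\,t\,dt$ and the total flux is $\Phi=\frac1{2\pi}\int_{\mathbb{R}^2}B\,dx$. The vector potential $A$, with $\operatorname{curl}A=B$, is $A(r,\theta)=\frac{\Phi(r)}{r}(-\sin\theta,\cos\theta)$. $H_B-V$ is the Friedrichs extension in $L^2(\mathbb{R}^2)$ of the operator generated by the form $\int(|(i\nabla+A)u|^2-V|u|^2)\,dx$, $u\in C_0^\infty(\mathbb{R}^2)$ (complex-valued), defined when the form is bounded from below. "Closable" is understood in the sense of semibounded forms, i.e. the form is bounded from below and closable. For a self-adjoint operator $T$ in $L^2(\mathbb{R}^2)$, $N(T,s)$ denotes the number of discrete eigenvalues of $T$ below $s$, counted with multiplicities. *)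

theory Defs
  imports "HOL-Analysis.Analysis" "HOL-Probability.Essential_Supremum"
begin

type_synonym wavefun = "real^2 \<Rightarrow> complex"

section \<open>The Hilbert space of square-integrable functions on the plane\<close>

text \<open>
  Elements of the Hilbert space are represented by functions; two functions represent the same
  element iff they agree almost everywhere.  The inner product is antilinear in its first argument.
\<close>

definition L2 :: "wavefun set" where
  "L2 = {u \<in> borel_measurable lebesgue. integrable lebesgue (\<lambda>x. (norm (u x))\<^sup>2)}"

definition l2_inner :: "wavefun \<Rightarrow> wavefun \<Rightarrow> complex" where
  "l2_inner u v = (LINT x|lebesgue. cnj (u x) * v x)"

definition l2_norm :: "wavefun \<Rightarrow> real" where
  "l2_norm u = sqrt (LINT x|lebesgue. (norm (u x))\<^sup>2)"

section \<open>Semibounded forms and the associated operators\<close>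

definition semibounded_form :: "wavefun set \<Rightarrow> (wavefun \<Rightarrow> wavefun \<Rightarrow> complex) \<Rightarrow> bool" where
  "semibounded_form D q \<longleftrightarrow>
     D \<subseteq> L2 \<and> D \<noteq> {} \<and>
     (\<forall>u\<in>D. \<forall>v\<in>D. \<forall>a b. (\<lambda>x. a * u x + b * v x) \<in> D) \<and>
     (\<forall>w\<in>D. \<forall>u\<in>D. \<forall>v\<in>D. \<forall>a b. q w (\<lambda>x. a * u x + b * v x) = a * q w u + b * q w v) \<and>
     (\<forall>u\<in>D. \<forall>v\<in>D. q v u = cnj (q u v)) \<and>
     (\<exists>c::real. \<forall>u\<in>D. c * (l2_norm u)\<^sup>2 \<le> Re (q u u))"

text \<open>
  Closedness makes the domain saturated under equality almost everywhere: if \<open>u\<close> vanishes almost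
  everywhere, apply the condition to the constant sequence \<open>0\<close> and the limit \<open>u\<close>.
\<close>

definition closed_form :: "wavefun set \<Rightarrow> (wavefun \<Rightarrow> wavefun \<Rightarrow> complex) \<Rightarrow> bool" where
  "closed_form D q \<longleftrightarrow>
     semibounded_form D q \<and>
     (\<forall>U u. (\<forall>n::nat. U n \<in> D) \<and> u \<in> L2 \<and>
        (\<lambda>n. l2_norm (\<lambda>x. U n x - u x)) \<longlonglongrightarrow> 0 \<and>
        (\<forall>e>0. \<exists>M. \<forall>m\<ge>M. \<forall>n\<ge>M. norm (q (\<lambda>x. U m x - U n x) (\<lambda>x. U m x - U n x)) < e)
        \<longrightarrow> u \<in> D \<and> (\<lambda>n. q (\<lambda>x. U n x - u x) (\<lambda>x. U n x - u x)) \<longlonglongrightarrow> 0)"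

definition form_extends ::
  "wavefun set \<Rightarrow> (wavefun \<Rightarrow> wavefun \<Rightarrow> complex) \<Rightarrow>
   wavefun set \<Rightarrow> (wavefun \<Rightarrow> wavefun \<Rightarrow> complex) \<Rightarrow> bool" where
  "form_extends D' q' D q \<longleftrightarrow> D \<subseteq> D' \<and> (\<forall>u\<in>D. \<forall>v\<in>D. q' u v = q u v)"

definition closable_form :: "wavefun set \<Rightarrow> (wavefun \<Rightarrow> wavefun \<Rightarrow> complex) \<Rightarrow> bool" where
  "closable_form D q \<longleftrightarrow>
     semibounded_form D q \<and> (\<exists>D' q'. closed_form D' q' \<and> form_extends D' q' D q)"

definition is_form_closure ::
  "wavefun set \<Rightarrow> (wavefun \<Rightarrow> wavefun \<Rightarrow> complex) \<Rightarrow>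
   wavefun set \<Rightarrow> (wavefun \<Rightarrow> wavefun \<Rightarrow> complex) \<Rightarrow> bool" where
  "is_form_closure D' q' D q \<longleftrightarrow>
     closed_form D' q' \<and> form_extends D' q' D q \<and>
     (\<forall>D'' q''. closed_form D'' q'' \<and> form_extends D'' q'' D q \<longrightarrow> form_extends D'' q'' D' q')"

text \<open>
  Operators are given by their graphs, which contain all representatives of the elements involved.
  The operator of a closed form is the one of the first representation theorem; the Friedrichs
  operator of a closable form is the operator of its closure.  The closure of a form determines its
  domain, and its values on that domain, uniquely, so at most one operator enters the union below.
\<close>

type_synonym l2_operator = "(wavefun \<times> wavefun) set"

definition form_operator :: "wavefun set \<Rightarrow> (wavefun \<Rightarrow> wavefun \<Rightarrow> complex) \<Rightarrow> l2_operator" where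
  "form_operator D q = {(u, f). u \<in> D \<and> f \<in> L2 \<and> (\<forall>v\<in>D. q v u = l2_inner v f)}"

definition friedrichs :: "wavefun set \<Rightarrow> (wavefun \<Rightarrow> wavefun \<Rightarrow> complex) \<Rightarrow> l2_operator" where
  "friedrichs D q = (\<Union>(D', q') \<in> {(D', q'). is_form_closure D' q' D q}. form_operator D' q')"

section \<open>Discrete eigenvalues\<close>

text \<open>
  The a priori estimate expresses both injectivity and boundedness of the inverse.
\<close>

definition resolvent_set :: "l2_operator \<Rightarrow> complex set" where
  "resolvent_set T = {z.
     (\<forall>g\<in>L2. \<exists>(u, f)\<in>T. AE x in lebesgue. f x - z * u x = g x) \<and>
     (\<exists>K::real. \<forall>(u, f)\<in>T. l2_norm u \<le> K * l2_norm (\<lambda>x. f x - z * u x))}"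

definition spectrum :: "l2_operator \<Rightarrow> complex set" where
  "spectrum T = - resolvent_set T"

definition eigenspace :: "l2_operator \<Rightarrow> complex \<Rightarrow> wavefun set" where
  "eigenspace T z = {u. (u, \<lambda>x. z * u x) \<in> T}"

text \<open>Complex dimension of the space of classes modulo equality almost everywhere.\<close>

definition ae_independent :: "nat \<Rightarrow> (nat \<Rightarrow> wavefun) \<Rightarrow> bool" where
  "ae_independent n e \<longleftrightarrow>
     (\<forall>c::nat \<Rightarrow> complex. (AE x in lebesgue. (\<Sum>k<n. c k * e k x) = 0) \<longrightarrow> (\<forall>k<n. c k = 0))"

definition ae_dim :: "wavefun set \<Rightarrow> enat" where
  "ae_dim E = (SUP n \<in> {n. \<exists>e. (\<forall>k<n. e k \<in> E) \<and> ae_independent n e}. enat n)"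

definition discrete_eigenvalues :: "l2_operator \<Rightarrow> real set" where
  "discrete_eigenvalues T = {l.
     0 < ae_dim (eigenspace T (of_real l)) \<and> ae_dim (eigenspace T (of_real l)) < \<infinity> \<and>
     complex_of_real l isolated_in spectrum T}"

definition num_eigenvalues_below :: "l2_operator \<Rightarrow> real \<Rightarrow> ennreal" where
  "num_eigenvalues_below T s =
     (\<Sum>\<^sub>\<infinity>l\<in>{l \<in> discrete_eigenvalues T. l < s}. ennreal_of_enat (ae_dim (eigenspace T (of_real l))))"

section \<open>Radial functions and norms of potentials\<close>

definition radial :: "(real^2 \<Rightarrow> real) \<Rightarrow> bool" where
  "radial F \<longleftrightarrow> (\<forall>x y. norm x = norm y \<longrightarrow> F x = F y)"

definition polar :: "real \<Rightarrow> real \<Rightarrow> real^2" where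
  "polar r \<theta> = vector [r * cos \<theta>, r * sin \<theta>]"

definition profile :: "(real^2 \<Rightarrow> real) \<Rightarrow> real \<Rightarrow> real" where
  "profile F r = F (polar r 0)"

definition L1_norm :: "(real^2 \<Rightarrow> real) \<Rightarrow> ennreal" where
  "L1_norm F = (\<integral>\<^sup>+x. ennreal \<bar>F x\<bar> \<partial>lebesgue)"

text \<open>
  For Lebesgue measurable \<open>V\<close> the angular sections are measurable for almost every \<open>r\<close> only; on the
  exceptional null set \<^const>\<open>esssup\<close> is \<open>\<infinity>\<close> by convention, which does not affect the integral.
\<close>

definition L1_Linfty_norm :: "(real^2 \<Rightarrow> real) \<Rightarrow> ennreal" where
  "L1_Linfty_norm V =
     (\<integral>\<^sup>+r\<in>{0<..}. esssup (lebesgue_on {0..2*pi}) (\<lambda>\<theta>. ennreal \<bar>V (polar r \<theta>)\<bar>) * ennreal r \<partial>lebesgue)"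

section \<open>The magnetic Schroedinger form\<close>

definition flux :: "(real^2 \<Rightarrow> real) \<Rightarrow> real \<Rightarrow> real" where
  "flux B r = (LINT x:cball 0 r|lebesgue. B x) / (2 * pi)"

definition total_flux :: "(real^2 \<Rightarrow> real) \<Rightarrow> real" where
  "total_flux B = (LINT x|lebesgue. B x) / (2 * pi)"

text \<open>At a point \<open>x \<noteq> 0\<close> with polar angle \<open>\<theta>\<close>, \<open>(- sin \<theta>, cos \<theta>)\<close> is \<open>(- x\<^sub>2, x\<^sub>1) / |x|\<close>.\<close>

definition vector_potential :: "(real^2 \<Rightarrow> real) \<Rightarrow> real^2 \<Rightarrow> real^2" where
  "vector_potential B x =
     (flux B (norm x) / norm x) *\<^sub>R vector [- (x $ 2) / norm x, x $ 1 / norm x]"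

definition partial :: "2 \<Rightarrow> wavefun \<Rightarrow> wavefun" where
  "partial j u x = frechet_derivative u (at x) (axis j 1)"

text \<open>
  Smoothness: all iterated partial derivatives exist and are (totally) differentiable, hence
  continuous.
\<close>

definition test_functions :: "wavefun set" where
  "test_functions = {u.
     (\<forall>js. \<forall>x. foldr partial js u differentiable (at x)) \<and> compact (closure {x. u x \<noteq> 0})}"

definition magnetic_grad :: "(real^2 \<Rightarrow> real^2) \<Rightarrow> 2 \<Rightarrow> wavefun \<Rightarrow> wavefun" where
  "magnetic_grad A j u x = \<i> * partial j u x + of_real (A x $ j) * u x"

text \<open>
  The sesquilinear form whose diagonal is \<open>\<integral> |(i \<nabla> + A) u|\<^sup>2 - V |u|\<^sup>2\<close>.
\<close>

definition schroedinger_form ::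
  "(real^2 \<Rightarrow> real) \<Rightarrow> (real^2 \<Rightarrow> real) \<Rightarrow> wavefun \<Rightarrow> wavefun \<Rightarrow> complex" where
  "schroedinger_form B V u v =
     (LINT x|lebesgue.
        (\<Sum>j\<in>UNIV. cnj (magnetic_grad (vector_potential B) j u x) *
                  magnetic_grad (vector_potential B) j v x)
        - of_real (V x) * (cnj (u x) * v x))"

definition magnetic_schroedinger :: "(real^2 \<Rightarrow> real) \<Rightarrow> (real^2 \<Rightarrow> real) \<Rightarrow> l2_operator" where
  "magnetic_schroedinger B V = friedrichs test_functions (schroedinger_form B V)"

end

theory Submission
  imports Defs "HOL-Probability.Distribution_Functions"
begin

text \<open>
  In coordinates \<open>x = exp t (cos \<theta>, sin \<theta>)\<close> the form of \<open>H\<^sub>B\<close> decouples into the forms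
  \<open>\<integral> |F'|\<^sup>2 + (\<Phi>(exp t) - m)\<^sup>2 |F|\<^sup>2 dt\<close> of the Fourier modes \<open>F\<^sub>m\<close>. It suffices to find a finite set
  \<open>S\<close> of pairs \<open>(s, m)\<close>, of size controlled by the norms of \<open>V\<close>, such that
  \<open>\<integral> V |u|\<^sup>2 \<le> h[u] + K \<Sum>\<^sub>S |F\<^sub>m(s)|\<^sup>2\<close>: eigenvectors spanning a space of dimension larger than the size of \<open>S\<close>
  would contain a nonzero vector with \<open>F\<^sub>m(s) = 0\<close> on \<open>S\<close>. For large \<open>|m|\<close> the barrier is at least
  \<open>m\<^sup>2 / 4\<close>; the line is cut into intervals of length \<open>l\<close> with \<open>l \<integral> W\<close> bounded above and below, where
  \<open>W(t) = exp (2 t) sup\<^sub>\<theta> V\<close>, and an interval costs the modes with \<open>|m| < 1 / l\<close>, about \<open>2 / l\<close> of them,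
  hence at most a multiple of \<open>\<integral> W\<close>. The finitely many remaining modes have a
  barrier that does not vanish identically because \<open>B\<close> does not, which gives a Hardy inequality
  \<open>|F(t)|\<^sup>2 \<le> H (1 + |t|) h\<^sub>m[F]\<close> and a Bargmann-type count; only the angular average of \<open>V\<close> enters there.
  The same estimate for \<open>2 V\<close> shows that the potential is form bounded with relative bound below one.
\<close>

section \<open>Nonnegative sesquilinear forms\<close>

text \<open>The bound must be linear in the norms of \<open>V\<close>, without an additive constant,
  and this shapes every estimate: where the norms are small, the set \<open>S\<close> has to be
  empty. On the other hand only the cardinality of \<open>S\<close> is counted. The factor
  \<open>K\<close> may depend on \<open>V\<close> in any way, because the functionals vanish on the
  vectors that are tested. For the low modes the obstacle is that the barrier gives no uniform
  positivity; for \<open>m = 0\<close> it tends to zero at the origin, as the flux does. A window on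
  which the barrier is positive still anchors \<open>F\<close>, and away from it
  \<open>|F(t)|^2\<close> grows at most linearly in \<open>|t|\<close>. This growth is the source of
  the weight \<open>|log |x||\<close>. The potential couples the modes. A trigonometric polynomial
  with a fixed number of modes is bounded pointwise by its coefficients, so the low part sees only
  the angular average of \<open>V\<close>. The infinitely many high modes are controlled in mean
  square only, by Parseval, and this brings in the supremum over the angle.\<close>

locale positive_form =
  fixes D :: "('a \<Rightarrow> complex) set" and a :: "('a \<Rightarrow> complex) \<Rightarrow> ('a \<Rightarrow> complex) \<Rightarrow> complex"
  assumes nonempty: "D \<noteq> {}"
    and lincomb: "u \<in> D \<Longrightarrow> v \<in> D \<Longrightarrow> (\<lambda>x. \<alpha> * u x + \<beta> * v x) \<in> D"
    and linear_right: "w \<in> D \<Longrightarrow> u \<in> D \<Longrightarrow> v \<in> D \<Longrightarrow> a w (\<lambda>x. \<alpha> * u x + \<beta> * v x) = \<alpha> * a w u + \<beta> * a w v"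
    and hermitian: "u \<in> D \<Longrightarrow> v \<in> D \<Longrightarrow> a v u = cnj (a u v)"
    and nonneg: "u \<in> D \<Longrightarrow> 0 \<le> Re (a u u)"
begin

text \<open>Only a seminorm: elements are functions, not classes, so \<open>nrm u = 0\<close> does
  not make \<open>u\<close> the zero function. The same calculus is used for
  \<open>l2_inner\<close>, for the shifted form and for its closure.\<close>

definition nrm :: "('a \<Rightarrow> complex) \<Rightarrow> real" where
  "nrm u = sqrt (Re (a u u))"

lemma diff_mem: "u \<in> D \<Longrightarrow> v \<in> D \<Longrightarrow> (\<lambda>x. u x - v x) \<in> D"
  using lincomb[of u v 1 "-1"] by simp

lemma zero_mem: "(\<lambda>x. 0) \<in> D"
  using nonempty lincomb[of _ _ 0 0] by fastforce

lemma sum_mem: "(\<And>i. i \<in> I \<Longrightarrow> u i \<in> D) \<Longrightarrow> (\<lambda>x. \<Sum>i\<in>I. c i * u i x) \<in> D"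
proof (induction I rule: infinite_finite_induct)
  case (insert i I)
  then have "(\<lambda>x. c i * u i x + 1 * (\<Sum>i\<in>I. c i * u i x)) \<in> D" by (intro lincomb) auto
  then show ?case using insert by simp
qed (auto simp: zero_mem)

lemma zero_right: "u \<in> D \<Longrightarrow> a u (\<lambda>x. 0) = 0"
  using linear_right[of u u u 0 0] by simp

lemma sum_right:
  "w \<in> D \<Longrightarrow> (\<And>i. i \<in> I \<Longrightarrow> u i \<in> D) \<Longrightarrow> a w (\<lambda>x. \<Sum>i\<in>I. c i * u i x) = (\<Sum>i\<in>I. c i * a w (u i))"
proof (induction I rule: infinite_finite_induct)
  case (insert i I)
  have "a w (\<lambda>x. c i * u i x + 1 * (\<Sum>i\<in>I. c i * u i x)) = c i * a w (u i) + 1 * a w (\<lambda>x. \<Sum>i\<in>I. c i * u i x)"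
    using insert by (intro linear_right sum_mem) auto
  then show ?case using insert by simp
qed (auto simp: zero_right)

lemma linear_left:
  assumes "w \<in> D" "u \<in> D" "v \<in> D"
  shows "a (\<lambda>x. \<alpha> * u x + \<beta> * v x) w = cnj \<alpha> * a u w + cnj \<beta> * a v w"
proof -
  have "a (\<lambda>x. \<alpha> * u x + \<beta> * v x) w = cnj (a w (\<lambda>x. \<alpha> * u x + \<beta> * v x))"
    using assms by (intro hermitian lincomb)
  then show ?thesis using assms by (simp add: linear_right hermitian[of w u] hermitian[of w v])
qed

lemma sum_left:
  assumes "w \<in> D" "\<And>i. i \<in> I \<Longrightarrow> u i \<in> D"
  shows "a (\<lambda>x. \<Sum>i\<in>I. c i * u i x) w = (\<Sum>i\<in>I. cnj (c i) * a (u i) w)"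
proof -
  have "a (\<lambda>x. \<Sum>i\<in>I. c i * u i x) w = cnj (a w (\<lambda>x. \<Sum>i\<in>I. c i * u i x))"
    using assms by (intro hermitian sum_mem)
  also have "\<dots> = (\<Sum>i\<in>I. cnj (c i) * a (u i) w)"
    using assms by (auto simp: sum_right hermitian[of w "u _"] intro!: sum.cong)
  finally show ?thesis .
qed

lemma diff_right: "w \<in> D \<Longrightarrow> u \<in> D \<Longrightarrow> v \<in> D \<Longrightarrow> a w (\<lambda>x. u x - v x) = a w u - a w v"
  using linear_right[of w u v 1 "-1"] by simp

lemma diff_left: "w \<in> D \<Longrightarrow> u \<in> D \<Longrightarrow> v \<in> D \<Longrightarrow> a (\<lambda>x. u x - v x) w = a u w - a v w"
  using linear_left[of w u v 1 "-1"] by simp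

lemma Im_diag: "u \<in> D \<Longrightarrow> Im (a u u) = 0"
  using arg_cong[OF hermitian[of u u], of Im] by simp

lemma diag_eq: "u \<in> D \<Longrightarrow> a u u = of_real ((nrm u)\<^sup>2)"
  by (auto simp: complex_eq_iff nrm_def nonneg Im_diag)

lemma norm_diag: "u \<in> D \<Longrightarrow> norm (a u u) = (nrm u)\<^sup>2"
  by (simp add: diag_eq norm_power)

lemma nrm_nonneg: "u \<in> D \<Longrightarrow> 0 \<le> nrm u"
  by (simp add: nrm_def nonneg)

lemma nrm_lincomb_sq:
  assumes "u \<in> D" "v \<in> D"
  shows "(nrm (\<lambda>x. \<alpha> * u x + \<beta> * v x))\<^sup>2 =
    (norm \<alpha>)\<^sup>2 * (nrm u)\<^sup>2 + 2 * Re (cnj \<alpha> * \<beta> * a u v) + (norm \<beta>)\<^sup>2 * (nrm v)\<^sup>2"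
proof -
  let ?w = "\<lambda>x. \<alpha> * u x + \<beta> * v x"
  have w: "?w \<in> D" using assms by (rule lincomb)
  have "of_real ((nrm ?w)\<^sup>2) = a ?w ?w" using w by (simp add: diag_eq)
  also have "\<dots> = \<alpha> * (cnj \<alpha> * a u u + cnj \<beta> * a v u) + \<beta> * (cnj \<alpha> * a u v + cnj \<beta> * a v v)"
    using assms w by (simp add: linear_right linear_left)
  finally have "(nrm ?w)\<^sup>2 = Re (\<alpha> * (cnj \<alpha> * a u u + cnj \<beta> * a v u) + \<beta> * (cnj \<alpha> * a u v + cnj \<beta> * a v v))"
    by (metis Re_complex_of_real)
  then show ?thesis using assms unfolding cmod_power2
    by (simp add: hermitian[of u v] diag_eq algebra_simps power2_eq_square)
qed

lemma cauchy_schwarz: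
  assumes "u \<in> D" "v \<in> D"
  shows "norm (a u v) \<le> nrm u * nrm v"
proof -
  define z where "z = a u v"
  have main: "0 \<le> s\<^sup>2 * (nrm u)\<^sup>2 - 2 * s * (norm z)\<^sup>2 + (norm z)\<^sup>2 * (nrm v)\<^sup>2" for s :: real
  proof -
    have "0 \<le> (nrm (\<lambda>x. of_real s * u x + (- cnj z) * v x))\<^sup>2" by simp
    also have "\<dots> = s\<^sup>2 * (nrm u)\<^sup>2 - 2 * s * (norm z)\<^sup>2 + (norm z)\<^sup>2 * (nrm v)\<^sup>2"
      unfolding nrm_lincomb_sq[OF assms] z_def[symmetric] cmod_power2
      by (simp add: cmod_power2 algebra_simps) (simp add: algebra_simps power2_eq_square)
    finally show ?thesis .
  qed
  have "(norm z)\<^sup>2 \<le> (nrm u)\<^sup>2 * (nrm v)\<^sup>2"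
  proof (cases "nrm u = 0")
    case True
    \<comment> \<open>The quadratic in \<open>s\<close> has lost its leading term; being nonnegative
      for arbitrarily large \<open>s\<close>, it forces \<open>z = 0\<close>.\<close>
    have "(norm z)\<^sup>2 * (2 * s) \<le> (norm z)\<^sup>2 * (nrm v)\<^sup>2" for s
      using main[of s] True by (simp add: mult.commute mult.left_commute)
    from this[of "(nrm v)\<^sup>2 / 2 + 1"] have "(norm z)\<^sup>2 \<le> 0" by (simp add: algebra_simps)
    then show ?thesis using True by simp
  next
    case False
    define p where "p = (nrm u)\<^sup>2"
    define n where "n = (norm z)\<^sup>2"
    have p: "p > 0" using False by (simp add: p_def)
    \<comment> \<open>\<open>n / p\<close> minimises the quadratic in \<open>s\<close>.\<close>
    have "0 \<le> (n / p)\<^sup>2 * p - 2 * (n / p) * n + n * (nrm v)\<^sup>2"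
      using main[of "n / p"] by (simp add: p_def n_def)
    also have "\<dots> = n * ((nrm v)\<^sup>2 - n / p)" using p by (simp add: power2_eq_square field_simps)
    finally have "0 \<le> n * ((nrm v)\<^sup>2 - n / p)" .
    moreover have "n \<ge> 0" by (simp add: n_def)
    ultimately have "n / p \<le> (nrm v)\<^sup>2"
      using p by (cases "n = 0") (auto simp: zero_le_mult_iff)
    then show ?thesis using p by (simp add: p_def[symmetric] n_def[symmetric] field_simps)
  qed
  then have "(norm z)\<^sup>2 \<le> (nrm u * nrm v)\<^sup>2" by (simp add: power_mult_distrib)
  then show ?thesis unfolding z_def
    by (rule power2_le_imp_le) (simp add: assms nrm_nonneg)
qed

lemma nrm_triangle:
  assumes "u \<in> D" "v \<in> D"
  shows "nrm (\<lambda>x. u x + v x) \<le> nrm u + nrm v"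
proof -
  have "(nrm (\<lambda>x. u x + v x))\<^sup>2 = (nrm u)\<^sup>2 + 2 * Re (a u v) + (nrm v)\<^sup>2"
    using nrm_lincomb_sq[OF assms, of 1 1] by simp
  also have "\<dots> \<le> (nrm u)\<^sup>2 + 2 * (nrm u * nrm v) + (nrm v)\<^sup>2"
    using cauchy_schwarz[OF assms] complex_Re_le_cmod[of "a u v"] by linarith
  also have "\<dots> = (nrm u + nrm v)\<^sup>2" by (simp add: power2_eq_square algebra_simps)
  finally show ?thesis using assms by (auto intro: power2_le_imp_le simp: nrm_nonneg)
qed

lemma nrm_scale: "u \<in> D \<Longrightarrow> nrm (\<lambda>x. \<alpha> * u x) = norm \<alpha> * nrm u"
proof -
  assume u: "u \<in> D"
  have "(nrm (\<lambda>x. \<alpha> * u x))\<^sup>2 = (norm \<alpha> * nrm u)\<^sup>2"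
    using nrm_lincomb_sq[OF u u, of \<alpha> 0] by (simp add: power_mult_distrib)
  moreover have "(\<lambda>x. \<alpha> * u x) \<in> D" using lincomb[OF u u, of \<alpha> 0] by simp
  ultimately show ?thesis using u by (simp add: power2_eq_iff_nonneg nrm_nonneg)
qed

lemma nrm_diff_triangle:
  assumes "u \<in> D" "v \<in> D" "w \<in> D"
  shows "nrm (\<lambda>x. u x - w x) \<le> nrm (\<lambda>x. u x - v x) + nrm (\<lambda>x. v x - w x)"
  using nrm_triangle[OF diff_mem[OF assms(1,2)] diff_mem[OF assms(2,3)]] by (simp add: algebra_simps)

lemma nrm_diff_commute: "u \<in> D \<Longrightarrow> v \<in> D \<Longrightarrow> nrm (\<lambda>x. u x - v x) = nrm (\<lambda>x. v x - u x)"
  using nrm_scale[OF diff_mem[of v u], of "-1"] by simp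

lemma nrm_le_add_diff: "u \<in> D \<Longrightarrow> v \<in> D \<Longrightarrow> nrm u \<le> nrm v + nrm (\<lambda>x. u x - v x)"
  using nrm_triangle[of v "\<lambda>x. u x - v x"] diff_mem[of u v] by simp

lemma form_diff_le:
  assumes "u \<in> D" "v \<in> D" "u' \<in> D" "v' \<in> D"
  shows "norm (a u v - a u' v') \<le> nrm (\<lambda>x. u x - u' x) * nrm v + nrm u' * nrm (\<lambda>x. v x - v' x)"
proof -
  have "a u v - a u' v' = a (\<lambda>x. u x - u' x) v + a u' (\<lambda>x. v x - v' x)"
    using assms by (simp add: diff_left diff_right)
  then show ?thesis
    by (simp only:) (rule order_trans[OF norm_triangle_ineq], intro add_mono cauchy_schwarz diff_mem assms)
qed

lemma tendsto_form:
  assumes U: "\<And>n. U n \<in> D" "u \<in> D" "(\<lambda>n. nrm (\<lambda>x. U n x - u x)) \<longlonglongrightarrow> 0"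
    and V: "\<And>n. V n \<in> D" "v \<in> D" "(\<lambda>n. nrm (\<lambda>x. V n x - v x)) \<longlonglongrightarrow> 0"
  shows "(\<lambda>n. a (U n) (V n)) \<longlonglongrightarrow> a u v"
proof (rule LIM_zero_cancel, rule Lim_null_comparison)
  show "\<forall>\<^sub>F n in sequentially. norm (a (U n) (V n) - a u v) \<le>
      nrm (\<lambda>x. U n x - u x) * (nrm v + nrm (\<lambda>x. V n x - v x)) + nrm u * nrm (\<lambda>x. V n x - v x)"
  proof (rule always_eventually, rule allI)
    fix n
    have "norm (a (U n) (V n) - a u v) \<le> nrm (\<lambda>x. U n x - u x) * nrm (V n) + nrm u * nrm (\<lambda>x. V n x - v x)"
      using U V by (intro form_diff_le)
    also have "\<dots> \<le> nrm (\<lambda>x. U n x - u x) * (nrm v + nrm (\<lambda>x. V n x - v x)) + nrm u * nrm (\<lambda>x. V n x - v x)"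
      using U V by (intro add_right_mono mult_left_mono nrm_le_add_diff nrm_nonneg diff_mem)
    finally show "norm (a (U n) (V n) - a u v) \<le>
      nrm (\<lambda>x. U n x - u x) * (nrm v + nrm (\<lambda>x. V n x - v x)) + nrm u * nrm (\<lambda>x. V n x - v x)" .
  qed
  show "(\<lambda>n. nrm (\<lambda>x. U n x - u x) * (nrm v + nrm (\<lambda>x. V n x - v x)) + nrm u * nrm (\<lambda>x. V n x - v x)) \<longlonglongrightarrow> 0"
    using tendsto_add[OF tendsto_mult[OF U(3) tendsto_add[OF tendsto_const V(3)]] tendsto_mult[OF tendsto_const V(3)], of "nrm v" "nrm u"]
    by simp
qed

section \<open>Cauchy sequences for the seminorm of a form\<close>

definition cauchy_seq :: "(nat \<Rightarrow> 'a \<Rightarrow> complex) \<Rightarrow> bool" where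
  "cauchy_seq U \<longleftrightarrow> (\<forall>n. U n \<in> D) \<and> (\<forall>e>0. \<exists>M. \<forall>m\<ge>M. \<forall>n\<ge>M. nrm (\<lambda>x. U m x - U n x) < e)"

lemma cauchy_seqD: "cauchy_seq U \<Longrightarrow> U n \<in> D"
  by (simp add: cauchy_seq_def)

lemma cauchy_seq_bounded:
  assumes "cauchy_seq U"
  obtains K where "0 < K" "\<And>n. nrm (U n) \<le> K"
proof -
  have mem: "U n \<in> D" for n using assms by (rule cauchy_seqD)
  obtain M where M: "\<And>m n. m \<ge> M \<Longrightarrow> n \<ge> M \<Longrightarrow> nrm (\<lambda>x. U m x - U n x) < 1"
    using assms unfolding cauchy_seq_def by (meson zero_less_one)
  define K where "K = Max (nrm ` U ` {..M}) + 1"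
  have le: "nrm (U n) \<le> K - 1" if "n \<le> M" for n
    using that unfolding K_def by (auto intro!: Max_ge)
  have "nrm (U n) \<le> K" for n
  proof (cases "n \<le> M")
    case False
    then have "nrm (U n) \<le> nrm (U M) + 1"
      using nrm_le_add_diff[OF mem mem, of n M] M[of n M] by auto
    then show ?thesis using le[of M] by simp
  qed (use le in fastforce)
  moreover have "0 < K" using le[of M] nrm_nonneg[OF mem[of M]] by simp
  ultimately show ?thesis using that by blast
qed

lemma cauchy_seq_form_convergent:
  assumes U: "cauchy_seq U" and V: "cauchy_seq V"
  shows "convergent (\<lambda>n. a (U n) (V n))"
proof -
  obtain K where K: "0 < K" "\<And>n. nrm (U n) \<le> K" using cauchy_seq_bounded[OF U] by blast
  obtain L where L: "0 < L" "\<And>n. nrm (V n) \<le> L" using cauchy_seq_bounded[OF V] by blast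
  have "Cauchy (\<lambda>n. a (U n) (V n))"
  proof (rule CauchyI)
    fix e :: real assume e: "e > 0"
    obtain M1 where M1: "\<And>m n. m \<ge> M1 \<Longrightarrow> n \<ge> M1 \<Longrightarrow> nrm (\<lambda>x. U m x - U n x) < e / (2 * L)"
      using U e L(1) unfolding cauchy_seq_def by (meson divide_pos_pos mult_pos_pos zero_less_numeral)
    obtain M2 where M2: "\<And>m n. m \<ge> M2 \<Longrightarrow> n \<ge> M2 \<Longrightarrow> nrm (\<lambda>x. V m x - V n x) < e / (2 * K)"
      using V e K(1) unfolding cauchy_seq_def by (meson divide_pos_pos mult_pos_pos zero_less_numeral)
    show "\<exists>M. \<forall>m\<ge>M. \<forall>n\<ge>M. norm (a (U m) (V m) - a (U n) (V n)) < e"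
    proof (intro exI[of _ "max M1 M2"] allI impI)
      fix m n assume mn: "max M1 M2 \<le> m" "max M1 M2 \<le> n"
      have mem: "U k \<in> D" "V k \<in> D" for k using U V by (auto dest: cauchy_seqD)
      have "norm (a (U m) (V m) - a (U n) (V n)) \<le> nrm (\<lambda>x. U m x - U n x) * nrm (V m) + nrm (U n) * nrm (\<lambda>x. V m x - V n x)"
        using mem by (intro form_diff_le)
      also have "\<dots> \<le> nrm (\<lambda>x. U m x - U n x) * L + K * nrm (\<lambda>x. V m x - V n x)"
        using mem K L by (intro add_mono mult_left_mono mult_right_mono nrm_nonneg diff_mem)
      also have "\<dots> < e / (2 * L) * L + K * (e / (2 * K))"
        using M1[of m n] M2[of m n] mn K L by (intro add_strict_mono mult_strict_right_mono mult_strict_left_mono) auto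
      also have "\<dots> = e" using K L by simp
      finally show "norm (a (U m) (V m) - a (U n) (V n)) < e" .
    qed
  qed
  then show ?thesis by (rule Cauchy_convergent)
qed

lemma cauchy_seq_const: "u \<in> D \<Longrightarrow> cauchy_seq (\<lambda>n. u)"
  by (simp add: cauchy_seq_def nrm_def zero_right zero_mem)

lemma cauchy_seq_lincomb:
  assumes U: "cauchy_seq U" and V: "cauchy_seq V"
  shows "cauchy_seq (\<lambda>n x. \<alpha> * U n x + \<beta> * V n x)"
  unfolding cauchy_seq_def
proof (intro conjI allI impI)
  have mem: "U k \<in> D" "V k \<in> D" for k using U V by (auto dest: cauchy_seqD)
  show "(\<lambda>x. \<alpha> * U n x + \<beta> * V n x) \<in> D" for n using mem by (intro lincomb)
  fix e :: real assume e: "e > 0"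
  \<comment> \<open>The added one keeps \<open>K\<close> positive when both coefficients
    vanish.\<close>
  define K where "K = norm \<alpha> + norm \<beta> + 1"
  have K: "K > 0" unfolding K_def by (intro add_nonneg_pos add_nonneg_nonneg) auto
  obtain M1 where M1: "\<And>m n. m \<ge> M1 \<Longrightarrow> n \<ge> M1 \<Longrightarrow> nrm (\<lambda>x. U m x - U n x) < e / K"
    using U e K unfolding cauchy_seq_def by (meson divide_pos_pos)
  obtain M2 where M2: "\<And>m n. m \<ge> M2 \<Longrightarrow> n \<ge> M2 \<Longrightarrow> nrm (\<lambda>x. V m x - V n x) < e / K"
    using V e K unfolding cauchy_seq_def by (meson divide_pos_pos)
  show "\<exists>M. \<forall>m\<ge>M. \<forall>n\<ge>M. nrm (\<lambda>x. \<alpha> * U m x + \<beta> * V m x - (\<alpha> * U n x + \<beta> * V n x)) < e"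
  proof (intro exI[of _ "max M1 M2"] allI impI)
    fix m n assume mn: "max M1 M2 \<le> m" "max M1 M2 \<le> n"
    have eq: "(\<lambda>x. \<alpha> * U m x + \<beta> * V m x - (\<alpha> * U n x + \<beta> * V n x)) =
      (\<lambda>x. \<alpha> * (U m x - U n x) + \<beta> * (V m x - V n x))"
      by (simp add: algebra_simps)
    have mem': "(\<lambda>x. \<gamma> * u x) \<in> D" if "u \<in> D" for u \<gamma> using lincomb[OF that that, of \<gamma> 0] by simp
    have "nrm (\<lambda>x. \<alpha> * (U m x - U n x) + \<beta> * (V m x - V n x)) \<le>
       nrm (\<lambda>x. \<alpha> * (U m x - U n x)) + nrm (\<lambda>x. \<beta> * (V m x - V n x))"
      using mem by (intro nrm_triangle mem' diff_mem)
    also have "\<dots> = norm \<alpha> * nrm (\<lambda>x. U m x - U n x) + norm \<beta> * nrm (\<lambda>x. V m x - V n x)"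
      using mem by (simp add: nrm_scale diff_mem)
    also have "\<dots> \<le> norm \<alpha> * (e / K) + norm \<beta> * (e / K)"
      using M1[of m n] M2[of m n] mn by (intro add_mono mult_left_mono) auto
    also have "\<dots> = (K - 1) * (e / K)" by (simp only: K_def distrib_right[symmetric]) simp
    also have "\<dots> < K * (e / K)" using e K by (intro mult_strict_right_mono) auto
    also have "\<dots> = e" using K by simp
    finally show "nrm (\<lambda>x. \<alpha> * U m x + \<beta> * V m x - (\<alpha> * U n x + \<beta> * V n x)) < e"
      by (simp add: eq)
  qed
qed

end

section \<open>Logarithmic polar coordinates\<close>

lemma polar_nth [simp]: "polar r \<theta> $ 1 = r * cos \<theta>" "polar r \<theta> $ 2 = r * sin \<theta>"
  by (simp_all add: polar_def)

lemma polar_eq_axis: "polar r \<theta> = (r * cos \<theta>) *\<^sub>R axis 1 1 + (r * sin \<theta>) *\<^sub>R axis 2 1"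
  by (simp add: vec_eq_iff forall_2 axis_def)

lemma norm_vec2: "norm (x :: real^2) = sqrt ((x $ 1)\<^sup>2 + (x $ 2)\<^sup>2)"
  by (simp add: norm_vec_def L2_set_def sum_2)

lemma norm_polar [simp]: "norm (polar r \<theta>) = \<bar>r\<bar>"
  by (simp add: norm_vec2 power_mult_distrib flip: distrib_left)

lemma continuous_on_polar [continuous_intros]:
  fixes f g :: "'a::t2_space \<Rightarrow> real"
  assumes "continuous_on S f" "continuous_on S g"
  shows "continuous_on S (\<lambda>x. polar (f x) (g x))"
  unfolding polar_eq_axis
  by (intro continuous_intros assms continuous_on_cos continuous_on_sin)

lemma borel_measurable_polar [measurable]:
  assumes [measurable]: "f \<in> borel_measurable M" "g \<in> borel_measurable M"
  shows "(\<lambda>x. polar (f x) (g x)) \<in> borel_measurable M"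
  unfolding polar_eq_axis by measurable

text \<open>Lebesgue measure is determined by its values on boxes, and the preimage of a box is a
  rectangle. This gives access to Fubini on \<open>real^2\<close>.\<close>

lemma distr_vector_lborel:
  "distr (lborel \<Otimes>\<^sub>M lborel) borel (\<lambda>(t, \<theta>). vector [t, \<theta>] :: real^2) = lborel"
proof (rule sym, rule lborel_eqI)
  have vec: "(\<lambda>(t, \<theta>). vector [t, \<theta>] :: real^2) = (\<lambda>p. fst p *\<^sub>R axis 1 1 + snd p *\<^sub>R axis 2 1)"
    by (auto simp: fun_eq_iff vec_eq_iff forall_2 axis_def)
  have meas: "(\<lambda>(t, \<theta>). vector [t, \<theta>] :: real^2) \<in> (lborel \<Otimes>\<^sub>M lborel) \<rightarrow>\<^sub>M borel"
    unfolding vec by measurable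
  fix l u :: "real^2"
  assume le: "\<And>b. b \<in> Basis \<Longrightarrow> l \<bullet> b \<le> u \<bullet> b"
  have B: "(Basis :: (real^2) set) = {axis 1 1, axis 2 1}"
    by (auto simp: Basis_vec_def UNIV_2)
  have ne: "axis 1 1 \<noteq> (axis 2 1 :: real^2)" by (simp add: axis_eq_axis)
  have le': "l $ 1 \<le> u $ 1" "l $ 2 \<le> u $ 2"
    using le[of "axis 1 1"] le[of "axis 2 1"] unfolding B by (simp_all add: inner_axis)
  have "emeasure (distr (lborel \<Otimes>\<^sub>M lborel) borel (\<lambda>(t, \<theta>). vector [t, \<theta>] :: real^2)) (box l u)
      = emeasure (lborel \<Otimes>\<^sub>M lborel) ({l$1<..<u$1} \<times> {l$2<..<u$2})"
    by (subst emeasure_distr[OF meas]) (auto intro!: arg_cong[where f="emeasure _"] simp: mem_box_cart forall_2 space_pair_measure)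
  also have "\<dots> = ennreal (u$1 - l$1) * ennreal (u$2 - l$2)"
    using le' by (subst lborel.emeasure_pair_measure_Times) auto
  also have "\<dots> = (\<Prod>b\<in>Basis. (u - l) \<bullet> b)"
    unfolding B using ne le' by (simp add: inner_axis ennreal_mult)
  finally show "emeasure (distr (lborel \<Otimes>\<^sub>M lborel) borel (\<lambda>(t, \<theta>). vector [t, \<theta>] :: real^2)) (box l u)
      = (\<Prod>b\<in>Basis. (u - l) \<bullet> b)" .
qed simp

lemma nn_integral_lborel_vec2:
  assumes [measurable]: "f \<in> borel_measurable (borel :: (real^2) measure)"
  shows "(\<integral>\<^sup>+x. f x \<partial>lborel) = (\<integral>\<^sup>+t. \<integral>\<^sup>+\<theta>. f (vector [t, \<theta>]) \<partial>lborel \<partial>lborel)"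
proof -
  have vec: "(\<lambda>p. vector [fst p, snd p] :: real^2) = (\<lambda>p. fst p *\<^sub>R axis 1 1 + snd p *\<^sub>R axis 2 1)"
    by (auto simp: fun_eq_iff vec_eq_iff forall_2 axis_def)
  have meas [measurable]: "(\<lambda>p. vector [fst p, snd p] :: real^2) \<in> (lborel \<Otimes>\<^sub>M lborel) \<rightarrow>\<^sub>M borel"
    unfolding vec by measurable
  have "(\<integral>\<^sup>+x. f x \<partial>lborel) = (\<integral>\<^sup>+p. f (vector [fst p, snd p]) \<partial>(lborel \<Otimes>\<^sub>M lborel))"
    by (subst distr_vector_lborel[symmetric]) (simp add: nn_integral_distr case_prod_beta)
  also have "\<dots> = (\<integral>\<^sup>+t. \<integral>\<^sup>+\<theta>. f (vector [t, \<theta>]) \<partial>lborel \<partial>lborel)"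
    by (subst lborel.nn_integral_fst[symmetric]) simp_all
  finally show ?thesis .
qed

definition log_polar :: "real^2 \<Rightarrow> real^2" where
  "log_polar x = polar (exp (x $ 1)) (x $ 2)"

lemma inj_on_log_polar: "inj_on log_polar {x. 0 < x $ 2 \<and> x $ 2 < 2 * pi}"
proof (rule inj_onI)
  fix x y :: "real^2"
  assume x: "x \<in> {x. 0 < x $ 2 \<and> x $ 2 < 2 * pi}" and y: "y \<in> {x. 0 < x $ 2 \<and> x $ 2 < 2 * pi}"
    and eq: "log_polar x = log_polar y"
  from arg_cong[OF eq, of norm] have 1: "x $ 1 = y $ 1" by (simp add: log_polar_def)
  have "cos (x $ 2) = cos (y $ 2)" "sin (x $ 2) = sin (y $ 2)"
    using arg_cong[OF eq, of "\<lambda>z. z $ 1"] arg_cong[OF eq, of "\<lambda>z. z $ 2"] 1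
    by (simp_all add: log_polar_def)
  then obtain n :: int where n: "x $ 2 = y $ 2 + 2 * pi * n"
    using sin_cos_eq_iff[of "x $ 2" "y $ 2"] by auto
  have "\<bar>2 * pi * n\<bar> < 2 * pi * 1" using n x y by auto
  then have "\<bar>real_of_int n\<bar> < 1" by (simp add: abs_mult)
  then have "n = 0" by linarith
  then show "x = y" using 1 n by (simp add: vec_eq_iff forall_2)
qed

text \<open>The image of the open strip misses only the closed half-axis of angle zero; removing the
  whole axis is simpler and costs a null set.\<close>

lemma log_polar_image:
  "- {x. x $ 2 = 0} \<subseteq> log_polar ` {x. 0 < x $ 2 \<and> x $ 2 < 2 * pi}"
proof
  fix z :: "real^2"
  assume "z \<in> - {x. x $ 2 = 0}"
  then have z2: "z $ 2 \<noteq> 0" by simp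
  define r where "r = norm z"
  have r: "r > 0" using z2 by (auto simp: r_def)
  have rr: "r\<^sup>2 = (z $ 1)\<^sup>2 + (z $ 2)\<^sup>2"
    by (simp add: r_def norm_vec2)
  have "(z $ 1 / r)\<^sup>2 + (z $ 2 / r)\<^sup>2 = 1"
    using r by (simp add: power_divide rr[symmetric] flip: add_divide_distrib)
  then obtain t where t: "0 \<le> t" "t < 2 * pi" "z $ 1 / r = cos t" "z $ 2 / r = sin t"
    using sincos_total_2pi by blast
  have "t \<noteq> 0" using t z2 r by auto
  moreover have "log_polar (vector [ln r, t]) = z"
    using t r by (simp add: log_polar_def vec_eq_iff forall_2 field_simps)
  ultimately show "z \<in> log_polar ` {x. 0 < x $ 2 \<and> x $ 2 < 2 * pi}"
    using t by (intro image_eqI[of _ _ "vector [ln r, t]"]) auto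
qed

definition log_polar_deriv :: "real^2 \<Rightarrow> real^2 \<Rightarrow> real^2" where
  "log_polar_deriv x h = vector [
     exp (x $ 1) * (cos (x $ 2) * h $ 1 - sin (x $ 2) * h $ 2),
     exp (x $ 1) * (sin (x $ 2) * h $ 1 + cos (x $ 2) * h $ 2)]"

lemma has_derivative_log_polar: "(log_polar has_derivative log_polar_deriv x) (at x within S)"
proof -
  have eq: "log_polar = (\<lambda>x. (exp (x $ 1) * cos (x $ 2)) *\<^sub>R axis 1 1 + (exp (x $ 1) * sin (x $ 2)) *\<^sub>R axis 2 1)"
    by (simp add: fun_eq_iff log_polar_def polar_eq_axis)
  have eq': "log_polar_deriv x = (\<lambda>h. (exp (x $ 1) * (cos (x $ 2) * h $ 1 - sin (x $ 2) * h $ 2)) *\<^sub>R axis 1 1 +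
     (exp (x $ 1) * (sin (x $ 2) * h $ 1 + cos (x $ 2) * h $ 2)) *\<^sub>R axis 2 1)"
    by (simp add: fun_eq_iff log_polar_deriv_def vec_eq_iff forall_2 axis_def)
  show ?thesis unfolding eq eq'
    by (rule derivative_eq_intros bounded_linear.has_derivative[OF bounded_linear_vec_nth] | rule refl)+
       (auto simp: fun_eq_iff algebra_simps)
qed

lemma det_log_polar_deriv: "det (matrix (log_polar_deriv x)) = exp (2 * x $ 1)"
proof -
  have "det (matrix (log_polar_deriv x)) = (exp (x $ 1))\<^sup>2 * ((cos (x $ 2))\<^sup>2 + (sin (x $ 2))\<^sup>2)"
    by (simp add: det_2 matrix_def log_polar_deriv_def axis_def algebra_simps power2_eq_square del: sin_cos_squared_add sin_cos_squared_add2 sin_cos_squared_add3)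
  also have "\<dots> = exp (2 * x $ 1)" by (simp add: exp_double)
  finally show ?thesis .
qed

lemma borel_measurable_log_polar [measurable]: "log_polar \<in> borel_measurable borel"
  unfolding log_polar_def by measurable

text \<open>The change of variables theorem for injective differentiable maps is applied only to
  preimages of boxes. This identifies Lebesgue measure with the image of the density
  \<open>exp (2 * t)\<close> on the strip, and the formula for every nonnegative Borel
  \<open>f\<close> follows at once.\<close>

lemma nn_integral_log_polar_vec:
  fixes f :: "real^2 \<Rightarrow> ennreal"
  assumes [measurable]: "f \<in> borel_measurable borel"
  shows "(\<integral>\<^sup>+x. f x \<partial>lborel) =
    (\<integral>\<^sup>+x. ennreal (exp (2 * x $ 1)) * indicator {x. 0 < x $ 2 \<and> x $ 2 < 2 * pi} x * f (log_polar x) \<partial>lborel)"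
proof -
  let ?S = "{x::real^2. 0 < x $ 2 \<and> x $ 2 < 2 * pi}"
  let ?d = "\<lambda>x::real^2. ennreal (exp (2 * x $ 1)) * indicator ?S x"
  have S [measurable]: "?S \<in> sets borel" by measurable
  have d [measurable]: "?d \<in> borel_measurable borel" by measurable
  have "lborel = distr (density lborel ?d) borel log_polar"
  proof (rule lborel_eqI)
    fix l u :: "real^2"
    assume le: "\<And>b. b \<in> Basis \<Longrightarrow> l \<bullet> b \<le> u \<bullet> b"
    let ?A = "?S \<inter> log_polar -` box l u"
    have A [measurable]: "?A \<in> sets borel"
      using measurable_sets[OF borel_measurable_log_polar, of "box l u"] by auto
    have img: "log_polar ` ?A = box l u \<inter> log_polar ` ?S" by auto
    have "negligible {x::real^2. axis 2 1 \<bullet> x = 0}"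
      by (rule negligible_hyperplane) (simp add: axis_eq_0_iff)
    then have neg: "negligible {x::real^2. x $ 2 = 0}" by (simp add: inner_axis')
    have "box l u - log_polar ` ?A \<subseteq> {x. x $ 2 = 0}" using log_polar_image by (auto simp: img)
    then have "negligible ((box l u - log_polar ` ?A) \<union> (log_polar ` ?A - box l u))"
      using neg by (auto intro!: negligible_subset[OF neg] simp: img)
    then have sd: "negligible (box l u - log_polar ` ?A \<union> (log_polar ` ?A - box l u))" .
    have lm: "log_polar ` ?A \<in> lmeasurable" "measure lebesgue (log_polar ` ?A) = measure lebesgue (box l u)"
      using lmeasurable_negligible_symdiff[OF _ sd] measure_negligible_symdiff[OF _ sd] by auto
    have "((\<lambda>x. \<bar>det (matrix (log_polar_deriv x))\<bar>) has_integral measure lebesgue (box l u)) ?A"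
      using has_measure_differentiable_image[of ?A log_polar log_polar_deriv "measure lebesgue (box l u)"]
        lm has_derivative_log_polar inj_on_subset[OF inj_on_log_polar, of ?A] A by (auto simp del: lebesgue_on_UNIV_eq)
    then have hi: "((\<lambda>x. exp (2 * x $ 1)) has_integral measure lebesgue (box l u)) ?A"
      by (simp add: det_log_polar_deriv)
    have "emeasure (distr (density lborel ?d) borel log_polar) (box l u) = emeasure (density lborel ?d) (log_polar -` box l u)"
      by (subst emeasure_distr) auto
    also have "\<dots> = (\<integral>\<^sup>+x. ?d x * indicator (log_polar -` box l u) x \<partial>lborel)"
      using measurable_sets[OF borel_measurable_log_polar, of "box l u"] by (subst emeasure_density) auto
    also have "\<dots> = (\<integral>\<^sup>+x. ennreal (exp (2 * x $ 1)) * indicator ?A x \<partial>lborel)"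
      by (intro nn_integral_cong) (auto simp: indicator_def)
    also have "\<dots> = ennreal (measure lebesgue (box l u))"
      by (rule nn_integral_has_integral_lebesgue'[OF _ hi]) auto
    also have "\<dots> = ennreal (measure lborel (box l u))" by simp
    also have "\<dots> = (\<Prod>b\<in>Basis. (u - l) \<bullet> b)" using le by (subst measure_lborel_box) auto
    finally show "emeasure (distr (density lborel ?d) borel log_polar) (box l u) = (\<Prod>b\<in>Basis. (u - l) \<bullet> b)" .
  qed simp
  then have "(\<integral>\<^sup>+x. f x \<partial>lborel) = (\<integral>\<^sup>+x. f x \<partial>distr (density lborel ?d) borel log_polar)" by simp
  also have "\<dots> = (\<integral>\<^sup>+x. ?d x * f (log_polar x) \<partial>lborel)"
    by (simp add: nn_integral_distr nn_integral_density)
  finally show ?thesis .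
qed

lemma nn_integral_log_polar:
  fixes f :: "real^2 \<Rightarrow> ennreal"
  assumes [measurable]: "f \<in> borel_measurable borel"
  shows "(\<integral>\<^sup>+x. f x \<partial>lborel) =
    (\<integral>\<^sup>+t. ennreal (exp (2 * t)) * (\<integral>\<^sup>+\<theta>\<in>{0..2*pi}. f (polar (exp t) \<theta>) \<partial>lborel) \<partial>lborel)"
proof -
  have "(\<integral>\<^sup>+x. f x \<partial>lborel) = (\<integral>\<^sup>+t. \<integral>\<^sup>+\<theta>. ennreal (exp (2 * t)) *
      (f (polar (exp t) \<theta>) * indicator {0<..<2*pi} \<theta>) \<partial>lborel \<partial>lborel)"
    by (subst nn_integral_log_polar_vec, simp, subst nn_integral_lborel_vec2, measurable)
       (auto intro!: nn_integral_cong simp: log_polar_def indicator_def)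
  also have "\<dots> = (\<integral>\<^sup>+t. ennreal (exp (2 * t)) * (\<integral>\<^sup>+\<theta>\<in>{0<..<2*pi}. f (polar (exp t) \<theta>) \<partial>lborel) \<partial>lborel)"
    by (intro nn_integral_cong nn_integral_cmult) measurable
  also have "\<dots> = (\<integral>\<^sup>+t. ennreal (exp (2 * t)) * (\<integral>\<^sup>+\<theta>\<in>{0..2*pi}. f (polar (exp t) \<theta>) \<partial>lborel) \<partial>lborel)"
  proof (rule nn_integral_cong, rule arg_cong2[where f="(*)", OF refl], rule nn_integral_cong_AE)
    fix t :: real
    have "AE \<theta> in lborel. \<theta> \<noteq> 0" "AE \<theta> in lborel. \<theta> \<noteq> 2 * pi"
      by (rule AE_lborel_singleton)+
    then show "AE \<theta> in lborel. f (polar (exp t) \<theta>) * indicator {0<..<2*pi} \<theta> = f (polar (exp t) \<theta>) * indicator {0..2*pi} \<theta>"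
      by eventually_elim (auto simp: indicator_def)
  qed
  finally show ?thesis .
qed

text \<open>The substitution rule is used on compact intervals, which exhaust the half-line;
  monotone convergence does the rest.\<close>

lemma nn_integral_exp_substitution:
  fixes f :: "real \<Rightarrow> ennreal"
  assumes [measurable]: "f \<in> borel_measurable borel"
  shows "(\<integral>\<^sup>+r\<in>{0<..}. f r \<partial>lborel) = (\<integral>\<^sup>+t. f (exp t) * ennreal (exp t) \<partial>lborel)"
proof -
  let ?I = "\<lambda>n::nat. {exp (- real (Suc n))..exp (real (Suc n))}"
  have sub: "(\<integral>\<^sup>+r. f r * indicator (?I n) r \<partial>lborel) = (\<integral>\<^sup>+t. f (exp t) * ennreal (exp t) * indicator {- real (Suc n)..real (Suc n)} t \<partial>lborel)" for n
    by (rule nn_integral_substitution_aux) (auto intro!: derivative_eq_intros continuous_intros)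
  have "r \<in> (\<Union>n. ?I n)" if r: "r > 0" for r :: real
  proof -
    obtain n :: nat where n: "\<bar>ln r\<bar> \<le> real n" using real_arch_simple by blast
    then have "- real (Suc n) \<le> ln r" "ln r \<le> real (Suc n)" by auto
    then have "exp (- real (Suc n)) \<le> r" "r \<le> exp (real (Suc n))"
      using r by (metis exp_le_cancel_iff exp_ln)+
    then show ?thesis by auto
  qed
  then have U: "(\<Union>n. ?I n) = {0<..}" by (auto intro: less_le_trans[OF exp_gt_zero])
  have ind: "(SUP n. c * indicator (A n) x) = c * indicator (\<Union>n. A n) x"
    for c :: ennreal and A :: "nat \<Rightarrow> real set" and x
  proof (cases "x \<in> (\<Union>n. A n)")
    case True
    then obtain n where "x \<in> A n" by auto
    then have "c \<le> (SUP n. c * indicator (A n) x)" by (intro SUP_upper2[of n]) auto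
    moreover have "(SUP n. c * indicator (A n) x) \<le> c" by (intro SUP_least) (auto simp: indicator_def)
    ultimately show ?thesis using True by simp
  qed simp
  have V: "(\<Union>n. {- real (Suc n)..real (Suc n)}) = UNIV"
  proof (auto)
    fix x :: real
    obtain n :: nat where n: "\<bar>x\<bar> \<le> real n" using real_arch_simple by blast
    then show "\<exists>n. - 1 - real n \<le> x \<and> x \<le> 1 + real n" by (intro exI[of _ n]) auto
  qed
  have "(\<integral>\<^sup>+r\<in>{0<..}. f r \<partial>lborel) = (\<integral>\<^sup>+r. (SUP n. f r * indicator (?I n) r) \<partial>lborel)"
    unfolding ind U ..
  also have "\<dots> = (SUP n. \<integral>\<^sup>+r. f r * indicator (?I n) r \<partial>lborel)"
  proof (rule nn_integral_monotone_convergence_SUP)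
    show "incseq (\<lambda>n r. f r * indicator (?I n) r)"
      unfolding incseq_def le_fun_def
    proof (intro allI impI mult_left_mono indicator_leI)
      fix m n :: nat and r assume "m \<le> n" "r \<in> ?I m"
      moreover from \<open>m \<le> n\<close> have "exp (- real (Suc n)) \<le> exp (- real (Suc m))" "exp (real (Suc m)) \<le> exp (real (Suc n))"
        by simp_all
      ultimately show "r \<in> ?I n" unfolding atLeastAtMost_iff by linarith
    qed simp
  qed simp
  also have "\<dots> = (SUP n. \<integral>\<^sup>+t. f (exp t) * ennreal (exp t) * indicator {- real (Suc n)..real (Suc n)} t \<partial>lborel)"
    by (simp only: sub)
  also have "\<dots> = (\<integral>\<^sup>+t. (SUP n. f (exp t) * ennreal (exp t) * indicator {- real (Suc n)..real (Suc n)} t) \<partial>lborel)"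
    by (rule nn_integral_monotone_convergence_SUP[symmetric]) (auto simp: incseq_def le_fun_def indicator_def)
  also have "\<dots> = (\<integral>\<^sup>+t. f (exp t) * ennreal (exp t) \<partial>lborel)"
    unfolding ind V by simp
  finally show ?thesis .
qed

section \<open>The closure of a semibounded form\<close>

lemma L2_lincomb:
  assumes u: "u \<in> L2" and v: "v \<in> L2"
  shows "(\<lambda>x. \<alpha> * u x + \<beta> * v x) \<in> L2"
proof -
  have [measurable]: "u \<in> borel_measurable lebesgue" "v \<in> borel_measurable lebesgue"
    using u v by (auto simp: L2_def)
  have i: "integrable lebesgue (\<lambda>x. 2 * (norm \<alpha>)\<^sup>2 * (norm (u x))\<^sup>2 + 2 * (norm \<beta>)\<^sup>2 * (norm (v x))\<^sup>2)"
    using u v by (auto simp: L2_def)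
  have "(norm (\<alpha> * u x + \<beta> * v x))\<^sup>2 \<le> 2 * (norm \<alpha>)\<^sup>2 * (norm (u x))\<^sup>2 + 2 * (norm \<beta>)\<^sup>2 * (norm (v x))\<^sup>2" for x
  proof -
    have "(norm (\<alpha> * u x + \<beta> * v x))\<^sup>2 \<le> (norm (\<alpha> * u x) + norm (\<beta> * v x))\<^sup>2"
      by (intro power_mono norm_triangle_ineq) auto
    also have "\<dots> \<le> 2 * (norm (\<alpha> * u x))\<^sup>2 + 2 * (norm (\<beta> * v x))\<^sup>2"
      using sum_squares_bound[of "norm (\<alpha> * u x)" "norm (\<beta> * v x)"] by (simp add: power2_sum)
    finally show ?thesis by (simp add: norm_mult power_mult_distrib)
  qed
  then have "integrable lebesgue (\<lambda>x. (norm (\<alpha> * u x + \<beta> * v x))\<^sup>2)"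
    by (intro Bochner_Integration.integrable_bound[OF i]) (auto intro!: AE_I2)
  then show ?thesis by (simp add: L2_def)
qed

lemma borel_measurable_cnj [measurable]: "cnj \<in> borel_measurable borel"
  by (intro borel_measurable_continuous_onI continuous_intros)

lemma integrable_l2_inner:
  assumes u: "u \<in> L2" and v: "v \<in> L2"
  shows "integrable lebesgue (\<lambda>x. cnj (u x) * v x)"
proof -
  have [measurable]: "u \<in> borel_measurable lebesgue" "v \<in> borel_measurable lebesgue"
    using u v by (auto simp: L2_def)
  have i: "integrable lebesgue (\<lambda>x. (norm (u x))\<^sup>2 + (norm (v x))\<^sup>2)"
    using u v by (auto simp: L2_def)
  have "norm (u x) * norm (v x) \<le> (norm (u x))\<^sup>2 + (norm (v x))\<^sup>2" for x
  proof -
    have "0 \<le> norm (u x) * norm (v x)" by simp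
    then show ?thesis using sum_squares_bound[of "norm (u x)" "norm (v x)"] by linarith
  qed
  moreover have "(\<lambda>x. cnj (u x) * v x) \<in> borel_measurable lebesgue"
    by measurable
  ultimately show ?thesis
    by (intro Bochner_Integration.integrable_bound[OF i]) (auto intro!: AE_I2 simp: norm_mult)
qed

lemma Re_l2_inner_self: "Re (l2_inner u u) = (LINT x|lebesgue. (norm (u x))\<^sup>2)"
  by (simp add: l2_inner_def mult.commute[of "cnj _"] complex_norm_square[symmetric] integral_complex_of_real flip: of_real_power)

interpretation l2: positive_form L2 l2_inner
proof
  have "(\<lambda>x. 0) \<in> L2" by (simp add: L2_def)
  then show "L2 \<noteq> {}" by blast
  show "(\<lambda>x. \<alpha> * u x + \<beta> * v x) \<in> L2" if "u \<in> L2" "v \<in> L2" for u v \<alpha> \<beta>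
    using that by (rule L2_lincomb)
  show "l2_inner w (\<lambda>x. \<alpha> * u x + \<beta> * v x) = \<alpha> * l2_inner w u + \<beta> * l2_inner w v"
    if "w \<in> L2" "u \<in> L2" "v \<in> L2" for w u v \<alpha> \<beta>
  proof -
    have "l2_inner w (\<lambda>x. \<alpha> * u x + \<beta> * v x) = (LINT x|lebesgue. \<alpha> * (cnj (w x) * u x) + \<beta> * (cnj (w x) * v x))"
      by (simp add: l2_inner_def algebra_simps)
    also have "\<dots> = \<alpha> * l2_inner w u + \<beta> * l2_inner w v"
      unfolding l2_inner_def using that by (subst Bochner_Integration.integral_add) (auto intro: integrable_l2_inner)
    finally show ?thesis .
  qed
  show "l2_inner v u = cnj (l2_inner u v)" if "u \<in> L2" "v \<in> L2" for u v
  proof -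
    have "cnj (l2_inner u v) = (LINT x|lebesgue. cnj (cnj (u x) * v x))"
      unfolding l2_inner_def by (rule Bochner_Integration.integral_cnj[symmetric])
    then show ?thesis by (simp add: l2_inner_def mult.commute)
  qed
  show "0 \<le> Re (l2_inner u u)" if "u \<in> L2" for u
    by (simp add: Re_l2_inner_self)
qed

lemma l2_nrm [simp]: "l2.nrm u = l2_norm u"
  by (simp add: l2.nrm_def l2_norm_def Re_l2_inner_self)

lemma l2_inner_self: "u \<in> L2 \<Longrightarrow> l2_inner u u = of_real ((l2_norm u)\<^sup>2)"
  using l2.diag_eq by simp

lemma l2_norm_zero_iff: "u \<in> L2 \<Longrightarrow> l2_norm u = 0 \<longleftrightarrow> (AE x in lebesgue. u x = 0)"
  by (auto simp: l2_norm_def L2_def integral_nonneg_eq_0_iff_AE)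

section \<open>The form norm and the closure inside the space of square-integrable functions\<close>

locale semibounded =
  fixes D :: "wavefun set" and q :: "wavefun \<Rightarrow> wavefun \<Rightarrow> complex" and c :: real
  assumes semibounded: "semibounded_form D q"
    and lower_bound: "u \<in> D \<Longrightarrow> c * (l2_norm u)\<^sup>2 \<le> Re (q u u)"
begin

text \<open>Adding \<open>1 - c\<close> times the inner product makes the form at least the square
  of the L2 norm, so that its \<open>nrm\<close> is the form norm.\<close>

definition shifted :: "wavefun \<Rightarrow> wavefun \<Rightarrow> complex" where
  "shifted u v = q u v + of_real (1 - c) * l2_inner u v"

lemma in_L2: "u \<in> D \<Longrightarrow> u \<in> L2"
  using semibounded unfolding semibounded_form_def by blast

sublocale positive_form D shifted
proof
  show "D \<noteq> {}" using semibounded unfolding semibounded_form_def by blast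
  show "(\<lambda>x. \<alpha> * u x + \<beta> * v x) \<in> D" if "u \<in> D" "v \<in> D" for u v \<alpha> \<beta>
    using semibounded that unfolding semibounded_form_def by blast
  show "shifted w (\<lambda>x. \<alpha> * u x + \<beta> * v x) = \<alpha> * shifted w u + \<beta> * shifted w v"
    if "w \<in> D" "u \<in> D" "v \<in> D" for w u v \<alpha> \<beta>
  proof -
    have "\<forall>w\<in>D. \<forall>u\<in>D. \<forall>v\<in>D. \<forall>a b. q w (\<lambda>x. a * u x + b * v x) = a * q w u + b * q w v"
      using semibounded unfolding semibounded_form_def by (elim conjE)
    with that have "q w (\<lambda>x. \<alpha> * u x + \<beta> * v x) = \<alpha> * q w u + \<beta> * q w v"
      by blast
    then show ?thesis using that
      by (simp add: shifted_def l2.linear_right in_L2 algebra_simps)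
  qed
  show "shifted v u = cnj (shifted u v)" if "u \<in> D" "v \<in> D" for u v
  proof -
    have "\<forall>u\<in>D. \<forall>v\<in>D. q v u = cnj (q u v)"
      using semibounded unfolding semibounded_form_def by (elim conjE)
    with that have "q v u = cnj (q u v)" by blast
    then show ?thesis using that l2.hermitian[of u v] by (simp add: shifted_def in_L2)
  qed
  show "0 \<le> Re (shifted u u)" if "u \<in> D" for u
  proof -
    have "Re (shifted u u) = Re (q u u) + (1 - c) * (l2_norm u)\<^sup>2"
      using that by (simp add: shifted_def l2_inner_self in_L2 del: of_real_diff)
    also have "\<dots> \<ge> (l2_norm u)\<^sup>2" using lower_bound[OF that] by (simp add: algebra_simps)
    finally show ?thesis by (meson order_trans zero_le_power2)
  qed
qed

lemma nrm_sq: "u \<in> D \<Longrightarrow> (nrm u)\<^sup>2 = Re (q u u) + (1 - c) * (l2_norm u)\<^sup>2"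
  using nonneg[of u] by (simp add: nrm_def shifted_def l2_inner_self in_L2 del: of_real_diff)

lemma l2_norm_le_nrm: "u \<in> D \<Longrightarrow> l2_norm u \<le> nrm u"
proof (rule power2_le_imp_le)
  assume "u \<in> D"
  then show "(l2_norm u)\<^sup>2 \<le> (nrm u)\<^sup>2" "0 \<le> nrm u"
    using lower_bound[of u] by (simp_all add: nrm_sq nrm_nonneg algebra_simps)
qed

lemma q_eq: "u \<in> D \<Longrightarrow> q u u = of_real ((nrm u)\<^sup>2 - (1 - c) * (l2_norm u)\<^sup>2)"
  using diag_eq[of u] by (simp add: shifted_def l2_inner_self in_L2 algebra_simps)

text \<open>\<open>closed_form\<close> speaks of convergence in L2 and of convergence of
  \<open>q\<close> separately; this translates both to the form norm and back.\<close>

lemma nrm_tendsto_0_iff: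
  assumes "\<And>n. U n \<in> D"
  shows "(\<lambda>n. nrm (U n)) \<longlonglongrightarrow> 0 \<longleftrightarrow> (\<lambda>n. l2_norm (U n)) \<longlonglongrightarrow> 0 \<and> (\<lambda>n. q (U n) (U n)) \<longlonglongrightarrow> 0"
proof (intro iffI conjI)
  assume L: "(\<lambda>n. nrm (U n)) \<longlonglongrightarrow> 0"
  show 1: "(\<lambda>n. l2_norm (U n)) \<longlonglongrightarrow> 0"
    by (rule tendsto_sandwich[OF _ _ tendsto_const L])
       (auto intro!: always_eventually l2_norm_le_nrm assms l2.nrm_nonneg[simplified] in_L2)
  have "(\<lambda>n. complex_of_real ((nrm (U n))\<^sup>2 - (1 - c) * (l2_norm (U n))\<^sup>2)) \<longlonglongrightarrow> of_real (0\<^sup>2 - (1 - c) * 0\<^sup>2)"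
    by (intro tendsto_intros L 1)
  then show "(\<lambda>n. q (U n) (U n)) \<longlonglongrightarrow> 0"
    using assms by (simp add: q_eq del: of_real_diff)
next
  assume L: "(\<lambda>n. l2_norm (U n)) \<longlonglongrightarrow> 0 \<and> (\<lambda>n. q (U n) (U n)) \<longlonglongrightarrow> 0"
  have "(\<lambda>n. sqrt (Re (q (U n) (U n)) + (1 - c) * (l2_norm (U n))\<^sup>2)) \<longlonglongrightarrow> sqrt (Re 0 + (1 - c) * 0\<^sup>2)"
    using L by (intro tendsto_intros) auto
  moreover have "nrm (U n) = sqrt (Re (q (U n) (U n)) + (1 - c) * (l2_norm (U n))\<^sup>2)" for n
    using nrm_sq[OF assms[of n]] nrm_nonneg[OF assms[of n]] by (metis real_sqrt_abs abs_of_nonneg)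
  ultimately show "(\<lambda>n. nrm (U n)) \<longlonglongrightarrow> 0" by simp
qed

text \<open>The closure is built inside L2: a sequence that is Cauchy in the form norm represents
  its L2 limit.\<close>

definition approx :: "(nat \<Rightarrow> wavefun) \<Rightarrow> wavefun \<Rightarrow> bool" where
  "approx U u \<longleftrightarrow> cauchy_seq U \<and> u \<in> L2 \<and> (\<lambda>n. l2_norm (\<lambda>x. U n x - u x)) \<longlonglongrightarrow> 0"

lemma approx_const: "u \<in> D \<Longrightarrow> approx (\<lambda>n. u) u"
  by (simp add: approx_def cauchy_seq_const in_L2 l2_norm_def)

lemma approx_lincomb:
  assumes "approx U u" "approx V v"
  shows "approx (\<lambda>n x. \<alpha> * U n x + \<beta> * V n x) (\<lambda>x. \<alpha> * u x + \<beta> * v x)"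
  unfolding approx_def
proof (intro conjI cauchy_seq_lincomb L2_lincomb)
  have mem: "U n \<in> L2" "V n \<in> L2" "u \<in> L2" "v \<in> L2" for n
    using assms by (auto simp: approx_def dest: cauchy_seqD intro: in_L2)
  let ?b = "\<lambda>n. norm \<alpha> * l2_norm (\<lambda>x. U n x - u x) + norm \<beta> * l2_norm (\<lambda>x. V n x - v x)"
  have "?b \<longlonglongrightarrow> norm \<alpha> * 0 + norm \<beta> * 0"
    using assms by (intro tendsto_intros) (auto simp: approx_def)
  then have b: "?b \<longlonglongrightarrow> 0" by simp
  have le: "l2_norm (\<lambda>x. \<alpha> * U n x + \<beta> * V n x - (\<alpha> * u x + \<beta> * v x)) \<le> ?b n" for n
  proof -
    have eq: "(\<lambda>x. \<alpha> * U n x + \<beta> * V n x - (\<alpha> * u x + \<beta> * v x)) = (\<lambda>x. \<alpha> * (U n x - u x) + \<beta> * (V n x - v x))"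
      by (simp add: algebra_simps)
    have sc: "(\<lambda>x. \<gamma> * w x) \<in> L2" if "w \<in> L2" for w \<gamma> using L2_lincomb[OF that that, of \<gamma> 0] by simp
    show ?thesis unfolding eq
      using l2.nrm_triangle[of "\<lambda>x. \<alpha> * (U n x - u x)" "\<lambda>x. \<beta> * (V n x - v x)"] mem
      by (simp add: sc l2.diff_mem l2.nrm_scale[simplified])
  qed
  show "(\<lambda>n. l2_norm (\<lambda>x. \<alpha> * U n x + \<beta> * V n x - (\<alpha> * u x + \<beta> * v x))) \<longlonglongrightarrow> 0"
    by (rule tendsto_sandwich[OF _ _ tendsto_const b])
       (auto intro!: always_eventually le l2.nrm_nonneg[simplified] l2.diff_mem L2_lincomb mem)
qed (use assms in \<open>auto simp: approx_def\<close>)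

lemma approx_diff: "approx U u \<Longrightarrow> approx V v \<Longrightarrow> approx (\<lambda>n x. U n x - V n x) (\<lambda>x. u x - v x)"
  using approx_lincomb[of U u V v 1 "-1"] by simp

definition closure_dom :: "wavefun set" where
  "closure_dom = {u. \<exists>U. approx U u}"

definition approximant :: "wavefun \<Rightarrow> nat \<Rightarrow> wavefun" where
  "approximant u = (SOME U. approx U u)"

text \<open>The limit is taken along chosen approximants. That every approximating sequence yields
  the same value is \<open>tendsto_shifted_closure\<close>, and this is where closability
  enters.\<close>

definition shifted_closure :: "wavefun \<Rightarrow> wavefun \<Rightarrow> complex" where
  "shifted_closure u v = lim (\<lambda>n. shifted (approximant u n) (approximant v n))"

definition closure_form :: "wavefun \<Rightarrow> wavefun \<Rightarrow> complex" where
  "closure_form u v = shifted_closure u v - of_real (1 - c) * l2_inner u v"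

lemma approximant: "u \<in> closure_dom \<Longrightarrow> approx (approximant u) u"
  unfolding closure_dom_def approximant_def mem_Collect_eq by (rule someI_ex[of "\<lambda>U. approx U u"])

lemma subset_closure_dom: "D \<subseteq> closure_dom"
  using approx_const by (auto simp: closure_dom_def)

lemma closure_dom_L2: "u \<in> closure_dom \<Longrightarrow> u \<in> L2"
  by (auto simp: closure_dom_def approx_def)

end

locale closable_semibounded = semibounded +
  assumes closability: "cauchy_seq U \<Longrightarrow> (\<lambda>n. l2_norm (U n)) \<longlonglongrightarrow> 0 \<Longrightarrow> (\<lambda>n. nrm (U n)) \<longlonglongrightarrow> 0"
begin

text \<open>The difference of two approximating sequences is Cauchy in the form norm and tends to
  zero in L2.\<close>

lemma approx_unique:
  assumes "approx U u" "approx V u"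
  shows "(\<lambda>n. nrm (\<lambda>x. U n x - V n x)) \<longlonglongrightarrow> 0"
proof (rule closability)
  have a: "approx (\<lambda>n x. U n x - V n x) (\<lambda>x. u x - u x)"
    using assms by (intro approx_diff)
  then show "cauchy_seq (\<lambda>n x. U n x - V n x)" by (simp add: approx_def)
  show "(\<lambda>n. l2_norm (\<lambda>x. U n x - V n x)) \<longlonglongrightarrow> 0"
    using a by (simp add: approx_def)
qed

lemma tendsto_shifted_closure:
  assumes U: "approx U u" and V: "approx V v"
  shows "(\<lambda>n. shifted (U n) (V n)) \<longlonglongrightarrow> shifted_closure u v"
proof -
  have u: "approx (approximant u) u" and v: "approx (approximant v) v"
    using assms by (auto intro!: approximant simp: closure_dom_def)
  have cs: "cauchy_seq U" "cauchy_seq V" "cauchy_seq (approximant u)" "cauchy_seq (approximant v)"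
    using U V u v by (auto simp: approx_def)
  have mem: "U n \<in> D" "V n \<in> D" "approximant u n \<in> D" "approximant v n \<in> D" for n
    using cs by (auto dest: cauchy_seqD)
  obtain K where K: "0 < K" "\<And>n. nrm (V n) \<le> K" using cauchy_seq_bounded[OF cs(2)] by blast
  obtain L where L: "0 < L" "\<And>n. nrm (approximant u n) \<le> L" using cauchy_seq_bounded[OF cs(3)] by blast
  have lim: "(\<lambda>n. shifted (approximant u n) (approximant v n)) \<longlonglongrightarrow> shifted_closure u v"
    unfolding shifted_closure_def using cauchy_seq_form_convergent[OF cs(3,4)] by (simp add: convergent_LIMSEQ_iff)
  let ?b = "\<lambda>n. nrm (\<lambda>x. U n x - approximant u n x) * K + L * nrm (\<lambda>x. V n x - approximant v n x)"
  have "?b \<longlonglongrightarrow> 0 * K + L * 0"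
    by (intro tendsto_intros approx_unique[OF U u] approx_unique[OF V v])
  then have b: "?b \<longlonglongrightarrow> 0" by simp
  have le: "norm (shifted (U n) (V n) - shifted (approximant u n) (approximant v n)) \<le> ?b n" for n
  proof -
    have "norm (shifted (U n) (V n) - shifted (approximant u n) (approximant v n)) \<le>
       nrm (\<lambda>x. U n x - approximant u n x) * nrm (V n) + nrm (approximant u n) * nrm (\<lambda>x. V n x - approximant v n x)"
      using mem by (intro form_diff_le)
    also have "\<dots> \<le> ?b n"
      using mem K L by (intro add_mono mult_left_mono mult_right_mono nrm_nonneg diff_mem)
    finally show ?thesis .
  qed
  have "(\<lambda>n. shifted (U n) (V n) - shifted (approximant u n) (approximant v n)) \<longlonglongrightarrow> 0"
    by (rule Lim_null_comparison[OF always_eventually b]) (use le in blast)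
  from tendsto_add[OF this lim] show ?thesis by simp
qed

lemma shifted_closure_eq: "u \<in> D \<Longrightarrow> v \<in> D \<Longrightarrow> shifted_closure u v = shifted u v"
  using tendsto_shifted_closure[OF approx_const approx_const] by (simp add: LIMSEQ_const_iff)

sublocale cl: positive_form closure_dom shifted_closure
proof
  show "closure_dom \<noteq> {}" using subset_closure_dom nonempty by blast
  show "(\<lambda>x. \<alpha> * u x + \<beta> * v x) \<in> closure_dom" if "u \<in> closure_dom" "v \<in> closure_dom" for u v \<alpha> \<beta>
    using that approx_lincomb unfolding closure_dom_def by blast
  fix u v w assume u: "u \<in> closure_dom" and v: "v \<in> closure_dom"
  then obtain U V where U: "approx U u" and V: "approx V v" by (auto simp: closure_dom_def)
  have mem: "U n \<in> D" "V n \<in> D" for n using U V by (auto simp: approx_def dest: cauchy_seqD)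
  show "shifted_closure w (\<lambda>x. \<alpha> * u x + \<beta> * v x) = \<alpha> * shifted_closure w u + \<beta> * shifted_closure w v"
    if "w \<in> closure_dom" for \<alpha> \<beta>
  proof -
    obtain W where W: "approx W w" using \<open>w \<in> closure_dom\<close> by (auto simp: closure_dom_def)
    have memW: "W n \<in> D" for n using W by (auto simp: approx_def dest: cauchy_seqD)
    have "(\<lambda>n. shifted (W n) (\<lambda>x. \<alpha> * U n x + \<beta> * V n x)) \<longlonglongrightarrow> \<alpha> * shifted_closure w u + \<beta> * shifted_closure w v"
      using mem memW by (simp add: linear_right) (intro tendsto_intros tendsto_shifted_closure U V W)
    moreover have "(\<lambda>n. shifted (W n) (\<lambda>x. \<alpha> * U n x + \<beta> * V n x)) \<longlonglongrightarrow> shifted_closure w (\<lambda>x. \<alpha> * u x + \<beta> * v x)"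
      by (intro tendsto_shifted_closure U V W approx_lincomb)
    ultimately show ?thesis by (rule LIMSEQ_unique[rotated])
  qed
  show "shifted_closure v u = cnj (shifted_closure u v)"
  proof (rule LIMSEQ_unique)
    show "(\<lambda>n. shifted (V n) (U n)) \<longlonglongrightarrow> shifted_closure v u"
      by (intro tendsto_shifted_closure U V)
    have "(\<lambda>n. cnj (shifted (U n) (V n))) \<longlonglongrightarrow> cnj (shifted_closure u v)"
      by (intro tendsto_cnj tendsto_shifted_closure U V)
    then show "(\<lambda>n. shifted (V n) (U n)) \<longlonglongrightarrow> cnj (shifted_closure u v)"
      using mem by (simp add: hermitian[symmetric])
  qed
  show "0 \<le> Re (shifted_closure u u)"
  proof (rule tendsto_lowerbound)
    show "(\<lambda>n. Re (shifted (U n) (U n))) \<longlonglongrightarrow> Re (shifted_closure u u)"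
      by (intro tendsto_Re tendsto_shifted_closure U)
  qed (use mem nonneg in auto)
qed

lemma cl_nrm_eq: "u \<in> D \<Longrightarrow> cl.nrm u = nrm u"
  by (simp add: cl.nrm_def nrm_def shifted_closure_eq)

lemma tendsto_nrm:
  assumes U: "approx U u"
  shows "(\<lambda>n. nrm (U n)) \<longlonglongrightarrow> cl.nrm u"
  unfolding nrm_def cl.nrm_def by (intro tendsto_intros tendsto_shifted_closure U)

lemma l2_norm_le_cl_nrm: "u \<in> closure_dom \<Longrightarrow> l2_norm u \<le> cl.nrm u"
proof -
  assume "u \<in> closure_dom"
  then obtain U where U: "approx U u" by (auto simp: closure_dom_def)
  have mem: "U n \<in> D" for n using U by (auto simp: approx_def dest: cauchy_seqD)
  have u: "u \<in> L2" using U by (simp add: approx_def)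
  have le: "l2_norm u \<le> nrm (U n) + l2_norm (\<lambda>x. U n x - u x)" for n
  proof -
    have "l2_norm u \<le> l2_norm (U n) + l2_norm (\<lambda>x. u x - U n x)"
      using l2.nrm_le_add_diff[of u "U n"] u mem in_L2 by simp
    moreover have "l2_norm (\<lambda>x. u x - U n x) = l2_norm (\<lambda>x. U n x - u x)"
      using l2.nrm_diff_commute[of u "U n"] u mem in_L2 by simp
    ultimately show ?thesis using l2_norm_le_nrm[OF mem[of n]] by simp
  qed
  have "(\<lambda>n. nrm (U n) + l2_norm (\<lambda>x. U n x - u x)) \<longlonglongrightarrow> cl.nrm u + 0"
    using U by (intro tendsto_intros tendsto_nrm) (auto simp: approx_def)
  then show ?thesis using le by (auto intro: LIMSEQ_le_const)
qed

lemma approx_tendsto_cl_nrm: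
  assumes U: "approx U u"
  shows "(\<lambda>n. cl.nrm (\<lambda>x. U n x - u x)) \<longlonglongrightarrow> 0"
proof (rule LIMSEQ_I)
  fix e :: real assume e: "0 < e"
  have cs: "cauchy_seq U" using U by (simp add: approx_def)
  then obtain M where M: "\<And>m n. m \<ge> M \<Longrightarrow> n \<ge> M \<Longrightarrow> nrm (\<lambda>x. U m x - U n x) < e / 2"
    using e unfolding cauchy_seq_def by (meson half_gt_zero)
  have mem: "U n \<in> D" for n using cs by (rule cauchy_seqD)
  show "\<exists>M. \<forall>n\<ge>M. norm (cl.nrm (\<lambda>x. U n x - u x) - 0) < e"
  proof (intro exI[of _ M] allI impI)
    fix m assume m: "M \<le> m"
    \<comment> \<open>With \<open>m\<close> fixed, the sequence \<open>U m - U n\<close>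
      approximates \<open>U m - u\<close>, so the Cauchy estimate passes to the limit in
      \<open>n\<close>.\<close>
    have ap: "approx (\<lambda>n x. U m x - U n x) (\<lambda>x. U m x - u x)"
      by (intro approx_diff approx_const U mem)
    have "cl.nrm (\<lambda>x. U m x - u x) \<le> e / 2"
      by (rule LIMSEQ_le_const2[OF tendsto_nrm[OF ap]]) (use M m less_imp_le in blast)
    moreover have "0 \<le> cl.nrm (\<lambda>x. U m x - u x)"
      using ap by (intro cl.nrm_nonneg) (auto simp: closure_dom_def)
    ultimately show "norm (cl.nrm (\<lambda>x. U m x - u x) - 0) < e" using e by simp
  qed
qed

lemma closure_form_extends: "form_extends closure_dom closure_form D q"
  using subset_closure_dom by (simp add: form_extends_def closure_form_def shifted_closure_eq shifted_def)

lemma closure_form_linear_right: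
  "w \<in> closure_dom \<Longrightarrow> u \<in> closure_dom \<Longrightarrow> v \<in> closure_dom \<Longrightarrow>
   closure_form w (\<lambda>x. \<alpha> * u x + \<beta> * v x) = \<alpha> * closure_form w u + \<beta> * closure_form w v"
  by (simp add: closure_form_def cl.linear_right l2.linear_right closure_dom_L2 algebra_simps)

lemma closure_form_hermitian:
  "u \<in> closure_dom \<Longrightarrow> v \<in> closure_dom \<Longrightarrow> closure_form v u = cnj (closure_form u v)"
  using cl.hermitian[of u v] l2.hermitian[of u v] by (simp add: closure_form_def closure_dom_L2)

lemma closure_form_self:
  "u \<in> closure_dom \<Longrightarrow> closure_form u u = of_real ((cl.nrm u)\<^sup>2 - (1 - c) * (l2_norm u)\<^sup>2)"
  by (simp add: closure_form_def cl.diag_eq l2_inner_self closure_dom_L2)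

lemma semibounded_closure: "semibounded closure_dom closure_form c"
proof
  have lb: "c * (l2_norm u)\<^sup>2 \<le> Re (closure_form u u)" if "u \<in> closure_dom" for u
  proof -
    have "(l2_norm u)\<^sup>2 \<le> (cl.nrm u)\<^sup>2"
      using that l2_norm_le_cl_nrm[OF that] by (intro power_mono) (auto intro: l2.nrm_nonneg[simplified] closure_dom_L2)
    then show ?thesis using that by (simp add: closure_form_self algebra_simps)
  qed
  then show "u \<in> closure_dom \<Longrightarrow> c * (l2_norm u)\<^sup>2 \<le> Re (closure_form u u)" for u .
  show "semibounded_form closure_dom closure_form"
    unfolding semibounded_form_def
    using lb by (auto intro: closure_dom_L2 cl.lincomb closure_form_linear_right closure_form_hermitian)
       (use cl.nonempty in blast)
qed

text \<open>The closure is semibounded with the same \<open>c\<close> and its shift is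
  \<open>shifted_closure\<close>, so the facts on convergence in the form norm hold for it as
  well.\<close>

interpretation sc: semibounded closure_dom closure_form c
  rewrites "semibounded.shifted closure_form c = shifted_closure"
proof -
  show "semibounded closure_dom closure_form c" by (rule semibounded_closure)
  then interpret sc: semibounded closure_dom closure_form c .
  show "semibounded.shifted closure_form c = shifted_closure"
    by (simp add: fun_eq_iff sc.shifted_def closure_form_def)
qed

theorem closed_closure: "closed_form closure_dom closure_form"
  unfolding closed_form_def
proof (intro conjI allI impI)
  show "semibounded_form closure_dom closure_form" by (rule sc.semibounded)
  fix U u
  assume A: "(\<forall>n::nat. U n \<in> closure_dom) \<and> u \<in> L2 \<and> (\<lambda>n. l2_norm (\<lambda>x. U n x - u x)) \<longlonglongrightarrow> 0 \<and>
    (\<forall>e>0. \<exists>M. \<forall>m\<ge>M. \<forall>n\<ge>M. norm (closure_form (\<lambda>x. U m x - U n x) (\<lambda>x. U m x - U n x)) < e)"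
  then have mem: "\<And>n. U n \<in> closure_dom" and u: "u \<in> L2" and L: "(\<lambda>n. l2_norm (\<lambda>x. U n x - u x)) \<longlonglongrightarrow> 0"
    by auto
  have UL2: "U n \<in> L2" for n using mem by (rule closure_dom_L2)
  \<comment> \<open>The assumption is a Cauchy condition for the unshifted form; convergence in L2
    takes care of the shift.\<close>
  have cauchy: "\<exists>M. \<forall>m\<ge>M. \<forall>n\<ge>M. cl.nrm (\<lambda>x. U m x - U n x) < e" if e: "e > 0" for e
  proof -
    define K where "K = \<bar>1 - c\<bar> + 1"
    have K: "K > 0" unfolding K_def by simp
    obtain M1 where M1: "\<And>m n. m \<ge> M1 \<Longrightarrow> n \<ge> M1 \<Longrightarrow>
        norm (closure_form (\<lambda>x. U m x - U n x) (\<lambda>x. U m x - U n x)) < e\<^sup>2 / 2"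
      using A e by (meson half_gt_zero zero_less_power)
    \<comment> \<open>Chosen so that \<open>K * (2 * d)\<^sup>2\<close> is half of
      \<open>e\<^sup>2\<close>.\<close>
    define d where "d = e / (2 * sqrt (2 * K))"
    have d: "d > 0" using e K by (simp add: d_def)
    obtain M2 where M2: "\<And>n. n \<ge> M2 \<Longrightarrow> l2_norm (\<lambda>x. U n x - u x) < d"
      using order_tendstoD(2)[OF L d] by (auto simp: eventually_sequentially)
    show ?thesis
    proof (intro exI[of _ "max M1 M2"] allI impI)
      fix m n assume mn: "max M1 M2 \<le> m" "max M1 M2 \<le> n"
      let ?w = "\<lambda>x. U m x - U n x"
      have w: "?w \<in> closure_dom" using mem by (intro cl.diff_mem)
      have "l2_norm ?w \<le> l2_norm (\<lambda>x. U m x - u x) + l2_norm (\<lambda>x. u x - U n x)"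
        using l2.nrm_diff_triangle[of "U m" u "U n"] UL2 u by simp
      also have "l2_norm (\<lambda>x. u x - U n x) = l2_norm (\<lambda>x. U n x - u x)"
        using l2.nrm_diff_commute[of "U n" u] UL2 u by simp
      finally have "l2_norm ?w \<le> 2 * d" using M2[of m] M2[of n] mn by simp
      then have "(l2_norm ?w)\<^sup>2 \<le> (2 * d)\<^sup>2"
        by (intro power_mono) (auto intro!: l2.nrm_nonneg[simplified] closure_dom_L2 w)
      also have "\<dots> = e\<^sup>2 / (2 * K)" using K by (simp add: d_def power_divide power_mult_distrib)
      finally have 1: "K * (l2_norm ?w)\<^sup>2 \<le> e\<^sup>2 / 2" using K by (simp add: field_simps)
      have "(cl.nrm ?w)\<^sup>2 = Re (closure_form ?w ?w) + (1 - c) * (l2_norm ?w)\<^sup>2"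
        using w by (simp add: closure_form_self)
      also have "Re (closure_form ?w ?w) < e\<^sup>2 / 2"
        using M1[of m n] mn complex_Re_le_cmod[of "closure_form ?w ?w"] by linarith
      also have "(1 - c) * (l2_norm ?w)\<^sup>2 \<le> K * (l2_norm ?w)\<^sup>2"
        by (intro mult_right_mono) (auto simp: K_def)
      finally have "(cl.nrm ?w)\<^sup>2 < e\<^sup>2" using 1 by linarith
      then show "cl.nrm ?w < e" using e by (intro power2_less_imp_less[of _ e]) auto
    qed
  qed
  \<comment> \<open>Diagonal argument: each \<open>U k\<close> is replaced by an element of
    \<open>D\<close> at distance less than \<open>1 / (k + 1)\<close>.\<close>
  have ex: "\<exists>\<phi>. \<phi> \<in> D \<and> cl.nrm (\<lambda>x. \<phi> x - U k x) < inverse (real (Suc k))" for k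
  proof -
    have "(\<lambda>n. cl.nrm (\<lambda>x. approximant (U k) n x - U k x)) \<longlonglongrightarrow> 0"
      by (intro approx_tendsto_cl_nrm approximant mem)
    then have "\<forall>\<^sub>F n in sequentially. cl.nrm (\<lambda>x. approximant (U k) n x - U k x) < inverse (real (Suc k))"
      by (rule order_tendstoD) simp
    then obtain n where "cl.nrm (\<lambda>x. approximant (U k) n x - U k x) < inverse (real (Suc k))"
      by (auto simp: eventually_sequentially)
    moreover have "approximant (U k) n \<in> D"
      using approximant[OF mem[of k]] by (auto simp: approx_def dest: cauchy_seqD)
    ultimately show ?thesis by blast
  qed
  obtain \<phi> where \<phi>: "\<And>k. \<phi> k \<in> D" "\<And>k. cl.nrm (\<lambda>x. \<phi> k x - U k x) < inverse (real (Suc k))"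
  proof -
    have "\<forall>k. \<exists>\<phi>. \<phi> \<in> D \<and> cl.nrm (\<lambda>x. \<phi> x - U k x) < inverse (real (Suc k))"
      using ex by blast
    from choice[OF this] show ?thesis using that by blast
  qed
  have \<phi>cl: "\<phi> k \<in> closure_dom" for k using \<phi>(1) subset_closure_dom by blast
  have inv0: "(\<lambda>k. inverse (real (Suc k))) \<longlonglongrightarrow> 0" by (rule LIMSEQ_inverse_real_of_nat)
  have \<phi>U: "(\<lambda>k. cl.nrm (\<lambda>x. \<phi> k x - U k x)) \<longlonglongrightarrow> 0"
    by (rule tendsto_sandwich[OF _ _ tendsto_const inv0])
       (auto intro!: always_eventually cl.nrm_nonneg cl.diff_mem \<phi>cl mem less_imp_le[OF \<phi>(2)] simp del: of_nat_Suc)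
  have "cauchy_seq \<phi>"
    unfolding cauchy_seq_def
  proof (intro conjI allI impI \<phi>(1))
    fix e :: real assume e: "e > 0"
    then have e3: "e / 3 > 0" by simp
    obtain M1 where M1: "\<And>m n. m \<ge> M1 \<Longrightarrow> n \<ge> M1 \<Longrightarrow> cl.nrm (\<lambda>x. U m x - U n x) < e / 3"
      using cauchy[OF e3] by blast
    obtain M2 where M2: "\<And>n. n \<ge> M2 \<Longrightarrow> cl.nrm (\<lambda>x. \<phi> n x - U n x) < e / 3"
      using order_tendstoD(2)[OF \<phi>U e3] by (auto simp: eventually_sequentially)
    show "\<exists>M. \<forall>m\<ge>M. \<forall>n\<ge>M. nrm (\<lambda>x. \<phi> m x - \<phi> n x) < e"
    proof (intro exI[of _ "max M1 M2"] allI impI)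
      fix m n assume mn: "max M1 M2 \<le> m" "max M1 M2 \<le> n"
      have "nrm (\<lambda>x. \<phi> m x - \<phi> n x) = cl.nrm (\<lambda>x. \<phi> m x - \<phi> n x)"
        by (intro cl_nrm_eq[symmetric] diff_mem \<phi>)
      also have "\<dots> \<le> cl.nrm (\<lambda>x. \<phi> m x - U m x) + cl.nrm (\<lambda>x. U m x - \<phi> n x)"
        by (intro cl.nrm_diff_triangle \<phi>cl mem)
      also have "cl.nrm (\<lambda>x. U m x - \<phi> n x) \<le> cl.nrm (\<lambda>x. U m x - U n x) + cl.nrm (\<lambda>x. U n x - \<phi> n x)"
        by (intro cl.nrm_diff_triangle \<phi>cl mem)
      also have "cl.nrm (\<lambda>x. U n x - \<phi> n x) = cl.nrm (\<lambda>x. \<phi> n x - U n x)"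
        by (intro cl.nrm_diff_commute \<phi>cl mem)
      finally show "nrm (\<lambda>x. \<phi> m x - \<phi> n x) < e"
        using M1[of m n] M2[of m] M2[of n] mn by simp
    qed
  qed
  moreover have "(\<lambda>n. l2_norm (\<lambda>x. \<phi> n x - u x)) \<longlonglongrightarrow> 0"
  proof (rule tendsto_sandwich[OF _ _ tendsto_const])
    show "(\<lambda>n. cl.nrm (\<lambda>x. \<phi> n x - U n x) + l2_norm (\<lambda>x. U n x - u x)) \<longlonglongrightarrow> 0"
      using tendsto_add[OF \<phi>U L] by simp
    have "l2_norm (\<lambda>x. \<phi> n x - u x) \<le> cl.nrm (\<lambda>x. \<phi> n x - U n x) + l2_norm (\<lambda>x. U n x - u x)" for n
      using l2.nrm_diff_triangle[of "\<phi> n" "U n" u] in_L2[OF \<phi>(1)] UL2 u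
        l2_norm_le_cl_nrm[OF cl.diff_mem[OF \<phi>cl mem], of n n] by simp
    then show "\<forall>\<^sub>F n in sequentially. l2_norm (\<lambda>x. \<phi> n x - u x) \<le> cl.nrm (\<lambda>x. \<phi> n x - U n x) + l2_norm (\<lambda>x. U n x - u x)"
      by simp
    show "\<forall>\<^sub>F n in sequentially. 0 \<le> l2_norm (\<lambda>x. \<phi> n x - u x)"
      using l2.nrm_nonneg[OF l2.diff_mem[OF in_L2[OF \<phi>(1)] u]] by simp
  qed
  ultimately have ap: "approx \<phi> u" using u by (simp add: approx_def)
  then show ucl: "u \<in> closure_dom" by (auto simp: closure_dom_def)
  have "(\<lambda>n. cl.nrm (\<lambda>x. U n x - u x)) \<longlonglongrightarrow> 0"
  proof (rule tendsto_sandwich[OF _ _ tendsto_const])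
    show "(\<lambda>n. cl.nrm (\<lambda>x. \<phi> n x - U n x) + cl.nrm (\<lambda>x. \<phi> n x - u x)) \<longlonglongrightarrow> 0"
      using tendsto_add[OF \<phi>U approx_tendsto_cl_nrm[OF ap]] by simp
    have "cl.nrm (\<lambda>x. U n x - u x) \<le> cl.nrm (\<lambda>x. \<phi> n x - U n x) + cl.nrm (\<lambda>x. \<phi> n x - u x)" for n
      using cl.nrm_diff_triangle[OF mem \<phi>cl ucl, of n n] cl.nrm_diff_commute[OF mem \<phi>cl, of n n] by simp
    then show "\<forall>\<^sub>F n in sequentially. cl.nrm (\<lambda>x. U n x - u x) \<le> cl.nrm (\<lambda>x. \<phi> n x - U n x) + cl.nrm (\<lambda>x. \<phi> n x - u x)"
      by simp
    show "\<forall>\<^sub>F n in sequentially. 0 \<le> cl.nrm (\<lambda>x. U n x - u x)"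
      using cl.nrm_nonneg[OF cl.diff_mem[OF mem ucl]] by simp
  qed
  then show "(\<lambda>n. closure_form (\<lambda>x. U n x - u x) (\<lambda>x. U n x - u x)) \<longlonglongrightarrow> 0"
    using sc.nrm_tendsto_0_iff[of "\<lambda>n x. U n x - u x"] cl.diff_mem[OF mem ucl] by simp
qed

theorem closable: "closable_form D q"
  unfolding closable_form_def using semibounded closed_closure closure_form_extends by blast

end

section \<open>Counting negative eigenvalues\<close>

text \<open>Gaussian elimination: equation \<open>j\<close> is solved for a variable
  \<open>p0\<close> with nonzero coefficient and substituted into the other equations, whose new
  coefficients are \<open>N\<close>. If there is no such variable, the equation is void.\<close>

lemma homogeneous_system_nontrivial:
  fixes M :: "'i \<Rightarrow> 'k \<Rightarrow> 'f::field"
  assumes "finite I" "finite P" "card I < card P"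
  shows "\<exists>c. (\<exists>p\<in>P. c p \<noteq> 0) \<and> (\<forall>i\<in>I. (\<Sum>p\<in>P. c p * M i p) = 0)"
  using assms
proof (induction I arbitrary: P M rule: finite_induct)
  case empty
  then obtain p where "p \<in> P" by fastforce
  then show ?case by (intro exI[of _ "\<lambda>_. 1"]) auto
next
  case (insert j I)
  show ?case
  proof (cases "\<forall>p\<in>P. M j p = 0")
    case True
    have "card I < card P" using insert by simp
    from insert.IH[OF \<open>finite P\<close> this, of M] show ?thesis using True by auto
  next
    case False
    then obtain p0 where p0: "p0 \<in> P" "M j p0 \<noteq> 0" by auto
    define N where "N = (\<lambda>i p. M i p - M i p0 * M j p / M j p0)"
    have "card I < card (P - {p0})" using insert p0 by simp
    from insert.IH[OF _ this, of N] insert.prems obtain c where c: "\<exists>p\<in>P - {p0}. c p \<noteq> 0"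
      "\<And>i. i \<in> I \<Longrightarrow> (\<Sum>p\<in>P - {p0}. c p * N i p) = 0" by auto
    define s where "s = - (\<Sum>p\<in>P - {p0}. c p * M j p) / M j p0"
    define c' where "c' = c(p0 := s)"
    have sum: "(\<Sum>p\<in>P. c' p * M i p) = s * M i p0 + (\<Sum>p\<in>P - {p0}. c p * M i p)" for i
      using insert.prems p0 by (simp add: sum.remove[of P p0] c'_def)
    have "(\<Sum>p\<in>P. c' p * M i p) = 0" if i: "i \<in> insert j I" for i
    proof (cases "i = j")
      case True
      then show ?thesis using p0 by (simp add: sum s_def)
    next
      case False
      then have "i \<in> I" using i by simp
      then have "0 = (\<Sum>p\<in>P - {p0}. c p * N i p)" using c by simp
      also have "\<dots> = (\<Sum>p\<in>P - {p0}. c p * M i p - M i p0 / M j p0 * (c p * M j p))"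
        by (simp add: N_def algebra_simps)
      also have "\<dots> = (\<Sum>p\<in>P - {p0}. c p * M i p) - M i p0 / M j p0 * (\<Sum>p\<in>P - {p0}. c p * M j p)"
        by (simp only: sum_subtractf sum_distrib_left)
      finally show ?thesis by (simp add: sum s_def)
    qed
    moreover have "\<exists>p\<in>P. c' p \<noteq> 0" using c(1) by (auto simp: c'_def)
    ultimately show ?thesis by blast
  qed
qed

text \<open>The set of admissible sizes contains zero and has a finite supremum, so it is nonempty
  and finite and the supremum is a maximum.\<close>

lemma ae_dim_attained:
  assumes "ae_dim E = enat d"
  shows "\<exists>e. (\<forall>k<d. e k \<in> E) \<and> ae_independent d e"
proof -
  let ?N = "{n. \<exists>e. (\<forall>k<n. e k \<in> E) \<and> ae_independent n e}"
  have "0 \<in> ?N" by (simp add: ae_independent_def)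
  then have ne: "enat ` ?N \<noteq> {}" by blast
  have S: "Sup (enat ` ?N) = enat d" using assms by (simp add: ae_dim_def)
  then have fin: "finite (enat ` ?N)" using ne by (auto simp: Sup_enat_def split: if_splits)
  then have "Sup (enat ` ?N) = Max (enat ` ?N)"
    unfolding Sup_enat_def using ne by (simp only: if_False if_True)
  then have "Max (enat ` ?N) = enat d" using S by simp
  then have "enat d \<in> enat ` ?N" using Max_in[OF fin ne] by simp
  then show ?thesis by auto
qed

context closable_semibounded
begin

lemma approx_sum:
  assumes "\<And>p. p \<in> P \<Longrightarrow> approx (U p) (u p)"
  shows "approx (\<lambda>n x. \<Sum>p\<in>P. b p * U p n x) (\<lambda>x. \<Sum>p\<in>P. b p * u p x)"
  using assms
proof (induction P rule: infinite_finite_induct)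
  case (insert p P)
  then have "approx (\<lambda>n x. b p * U p n x + 1 * (\<Sum>p\<in>P. b p * U p n x)) (\<lambda>x. b p * u p x + 1 * (\<Sum>p\<in>P. b p * u p x))"
    by (intro approx_lincomb) auto
  then show ?case using insert by simp
qed (auto simp: approx_const zero_mem)

lemma closure_form_sum_left:
  assumes "w \<in> closure_dom" "\<And>p. p \<in> P \<Longrightarrow> u p \<in> closure_dom"
  shows "closure_form (\<lambda>x. \<Sum>p\<in>P. b p * u p x) w = (\<Sum>p\<in>P. cnj (b p) * closure_form (u p) w)"
  using assms by (simp add: closure_form_def cl.sum_left l2.sum_left closure_dom_L2 sum_subtractf[symmetric] sum_distrib_left algebra_simps)

lemma closure_form_sum_right:
  assumes "w \<in> closure_dom" "\<And>p. p \<in> P \<Longrightarrow> u p \<in> closure_dom"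
  shows "closure_form w (\<lambda>x. \<Sum>p\<in>P. b p * u p x) = (\<Sum>p\<in>P. b p * closure_form w (u p))"
  using assms by (simp add: closure_form_def cl.sum_right l2.sum_right closure_dom_L2 sum_subtractf[symmetric] sum_distrib_left algebra_simps)

lemma tendsto_closure_form:
  assumes U: "approx U u"
  shows "(\<lambda>n. q (U n) (U n)) \<longlonglongrightarrow> closure_form u u"
proof -
  have mem: "U n \<in> D" for n using U by (auto simp: approx_def dest: cauchy_seqD)
  have "(\<lambda>n. shifted (U n) (U n) - of_real (1 - c) * l2_inner (U n) (U n)) \<longlonglongrightarrow> closure_form u u"
    unfolding closure_form_def
    using U mem by (intro tendsto_intros tendsto_shifted_closure l2.tendsto_form) (auto simp: approx_def in_L2)
  then show ?thesis by (simp add: shifted_def)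
qed

text \<open>A closure is by definition contained in every closed extension, in particular in
  \<open>closure_form\<close>, so the eigenvalue equation can be tested there. Any two closures have
  the same domain. If there is no closure, the operator is empty and \<open>D' = {}\<close>
  serves.\<close>

lemma friedrichs_eigenspace:
  obtains D' where "D' \<subseteq> closure_dom"
    "\<And>z u. u \<in> eigenspace (friedrichs D q) z \<Longrightarrow> u \<in> D'"
    "\<And>z u v. u \<in> eigenspace (friedrichs D q) z \<Longrightarrow> v \<in> D' \<Longrightarrow> closure_form v u = z * l2_inner v u"
proof (cases "\<exists>D' q'. is_form_closure D' q' D q")
  case False
  then have "friedrichs D q = {}" by (auto simp: friedrichs_def)
  then show ?thesis by (intro that[of "{}"]) (auto simp: eigenspace_def)
next
  case True
  then obtain D' q' where cl: "is_form_closure D' q' D q" by blast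
  have sub: "form_extends closure_dom closure_form D1 q1" if "is_form_closure D1 q1 D q" for D1 q1
    using that closed_closure closure_form_extends unfolding is_form_closure_def by blast
  have eqD: "D1 = D'" if "is_form_closure D1 q1 D q" for D1 q1
    using that cl unfolding is_form_closure_def form_extends_def by (meson subset_antisym)
  have D': "D' \<subseteq> closure_dom" using sub[OF cl] by (simp add: form_extends_def)
  have main: "u \<in> D' \<and> (\<forall>v\<in>D'. closure_form v u = z * l2_inner v u)"
    if u: "u \<in> eigenspace (friedrichs D q) z" for u z
  proof -
    from u obtain D1 q1 where 1: "is_form_closure D1 q1 D q" "(u, \<lambda>x. z * u x) \<in> form_operator D1 q1"
      by (auto simp: eigenspace_def friedrichs_def)
    from 1 have uD: "u \<in> D'" by (auto simp: form_operator_def eqD[OF 1(1)])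
    moreover have "closure_form v u = z * l2_inner v u" if v: "v \<in> D'" for v
    proof -
      have "closure_form v u = q1 v u"
        using sub[OF 1(1)] v uD eqD[OF 1(1)] by (simp add: form_extends_def)
      also have "\<dots> = l2_inner v (\<lambda>x. z * u x)"
        using 1(2) v eqD[OF 1(1)] by (simp add: form_operator_def)
      also have "\<dots> = z * l2_inner v u"
      proof -
        have "u \<in> L2" "v \<in> L2" using uD v D' by (auto intro: closure_dom_L2)
        from l2.linear_right[OF this(2,1,1), of z 0] show ?thesis by simp
      qed
      finally show ?thesis .
    qed
    ultimately show ?thesis by blast
  qed
  show ?thesis by (rule that[of D']) (use D' main in auto)
qed

text \<open>
  The functionals extend to the form closure by continuity. If the eigenvectors spanned a space of
  dimension larger than \<open>card I\<close>, some nonzero vector would be annihilated by all of them, which makes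
  the form nonnegative on a combination of eigenvectors with negative eigenvalues.
\<close>

lemma sum_multiplicities_le:
  fixes l :: "'i \<Rightarrow> wavefun \<Rightarrow> complex"
  assumes I: "finite I"
    and lin: "\<And>i u v \<alpha> \<beta>. i \<in> I \<Longrightarrow> u \<in> D \<Longrightarrow> v \<in> D \<Longrightarrow> l i (\<lambda>x. \<alpha> * u x + \<beta> * v x) = \<alpha> * l i u + \<beta> * l i v"
    and bd: "\<And>i u. i \<in> I \<Longrightarrow> u \<in> D \<Longrightarrow> norm (l i u) \<le> K1 * nrm u"
    and low: "\<And>u. u \<in> D \<Longrightarrow> - K2 * (\<Sum>i\<in>I. (norm (l i u))\<^sup>2) \<le> Re (q u u)"
    and F: "finite F" "\<And>s. s \<in> F \<Longrightarrow> s < 0"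
    and e: "\<And>s k. s \<in> F \<Longrightarrow> k < d s \<Longrightarrow> e s k \<in> eigenspace (friedrichs D q) (of_real s)"
    and ind: "\<And>s. s \<in> F \<Longrightarrow> ae_independent (d s) (e s)"
  shows "(\<Sum>s\<in>F. d s) \<le> card I"
proof (rule ccontr)
  assume "\<not> (\<Sum>s\<in>F. d s) \<le> card I"
  define P where "P = (SIGMA s:F. {..<d s})"
  have P: "finite P" "card I < card P"
    using F \<open>\<not> _\<close> by (auto simp: P_def card_SigmaI)
  obtain D' where D': "D' \<subseteq> closure_dom"
    "\<And>z u. u \<in> eigenspace (friedrichs D q) z \<Longrightarrow> u \<in> D'"
    "\<And>z u v. u \<in> eigenspace (friedrichs D q) z \<Longrightarrow> v \<in> D' \<Longrightarrow> closure_form v u = z * l2_inner v u"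
    using friedrichs_eigenspace by metis
  define u where "u p = e (fst p) (snd p)" for p
  have uE: "u p \<in> eigenspace (friedrichs D q) (of_real (fst p))" if "p \<in> P" for p
    using that e by (auto simp: u_def P_def)
  have uD': "u p \<in> D'" if "p \<in> P" for p using D'(2) uE that by blast
  have ucl: "u p \<in> closure_dom" if "p \<in> P" for p using D'(1) uD' that by blast
  have uL2: "u p \<in> L2" if "p \<in> P" for p using closure_dom_L2 ucl that by blast
  define U where "U p = approximant (u p)" for p
  have U: "approx (U p) (u p)" if "p \<in> P" for p using that by (simp add: U_def approximant ucl)
  have UD: "U p n \<in> D" if "p \<in> P" for p n using U[OF that] by (auto simp: approx_def dest: cauchy_seqD)
  have l_diff: "l i (\<lambda>x. v x - w x) = l i v - l i w" if "i \<in> I" "v \<in> D" "w \<in> D" for i v w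
    using lin[OF that, of 1 "-1"] by simp
  have l_sum: "l i (\<lambda>x. \<Sum>p\<in>Q. c p * v p x) = (\<Sum>p\<in>Q. c p * l i (v p))"
    if "i \<in> I" "finite Q" "\<And>p. p \<in> Q \<Longrightarrow> v p \<in> D" for i Q and c :: "real \<times> nat \<Rightarrow> complex" and v
    using that(2,3)
  proof (induction Q rule: finite_induct)
    case empty
    show ?case using lin[OF that(1) zero_mem zero_mem, of 0 0] by simp
  next
    case (insert p Q)
    have "l i (\<lambda>x. c p * v p x + 1 * (\<Sum>p\<in>Q. c p * v p x)) = c p * l i (v p) + 1 * l i (\<lambda>x. \<Sum>p\<in>Q. c p * v p x)"
      using insert by (intro lin that(1) sum_mem) auto
    then show ?case using insert by simp
  qed
  \<comment> \<open>Boundedness in the form norm makes each functional converge along the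
    approximating sequence; the limit \<open>lam\<close> is its value at the eigenvector.\<close>
  have conv: "convergent (\<lambda>n. l i (U p n))" if i: "i \<in> I" and p: "p \<in> P" for i p
  proof -
    have "Cauchy (\<lambda>n. l i (U p n))"
    proof (rule CauchyI)
      fix \<epsilon> :: real assume \<epsilon>: "\<epsilon> > 0"
      define K where "K = \<bar>K1\<bar> + 1"
      have K: "K > 0" "K1 \<le> K" by (auto simp: K_def)
      have "cauchy_seq (U p)" using U[OF p] by (simp add: approx_def)
      then obtain M where M: "\<And>m n. m \<ge> M \<Longrightarrow> n \<ge> M \<Longrightarrow> nrm (\<lambda>x. U p m x - U p n x) < \<epsilon> / K"
        using \<epsilon> K unfolding cauchy_seq_def by (meson divide_pos_pos)
      show "\<exists>M. \<forall>m\<ge>M. \<forall>n\<ge>M. norm (l i (U p m) - l i (U p n)) < \<epsilon>"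
      proof (intro exI[of _ M] allI impI)
        fix m n assume mn: "M \<le> m" "M \<le> n"
        have "norm (l i (U p m) - l i (U p n)) = norm (l i (\<lambda>x. U p m x - U p n x))"
          using i p by (simp add: l_diff UD)
        also have "\<dots> \<le> K1 * nrm (\<lambda>x. U p m x - U p n x)"
          using i p by (intro bd diff_mem UD)
        also have "\<dots> \<le> K * nrm (\<lambda>x. U p m x - U p n x)"
          using K p by (intro mult_right_mono nrm_nonneg diff_mem UD)
        also have "\<dots> < K * (\<epsilon> / K)"
          using M[OF mn] K by (intro mult_strict_left_mono)
        finally show "norm (l i (U p m) - l i (U p n)) < \<epsilon>" using K by simp
      qed
    qed
    then show ?thesis by (rule Cauchy_convergent)
  qed
  define lam where "lam i p = lim (\<lambda>n. l i (U p n))" for i p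
  have lam: "(\<lambda>n. l i (U p n)) \<longlonglongrightarrow> lam i p" if "i \<in> I" "p \<in> P" for i p
    using conv[OF that] by (simp add: lam_def convergent_LIMSEQ_iff)
  obtain c where c: "\<exists>p\<in>P. c p \<noteq> 0" "\<And>i. i \<in> I \<Longrightarrow> (\<Sum>p\<in>P. c p * lam i p) = 0"
    using homogeneous_system_nontrivial[OF I P, of lam] by blast
  define w where "w = (\<lambda>x. \<Sum>p\<in>P. c p * u p x)"
  define W where "W = (\<lambda>n x. \<Sum>p\<in>P. c p * U p n x)"
  have W: "approx W w" unfolding W_def w_def by (intro approx_sum U)
  have WD: "W n \<in> D" for n using W by (auto simp: approx_def dest: cauchy_seqD)
  have wcl: "w \<in> closure_dom" using W by (auto simp: closure_dom_def)
  have lW: "(\<lambda>n. l i (W n)) \<longlonglongrightarrow> 0" if i: "i \<in> I" for i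
  proof -
    have "(\<lambda>n. \<Sum>p\<in>P. c p * l i (U p n)) \<longlonglongrightarrow> (\<Sum>p\<in>P. c p * lam i p)"
      using i by (intro tendsto_intros lam)
    moreover have "l i (W n) = (\<Sum>p\<in>P. c p * l i (U p n))" for n
      unfolding W_def using i P by (intro l_sum UD)
    ultimately show ?thesis using c(2)[OF i] by simp
  qed
  \<comment> \<open>The functionals tend to zero along \<open>W\<close>, so the lower bound
    \<open>low\<close> loses its negative part in the limit.\<close>
  have "0 \<le> Re (closure_form w w)"
  proof (rule LIMSEQ_le)
    have "(\<lambda>n. - K2 * (\<Sum>i\<in>I. (norm (l i (W n)))\<^sup>2)) \<longlonglongrightarrow> - K2 * (\<Sum>i\<in>I. (norm (0::complex))\<^sup>2)"
      by (intro tendsto_intros lW)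
    then show "(\<lambda>n. - K2 * (\<Sum>i\<in>I. (norm (l i (W n)))\<^sup>2)) \<longlonglongrightarrow> 0" by simp
    show "(\<lambda>n. Re (q (W n) (W n))) \<longlonglongrightarrow> Re (closure_form w w)"
      by (intro tendsto_intros tendsto_closure_form W)
  qed (use low WD in blast)
  \<comment> \<open>Hermitian symmetry makes eigenvectors for different eigenvalues
    orthogonal.\<close>
  have orth: "l2_inner (u p) (u r) = 0" if p: "p \<in> P" and r: "r \<in> P" and ne: "fst p \<noteq> fst r" for p r
  proof -
    have "of_real (fst r) * l2_inner (u p) (u r) = closure_form (u p) (u r)"
      using D'(3)[OF uE[OF r] uD'[OF p]] by simp
    also have "\<dots> = cnj (closure_form (u r) (u p))"
      using p r by (intro closure_form_hermitian ucl)
    also have "\<dots> = cnj (of_real (fst p) * l2_inner (u r) (u p))"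
      using D'(3)[OF uE[OF p] uD'[OF r]] by simp
    also have "\<dots> = of_real (fst p) * l2_inner (u p) (u r)"
      using l2.hermitian[OF uL2[OF r] uL2[OF p]] by simp
    finally show ?thesis using ne by simp
  qed
  define ws where "ws s = (\<lambda>x. \<Sum>k<d s. c (s, k) * e s k x)" for s
  have ws: "ws s = (\<lambda>x. \<Sum>p\<in>{s} \<times> {..<d s}. c p * u p x)" for s
    unfolding ws_def u_def by (simp add: sum.cartesian_product' fun_eq_iff)
  have subP: "p \<in> P" if "s \<in> F" "p \<in> {s} \<times> {..<d s}" for p s using that by (auto simp: P_def)
  have wsL2: "ws s \<in> L2" if "s \<in> F" for s
    unfolding ws using subP[OF that] by (intro l2.sum_mem uL2)
  have w_eq: "w = (\<lambda>x. \<Sum>s\<in>F. 1 * ws s x)"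
    unfolding w_def ws_def u_def P_def using F by (simp add: sum.Sigma case_prod_beta fun_eq_iff)
  have "closure_form w w = (\<Sum>p\<in>P. c p * closure_form w (u p))"
    by (subst (2) w_def) (intro closure_form_sum_right wcl ucl)
  also have "\<dots> = (\<Sum>p\<in>P. c p * (of_real (fst p) * l2_inner w (u p)))"
  proof (intro sum.cong refl arg_cong2[where f="(*)"])
    fix p assume p: "p \<in> P"
    have "closure_form w (u p) = (\<Sum>r\<in>P. cnj (c r) * closure_form (u r) (u p))"
      unfolding w_def using p by (intro closure_form_sum_left ucl)
    also have "\<dots> = (\<Sum>r\<in>P. cnj (c r) * (of_real (fst p) * l2_inner (u r) (u p)))"
      using D'(3)[OF uE[OF p] uD'] by simp
    also have "\<dots> = of_real (fst p) * (\<Sum>r\<in>P. cnj (c r) * l2_inner (u r) (u p))"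
      by (simp add: sum_distrib_left algebra_simps)
    also have "(\<Sum>r\<in>P. cnj (c r) * l2_inner (u r) (u p)) = l2_inner w (u p)"
      unfolding w_def using p by (intro l2.sum_left[symmetric] uL2)
    finally show "closure_form w (u p) = of_real (fst p) * l2_inner w (u p)" .
  qed
  also have "\<dots> = (\<Sum>s\<in>F. \<Sum>k<d s. c (s, k) * (of_real s * l2_inner w (e s k)))"
    unfolding P_def using F by (subst sum.Sigma) (auto simp: u_def case_prod_beta)
  also have "\<dots> = (\<Sum>s\<in>F. of_real s * l2_inner w (ws s))"
  proof (intro sum.cong refl)
    fix s assume s: "s \<in> F"
    have "l2_inner w (ws s) = (\<Sum>k<d s. c (s, k) * l2_inner w (e s k))"
      unfolding ws_def using s uL2[of "(s, _)"] wcl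
      by (intro l2.sum_right) (auto simp: u_def P_def closure_dom_L2)
    then show "(\<Sum>k<d s. c (s, k) * (of_real s * l2_inner w (e s k))) = of_real s * l2_inner w (ws s)"
      by (simp add: sum_distrib_left algebra_simps)
  qed
  also have "\<dots> = (\<Sum>s\<in>F. of_real (s * (l2_norm (ws s))\<^sup>2))"
  proof (intro sum.cong refl)
    fix s assume s: "s \<in> F"
    have orth': "l2_inner (ws t) (ws s) = 0" if t: "t \<in> F" "t \<noteq> s" for t
    proof -
      have "l2_inner (ws t) (ws s) = (\<Sum>p\<in>{t} \<times> {..<d t}. cnj (c p) * l2_inner (u p) (ws s))"
        by (subst ws[of t]) (intro l2.sum_left wsL2 s uL2 subP[OF t(1)])
      also have "\<dots> = 0"
      proof (intro sum.neutral ballI)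
        fix p assume p: "p \<in> {t} \<times> {..<d t}"
        have "l2_inner (u p) (ws s) = (\<Sum>r\<in>{s} \<times> {..<d s}. c r * l2_inner (u p) (u r))"
          unfolding ws by (intro l2.sum_right uL2 subP[OF t(1) p] subP[OF s])
        also have "\<dots> = 0"
        proof (intro sum.neutral ballI)
          fix r assume r: "r \<in> {s} \<times> {..<d s}"
          have "l2_inner (u p) (u r) = 0"
            using p r t by (intro orth[OF subP[OF t(1) p] subP[OF s r]]) auto
          then show "c r * l2_inner (u p) (u r) = 0" by simp
        qed
        finally show "cnj (c p) * l2_inner (u p) (ws s) = 0" by simp
      qed
      finally show ?thesis .
    qed
    have "l2_inner w (ws s) = (\<Sum>t\<in>F. cnj 1 * l2_inner (ws t) (ws s))"
      unfolding w_eq by (intro l2.sum_left wsL2 s)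
    also have "\<dots> = (\<Sum>t\<in>F. if t = s then l2_inner (ws s) (ws s) else 0)"
      using orth' by (intro sum.cong) auto
    also have "\<dots> = of_real ((l2_norm (ws s))\<^sup>2)"
      using F s by (simp add: l2_inner_self wsL2)
    finally show "of_real s * l2_inner w (ws s) = of_real (s * (l2_norm (ws s))\<^sup>2)" by simp
  qed
  \<comment> \<open>The form is diagonal in the eigenvalues. Every summand is nonpositive while the
    sum is nonnegative, so each component \<open>ws s\<close> vanishes almost everywhere, and
    independence kills the coefficients.\<close>
  finally have eq: "Re (closure_form w w) = (\<Sum>s\<in>F. s * (l2_norm (ws s))\<^sup>2)" by simp
  have le0: "s * (l2_norm (ws s))\<^sup>2 \<le> 0" if "s \<in> F" for s
    using F(2)[OF that] by (simp add: mult_le_0_iff)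
  have "(\<Sum>s\<in>F. - (s * (l2_norm (ws s))\<^sup>2)) = 0"
    using \<open>0 \<le> Re (closure_form w w)\<close> eq sum_nonpos[of F "\<lambda>s. s * (l2_norm (ws s))\<^sup>2"] le0
    by (auto simp: sum_negf)
  then have z: "\<forall>s\<in>F. - (s * (l2_norm (ws s))\<^sup>2) = 0"
    using F le0 by (subst (asm) sum_nonneg_eq_0_iff) auto
  have "c p = 0" if p: "p \<in> P" for p
  proof -
    obtain s k where sk: "p = (s, k)" "s \<in> F" "k < d s" using p by (auto simp: P_def)
    have "l2_norm (ws s) = 0" using z sk F(2)[of s] by auto
    then have "AE x in lebesgue. ws s x = 0" using l2_norm_zero_iff wsL2 sk by blast
    then have "AE x in lebesgue. (\<Sum>k<d s. c (s, k) * e s k x) = 0" by (simp add: ws_def)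
    with ind[OF sk(2)] have "\<forall>k<d s. c (s, k) = 0"
      unfolding ae_independent_def by (drule_tac x = "\<lambda>k. c (s, k)" in spec) simp
    then show ?thesis using sk by simp
  qed
  then show False using c(1) by blast
qed

text \<open>An infinite sum in \<open>ennreal\<close> is bounded once its finite partial sums are.
  Discrete eigenvalues have finite multiplicity, which by \<open>ae_dim_attained\<close> is realised
  by an independent family.\<close>

theorem num_eigenvalues_below_le:
  fixes l :: "'i \<Rightarrow> wavefun \<Rightarrow> complex"
  assumes I: "finite I"
    and lin: "\<And>i u v \<alpha> \<beta>. i \<in> I \<Longrightarrow> u \<in> D \<Longrightarrow> v \<in> D \<Longrightarrow> l i (\<lambda>x. \<alpha> * u x + \<beta> * v x) = \<alpha> * l i u + \<beta> * l i v"
    and bd: "\<And>i u. i \<in> I \<Longrightarrow> u \<in> D \<Longrightarrow> norm (l i u) \<le> K1 * nrm u"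
    and low: "\<And>u. u \<in> D \<Longrightarrow> - K2 * (\<Sum>i\<in>I. (norm (l i u))\<^sup>2) \<le> Re (q u u)"
  shows "num_eigenvalues_below (friedrichs D q) 0 \<le> of_nat (card I)"
  unfolding num_eigenvalues_below_def
proof (rule infsum_le_finite_sums)
  let ?E = "\<lambda>s. eigenspace (friedrichs D q) (of_real s)"
  fix F assume F: "finite F" "F \<subseteq> {l \<in> discrete_eigenvalues (friedrichs D q). l < 0}"
  have "\<exists>n. ae_dim (?E s) = enat n" if "s \<in> F" for s
    using F that by (auto simp: discrete_eigenvalues_def)
  then obtain d where d: "\<And>s. s \<in> F \<Longrightarrow> ae_dim (?E s) = enat (d s)" by metis
  have "\<exists>e. (\<forall>k<d s. e k \<in> ?E s) \<and> ae_independent (d s) e" if "s \<in> F" for s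
    using ae_dim_attained[OF d[OF that]] .
  then obtain e where e: "\<And>s. s \<in> F \<Longrightarrow> (\<forall>k<d s. e s k \<in> ?E s) \<and> ae_independent (d s) (e s)" by metis
  have "(\<Sum>s\<in>F. d s) \<le> card I"
    using e F by (intro sum_multiplicities_le[OF I lin bd low F(1), where e = e]) auto
  then have "(of_nat (\<Sum>s\<in>F. d s) :: ennreal) \<le> of_nat (card I)" by (rule of_nat_mono)
  moreover have "(\<Sum>s\<in>F. ennreal_of_enat (ae_dim (?E s))) = of_nat (\<Sum>s\<in>F. d s)"
    by (simp add: d)
  ultimately show "(\<Sum>s\<in>F. ennreal_of_enat (ae_dim (?E s))) \<le> of_nat (card I)" by simp
qed (rule summable_on_ennreal)

end

section \<open>One-dimensional functions\<close>

definition c1_pair :: "(real \<Rightarrow> complex) \<Rightarrow> (real \<Rightarrow> complex) \<Rightarrow> bool" where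
  "c1_pair F F' \<longleftrightarrow> (\<forall>t. (F has_vector_derivative F' t) (at t)) \<and> continuous_on UNIV F'"

text \<open>Values in \<open>ennreal\<close>, so that integrals of \<open>sq\<close> can be compared
  without integrability conditions.\<close>

definition sq :: "complex \<Rightarrow> ennreal" where
  "sq z = ennreal ((norm z)\<^sup>2)"

lemma sq_measurable [measurable]: "sq \<in> borel_measurable borel"
  unfolding sq_def by measurable

lemma sq_add_le: "sq (x + y) \<le> 2 * sq x + 2 * sq y"
proof -
  have "(norm (x + y))\<^sup>2 \<le> (norm x + norm y)\<^sup>2"
    by (intro power_mono norm_triangle_ineq) auto
  also have "\<dots> \<le> 2 * (norm x)\<^sup>2 + 2 * (norm y)\<^sup>2"
    using sum_squares_bound[of "norm x" "norm y"] by (simp add: power2_sum)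
  finally show ?thesis
    unfolding sq_def by (simp flip: ennreal_plus ennreal_numeral ennreal_mult)
qed

lemma c1_pair_continuous: "c1_pair F F' \<Longrightarrow> continuous_on UNIV F"
  unfolding c1_pair_def by (meson continuous_at_imp_continuous_on has_vector_derivative_continuous)

lemma c1_pair_measurable:
  assumes "c1_pair F F'"
  shows "F \<in> borel_measurable borel" "F' \<in> borel_measurable borel"
  using assms c1_pair_continuous[OF assms] by (auto simp: c1_pair_def intro: borel_measurable_continuous_onI)

text \<open>Expands the nonnegative integral of \<open>(g - m)^2\<close>, where \<open>m\<close> is
  the mean of \<open>g\<close>.\<close>

lemma integral_cauchy_schwarz:
  fixes g :: "real \<Rightarrow> real"
  assumes g: "continuous_on {s..t} g" and st: "s \<le> t"
  shows "(integral {s..t} g)\<^sup>2 \<le> (t - s) * integral {s..t} (\<lambda>x. (g x)\<^sup>2)"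
proof (cases "s = t")
  case False
  then have l: "t - s > 0" using st by simp
  define m where "m = integral {s..t} g / (t - s)"
  have i: "g integrable_on {s..t}" "(\<lambda>x. (g x)\<^sup>2) integrable_on {s..t}"
    using g by (auto intro!: integrable_continuous_interval continuous_intros)
  have "0 \<le> integral {s..t} (\<lambda>x. (g x - m)\<^sup>2)"
    by (intro Henstock_Kurzweil_Integration.integral_nonneg integrable_continuous_interval continuous_intros g) auto
  also have "(\<lambda>x. (g x - m)\<^sup>2) = (\<lambda>x. ((g x)\<^sup>2 - (2 * m) * g x) + m\<^sup>2)"
    by (simp add: power2_diff algebra_simps fun_eq_iff)
  also have "integral {s..t} (\<lambda>x. ((g x)\<^sup>2 - (2 * m) * g x) + m\<^sup>2) =
      integral {s..t} (\<lambda>x. (g x)\<^sup>2) - 2 * m * integral {s..t} g + m\<^sup>2 * (t - s)"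
    using i st by (simp add: Henstock_Kurzweil_Integration.integral_add Henstock_Kurzweil_Integration.integral_diff integrable_diff
      integrable_on_mult_right integrable_const_ivl)
  also have "\<dots> = integral {s..t} (\<lambda>x. (g x)\<^sup>2) - (integral {s..t} g)\<^sup>2 / (t - s)"
  proof -
    have "x - 2 * (y / l) * y + (y / l)\<^sup>2 * l = x - y\<^sup>2 / l" if "l > 0" for x y l :: real
      using that by (simp add: power2_eq_square field_simps)
    from this[OF l] show ?thesis unfolding m_def .
  qed
  finally show ?thesis using l by (simp add: field_simps)
qed simp

lemma nn_integral_interval_continuous:
  fixes g :: "real \<Rightarrow> real"
  assumes g: "continuous_on {s..t} g" and nn: "\<And>x. 0 \<le> g x"
  shows "(\<integral>\<^sup>+x\<in>{s..t}. ennreal (g x) \<partial>lborel) = ennreal (integral {s..t} g)"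
  using g by (intro nn_integral_has_integral_lebesgue' nn integrable_integral integrable_continuous_interval)

lemma sq_increment:
  assumes F: "c1_pair F F'" and st: "s \<le> t"
  shows "sq (F t - F s) \<le> ennreal (t - s) * (\<integral>\<^sup>+x\<in>{s..t}. sq (F' x) \<partial>lborel)"
proof -
  have c: "continuous_on {s..t} F'" using F by (auto simp: c1_pair_def intro: continuous_on_subset)
  have "(F' has_integral F t - F s) {s..t}"
    using F st by (intro fundamental_theorem_of_calculus) (auto simp: c1_pair_def intro: has_vector_derivative_at_within)
  then have "F t - F s = integral {s..t} F'" by (simp add: integral_unique)
  also have "norm \<dots> \<le> integral {s..t} (\<lambda>x. norm (F' x))"
    using c by (intro integral_norm_bound_integral integrable_continuous_interval continuous_intros) auto
  finally have "(norm (F t - F s))\<^sup>2 \<le> (integral {s..t} (\<lambda>x. norm (F' x)))\<^sup>2"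
    by (intro power_mono) auto
  also have "\<dots> \<le> (t - s) * integral {s..t} (\<lambda>x. (norm (F' x))\<^sup>2)"
    using c st by (intro integral_cauchy_schwarz continuous_intros)
  finally have "sq (F t - F s) \<le> ennreal ((t - s) * integral {s..t} (\<lambda>x. (norm (F' x))\<^sup>2))"
    unfolding sq_def by (rule ennreal_leI)
  also have "\<dots> = ennreal (t - s) * (\<integral>\<^sup>+x\<in>{s..t}. sq (F' x) \<partial>lborel)"
    unfolding sq_def using st c
    by (subst nn_integral_interval_continuous) (auto intro!: continuous_intros ennreal_mult Henstock_Kurzweil_Integration.integral_nonneg integrable_continuous_interval)
  finally show ?thesis .
qed

lemma set_nn_integral_mono_set: "A \<subseteq> B \<Longrightarrow> (\<integral>\<^sup>+x\<in>A. f x \<partial>M) \<le> (\<integral>\<^sup>+x\<in>B. f x \<partial>M)"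
  by (intro nn_integral_mono mult_left_mono) (auto simp: indicator_def)

section \<open>Pointwise bounds by the integral of the squared derivative\<close>

lemma sq_two_points:
  assumes F: "c1_pair F F'" and A: "{min s t..max s t} \<subseteq> A"
  shows "sq (F t) \<le> 2 * sq (F s) + ennreal (2 * \<bar>t - s\<bar>) * (\<integral>\<^sup>+x\<in>A. sq (F' x) \<partial>lborel)"
proof -
  have sym: "sq (x - y) = sq (y - x)" for x y by (simp add: sq_def norm_minus_commute)
  have "sq (F t - F s) \<le> ennreal \<bar>t - s\<bar> * (\<integral>\<^sup>+x\<in>{min s t..max s t}. sq (F' x) \<partial>lborel)"
    using sq_increment[OF F, of s t] sq_increment[OF F, of t s] sym[of "F t" "F s"]
    by (cases "s \<le> t") (auto simp: min_def max_def)
  also have "\<dots> \<le> ennreal \<bar>t - s\<bar> * (\<integral>\<^sup>+x\<in>A. sq (F' x) \<partial>lborel)"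
    by (intro mult_left_mono set_nn_integral_mono_set A) auto
  finally have *: "sq (F t - F s) \<le> ennreal \<bar>t - s\<bar> * (\<integral>\<^sup>+x\<in>A. sq (F' x) \<partial>lborel)" .
  have "sq (F t) \<le> 2 * sq (F s) + 2 * sq (F t - F s)" using sq_add_le[of "F s" "F t - F s"] by simp
  also have "\<dots> \<le> 2 * sq (F s) + 2 * (ennreal \<bar>t - s\<bar> * (\<integral>\<^sup>+x\<in>A. sq (F' x) \<partial>lborel))"
    by (intro add_left_mono mult_left_mono *) auto
  finally show ?thesis by (simp add: ennreal_mult mult.assoc)
qed

text \<open>The two-point bound averaged over \<open>s\<close>, so that the value at
  \<open>t\<close> is controlled by an integral of \<open>sq (F x)\<close> instead of another point
  value.\<close>

lemma sq_average:
  assumes F: "c1_pair F F'" and h: "0 < h"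
    and A: "\<And>s. s \<in> {a..a+h} \<Longrightarrow> \<bar>t - s\<bar> \<le> r \<and> {min s t..max s t} \<subseteq> A"
  shows "sq (F t) \<le> ennreal (2 / h) * (\<integral>\<^sup>+x\<in>{a..a+h}. sq (F x) \<partial>lborel) + ennreal (2 * r) * (\<integral>\<^sup>+x\<in>A. sq (F' x) \<partial>lborel)"
proof -
  have [measurable]: "F \<in> borel_measurable borel" using c1_pair_measurable[OF F] by simp
  let ?D = "\<integral>\<^sup>+x\<in>A. sq (F' x) \<partial>lborel"
  have h1: "ennreal (1 / h) * ennreal h = 1" using h by (simp flip: ennreal_mult)
  have "ennreal h * sq (F t) = (\<integral>\<^sup>+x\<in>{a..a+h}. sq (F t) \<partial>lborel)"
    using h by (simp add: nn_integral_cmult_indicator mult.commute)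
  also have "\<dots> \<le> (\<integral>\<^sup>+x\<in>{a..a+h}. (2 * sq (F x) + ennreal (2 * r) * ?D) \<partial>lborel)"
  proof (intro nn_integral_mono)
    fix s
    show "sq (F t) * indicator {a..a+h} s \<le> (2 * sq (F s) + ennreal (2 * r) * ?D) * indicator {a..a+h} s"
    proof (cases "s \<in> {a..a+h}")
      case True
      have "sq (F t) \<le> 2 * sq (F s) + ennreal (2 * \<bar>t - s\<bar>) * ?D"
        using A[OF True] by (intro sq_two_points[OF F]) simp
      also have "\<dots> \<le> 2 * sq (F s) + ennreal (2 * r) * ?D"
        using A[OF True] by (intro add_left_mono mult_right_mono ennreal_leI) auto
      finally show ?thesis using True by simp
    qed simp
  qed
  also have "\<dots> = 2 * (\<integral>\<^sup>+x\<in>{a..a+h}. sq (F x) \<partial>lborel) + ennreal (2 * r) * ?D * ennreal h"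
    using h by (simp add: distrib_right nn_integral_add nn_integral_cmult nn_integral_cmult_indicator mult.assoc)
  finally have "ennreal (1 / h) * (ennreal h * sq (F t)) \<le>
      ennreal (1 / h) * (2 * (\<integral>\<^sup>+x\<in>{a..a+h}. sq (F x) \<partial>lborel) + ennreal (2 * r) * ?D * ennreal h)"
    by (rule mult_left_mono) simp
  also have "ennreal (1 / h) * (ennreal h * sq (F t)) = sq (F t)"
    by (simp add: mult.assoc[symmetric] h1)
  also have "ennreal (1 / h) * (2 * (\<integral>\<^sup>+x\<in>{a..a+h}. sq (F x) \<partial>lborel) + ennreal (2 * r) * ?D * ennreal h) =
      (ennreal (1 / h) * 2) * (\<integral>\<^sup>+x\<in>{a..a+h}. sq (F x) \<partial>lborel) + (ennreal (1 / h) * ennreal h) * (ennreal (2 * r) * ?D)"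
    by (simp add: algebra_simps)
  also have "ennreal (1 / h) * 2 = ennreal (2 / h)"
    using h by (simp flip: ennreal_numeral ennreal_mult)
  finally show ?thesis using h1 by simp
qed

section \<open>High angular modes\<close>

text \<open>\<open>\<mu>^2 / 4\<close> stands for the barrier \<open>(\<Phi> - m)^2\<close> of a
  mode with \<open>|m| = \<mu>\<close>; it is a lower bound as soon as the flux is at most
  \<open>\<mu> / 2\<close> in absolute value.\<close>

definition energy :: "real \<Rightarrow> (real \<Rightarrow> complex) \<Rightarrow> (real \<Rightarrow> complex) \<Rightarrow> real set \<Rightarrow> ennreal" where
  "energy \<mu> F F' A = (\<integral>\<^sup>+x\<in>A. sq (F' x) \<partial>lborel) + ennreal (\<mu>\<^sup>2 / 4) * (\<integral>\<^sup>+x\<in>A. sq (F x) \<partial>lborel)"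

lemma energy_Un:
  assumes F: "c1_pair F F'" and AB: "A \<inter> B = {}" "A \<in> sets borel" "B \<in> sets borel"
  shows "energy \<mu> F F' (A \<union> B) = energy \<mu> F F' A + energy \<mu> F F' B"
proof -
  have [measurable]: "F \<in> borel_measurable borel" "F' \<in> borel_measurable borel" using c1_pair_measurable[OF F] by auto
  show ?thesis unfolding energy_def using AB
    by (simp add: nn_integral_disjoint_pair distrib_left ac_simps)
qed

text \<open>The Sobolev inequality on the length scale \<open>1 / (2 * \<mu>)\<close> bounds
  \<open>|F|^2\<close> by \<open>16 / \<mu>\<close> times the energy; integration against a mass of
  at most \<open>\<mu> / 32\<close> leaves one half.\<close>

lemma high_mode_no_functional:
  assumes F: "c1_pair F F'" and \<mu>: "0 < \<mu>" and A [measurable]: "A \<in> sets borel"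
    and W [measurable]: "W \<in> borel_measurable borel"
    and sub: "\<And>t. t \<in> A \<Longrightarrow> {t..t + 1/(2*\<mu>)} \<subseteq> A \<or> {t - 1/(2*\<mu>)..t} \<subseteq> A"
    and w: "(\<integral>\<^sup>+x\<in>A. W x \<partial>lborel) \<le> ennreal (\<mu> / 32)"
  shows "(\<integral>\<^sup>+x\<in>A. W x * sq (F x) \<partial>lborel) \<le> ennreal (1/2) * energy \<mu> F F' A"
proof -
  have pt: "sq (F t) \<le> ennreal (16 / \<mu>) * energy \<mu> F F' A" if t: "t \<in> A" for t
  proof -
    \<comment> \<open>\<open>2 / h = 4 * \<mu>\<close> is \<open>16 / \<mu>\<close> times
      \<open>\<mu>^2 / 4\<close>, and \<open>2 * h = 1 / \<mu>\<close> is below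
      \<open>16 / \<mu>\<close>, so one constant serves both parts of the energy.\<close>
    define h where "h = 1 / (2 * \<mu>)"
    have h: "h > 0" using \<mu> by (simp add: h_def)
    obtain a where a: "{a..a+h} \<subseteq> A" "t \<in> {a..a+h}"
      using sub[OF t] h that[of t] that[of "t - h"] by (auto simp: h_def[symmetric])
    have "sq (F t) \<le> ennreal (2 / h) * (\<integral>\<^sup>+x\<in>{a..a+h}. sq (F x) \<partial>lborel) + ennreal (2 * h) * (\<integral>\<^sup>+x\<in>A. sq (F' x) \<partial>lborel)"
      using a by (intro sq_average[OF F h]) (auto simp: min_def max_def)
    also have "\<dots> \<le> ennreal (2 / h) * (\<integral>\<^sup>+x\<in>A. sq (F x) \<partial>lborel) + ennreal (16 / \<mu>) * (\<integral>\<^sup>+x\<in>A. sq (F' x) \<partial>lborel)"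
      using a \<mu> by (intro add_mono mult_left_mono mult_right_mono set_nn_integral_mono_set ennreal_leI) (auto simp: h_def field_simps)
    also have "ennreal (2 / h) = ennreal (16 / \<mu>) * ennreal (\<mu>\<^sup>2 / 4)"
      using \<mu> by (simp add: h_def power2_eq_square flip: ennreal_mult)
    finally show ?thesis by (simp add: energy_def distrib_left ac_simps)
  qed
  have "(\<integral>\<^sup>+x\<in>A. W x * sq (F x) \<partial>lborel) \<le> (\<integral>\<^sup>+x. (ennreal (16 / \<mu>) * energy \<mu> F F' A) * (W x * indicator A x) \<partial>lborel)"
    using pt by (intro nn_integral_mono) (auto simp: indicator_def mult.commute intro!: mult_left_mono)
  also have "\<dots> = ennreal (16 / \<mu>) * energy \<mu> F F' A * (\<integral>\<^sup>+x\<in>A. W x \<partial>lborel)"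
    by (rule nn_integral_cmult) measurable
  also have "\<dots> \<le> ennreal (16 / \<mu>) * energy \<mu> F F' A * ennreal (\<mu> / 32)"
    by (intro mult_left_mono w) auto
  also have "\<dots> = (ennreal (16 / \<mu>) * ennreal (\<mu> / 32)) * energy \<mu> F F' A" by (simp add: ac_simps)
  also have "ennreal (16 / \<mu>) * ennreal (\<mu> / 32) = ennreal (1/2)" using \<mu> by (simp flip: ennreal_mult)
  finally show ?thesis .
qed

text \<open>Anchored at \<open>a\<close>, a function satisfies
  \<open>|F(t)|^2 \<le> 2 |F(a)|^2 + 2 (t - a) \<integral>|F'|^2\<close>, so the potential term is
  governed by the first moment of \<open>W\<close> about \<open>a\<close>. This is the mechanism of
  Bargmann's bound.\<close>

lemma one_functional:
  assumes F: "c1_pair F F'"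
    and W [measurable]: "W \<in> borel_measurable borel"
    and A [measurable]: "A \<in> sets borel" and sub: "\<And>t. t \<in> A \<Longrightarrow> a \<le> t \<and> {a..t} \<subseteq> A"
    and w0: "(\<integral>\<^sup>+x\<in>A. W x \<partial>lborel) \<le> ennreal \<omega>"
    and w: "(\<integral>\<^sup>+x\<in>A. W x * ennreal (x - a) \<partial>lborel) \<le> ennreal \<kappa>" and nn: "0 \<le> \<omega>" "0 \<le> \<kappa>"
  shows "(\<integral>\<^sup>+x\<in>A. W x * sq (F x) \<partial>lborel) \<le> ennreal (2 * \<kappa>) * (\<integral>\<^sup>+x\<in>A. sq (F' x) \<partial>lborel) + ennreal (2 * \<omega>) * sq (F a)"
proof -
  let ?D = "\<integral>\<^sup>+x\<in>A. sq (F' x) \<partial>lborel"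
  have pt: "sq (F t) \<le> 2 * sq (F a) + 2 * ?D * ennreal (t - a)" if t: "t \<in> A" for t
  proof -
    have "sq (F t) \<le> 2 * sq (F a) + ennreal (2 * \<bar>t - a\<bar>) * ?D"
      using sub[OF t] by (intro sq_two_points[OF F]) (simp add: min_def max_def)
    also have "ennreal (2 * \<bar>t - a\<bar>) = 2 * ennreal (t - a)"
      using sub[OF t] by (subst ennreal_mult) auto
    finally show ?thesis by (simp add: ac_simps)
  qed
  have "(\<integral>\<^sup>+x\<in>A. W x * sq (F x) \<partial>lborel) \<le>
    (\<integral>\<^sup>+x. (2 * sq (F a)) * (W x * indicator A x) + (2 * ?D) * (W x * ennreal (x - a) * indicator A x) \<partial>lborel)"
  proof (intro nn_integral_mono)
    fix x
    show "W x * sq (F x) * indicator A x \<le> (2 * sq (F a)) * (W x * indicator A x) + (2 * ?D) * (W x * ennreal (x - a) * indicator A x)"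
    proof (cases "x \<in> A")
      case True
      have "W x * sq (F x) \<le> W x * (2 * sq (F a) + 2 * ?D * ennreal (x - a))"
        by (intro mult_left_mono pt True) auto
      also have "\<dots> = (2 * sq (F a)) * W x + (2 * ?D) * (W x * ennreal (x - a))"
        by (simp only: distrib_left ac_simps)
      finally show ?thesis using True by simp
    qed simp
  qed
  also have "\<dots> = (2 * sq (F a)) * (\<integral>\<^sup>+x\<in>A. W x \<partial>lborel) + (2 * ?D) * (\<integral>\<^sup>+x\<in>A. W x * ennreal (x - a) \<partial>lborel)"
    by (subst nn_integral_add; (subst nn_integral_cmult)?; (subst nn_integral_cmult)?; measurable)
  also have "\<dots> \<le> (2 * sq (F a)) * ennreal \<omega> + (2 * ?D) * ennreal \<kappa>"
    by (intro add_mono mult_left_mono w w0) auto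
  finally show ?thesis using nn by (simp add: ennreal_mult ac_simps)
qed

definition point_sum :: "(real \<times> int) set \<Rightarrow> int \<Rightarrow> (real \<Rightarrow> complex) \<Rightarrow> ennreal" where
  "point_sum S m F = (\<Sum>p\<in>S. if snd p = m then sq (F (fst p)) else 0)"

lemma point_sum_mono: "finite T \<Longrightarrow> S \<subseteq> T \<Longrightarrow> point_sum S m F \<le> point_sum T m F"
  unfolding point_sum_def by (intro sum_mono2) auto

text \<open>One set \<open>S\<close> serves all nonzero modes, because the functionals of all modes
  are counted together; \<open>K\<close> is never estimated. Mode zero is excluded since its
  \<open>energy\<close> has no zeroth-order term.\<close>

definition controls :: "(real \<Rightarrow> ennreal) \<Rightarrow> real set \<Rightarrow> (real \<times> int) set \<Rightarrow> real \<Rightarrow> bool" where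
  "controls W A S K \<longleftrightarrow> finite S \<and> 0 \<le> K \<and> (\<forall>m F F'. m \<noteq> 0 \<longrightarrow> c1_pair F F' \<longrightarrow>
     (\<integral>\<^sup>+x\<in>A. W x * sq (F x) \<partial>lborel) \<le> ennreal (1/2) * energy \<bar>real_of_int m\<bar> F F' A + ennreal K * point_sum S m F)"

text \<open>Energies add over disjoint sets, so the pieces of the line decouple and their
  functionals are simply collected.\<close>

lemma controls_Un:
  assumes 1: "controls W A S K" and 2: "controls W B T L"
    and AB: "A \<inter> B = {}" and [measurable]: "A \<in> sets borel" "B \<in> sets borel" "W \<in> borel_measurable borel"
  shows "controls W (A \<union> B) (S \<union> T) (K + L)"
  unfolding controls_def
proof (intro conjI allI impI)
  show fin: "finite (S \<union> T)" "0 \<le> K + L" using 1 2 by (auto simp: controls_def)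
  fix m :: int and F F' assume m: "m \<noteq> 0" and F: "c1_pair F F'"
  have [measurable]: "F \<in> borel_measurable borel" using c1_pair_measurable[OF F] by simp
  let ?E = "energy \<bar>real_of_int m\<bar> F F'"
  have "(\<integral>\<^sup>+x\<in>A \<union> B. W x * sq (F x) \<partial>lborel) = (\<integral>\<^sup>+x\<in>A. W x * sq (F x) \<partial>lborel) + (\<integral>\<^sup>+x\<in>B. W x * sq (F x) \<partial>lborel)"
    using AB by (intro nn_integral_disjoint_pair) auto
  also have "\<dots> \<le> (ennreal (1/2) * ?E A + ennreal K * point_sum S m F) + (ennreal (1/2) * ?E B + ennreal L * point_sum T m F)"
    using 1 2 m F unfolding controls_def by (intro add_mono) blast+
  also have "\<dots> \<le> (ennreal (1/2) * ?E A + ennreal K * point_sum (S \<union> T) m F) + (ennreal (1/2) * ?E B + ennreal L * point_sum (S \<union> T) m F)"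
    using fin by (intro add_mono mult_left_mono point_sum_mono) auto
  also have "\<dots> = ennreal (1/2) * ?E (A \<union> B) + ennreal (K + L) * point_sum (S \<union> T) m F"
    using AB 1 2 by (simp add: energy_Un[OF F] controls_def distrib_left distrib_right ac_simps)
  finally show "(\<integral>\<^sup>+x\<in>A \<union> B. W x * sq (F x) \<partial>lborel) \<le> ennreal (1/2) * ?E (A \<union> B) + ennreal (K + L) * point_sum (S \<union> T) m F" .
qed

text \<open>The modes lie between \<open>- N\<close> and \<open>N\<close> for \<open>N\<close> the
  integer part of \<open>1 / l\<close>, with zero left out.\<close>

lemma card_small_modes:
  assumes l: "0 < l"
  shows "finite {m::int. m \<noteq> 0 \<and> \<bar>real_of_int m\<bar> * l < 1} \<and> real (card {m::int. m \<noteq> 0 \<and> \<bar>real_of_int m\<bar> * l < 1}) \<le> 2 / l"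
proof -
  define N where "N = \<lfloor>1 / l\<rfloor>"
  have N: "0 \<le> N" using l by (simp add: N_def)
  have sub: "{m::int. m \<noteq> 0 \<and> \<bar>real_of_int m\<bar> * l < 1} \<subseteq> {- N..N} - {0}"
  proof
    fix m :: int assume m: "m \<in> {m. m \<noteq> 0 \<and> \<bar>real_of_int m\<bar> * l < 1}"
    then have "real_of_int \<bar>m\<bar> \<le> 1 / l" using l by (simp add: field_simps)
    then have "\<bar>m\<bar> \<le> N" unfolding N_def by (simp add: le_floor_iff)
    then show "m \<in> {- N..N} - {0}" using m by auto
  qed
  have "card ({- N..N} - {0}) = nat (2 * N)" using N by (subst card_Diff_singleton) auto
  then have "real (card {m::int. m \<noteq> 0 \<and> \<bar>real_of_int m\<bar> * l < 1}) \<le> real (nat (2 * N))"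
    using card_mono[OF _ sub] by simp
  also have "\<dots> = 2 * real_of_int N" using N by simp
  also have "\<dots> \<le> 2 * (1 / l)" unfolding N_def by (intro mult_left_mono of_int_floor_le) auto
  finally show ?thesis using finite_subset[OF sub] by simp
qed

context
  fixes W :: "real \<Rightarrow> ennreal"
  assumes W [measurable]: "W \<in> borel_measurable borel" and fin: "(\<integral>\<^sup>+x. W x \<partial>lborel) < \<infinity>"
begin

definition mass :: "real set \<Rightarrow> real" where
  "mass A = enn2real (\<integral>\<^sup>+x\<in>A. W x \<partial>lborel)"

lemma ennreal_mass: "ennreal (mass A) = (\<integral>\<^sup>+x\<in>A. W x \<partial>lborel)"
proof -
  have "(\<integral>\<^sup>+x\<in>A. W x \<partial>lborel) \<le> (\<integral>\<^sup>+x. W x \<partial>lborel)"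
    by (intro nn_integral_mono) (auto simp: indicator_def)
  then have "(\<integral>\<^sup>+x\<in>A. W x \<partial>lborel) < top" using fin by (simp add: le_less_trans)
  then show ?thesis by (simp add: mass_def)
qed

lemma mass_nonneg: "0 \<le> mass A" by (simp add: mass_def)

lemma mass_Un: "A \<inter> B = {} \<Longrightarrow> A \<in> sets borel \<Longrightarrow> B \<in> sets borel \<Longrightarrow> mass (A \<union> B) = mass A + mass B"
proof -
  assume "A \<inter> B = {}" "A \<in> sets borel" "B \<in> sets borel"
  then have "ennreal (mass (A \<union> B)) = ennreal (mass A + mass B)"
    by (simp add: ennreal_mass nn_integral_disjoint_pair ennreal_plus[OF mass_nonneg mass_nonneg] del: ennreal_plus)
  then show ?thesis by (simp add: mass_nonneg del: ennreal_plus)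
qed

text \<open>Each mode with \<open>|m| * (b - a) < 1\<close> is pinned at the left end
  \<open>a\<close>. For the other modes the hypothesis gives a mass of at most
  \<open>|m| / 32\<close>, and the interval is long enough for
  \<open>high_mode_no_functional\<close>.\<close>

lemma controls_stopped:
  assumes ab: "a < b" and st: "(b - a) * mass {a..<b} \<le> 1 / 32"
  shows "\<exists>S K. controls W {a..<b} S K \<and> real (card S) \<le> 2 / (b - a) \<and> (1 \<le> b - a \<longrightarrow> S = {})"
proof -
  define M where "M = {m::int. m \<noteq> 0 \<and> \<bar>real_of_int m\<bar> * (b - a) < 1}"
  have M: "finite M" "real (card M) \<le> 2 / (b - a)"
    using card_small_modes[of "b - a"] ab by (auto simp: M_def)
  have "controls W {a..<b} ({a} \<times> M) (2 * mass {a..<b})"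
    unfolding controls_def
  proof (intro conjI allI impI)
    show "finite ({a} \<times> M)" "0 \<le> 2 * mass {a..<b}" using M by (auto simp: mass_nonneg)
    fix m :: int and F F' assume m: "m \<noteq> 0" and F: "c1_pair F F'"
    let ?E = "energy \<bar>real_of_int m\<bar> F F' {a..<b}"
    show "(\<integral>\<^sup>+x\<in>{a..<b}. W x * sq (F x) \<partial>lborel) \<le> ennreal (1/2) * ?E + ennreal (2 * mass {a..<b}) * point_sum ({a} \<times> M) m F"
    proof (cases "m \<in> M")
      case True
      have "(\<integral>\<^sup>+x\<in>{a..<b}. W x * ennreal (x - a) \<partial>lborel) \<le> (\<integral>\<^sup>+x. ennreal (b - a) * (W x * indicator {a..<b} x) \<partial>lborel)"
        by (intro nn_integral_mono) (auto simp: indicator_def mult.commute intro!: mult_left_mono ennreal_leI)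
      also have "\<dots> = ennreal ((b - a) * mass {a..<b})"
        using ab by (subst nn_integral_cmult) (simp_all add: ennreal_mass ennreal_mult mass_nonneg)
      also have "\<dots> \<le> ennreal (1 / 32)" by (intro ennreal_leI st)
      finally have "(\<integral>\<^sup>+x\<in>{a..<b}. W x * sq (F x) \<partial>lborel) \<le>
        ennreal (2 * (1 / 32)) * (\<integral>\<^sup>+x\<in>{a..<b}. sq (F' x) \<partial>lborel) + ennreal (2 * mass {a..<b}) * sq (F a)"
        by (intro one_functional F W) (auto simp: ennreal_mass mass_nonneg)
      also have "ennreal (2 * (1 / 32)) * (\<integral>\<^sup>+x\<in>{a..<b}. sq (F' x) \<partial>lborel) \<le> ennreal (1/2) * ?E"
        unfolding energy_def by (intro mult_mono ennreal_leI add_increasing2) auto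
      also have "sq (F a) = point_sum ({a} \<times> M) m F"
      proof -
        have "point_sum ({a} \<times> M) m F = (\<Sum>p\<in>{(a, m)}. if snd p = m then sq (F (fst p)) else 0)"
          unfolding point_sum_def using M True by (intro sum.mono_neutral_right) auto
        then show ?thesis by simp
      qed
      finally show ?thesis by (simp add: add_right_mono)
    next
      case False
      then have l: "1 \<le> \<bar>real_of_int m\<bar> * (b - a)" using m by (auto simp: M_def)
      have mu: "0 < \<bar>real_of_int m\<bar>" using m by simp
      have "mass {a..<b} \<le> \<bar>real_of_int m\<bar> / 32"
      proof -
        have "mass {a..<b} * 1 \<le> mass {a..<b} * (\<bar>real_of_int m\<bar> * (b - a))"
          by (intro mult_left_mono l mass_nonneg)
        also have "\<dots> = \<bar>real_of_int m\<bar> * ((b - a) * mass {a..<b})" by simp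
        also have "\<dots> \<le> \<bar>real_of_int m\<bar> * (1 / 32)" by (intro mult_left_mono st) auto
        finally show ?thesis by simp
      qed
      then have w: "(\<integral>\<^sup>+x\<in>{a..<b}. W x \<partial>lborel) \<le> ennreal (\<bar>real_of_int m\<bar> / 32)"
        by (simp flip: ennreal_mass add: ennreal_leI)
      \<comment> \<open>Two windows of length \<open>1 / (2 * |m|)\<close> fit into the interval, so
        from each point one of them fits on some side.\<close>
      have h: "2 * (1 / (2 * \<bar>real_of_int m\<bar>)) \<le> b - a" using l mu by (simp add: field_simps)
      have "(\<integral>\<^sup>+x\<in>{a..<b}. W x * sq (F x) \<partial>lborel) \<le> ennreal (1/2) * ?E"
      proof (rule high_mode_no_functional[OF F mu _ W _ w])
        fix t assume "t \<in> {a..<b}"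
        then show "{t..t + 1 / (2 * \<bar>real_of_int m\<bar>)} \<subseteq> {a..<b} \<or> {t - 1 / (2 * \<bar>real_of_int m\<bar>)..t} \<subseteq> {a..<b}"
          using h by (cases "t + 1 / (2 * \<bar>real_of_int m\<bar>) < b") (auto simp: not_less)
      qed simp
      also have "\<dots> \<le> ennreal (1/2) * ?E + ennreal (2 * mass {a..<b}) * point_sum ({a} \<times> M) m F" by simp
      finally show ?thesis .
    qed
  qed
  moreover have "M = {}" if "1 \<le> b - a"
  proof (rule ccontr)
    assume "M \<noteq> {}"
    then obtain m :: int where m: "m \<noteq> 0" "\<bar>real_of_int m\<bar> * (b - a) < 1" by (auto simp: M_def)
    have "1 * 1 \<le> \<bar>real_of_int m\<bar> * (b - a)" using m that by (intro mult_mono) linarith+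
    then show False using m by simp
  qed
  ultimately show ?thesis using M
    by (intro exI[of _ "{a} \<times> M"] exI[of _ "2 * mass {a..<b}"]) (auto simp: card_cartesian_product_singleton)
qed

text \<open>
  Intervals are halved until length times mass is small. The weight \<open>384 * mass - 4 / length\<close>, rather
  than a multiple of the mass alone, is what makes the count close under halving.
\<close>

lemma controls_interval:
  "a < b \<Longrightarrow> (b - a) * mass {a..<b} \<le> 2 ^ p / 32 \<Longrightarrow>
   \<exists>S K. controls W {a..<b} S K \<and> real (card S) \<le>
     (if (b - a) * mass {a..<b} \<le> 1 / 32 then 2 / (b - a) else 384 * mass {a..<b} - 4 / (b - a))"
proof (induction p arbitrary: a b)
  case 0
  then have st: "(b - a) * mass {a..<b} \<le> 1 / 32" by simp
  from controls_stopped[OF 0(1) st] show ?case unfolding if_P[OF st] by blast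
next
  case (Suc p)
  show ?case
  proof (cases "(b - a) * mass {a..<b} \<le> 1 / 32")
    case True
    from controls_stopped[OF Suc.prems(1) True] show ?thesis unfolding if_P[OF True] by blast
  next
    case False
    \<comment> \<open>Each half has half the length and at most the same mass, so the bound on
      length times mass is halved and \<open>p\<close> drops by one.\<close>
    define c where "c = (a + b) / 2"
    have c: "a < c" "c < b" "c - a = (b - a) / 2" "b - c = (b - a) / 2"
      using Suc.prems by (auto simp: c_def field_simps)
    have un: "{a..<b} = {a..<c} \<union> {c..<b}" using c by auto
    have m: "mass {a..<b} = mass {a..<c} + mass {c..<b}" unfolding un by (rule mass_Un) auto
    define l where "l = b - a"
    have l: "l > 0" using Suc.prems by (simp add: l_def)
    have ca: "c - a = l / 2" and bc: "b - c = l / 2" using c by (auto simp: l_def)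
    define x y where "x = mass {a..<c}" and "y = mass {c..<b}"
    have xy: "x \<ge> 0" "y \<ge> 0" by (auto simp: x_def y_def mass_nonneg)
    have p: "l * (x + y) \<le> 2 ^ Suc p / 32" using Suc.prems m by (simp add: l_def x_def y_def)
    have lx: "l * x \<le> l * (x + y)" "l * y \<le> l * (x + y)" using l xy by (auto intro: mult_left_mono)
    obtain S K where S: "controls W {a..<c} S K" "real (card S) \<le> (if l / 2 * x \<le> 1 / 32 then 2 / (l / 2) else 384 * x - 4 / (l / 2))"
    proof -
      have "(c - a) * mass {a..<c} \<le> 2 ^ p / 32" unfolding ca using lx(1) p by (simp add: x_def[symmetric])
      from Suc.IH[OF c(1) this] show ?thesis using that unfolding ca x_def[symmetric] by blast
    qed
    obtain T L where T: "controls W {c..<b} T L" "real (card T) \<le> (if l / 2 * y \<le> 1 / 32 then 2 / (l / 2) else 384 * y - 4 / (l / 2))"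
    proof -
      have "(b - c) * mass {c..<b} \<le> 2 ^ p / 32" unfolding bc using lx(2) p by (simp add: y_def[symmetric])
      from Suc.IH[OF c(2) this] show ?thesis using that unfolding bc y_def[symmetric] by blast
    qed
    have ctr: "controls W {a..<b} (S \<union> T) (K + L)"
      unfolding un by (rule controls_Un[OF S(1) T(1)]) auto
    have big: "1 / 32 < l * (x + y)" using False m by (simp add: l_def x_def y_def)
    then have big': "12 / l < 384 * (x + y)" using l by (simp add: field_simps)
    have "real (card (S \<union> T)) \<le> real (card S) + real (card T)" using card_Un_le[of S T] by linarith
    also have "\<dots> \<le> 384 * (x + y) - 4 / l"
    proof -
      \<comment> \<open>A stopped half costs at most \<open>k\<close>, any other half at most 384
        times its mass minus \<open>2 * k\<close>. The delicate case is that of two stopped halves: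
        there \<open>1 / 32 < l * (x + y)\<close> yields \<open>3 * k < 384 * (x + y)\<close>, which
        leaves room for \<open>2 * k\<close> and the new subtracted \<open>k\<close>. Hence 384 as
        12 times 32.\<close>
      define k where "k = 4 / l"
      have k: "2 / (l / 2) = k" "4 / (l / 2) = 2 * k" "12 / l = 3 * k" "4 / l = k" "0 < k"
        using l by (auto simp: k_def)
      show ?thesis using S(2) T(2) big' xy unfolding k(1-4) using k(5) by (auto split: if_splits)
    qed
    finally have "real (card (S \<union> T)) \<le> 384 * mass {a..<b} - 4 / (b - a)"
      unfolding m x_def y_def l_def .
    then show ?thesis using ctr unfolding if_not_P[OF False] by blast
  qed
qed

text \<open>Continuity from above of a finite measure. Asking for \<open>1 \<le> n\<close> makes the
  middle interval long enough to exclude all nonzero modes in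
  \<open>controls_stopped\<close>.\<close>

lemma mass_tail:
  assumes "0 < \<epsilon>"
  shows "\<exists>n. mass {..<- real n} \<le> \<epsilon> \<and> mass {real n..} \<le> \<epsilon> \<and> 1 \<le> n"
proof -
  define N where "N = density lborel W"
  interpret M: finite_measure N
    by standard (use fin in \<open>simp add: N_def emeasure_density less_top\<close>)
  have N [simp, measurable_cong]: "sets N = sets borel" by (simp add: N_def)
  have meq: "measure N A = mass A" if "A \<in> sets borel" for A
    using that by (simp add: N_def measure_def mass_def emeasure_density)
  have "(\<lambda>n. measure N ({..<- real n} \<union> {real n..})) \<longlonglongrightarrow> measure N (\<Inter>n. {..<- real n} \<union> {real n..})"
    by (intro M.finite_Lim_measure_decseq) (auto simp: decseq_def)
  also have "(\<Inter>n. {..<- real n} \<union> {real n..}) = {}"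
  proof -
    have "\<exists>n. x \<notin> {..<- real n} \<union> {real n..}" for x :: real
    proof -
      obtain n where "\<bar>x\<bar> < real n" using reals_Archimedean2 by blast
      then show ?thesis by (intro exI[of _ n]) auto
    qed
    then show ?thesis by blast
  qed
  finally have L: "(\<lambda>n. measure N ({..<- real n} \<union> {real n..})) \<longlonglongrightarrow> 0" by simp
  have "\<forall>\<^sub>F n in sequentially. measure N ({..<- real n} \<union> {real n..}) < \<epsilon> \<and> 1 \<le> n"
    using order_tendstoD(2)[OF L assms] eventually_ge_at_top[of 1] by eventually_elim auto
  then obtain n where n: "measure N ({..<- real n} \<union> {real n..}) < \<epsilon>" "1 \<le> n"
    by (auto simp: eventually_sequentially)
  have "measure N {..<- real n} \<le> measure N ({..<- real n} \<union> {real n..})" "measure N {real n..} \<le> measure N ({..<- real n} \<union> {real n..})"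
    by (intro M.finite_measure_mono; auto)+
  then show ?thesis using n by (intro exI[of _ n]) (auto simp: meq)
qed

text \<open>As \<open>|m| \<ge> 1\<close>, a mass of \<open>1 / 32\<close> is within the threshold
  of every nonzero mode at once, and a half-line contains windows of any length.\<close>

lemma controls_tail:
  assumes "A \<in> sets borel" "mass A \<le> 1 / 32" "\<And>t h. t \<in> A \<Longrightarrow> 0 < h \<Longrightarrow> {t..t+h} \<subseteq> A \<or> {t-h..t} \<subseteq> A"
  shows "controls W A {} 0"
  unfolding controls_def
proof (intro conjI allI impI)
  fix m :: int and F F' assume m: "m \<noteq> 0" and F: "c1_pair F F'"
  have mu: "1 \<le> \<bar>real_of_int m\<bar>" using m by linarith
  have "(\<integral>\<^sup>+x\<in>A. W x \<partial>lborel) \<le> ennreal (\<bar>real_of_int m\<bar> / 32)"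
    using assms(2) mu by (simp flip: ennreal_mass add: ennreal_leI)
  then have "(\<integral>\<^sup>+x\<in>A. W x * sq (F x) \<partial>lborel) \<le> ennreal (1/2) * energy \<bar>real_of_int m\<bar> F F' A"
    using mu assms by (intro high_mode_no_functional[OF F _ _ W]) auto
  then show "(\<integral>\<^sup>+x\<in>A. W x * sq (F x) \<partial>lborel) \<le> ennreal (1/2) * energy \<bar>real_of_int m\<bar> F F' A + ennreal 0 * point_sum {} m F"
    by simp
qed auto

text \<open>No additive constant arises: if the middle interval meets the stopping condition, its
  length excludes every nonzero mode and \<open>S\<close> is empty; otherwise the count of
  \<open>controls_interval\<close> applies. The tails are light enough to need no
  functional.\<close>

theorem high_modes:
  "\<exists>S K. controls W UNIV S K \<and> ennreal (real (card S)) \<le> 384 * (\<integral>\<^sup>+x. W x \<partial>lborel)"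
proof -
  obtain n where n: "mass {..<- real n} \<le> 1 / 32" "mass {real n..} \<le> 1 / 32" "1 \<le> n"
    using mass_tail[of "1 / 32"] by auto
  let ?I = "{- real n..<real n}"
  have I: "- real n < real n" "1 \<le> real n - (- real n)" using n(3) by auto
  obtain p where "32 * ((real n - (- real n)) * mass ?I) < 2 ^ p" using real_arch_pow[of 2] by auto
  then have p: "(real n - (- real n)) * mass ?I \<le> 2 ^ p / 32" by simp
  have "\<exists>S K. controls W ?I S K \<and> real (card S) \<le> 384 * mass ?I"
  proof (cases "(real n - (- real n)) * mass ?I \<le> 1 / 32")
    case True
    from controls_stopped[OF I(1) True] I(2) mass_nonneg show ?thesis by fastforce
  next
    case False
    from controls_interval[OF I(1) p] obtain S K where "controls W ?I S K"
      "real (card S) \<le> 384 * mass ?I - 4 / (real n - (- real n))" using False by auto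
    moreover have "0 \<le> 4 / (real n - (- real n))" by simp
    ultimately show ?thesis by (meson diff_le_eq le_add_same_cancel1 order_trans)
  qed
  then obtain S K where S: "controls W ?I S K" "real (card S) \<le> 384 * mass ?I" by blast
  have t1: "controls W {..<- real n} {} 0" using n by (intro controls_tail) auto
  have t2: "controls W {real n..} {} 0" using n by (intro controls_tail) auto
  have "controls W (({..<- real n} \<union> ?I) \<union> {real n..}) (({} \<union> S) \<union> {}) ((0 + K) + 0)"
    by (intro controls_Un t1 t2 S W) auto
  moreover have "({..<- real n} \<union> ?I) \<union> {real n..} = UNIV" by auto
  moreover have "ennreal (real (card S)) \<le> 384 * (\<integral>\<^sup>+x. W x \<partial>lborel)"
  proof -
    have "ennreal (real (card S)) \<le> ennreal (384 * mass ?I)" by (intro ennreal_leI S)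
    also have "\<dots> = 384 * (\<integral>\<^sup>+x\<in>?I. W x \<partial>lborel)" by (simp add: ennreal_mult mass_nonneg flip: ennreal_mass)
    also have "\<dots> \<le> 384 * (\<integral>\<^sup>+x. W x \<partial>lborel)"
      by (intro mult_left_mono nn_integral_mono) (auto simp: indicator_def)
    finally show ?thesis .
  qed
  ultimately show ?thesis by (intro exI[of _ S] exI[of _ K]) simp
qed

end

section \<open>Low angular modes\<close>

text \<open>For a single mode, with only the derivative on the right, since the barrier of a low
  mode may vanish on \<open>A\<close>.\<close>

definition controls_low :: "(real \<Rightarrow> ennreal) \<Rightarrow> real set \<Rightarrow> real \<Rightarrow> real set \<Rightarrow> real \<Rightarrow> bool" where
  "controls_low W A \<kappa> S K \<longleftrightarrow> finite S \<and> 0 \<le> K \<and> (\<forall>F F'. c1_pair F F' \<longrightarrow>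
     (\<integral>\<^sup>+x\<in>A. W x * sq (F x) \<partial>lborel) \<le> ennreal \<kappa> * (\<integral>\<^sup>+x\<in>A. sq (F' x) \<partial>lborel) + ennreal K * (\<Sum>s\<in>S. sq (F s)))"

lemma controls_low_Un:
  assumes 1: "controls_low W A \<kappa> S K" and 2: "controls_low W B \<kappa> T L"
    and AB: "A \<inter> B = {}" and [measurable]: "A \<in> sets borel" "B \<in> sets borel" "W \<in> borel_measurable borel"
  shows "controls_low W (A \<union> B) \<kappa> (S \<union> T) (K + L)"
  unfolding controls_low_def
proof (intro conjI allI impI)
  show fin: "finite (S \<union> T)" "0 \<le> K + L" using 1 2 by (auto simp: controls_low_def)
  fix F F' assume F: "c1_pair F F'"
  have [measurable]: "F \<in> borel_measurable borel" "F' \<in> borel_measurable borel" using c1_pair_measurable[OF F] by auto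
  let ?D = "\<lambda>A. \<integral>\<^sup>+x\<in>A. sq (F' x) \<partial>lborel"
  have "(\<integral>\<^sup>+x\<in>A \<union> B. W x * sq (F x) \<partial>lborel) = (\<integral>\<^sup>+x\<in>A. W x * sq (F x) \<partial>lborel) + (\<integral>\<^sup>+x\<in>B. W x * sq (F x) \<partial>lborel)"
    using AB by (intro nn_integral_disjoint_pair) auto
  also have "\<dots> \<le> (ennreal \<kappa> * ?D A + ennreal K * (\<Sum>s\<in>S. sq (F s))) + (ennreal \<kappa> * ?D B + ennreal L * (\<Sum>s\<in>T. sq (F s)))"
    using 1 2 F unfolding controls_low_def by (intro add_mono) blast+
  also have "\<dots> \<le> (ennreal \<kappa> * ?D A + ennreal K * (\<Sum>s\<in>S \<union> T. sq (F s))) + (ennreal \<kappa> * ?D B + ennreal L * (\<Sum>s\<in>S \<union> T. sq (F s)))"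
    using fin by (intro add_mono mult_left_mono sum_mono2) auto
  also have "\<dots> = ennreal \<kappa> * ?D (A \<union> B) + ennreal (K + L) * (\<Sum>s\<in>S \<union> T. sq (F s))"
    using AB 1 2 by (simp add: nn_integral_disjoint_pair controls_low_def distrib_left distrib_right ac_simps)
  finally show "(\<integral>\<^sup>+x\<in>A \<union> B. W x * sq (F x) \<partial>lborel) \<le> ennreal \<kappa> * ?D (A \<union> B) + ennreal (K + L) * (\<Sum>s\<in>S \<union> T. sq (F s))" .
qed

lemma controls_low_one:
  assumes [measurable]: "W \<in> borel_measurable borel" and fin: "(\<integral>\<^sup>+x. W x \<partial>lborel) < \<infinity>"
    and A [measurable]: "A \<in> sets borel" and sub: "\<And>t. t \<in> A \<Longrightarrow> a \<le> t \<and> {a..t} \<subseteq> A"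
    and w: "(\<integral>\<^sup>+x\<in>A. W x * ennreal (x - a) \<partial>lborel) \<le> ennreal \<kappa>" and \<kappa>: "0 \<le> \<kappa>"
  shows "\<exists>K. controls_low W A (2 * \<kappa>) {a} K"
proof -
  define \<omega> where "\<omega> = enn2real (\<integral>\<^sup>+x\<in>A. W x \<partial>lborel)"
  have "(\<integral>\<^sup>+x\<in>A. W x \<partial>lborel) \<le> (\<integral>\<^sup>+x. W x \<partial>lborel)"
    by (intro nn_integral_mono) (auto simp: indicator_def)
  then have "(\<integral>\<^sup>+x\<in>A. W x \<partial>lborel) < top" using fin by (simp add: le_less_trans)
  then have \<omega>: "(\<integral>\<^sup>+x\<in>A. W x \<partial>lborel) \<le> ennreal \<omega>" "0 \<le> \<omega>" by (simp_all add: \<omega>_def)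
  have "controls_low W A (2 * \<kappa>) {a} (2 * \<omega>)"
    unfolding controls_low_def using one_functional[OF _ _ A sub \<omega>(1) w \<omega>(2) \<kappa>] \<omega> assms(1) by auto
  then show ?thesis by blast
qed

text \<open>
  Each interval is chosen so that its first moment about its left end is exactly \<open>\<kappa>\<close>; the first
  moment of the remaining half-line about its own left end drops by at least \<open>\<kappa>\<close>.
\<close>

lemma controls_low_half_line:
  assumes W [measurable]: "W \<in> borel_measurable borel" and fin: "(\<integral>\<^sup>+x. W x \<partial>lborel) < \<infinity>" and \<kappa>: "0 < \<kappa>"
  shows "(\<integral>\<^sup>+x\<in>{a..}. W x * ennreal (x - a) \<partial>lborel) \<le> ennreal (real n * \<kappa>) \<Longrightarrow>
    \<exists>S K. controls_low W {a..} (2 * \<kappa>) S K \<and> card S \<le> n"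
proof (induction n arbitrary: a)
  case 0
  \<comment> \<open>With moment zero, \<open>W\<close> vanishes almost everywhere to the right of
    \<open>a\<close>.\<close>
  then have "(\<integral>\<^sup>+x\<in>{a..}. W x * ennreal (x - a) \<partial>lborel) = 0" by simp
  then have ae: "AE x in lborel. W x * ennreal (x - a) * indicator {a..} x = 0"
    by (subst (asm) nn_integral_0_iff_AE) auto
  have "controls_low W {a..} (2 * \<kappa>) {} 0"
    unfolding controls_low_def
  proof (intro conjI allI impI)
    fix F F' assume F: "c1_pair F F'"
    have "AE x in lborel. W x * sq (F x) * indicator {a..} x = 0"
      using ae AE_lborel_singleton[of a] by eventually_elim (auto simp: indicator_def split: if_splits)
    then have "(\<integral>\<^sup>+x\<in>{a..}. W x * sq (F x) \<partial>lborel) = (\<integral>\<^sup>+(x::real). 0 \<partial>lborel)"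
      by (rule nn_integral_cong_AE)
    then show "(\<integral>\<^sup>+x\<in>{a..}. W x * sq (F x) \<partial>lborel) \<le> ennreal (2 * \<kappa>) * (\<integral>\<^sup>+x\<in>{a..}. sq (F' x) \<partial>lborel) + ennreal 0 * (\<Sum>s\<in>{}. sq (F s))"
      by simp
  qed auto
  then show ?case by (intro exI[of _ "{}"] exI[of _ 0]) simp
next
  case (Suc n)
  let ?M = "\<lambda>a. \<integral>\<^sup>+x\<in>{a..}. W x * ennreal (x - a) \<partial>lborel"
  show ?case
  proof (cases "?M a \<le> ennreal \<kappa>")
    case True
    then obtain K where "controls_low W {a..} (2 * \<kappa>) {a} K"
      using controls_low_one[OF W fin, of "{a..}" a \<kappa>] \<kappa> by auto
    then show ?thesis by (intro exI[of _ "{a}"] exI[of _ K]) simp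
  next
    case False
    \<comment> \<open>A finite measure without atoms, so its distribution function is continuous and
      takes the value \<open>\<kappa>\<close> at some \<open>b\<close>.\<close>
    define N where "N = density lborel (\<lambda>x. W x * ennreal (x - a) * indicator {a..} x)"
    have N [simp, measurable_cong]: "sets N = sets borel" by (simp add: N_def)
    have eN: "emeasure N A = (\<integral>\<^sup>+x. W x * ennreal (x - a) * indicator ({a..} \<inter> A) x \<partial>lborel)" if "A \<in> sets borel" for A
      unfolding N_def using that by (subst emeasure_density) (auto intro!: nn_integral_cong simp: indicator_def)
    have spN: "space N = UNIV" by (simp add: N_def)
    have eNU: "emeasure N UNIV = ?M a" by (subst eN) auto
    have Mfin: "?M a < \<infinity>" using Suc.prems by (simp add: le_less_trans)
    interpret finite_borel_measure N
    proof (intro finite_borel_measure.intro finite_borel_measure_axioms.intro finite_measureI)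
      show "emeasure N (space N) \<noteq> \<infinity>" unfolding spN eNU using Mfin by (rule less_imp_neq)
      show "sets N = sets borel" by (rule N)
    qed
    have single: "measure N {x} = 0" for x
    proof -
      have "AE y in lborel. W y * ennreal (y - a) * indicator ({a..} \<inter> {x}) y = 0"
        using AE_lborel_singleton[of x] by eventually_elim (auto simp: indicator_def)
      then have "emeasure N {x} = (\<integral>\<^sup>+(y::real). 0 \<partial>lborel)"
        unfolding eN[OF borel_singleton[OF sets.empty_sets]] by (rule nn_integral_cong_AE)
      then show ?thesis by (simp add: measure_def)
    qed
    have cont: "isCont (cdf N) x" for x by (simp add: isCont_cdf single)
    have "cdf N a = 0"
    proof -
      have "AE y in lborel. W y * ennreal (y - a) * indicator ({a..} \<inter> {..a}) y = 0"
        using AE_lborel_singleton[of a] by eventually_elim (auto simp: indicator_def)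
      then have "emeasure N {..a} = (\<integral>\<^sup>+(y::real). 0 \<partial>lborel)"
        unfolding eN[OF atMost_borel] by (rule nn_integral_cong_AE)
      then show ?thesis by (simp add: cdf_def2 measure_def)
    qed
    moreover have "\<kappa> < measure N (space N)"
    proof -
      have "ennreal \<kappa> < ennreal (measure N UNIV)"
        using False eNU by (simp add: emeasure_eq_measure)
      then show ?thesis using \<kappa> by (simp add: spN ennreal_less_iff)
    qed
    then obtain b0 where "\<kappa> < cdf N b0"
      using order_tendstoD(1)[OF cdf_lim_at_top, of \<kappa>] by (auto simp: eventually_at_top_linorder)
    moreover from this have "a \<le> b0" using calculation(1) cdf_nondecreasing[of b0 a] \<kappa> by linarith
    ultimately obtain b where b: "a \<le> b" "cdf N b = \<kappa>"
      using IVT[of "cdf N" a \<kappa> b0] cont \<kappa> by auto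
    have ab: "a < b" using b \<open>cdf N a = 0\<close> \<kappa> by (cases "a = b") auto
    have ble: "emeasure N {..b} = ennreal \<kappa>" using b by (simp add: cdf_def2 emeasure_eq_measure)
    have first: "(\<integral>\<^sup>+x\<in>{a..<b}. W x * ennreal (x - a) \<partial>lborel) \<le> ennreal \<kappa>"
      unfolding ble[symmetric] by (subst eN) (auto intro!: nn_integral_mono simp: indicator_def)
    \<comment> \<open>Beyond \<open>b\<close> the weight \<open>x - b\<close> is at most
      \<open>x - a\<close>, so the new moment is at most the mass of \<open>N\<close> to the right
      of \<open>b\<close>.\<close>
    have rest: "?M b \<le> ennreal (real n * \<kappa>)"
    proof -
      have "AE x in lborel. W x * ennreal (x - b) * indicator {b..} x \<le> W x * ennreal (x - a) * indicator ({a..} \<inter> {b<..}) x"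
        using AE_lborel_singleton[of b]
        by eventually_elim (use ab in \<open>auto simp: indicator_def intro!: mult_left_mono ennreal_leI\<close>)
      then have "?M b \<le> emeasure N {b<..}"
        unfolding eN[OF greaterThan_borel] by (rule nn_integral_mono_AE)
      also have "{b<..} = UNIV - {..b}" by auto
      also have "emeasure N (UNIV - {..b}) = ?M a - ennreal \<kappa>"
        using ble eNU by (subst emeasure_Diff) auto
      also have "\<dots> \<le> ennreal (real (Suc n) * \<kappa>) - ennreal \<kappa>" by (intro ennreal_minus_mono Suc.prems) auto
      also have "\<dots> = ennreal (real n * \<kappa>)" using \<kappa> by (subst ennreal_minus) (auto simp: algebra_simps)
      finally show ?thesis .
    qed
    obtain K where K: "controls_low W {a..<b} (2 * \<kappa>) {a} K"
      using controls_low_one[OF W fin _ _ first] \<kappa> by fastforce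
    obtain S L where S: "controls_low W {b..} (2 * \<kappa>) S L" "card S \<le> n"
      using Suc.IH[OF rest] by blast
    have "controls_low W ({a..<b} \<union> {b..}) (2 * \<kappa>) ({a} \<union> S) (K + L)"
      by (intro controls_low_Un K S W) auto
    moreover have "{a..<b} \<union> {b..} = {a..}" using ab by auto
    moreover have "card ({a} \<union> S) \<le> Suc n" using S(2) card_Un_le[of "{a}" S] by simp
    ultimately show ?thesis by (intro exI[of _ "{a} \<union> S"] exI[of _ "K + L"]) simp
  qed
qed

lemma nn_integral_reflect:
  fixes f :: "real \<Rightarrow> ennreal"
  assumes "f \<in> borel_measurable borel"
  shows "(\<integral>\<^sup>+x. f (- x) \<partial>lborel) = (\<integral>\<^sup>+x. f x \<partial>lborel)"
  using nn_integral_real_affine[OF assms, of "-1" 0] by simp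

text \<open>Reduces left half-lines to right ones by reflection.\<close>

lemma controls_low_reflect:
  assumes W [measurable]: "W \<in> borel_measurable borel" and A [measurable]: "A \<in> sets borel"
    and "controls_low (\<lambda>x. W (- x)) A \<kappa> S K"
  shows "controls_low W (uminus ` A) \<kappa> (uminus ` S) K"
  unfolding controls_low_def
proof (intro conjI allI impI)
  show "finite (uminus ` S)" "0 \<le> K" using assms by (auto simp: controls_low_def)
  have ind: "indicator (uminus ` A) (- x) = (indicator A x :: ennreal)" for x :: real
    by (auto simp: indicator_def)
  have [measurable]: "uminus ` A \<in> sets borel"
  proof -
    have "uminus ` A = uminus -` A \<inter> space borel" by (auto intro: image_eqI[of _ _ "- x" for x])
    also have "\<dots> \<in> sets borel" by (rule measurable_sets[OF _ A]) simp
    finally show ?thesis .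
  qed
  fix F F' assume F: "c1_pair F F'"
  have [measurable]: "F \<in> borel_measurable borel" "F' \<in> borel_measurable borel" using c1_pair_measurable[OF F] by auto
  have G: "c1_pair (\<lambda>x. F (- x)) (\<lambda>x. - F' (- x))"
    unfolding c1_pair_def
  proof (intro conjI allI)
    fix t
    have "(F has_vector_derivative F' (- t)) (at (- t))" using F by (simp add: c1_pair_def)
    moreover have "((uminus :: real \<Rightarrow> real) has_vector_derivative - 1) (at t)"
      unfolding has_real_derivative_iff_has_vector_derivative[symmetric] by (auto intro!: derivative_eq_intros)
    ultimately show "((\<lambda>x. F (- x)) has_vector_derivative - F' (- t)) (at t)"
      using vector_diff_chain_at[of uminus "-1" t F "F' (- t)"] by (simp add: o_def)
    show "continuous_on UNIV (\<lambda>x. - F' (- x))"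
      using F by (auto simp: c1_pair_def intro!: continuous_intros continuous_on_compose2[of UNIV F'])
  qed
  have "(\<integral>\<^sup>+x\<in>uminus ` A. W x * sq (F x) \<partial>lborel) = (\<integral>\<^sup>+x\<in>A. W (- x) * sq (F (- x)) \<partial>lborel)"
    by (subst nn_integral_reflect[symmetric]) (simp_all add: ind)
  also have "\<dots> \<le> ennreal \<kappa> * (\<integral>\<^sup>+x\<in>A. sq (- F' (- x)) \<partial>lborel) + ennreal K * (\<Sum>s\<in>S. sq (F (- s)))"
    using assms(3) G unfolding controls_low_def by blast
  also have "(\<integral>\<^sup>+x\<in>A. sq (- F' (- x)) \<partial>lborel) = (\<integral>\<^sup>+x\<in>uminus ` A. sq (F' x) \<partial>lborel)"
    by (subst nn_integral_reflect[symmetric, of "\<lambda>x. sq (F' x) * indicator (uminus ` A) x"]) (simp_all add: ind sq_def)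
  also have "(\<Sum>s\<in>S. sq (F (- s))) = (\<Sum>s\<in>uminus ` S. sq (F s))"
    by (subst sum.reindex) auto
  finally show "(\<integral>\<^sup>+x\<in>uminus ` A. W x * sq (F x) \<partial>lborel) \<le>
    ennreal \<kappa> * (\<integral>\<^sup>+x\<in>uminus ` A. sq (F' x) \<partial>lborel) + ennreal K * (\<Sum>s\<in>uminus ` S. sq (F s))" .
qed

text \<open>On the window around \<open>t0\<close> the barrier controls the average of
  \<open>|F|^2\<close>; the derivative carries this value to \<open>t\<close> at a cost proportional
  to the distance. The linear growth in \<open>t\<close> becomes the logarithmic weight in the
  plane.\<close>

lemma hardy_pointwise:
  assumes F: "c1_pair F F'" and [measurable]: "p \<in> borel_measurable borel" and p: "\<And>t. t \<in> {t0 - \<delta>..t0 + \<delta>} \<Longrightarrow> \<epsilon> \<le> p t" and pos: "0 < \<delta>" "0 < \<epsilon>"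
    and H: "H = 1 / (\<delta> * \<epsilon>) + 2 * (1 + \<bar>t0\<bar> + \<delta>)"
  shows "sq (F t) \<le> ennreal (H * (1 + \<bar>t\<bar>)) * ((\<integral>\<^sup>+x. sq (F' x) \<partial>lborel) + (\<integral>\<^sup>+x. ennreal (p x) * sq (F x) \<partial>lborel))"
proof -
  let ?D = "\<integral>\<^sup>+x. sq (F' x) \<partial>lborel" and ?P = "\<integral>\<^sup>+x. ennreal (p x) * sq (F x) \<partial>lborel"
  have [measurable]: "F \<in> borel_measurable borel" using c1_pair_measurable[OF F] by auto
  let ?J = "{t0 - \<delta>..t0 - \<delta> + 2 * \<delta>}"
  have "sq (F t) \<le> ennreal (2 / (2 * \<delta>)) * (\<integral>\<^sup>+x\<in>?J. sq (F x) \<partial>lborel) + ennreal (2 * (\<bar>t\<bar> + \<bar>t0\<bar> + \<delta>)) * (\<integral>\<^sup>+x\<in>UNIV. sq (F' x) \<partial>lborel)"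
    using pos by (intro sq_average[OF F]) auto
  also have "(\<integral>\<^sup>+x\<in>?J. sq (F x) \<partial>lborel) \<le> (\<integral>\<^sup>+x. ennreal (1 / \<epsilon>) * (ennreal (p x) * sq (F x)) \<partial>lborel)"
  proof (intro nn_integral_mono)
    fix x
    show "sq (F x) * indicator ?J x \<le> ennreal (1 / \<epsilon>) * (ennreal (p x) * sq (F x))"
    proof (cases "x \<in> ?J")
      case True
      have "1 = ennreal (1 / \<epsilon>) * ennreal \<epsilon>" using pos by (simp flip: ennreal_mult)
      then have "sq (F x) = ennreal (1 / \<epsilon>) * (ennreal \<epsilon> * sq (F x))" by (simp add: mult.assoc[symmetric])
      also have "\<dots> \<le> ennreal (1 / \<epsilon>) * (ennreal (p x) * sq (F x))"
        using True p[of x] by (intro mult_left_mono mult_right_mono ennreal_leI) auto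
      finally show ?thesis using True by simp
    qed simp
  qed
  also have "\<dots> = ennreal (1 / \<epsilon>) * ?P" by (rule nn_integral_cmult) measurable
  finally have "sq (F t) \<le> ennreal (1 / (\<delta> * \<epsilon>)) * ?P + ennreal (2 * (\<bar>t\<bar> + \<bar>t0\<bar> + \<delta>)) * ?D"
    using pos by (simp add: mult.assoc[symmetric] flip: ennreal_mult) (simp add: mult_left_mono add_right_mono)
  also have "\<dots> \<le> ennreal (H * (1 + \<bar>t\<bar>)) * ?P + ennreal (H * (1 + \<bar>t\<bar>)) * ?D"
  proof (intro add_mono mult_right_mono ennreal_leI)
    have a: "0 \<le> 1 / (\<delta> * \<epsilon>)" "0 \<le> 2 * (1 + \<bar>t0\<bar> + \<delta>)" using pos by auto
    have "1 / (\<delta> * \<epsilon>) * 1 \<le> H * (1 + \<bar>t\<bar>)" using a by (intro mult_mono) (auto simp: H)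
    then show "1 / (\<delta> * \<epsilon>) \<le> H * (1 + \<bar>t\<bar>)" by simp
    have "2 * (\<bar>t\<bar> + \<bar>t0\<bar> + \<delta>) \<le> 2 * (1 + \<bar>t0\<bar> + \<delta>) * (1 + \<bar>t\<bar>)"
      using pos by (simp add: algebra_simps)
    also have "\<dots> \<le> H * (1 + \<bar>t\<bar>)" using a by (intro mult_right_mono) (auto simp: H)
    finally show "2 * (\<bar>t\<bar> + \<bar>t0\<bar> + \<delta>) \<le> H * (1 + \<bar>t\<bar>)" .
  qed auto
  finally show ?thesis by (simp add: distrib_left add.commute)
qed

text \<open>
  If the moment of \<open>W\<close> is small, the Hardy inequality needs no functional at all; this is what makes
  the bound on the number of functionals linear, without an additive constant.
\<close>

theorem low_modes:
  assumes p [measurable]: "p \<in> borel_measurable borel" and pos: "0 < \<delta>" "0 < \<epsilon>" "\<And>t. t \<in> {t0 - \<delta>..t0 + \<delta>} \<Longrightarrow> \<epsilon> \<le> p t"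
    and \<kappa>: "0 < \<kappa>"
  shows "\<exists>C\<ge>0. \<forall>W. W \<in> borel_measurable borel \<longrightarrow> (\<integral>\<^sup>+x. W x * ennreal (1 + \<bar>x\<bar>) \<partial>lborel) < \<infinity> \<longrightarrow>
    (\<exists>S K. finite S \<and> 0 \<le> K \<and> ennreal (real (card S)) \<le> ennreal C * (\<integral>\<^sup>+x. W x * ennreal (1 + \<bar>x\<bar>) \<partial>lborel) \<and>
      (\<forall>F F'. c1_pair F F' \<longrightarrow> (\<integral>\<^sup>+x. W x * sq (F x) \<partial>lborel) \<le>
        ennreal \<kappa> * ((\<integral>\<^sup>+x. sq (F' x) \<partial>lborel) + (\<integral>\<^sup>+x. ennreal (p x) * sq (F x) \<partial>lborel)) + ennreal K * (\<Sum>s\<in>S. sq (F s))))"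
proof -
  define H where "H = 1 / (\<delta> * \<epsilon>) + 2 * (1 + \<bar>t0\<bar> + \<delta>)"
  have H: "0 < H" unfolding H_def using pos by (intro add_nonneg_pos) auto
  \<comment> \<open>The first summand counts the moment in units of \<open>\<kappa> / 2\<close>; the
    second pays for rounding up to an integer, as \<open>H * j / \<kappa>\<close> exceeds one where
    functionals are needed; the factor two stands for the two half-lines.\<close>
  define C where "C = 2 * (2 * (1 + \<bar>t0\<bar>) / \<kappa> + H / \<kappa>)"
  have C: "0 \<le> C" using H \<kappa> by (simp add: C_def)
  show ?thesis
  proof (intro exI[of _ C] conjI allI impI C)
    fix W :: "real \<Rightarrow> ennreal"
    assume W [measurable]: "W \<in> borel_measurable borel"
    let ?J = "\<integral>\<^sup>+x. W x * ennreal (1 + \<bar>x\<bar>) \<partial>lborel"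
    assume fin: "?J < \<infinity>"
    then obtain j where j: "?J = ennreal j" "0 \<le> j" by (cases ?J) auto
    have W_le: "W x \<le> W x * ennreal (1 + \<bar>x\<bar>)" for x
      using mult_left_mono[of 1 "ennreal (1 + \<bar>x\<bar>)" "W x"] by simp
    have finW: "(\<integral>\<^sup>+x. W x \<partial>lborel) < \<infinity>"
      by (rule le_less_trans[OF _ fin]) (intro nn_integral_mono W_le)
    show "\<exists>S K. finite S \<and> 0 \<le> K \<and> ennreal (real (card S)) \<le> ennreal C * ?J \<and>
      (\<forall>F F'. c1_pair F F' \<longrightarrow> (\<integral>\<^sup>+x. W x * sq (F x) \<partial>lborel) \<le>
        ennreal \<kappa> * ((\<integral>\<^sup>+x. sq (F' x) \<partial>lborel) + (\<integral>\<^sup>+x. ennreal (p x) * sq (F x) \<partial>lborel)) + ennreal K * (\<Sum>s\<in>S. sq (F s)))"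
    proof (cases "H * j \<le> \<kappa>")
      case True
      have "(\<integral>\<^sup>+x. W x * sq (F x) \<partial>lborel) \<le> ennreal \<kappa> * ((\<integral>\<^sup>+x. sq (F' x) \<partial>lborel) + (\<integral>\<^sup>+x. ennreal (p x) * sq (F x) \<partial>lborel))"
        if F: "c1_pair F F'" for F F'
      proof -
        let ?E = "(\<integral>\<^sup>+x. sq (F' x) \<partial>lborel) + (\<integral>\<^sup>+x. ennreal (p x) * sq (F x) \<partial>lborel)"
        have "(\<integral>\<^sup>+x. W x * sq (F x) \<partial>lborel) \<le> (\<integral>\<^sup>+x. (ennreal H * ?E) * (W x * ennreal (1 + \<bar>x\<bar>)) \<partial>lborel)"
        proof (rule nn_integral_mono)
          fix x
          have "W x * sq (F x) \<le> W x * (ennreal (H * (1 + \<bar>x\<bar>)) * ?E)"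
            by (intro mult_left_mono hardy_pointwise[OF F p pos(3) pos(1,2) H_def]) auto
          also have "\<dots> = (ennreal H * ?E) * (W x * ennreal (1 + \<bar>x\<bar>))"
            using H by (simp add: ennreal_mult ac_simps del: ennreal_plus)
          finally show "W x * sq (F x) \<le> (ennreal H * ?E) * (W x * ennreal (1 + \<bar>x\<bar>))" .
        qed
        also have "\<dots> = (ennreal H * ?E) * ?J" by (rule nn_integral_cmult) measurable
        also have "\<dots> = ennreal (H * j) * ?E" using H j by (simp add: ennreal_mult ac_simps)
        also have "\<dots> \<le> ennreal \<kappa> * ?E" by (intro mult_right_mono ennreal_leI True) auto
        finally show ?thesis .
      qed
      then show ?thesis by (intro exI[of _ "{}"] exI[of _ 0]) auto
    next
      case False
      \<comment> \<open>\<open>controls_low_half_line\<close> charges twice its unit of moment to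
        the derivative.\<close>
      define c where "c = \<kappa> / 2"
      have c: "0 < c" "2 * c = \<kappa>" using \<kappa> by (auto simp: c_def)
      define n where "n = nat \<lceil>(1 + \<bar>t0\<bar>) * j / c\<rceil>"
      have "(1 + \<bar>t0\<bar>) * j / c \<le> real n" unfolding n_def by (rule of_nat_ceiling)
      then have n: "(1 + \<bar>t0\<bar>) * j \<le> real n * c" using c by (simp add: field_simps)
      have "real n \<le> (1 + \<bar>t0\<bar>) * j / c + 1" (is "_ \<le> ?x + 1")
      proof -
        have "0 \<le> (1 + \<bar>t0\<bar>) * j / c" using j c by simp
        then show ?thesis unfolding n_def by linarith
      qed
      moreover have "1 \<le> H * j / \<kappa>" using False \<kappa> by simp
      moreover have "(1 + \<bar>t0\<bar>) * j / c = 2 * (1 + \<bar>t0\<bar>) / \<kappa> * j" by (simp add: c_def)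
      moreover have "C * j = 2 * (2 * (1 + \<bar>t0\<bar>) / \<kappa> * j + H * j / \<kappa>)" by (simp add: C_def distrib_right mult.assoc)
      moreover have "2 * r \<le> z" if "r \<le> x + 1" "1 \<le> y" "x = x'" "z = 2 * (x' + y)" for r x x' y z :: real
        using that(1,2) unfolding that(3,4) by simp
      ultimately have n': "2 * real n \<le> C * j" by blast
      have mom: "(\<integral>\<^sup>+x\<in>{a..}. V x * ennreal (x - a) \<partial>lborel) \<le> ennreal (real n * c)"
        if V: "V \<in> borel_measurable borel" "(\<integral>\<^sup>+x. V x * ennreal (1 + \<bar>x\<bar>) \<partial>lborel) = ennreal j" and a: "\<bar>a\<bar> = \<bar>t0\<bar>" for V a
      proof -
        note [measurable] = V(1)
        have "(\<integral>\<^sup>+x\<in>{a..}. V x * ennreal (x - a) \<partial>lborel) \<le> (\<integral>\<^sup>+x. ennreal (1 + \<bar>t0\<bar>) * (V x * ennreal (1 + \<bar>x\<bar>)) \<partial>lborel)"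
        proof (rule nn_integral_mono)
          fix x
          have "x - a \<le> (1 + \<bar>t0\<bar>) * (1 + \<bar>x\<bar>)"
          proof -
            have "x - a \<le> \<bar>x\<bar> + \<bar>t0\<bar>" using a by linarith
            also have "\<dots> \<le> (1 + \<bar>t0\<bar>) * (1 + \<bar>x\<bar>)" by (simp add: algebra_simps)
            finally show ?thesis .
          qed
          then have "V x * ennreal (x - a) \<le> V x * ennreal ((1 + \<bar>t0\<bar>) * (1 + \<bar>x\<bar>))"
            by (intro mult_left_mono ennreal_leI) auto
          also have "\<dots> = ennreal (1 + \<bar>t0\<bar>) * (V x * ennreal (1 + \<bar>x\<bar>))"
            by (simp add: ennreal_mult ac_simps del: ennreal_plus)
          finally show "V x * ennreal (x - a) * indicator {a..} x \<le> ennreal (1 + \<bar>t0\<bar>) * (V x * ennreal (1 + \<bar>x\<bar>))"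
            by (auto simp: indicator_def)
        qed
        also have "\<dots> = ennreal (1 + \<bar>t0\<bar>) * (\<integral>\<^sup>+x. V x * ennreal (1 + \<bar>x\<bar>) \<partial>lborel)"
          by (rule nn_integral_cmult) measurable
        also have "\<dots> = ennreal ((1 + \<bar>t0\<bar>) * j)" using V j by (simp add: ennreal_mult del: ennreal_plus)
        also have "\<dots> \<le> ennreal (real n * c)" by (intro ennreal_leI n)
        finally show ?thesis .
      qed
      let ?R = "\<lambda>x. W (- x)"
      have R [measurable]: "?R \<in> borel_measurable borel" by measurable
      have finR: "(\<integral>\<^sup>+x. ?R x \<partial>lborel) < \<infinity>" using finW by (simp add: nn_integral_reflect)
      have momR: "(\<integral>\<^sup>+x. ?R x * ennreal (1 + \<bar>x\<bar>) \<partial>lborel) = ennreal j"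
        using nn_integral_reflect[of "\<lambda>x. W x * ennreal (1 + \<bar>x\<bar>)"] j by simp
      obtain S K where S: "controls_low W {t0..} (2 * c) S K" "card S \<le> n"
        using controls_low_half_line[OF W finW c(1) mom[OF W j(1) refl]] by blast
      obtain T L where T: "controls_low ?R {- t0..} (2 * c) T L" "card T \<le> n"
        using controls_low_half_line[OF R finR c(1) mom[OF R momR abs_minus_cancel]] by blast
      from controls_low_reflect[OF W _ T(1)] have T': "controls_low W {..t0} (2 * c) (uminus ` T) L" by simp
      have finT: "finite T" using T by (simp add: controls_low_def)
      \<comment> \<open>The point \<open>t0\<close> is removed to make the half-lines disjoint; a
        single point does not change the derivative term.\<close>
      have "controls_low W {..<t0} (2 * c) (uminus ` T) L"
        unfolding controls_low_def
      proof (intro conjI allI impI)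
        show "finite (uminus ` T)" "0 \<le> L" using T' by (auto simp: controls_low_def)
        fix F F' assume F: "c1_pair F F'"
        have "(\<integral>\<^sup>+x\<in>{..<t0}. W x * sq (F x) \<partial>lborel) \<le> (\<integral>\<^sup>+x\<in>{..t0}. W x * sq (F x) \<partial>lborel)"
          by (intro set_nn_integral_mono_set) auto
        also have "\<dots> \<le> ennreal (2 * c) * (\<integral>\<^sup>+x\<in>{..t0}. sq (F' x) \<partial>lborel) + ennreal L * (\<Sum>s\<in>uminus ` T. sq (F s))"
          using T' F unfolding controls_low_def by blast
        also have "(\<integral>\<^sup>+x\<in>{..t0}. sq (F' x) \<partial>lborel) = (\<integral>\<^sup>+x\<in>{..<t0}. sq (F' x) \<partial>lborel)"
        proof (rule nn_integral_cong_AE)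
          show "AE x in lborel. sq (F' x) * indicator {..t0} x = sq (F' x) * indicator {..<t0} x"
            using AE_lborel_singleton[of t0] by eventually_elim (auto simp: indicator_def)
        qed
        finally show "(\<integral>\<^sup>+x\<in>{..<t0}. W x * sq (F x) \<partial>lborel) \<le> ennreal (2 * c) * (\<integral>\<^sup>+x\<in>{..<t0}. sq (F' x) \<partial>lborel) + ennreal L * (\<Sum>s\<in>uminus ` T. sq (F s))" .
      qed
      moreover have "{..<t0} \<union> {t0..} = UNIV" "{..<t0} \<inter> {t0..} = {}" by auto
      ultimately have U: "controls_low W UNIV \<kappa> (uminus ` T \<union> S) (L + K)"
        using controls_low_Un[OF _ S(1), of "{..<t0}" "uminus ` T" L] c(2) by simp
      have "card (uminus ` T \<union> S) \<le> n + n"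
        using card_Un_le[of "uminus ` T" S] card_image_le[OF finT, of uminus] T(2) S(2) by linarith
      then have "real (card (uminus ` T \<union> S)) \<le> C * j" using n' by linarith
      then have "ennreal (real (card (uminus ` T \<union> S))) \<le> ennreal C * ?J"
        unfolding j using C j(2) by (simp add: ennreal_leI flip: ennreal_mult)
      moreover have "(\<integral>\<^sup>+x. W x * sq (F x) \<partial>lborel) \<le>
          ennreal \<kappa> * ((\<integral>\<^sup>+x. sq (F' x) \<partial>lborel) + (\<integral>\<^sup>+x. ennreal (p x) * sq (F x) \<partial>lborel)) + ennreal (L + K) * (\<Sum>s\<in>uminus ` T \<union> S. sq (F s))"
        if F: "c1_pair F F'" for F F'
      proof -
        have "(\<integral>\<^sup>+x. W x * sq (F x) \<partial>lborel) \<le> ennreal \<kappa> * (\<integral>\<^sup>+x. sq (F' x) \<partial>lborel) + ennreal (L + K) * (\<Sum>s\<in>uminus ` T \<union> S. sq (F s))"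
          using U F unfolding controls_low_def by auto
        also have "\<dots> \<le> ennreal \<kappa> * ((\<integral>\<^sup>+x. sq (F' x) \<partial>lborel) + (\<integral>\<^sup>+x. ennreal (p x) * sq (F x) \<partial>lborel)) + ennreal (L + K) * (\<Sum>s\<in>uminus ` T \<union> S. sq (F s))"
          by (intro add_right_mono mult_left_mono add_increasing2) auto
        finally show ?thesis .
      qed
      ultimately show ?thesis using U
        by (intro exI[of _ "uminus ` T \<union> S"] exI[of _ "L + K"]) (auto simp: controls_low_def)
    qed
  qed
qed

section \<open>Fourier coefficients on the circle\<close>

text \<open>Unnormalised: the coefficient in the Fourier series is
  \<open>fourier g m / (2 * pi)\<close>, whence the factors \<open>2 * pi\<close> in Bessel and
  Parseval.\<close>

definition fourier :: "(real \<Rightarrow> complex) \<Rightarrow> int \<Rightarrow> complex" where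
  "fourier g m = integral {0..2*pi} (\<lambda>\<theta>. g \<theta> * cis (- of_int m * \<theta>))"

lemma continuous_on_cis_mult [continuous_intros]:
  fixes c :: real
  shows "continuous_on S (\<lambda>\<theta>. cis (c * \<theta>))"
  unfolding cis_conv_exp by (intro continuous_intros)

lemma cis_of_int_mult_periodic: "cis (of_int m * (2 * pi)) = 1"
  using cis_multiple_2pi[of "of_int m"] by (simp add: mult.commute mult.left_commute)

lemma integral_cis:
  "integral {0..2*pi} (\<lambda>\<theta>. cis (of_int m * \<theta>)) = (if m = 0 then of_real (2 * pi) else 0)"
proof (cases "m = 0")
  case False
  let ?G = "\<lambda>\<theta>::real. cis (of_int m * \<theta>) / (\<i> * of_int m)"
  have "((\<lambda>\<theta>. cis (of_int m * \<theta>)) has_integral ?G (2 * pi) - ?G 0) {0..2*pi}"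
  proof (rule fundamental_theorem_of_calculus)
    fix x :: real
    have "((\<lambda>\<theta>. exp (\<i> * of_real (of_int m * \<theta>)) / (\<i> * of_int m)) has_vector_derivative exp (\<i> * of_real (of_int m * x))) (at x within {0..2*pi})"
      using False by (auto intro!: derivative_eq_intros has_vector_derivative_real_field simp: field_simps)
    then show "(?G has_vector_derivative cis (of_int m * x)) (at x within {0..2*pi})"
      by (simp add: cis_conv_exp)
  qed simp
  then show ?thesis using False by (simp add: integral_unique cis_of_int_mult_periodic)
qed (simp add: scaleR_conv_of_real)

lemma integrable_fourier:
  assumes "continuous_on {0..2*pi} g"
  shows "(\<lambda>\<theta>. g \<theta> * cis (c * \<theta>)) integrable_on {0..2*pi}"
  using assms by (intro integrable_continuous_interval continuous_intros)

definition trig_sum :: "int set \<Rightarrow> (int \<Rightarrow> complex) \<Rightarrow> real \<Rightarrow> complex" where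
  "trig_sum M c \<theta> = (\<Sum>m\<in>M. c m * cis (of_int m * \<theta>))"

lemma continuous_on_trig_sum [continuous_intros]: "continuous_on S (trig_sum M c)"
  unfolding trig_sum_def by (intro continuous_intros)

lemma integral_trig_sum_mult:
  assumes M: "finite M" and g: "continuous_on {0..2*pi} g"
  shows "integral {0..2*pi} (\<lambda>\<theta>. g \<theta> * cnj (trig_sum M c \<theta>)) = (\<Sum>m\<in>M. cnj (c m) * fourier g m)"
proof -
  have "(\<lambda>\<theta>. g \<theta> * cnj (trig_sum M c \<theta>)) = (\<lambda>\<theta>. \<Sum>m\<in>M. cnj (c m) * (g \<theta> * cis (- of_int m * \<theta>)))"
    by (simp add: trig_sum_def sum_distrib_left cis_cnj mult_ac fun_eq_iff)
  then have "integral {0..2*pi} (\<lambda>\<theta>. g \<theta> * cnj (trig_sum M c \<theta>)) =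
      (\<Sum>m\<in>M. integral {0..2*pi} (\<lambda>\<theta>. cnj (c m) * (g \<theta> * cis (- of_int m * \<theta>))))"
    by (simp only:) (intro Henstock_Kurzweil_Integration.integral_sum M integrable_on_mult_right integrable_fourier g)
  then show ?thesis by (simp only: Henstock_Kurzweil_Integration.integral_mult_right fourier_def)
qed

lemma fourier_trig_sum:
  assumes M: "finite M"
  shows "fourier (trig_sum M c) m = (if m \<in> M then of_real (2 * pi) * c m else 0)"
proof -
  have "fourier (trig_sum M c) m = integral {0..2*pi} (\<lambda>\<theta>. \<Sum>k\<in>M. c k * cis (of_int (k - m) * \<theta>))"
    unfolding fourier_def trig_sum_def
    by (intro integral_cong, simp only: sum_distrib_right mult.assoc cis_mult) (auto intro!: sum.cong simp: algebra_simps)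
  also have "\<dots> = (\<Sum>k\<in>M. c k * integral {0..2*pi} (\<lambda>\<theta>. cis (of_int (k - m) * \<theta>)))"
    using M by (subst Henstock_Kurzweil_Integration.integral_sum)
      (auto intro!: integrable_continuous_interval continuous_intros)
  also have "\<dots> = (\<Sum>k\<in>M. if k = m then of_real (2 * pi) * c m else 0)"
    unfolding integral_cis by (intro sum.cong) auto
  finally show ?thesis using M by simp
qed

lemma integrable_norm_sq:
  "continuous_on {0..2*pi} g \<Longrightarrow> (\<lambda>\<theta>. (norm (g \<theta> :: complex))\<^sup>2) integrable_on {0..2*pi}"
  by (intro integrable_continuous_interval continuous_intros)

lemma norm_sq_diff: "(norm (x - y :: complex))\<^sup>2 = (norm x)\<^sup>2 - 2 * Re (x * cnj y) + (norm y)\<^sup>2"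
  unfolding cmod_power2 by (simp add: power2_eq_square algebra_simps)

text \<open>Completes the square in the coefficients. The optimal choice
  \<open>fourier g m / (2 * pi)\<close> gives Bessel's inequality and the size of the remainder;
  discarding the last, nonnegative sum gives Parseval.\<close>

lemma integral_norm_sq_diff_trig_sum:
  assumes M: "finite M" and g: "continuous_on {0..2*pi} g"
  shows "integral {0..2*pi} (\<lambda>\<theta>. (norm (g \<theta> - trig_sum M c \<theta>))\<^sup>2) =
    integral {0..2*pi} (\<lambda>\<theta>. (norm (g \<theta>))\<^sup>2) - (\<Sum>m\<in>M. (norm (fourier g m))\<^sup>2) / (2 * pi)
      + 2 * pi * (\<Sum>m\<in>M. (norm (c m - fourier g m / of_real (2 * pi)))\<^sup>2)"
proof -
  let ?I = "\<lambda>f. integral {0..2*pi} f"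
  let ?t = "trig_sum M c"
  have i: "(\<lambda>\<theta>. g \<theta> * cnj (?t \<theta>)) integrable_on {0..2*pi}" "(\<lambda>\<theta>. ?t \<theta> * cnj (?t \<theta>)) integrable_on {0..2*pi}"
    using g by (auto intro!: integrable_continuous_interval continuous_intros)
  have Re: "?I (\<lambda>\<theta>. Re (f \<theta>)) = Re (?I f)" if "f integrable_on {0..2*pi}" for f
    using integral_linear[OF that bounded_linear_Re] by (simp add: o_def)
  have "?I (\<lambda>\<theta>. (norm (g \<theta> - ?t \<theta>))\<^sup>2) = ?I (\<lambda>\<theta>. (norm (g \<theta>))\<^sup>2 - 2 * Re (g \<theta> * cnj (?t \<theta>)) + Re (?t \<theta> * cnj (?t \<theta>)))"
    by (intro integral_cong) (simp only: norm_sq_diff complex_norm_square[symmetric] Re_complex_of_real flip: of_real_power)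
  also have "\<dots> = ?I (\<lambda>\<theta>. (norm (g \<theta>))\<^sup>2) - 2 * ?I (\<lambda>\<theta>. Re (g \<theta> * cnj (?t \<theta>))) + ?I (\<lambda>\<theta>. Re (?t \<theta> * cnj (?t \<theta>)))"
    using g by (subst Henstock_Kurzweil_Integration.integral_add Henstock_Kurzweil_Integration.integral_diff integral_mult_right;
      (intro integrable_continuous_interval continuous_intros)?; simp?)+
  also have "\<dots> = ?I (\<lambda>\<theta>. (norm (g \<theta>))\<^sup>2) - 2 * Re (\<Sum>m\<in>M. cnj (c m) * fourier g m) + Re (\<Sum>m\<in>M. cnj (c m) * fourier ?t m)"
    unfolding Re[OF i(1)] Re[OF i(2)] using M g by (simp add: integral_trig_sum_mult continuous_intros)
  also have "\<dots> = ?I (\<lambda>\<theta>. (norm (g \<theta>))\<^sup>2) + (\<Sum>m\<in>M. Re (cnj (c m) * (of_real (2 * pi) * c m)) - 2 * Re (cnj (c m) * fourier g m))"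
    using M by (simp add: fourier_trig_sum sum_subtractf sum_distrib_left)
  also have "(\<Sum>m\<in>M. Re (cnj (c m) * (of_real (2 * pi) * c m)) - 2 * Re (cnj (c m) * fourier g m)) =
     (\<Sum>m\<in>M. 2 * pi * (norm (c m - fourier g m / of_real (2 * pi)))\<^sup>2 - (norm (fourier g m))\<^sup>2 / (2 * pi))"
  proof (intro sum.cong refl)
    fix m
    have "Re (cnj z * (of_real L * z)) - 2 * Re (cnj z * w) = L * (norm (z - w / of_real L))\<^sup>2 - (norm w)\<^sup>2 / L" if "L > 0" for z w L
      using that unfolding cmod_power2
      by (simp add: power2_eq_square field_simps)
    then show "Re (cnj (c m) * (of_real (2 * pi) * c m)) - 2 * Re (cnj (c m) * fourier g m) =
      2 * pi * (norm (c m - fourier g m / of_real (2 * pi)))\<^sup>2 - (norm (fourier g m))\<^sup>2 / (2 * pi)" by simp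
  qed
  finally show ?thesis by (simp add: sum_subtractf sum_distrib_left sum_divide_distrib)
qed

lemma bessel:
  assumes M: "finite M" and g: "continuous_on {0..2*pi} g"
  shows "(\<Sum>m\<in>M. (norm (fourier g m))\<^sup>2) \<le> 2 * pi * integral {0..2*pi} (\<lambda>\<theta>. (norm (g \<theta>))\<^sup>2)"
proof -
  let ?c = "\<lambda>m. fourier g m / of_real (2 * pi)"
  have "0 \<le> integral {0..2*pi} (\<lambda>\<theta>. (norm (g \<theta> - trig_sum M ?c \<theta>))\<^sup>2)"
    using g by (intro Henstock_Kurzweil_Integration.integral_nonneg integrable_norm_sq continuous_intros) auto
  also have "\<dots> = integral {0..2*pi} (\<lambda>\<theta>. (norm (g \<theta>))\<^sup>2) - (\<Sum>m\<in>M. (norm (fourier g m))\<^sup>2) / (2 * pi)"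
    using integral_norm_sq_diff_trig_sum[OF M g, of ?c] by simp
  finally show ?thesis by (simp add: field_simps)
qed

section \<open>Density of trigonometric polynomials and Parseval\<close>

lemma trig_sum_lincomb_ex:
  assumes "\<exists>M c. finite M \<and> (\<forall>\<theta>. f \<theta> = trig_sum M c \<theta>)" "\<exists>M c. finite M \<and> (\<forall>\<theta>. g \<theta> = trig_sum M c \<theta>)"
  shows "\<exists>M c. finite M \<and> (\<forall>\<theta>. \<alpha> * f \<theta> + \<beta> * g \<theta> = trig_sum M c \<theta>)"
proof -
  obtain M c N d where f: "finite M" "\<And>\<theta>. f \<theta> = trig_sum M c \<theta>" and g: "finite N" "\<And>\<theta>. g \<theta> = trig_sum N d \<theta>"
    using assms by blast
  have ext: "trig_sum M c \<theta> = trig_sum (M \<union> N) (\<lambda>m. if m \<in> M then c m else 0) \<theta>"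
    "trig_sum N d \<theta> = trig_sum (M \<union> N) (\<lambda>m. if m \<in> N then d m else 0) \<theta>" for \<theta>
    unfolding trig_sum_def using f g by (auto intro!: sum.mono_neutral_cong_left)
  have "\<alpha> * f \<theta> + \<beta> * g \<theta> = trig_sum (M \<union> N) (\<lambda>m. \<alpha> * (if m \<in> M then c m else 0) + \<beta> * (if m \<in> N then d m else 0)) \<theta>" for \<theta>
    unfolding f g ext by (simp only: trig_sum_def sum_distrib_left sum.distrib[symmetric] distrib_right mult.assoc)
  then show ?thesis using f g by blast
qed

lemma trig_sum_mult_ex:
  assumes "\<exists>M c. finite M \<and> (\<forall>\<theta>. f \<theta> = trig_sum M c \<theta>)" "\<exists>M c. finite M \<and> (\<forall>\<theta>. g \<theta> = trig_sum M c \<theta>)"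
  shows "\<exists>M c. finite M \<and> (\<forall>\<theta>. f \<theta> * g \<theta> = trig_sum M c \<theta>)"
proof -
  obtain M c where f: "finite M" "\<And>\<theta>. f \<theta> = trig_sum M c \<theta>" using assms by blast
  have single: "\<exists>N d. finite N \<and> (\<forall>\<theta>. cis (of_int m * \<theta>) * g \<theta> = trig_sum N d \<theta>)" for m
  proof -
    obtain N d where g: "finite N" "\<And>\<theta>. g \<theta> = trig_sum N d \<theta>" using assms by blast
    have "cis (of_int m * \<theta>) * g \<theta> = trig_sum ((\<lambda>n. m + n) ` N) (\<lambda>k. d (k - m)) \<theta>" for \<theta>
      unfolding g trig_sum_def
      by (subst sum.reindex) (auto simp: sum_distrib_left cis_mult algebra_simps intro!: sum.cong)
    then show ?thesis using g by blast
  qed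
  have "\<exists>N d. finite N \<and> (\<forall>\<theta>. trig_sum M c \<theta> * g \<theta> = trig_sum N d \<theta>)"
    using f(1)
  proof (induction M rule: finite_induct)
    case empty
    then show ?case by (intro exI[of _ "{}"]) (simp add: trig_sum_def)
  next
    case (insert m M)
    have "trig_sum (insert m M) c \<theta> * g \<theta> = c m * (cis (of_int m * \<theta>) * g \<theta>) + 1 * (trig_sum M c \<theta> * g \<theta>)" for \<theta>
      using insert by (simp add: trig_sum_def distrib_right mult.assoc)
    then show ?case using trig_sum_lincomb_ex[OF single[of m] insert.IH, of "c m" 1] by simp
  qed
  then show ?thesis using f by simp
qed

lemma trig_sum_single_ex: "\<exists>M c. finite M \<and> (\<forall>\<theta>. a * cis (of_int m * \<theta>) = trig_sum M c \<theta>)"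
  by (intro exI[of _ "{m}"] exI[of _ "\<lambda>_. a"]) (simp add: trig_sum_def)

lemma trig_sum_const_ex: "\<exists>M c. finite M \<and> (\<forall>\<theta>. a = trig_sum M c \<theta>)"
  using trig_sum_single_ex[of a 0] by simp

lemma polynomial_circle_trig_sum:
  fixes p :: "complex \<Rightarrow> real"
  assumes "real_polynomial_function p"
  shows "\<exists>M c. finite M \<and> (\<forall>\<theta>. of_real (p (cis \<theta>)) = trig_sum M c \<theta>)"
  using assms
proof (induction p rule: real_polynomial_function.induct)
  case (linear f)
  \<comment> \<open>Euler's formulas applied to
    \<open>cos \<theta> * f 1 + sin \<theta> * f \<i>\<close>.\<close>
  have "\<exists>M c. finite M \<and> (\<forall>\<theta>. ((of_real (f 1) - \<i> * of_real (f \<i>)) / 2) * cis (of_int 1 * \<theta>) + ((of_real (f 1) + \<i> * of_real (f \<i>)) / 2) * cis (of_int (-1) * \<theta>) = trig_sum M c \<theta>)"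
    using trig_sum_lincomb_ex[OF trig_sum_single_ex[of 1 1] trig_sum_single_ex[of 1 "-1"],
        of "(of_real (f 1) - \<i> * of_real (f \<i>)) / 2" "(of_real (f 1) + \<i> * of_real (f \<i>)) / 2"]
    by (simp only: mult_1_left)
  moreover have "of_real (f (cis \<theta>)) = ((of_real (f 1) - \<i> * of_real (f \<i>)) / 2) * cis (of_int 1 * \<theta>) + ((of_real (f 1) + \<i> * of_real (f \<i>)) / 2) * cis (of_int (-1) * \<theta>)" for \<theta>
  proof -
    interpret bounded_linear f by fact
    have "cis \<theta> = cos \<theta> *\<^sub>R 1 + sin \<theta> *\<^sub>R \<i>" by (simp add: complex_eq_iff)
    then have "f (cis \<theta>) = cos \<theta> * f 1 + sin \<theta> * f \<i>" by (simp only: add scale) simp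
    then show ?thesis by (simp add: complex_eq_iff field_simps)
  qed
  ultimately show ?case by simp
next
  case (const a)
  then show ?case by (rule trig_sum_const_ex)
next
  case (add f g)
  then show ?case using trig_sum_lincomb_ex[of "\<lambda>\<theta>. of_real (f (cis \<theta>))" "\<lambda>\<theta>. of_real (g (cis \<theta>))" 1 1] by simp
next
  case (mult f g)
  then show ?case using trig_sum_mult_ex[of "\<lambda>\<theta>. of_real (f (cis \<theta>))" "\<lambda>\<theta>. of_real (g (cis \<theta>))"] by simp
qed

text \<open>Stone-Weierstrass on the circle, for the real and the imaginary part; polynomials
  restricted to the circle are trigonometric.\<close>

lemma trig_sum_dense:
  fixes u :: "complex \<Rightarrow> complex"
  assumes u: "continuous_on (sphere 0 1) u" and e: "0 < e"
  shows "\<exists>M c. finite M \<and> (\<forall>\<theta>. norm (u (cis \<theta>) - trig_sum M c \<theta>) < e)"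
proof -
  have e2: "e / 2 > 0" using e by simp
  obtain p where p: "real_polynomial_function p" "\<And>x. x \<in> sphere 0 1 \<Longrightarrow> \<bar>Re (u x) - p x\<bar> < e / 2"
    using Stone_Weierstrass_real_polynomial_function[OF compact_sphere _ e2, of 0 1 "\<lambda>x. Re (u x)"] u
    by (metis continuous_on_Re)
  obtain r where r: "real_polynomial_function r" "\<And>x. x \<in> sphere 0 1 \<Longrightarrow> \<bar>Im (u x) - r x\<bar> < e / 2"
    using Stone_Weierstrass_real_polynomial_function[OF compact_sphere _ e2, of 0 1 "\<lambda>x. Im (u x)"] u
    by (metis continuous_on_Im)
  obtain M c where M: "finite M" "\<And>\<theta>. 1 * of_real (p (cis \<theta>)) + \<i> * of_real (r (cis \<theta>)) = trig_sum M c \<theta>"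
    using trig_sum_lincomb_ex[OF polynomial_circle_trig_sum[OF p(1)] polynomial_circle_trig_sum[OF r(1)]] by blast
  have "norm (u (cis \<theta>) - trig_sum M c \<theta>) < e" for \<theta>
  proof -
    have s: "cis \<theta> \<in> sphere 0 1" by simp
    have "norm (u (cis \<theta>) - trig_sum M c \<theta>) \<le> \<bar>Re (u (cis \<theta>) - trig_sum M c \<theta>)\<bar> + \<bar>Im (u (cis \<theta>) - trig_sum M c \<theta>)\<bar>"
      by (rule cmod_le)
    also have "\<dots> < e / 2 + e / 2"
      using p(2)[OF s] r(2)[OF s] by (intro add_strict_mono) (simp_all flip: M(2))
    finally show ?thesis by simp
  qed
  then show ?thesis using M(1) by blast
qed

text \<open>Stated with an error \<open>e\<close> and for all large finite \<open>N\<close>, so that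
  it combines with finite sums over modes. A uniformly close trigonometric polynomial, extended by
  zero coefficients to \<open>N\<close>, is inserted into
  \<open>integral_norm_sq_diff_trig_sum\<close>.\<close>

lemma parseval:
  fixes u :: "complex \<Rightarrow> complex"
  assumes u: "continuous_on (sphere 0 1) u" and e: "0 < e"
  shows "\<exists>M. finite M \<and> (\<forall>N. finite N \<longrightarrow> M \<subseteq> N \<longrightarrow>
     2 * pi * integral {0..2*pi} (\<lambda>\<theta>. (norm (u (cis \<theta>)))\<^sup>2) \<le> (\<Sum>m\<in>N. (norm (fourier (\<lambda>\<theta>. u (cis \<theta>)) m))\<^sup>2) + e)"
proof -
  \<comment> \<open>A uniform error \<open>d\<close> costs \<open>2 * pi * d^2\<close> in the
    integral, and multiplication by \<open>2 * pi\<close> turns this into \<open>e\<close>.\<close>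
  define d where "d = sqrt (e / (4 * pi\<^sup>2))"
  have d: "0 < d" "2 * pi * (2 * pi * d\<^sup>2) = e" using e by (auto simp: d_def power2_eq_square)
  have c: "continuous_on {0..2*pi} (\<lambda>\<theta>. u (cis \<theta>))"
    by (rule continuous_on_compose2[OF u]) (auto intro!: continuous_intros)
  obtain M c where M: "finite M" "\<And>\<theta>. norm (u (cis \<theta>) - trig_sum M c \<theta>) < d"
    using trig_sum_dense[OF u d(1)] by blast
  show ?thesis
  proof (intro exI[of _ M] conjI allI impI M)
    fix N assume N: "finite N" "M \<subseteq> N"
    let ?g = "\<lambda>\<theta>. u (cis \<theta>)" and ?I = "\<lambda>f::real \<Rightarrow> real. integral {0..2*pi} f"
    define c' where "c' = (\<lambda>m. if m \<in> M then c m else 0)"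
    have t: "trig_sum M c \<theta> = trig_sum N c' \<theta>" for \<theta>
      unfolding trig_sum_def c'_def using N by (intro sum.mono_neutral_cong_left) auto
    have "?I (\<lambda>\<theta>. (norm (?g \<theta>))\<^sup>2) - (\<Sum>m\<in>N. (norm (fourier ?g m))\<^sup>2) / (2 * pi) \<le> ?I (\<lambda>\<theta>. (norm (?g \<theta> - trig_sum N c' \<theta>))\<^sup>2)"
      unfolding integral_norm_sq_diff_trig_sum[OF N(1) c] by (simp add: sum_nonneg)
    also have "\<dots> \<le> ?I (\<lambda>\<theta>. d\<^sup>2)"
      using power_mono[OF less_imp_le[OF M(2)[unfolded t]] norm_ge_zero, where n = 2]
      by (intro Henstock_Kurzweil_Integration.integral_le integrable_norm_sq continuous_intros c) blast+
    also have "\<dots> = 2 * pi * d\<^sup>2" by simp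
    finally have "2 * pi * (?I (\<lambda>\<theta>. (norm (?g \<theta>))\<^sup>2) - (\<Sum>m\<in>N. (norm (fourier ?g m))\<^sup>2) / (2 * pi)) \<le> 2 * pi * (2 * pi * d\<^sup>2)"
      by (intro mult_left_mono) auto
    then show "2 * pi * ?I (\<lambda>\<theta>. (norm (?g \<theta>))\<^sup>2) \<le> (\<Sum>m\<in>N. (norm (fourier ?g m))\<^sup>2) + e"
      unfolding d(2) by (simp add: right_diff_distrib)
  qed
qed

section \<open>Test functions\<close>

lemma test_function_differentiable:
  assumes "u \<in> test_functions"
  shows "u differentiable (at x)"
proof -
  have "foldr partial [] u differentiable (at x)" using assms unfolding test_functions_def by blast
  then show ?thesis by simp
qed

lemma has_derivative_partial:
  assumes "u differentiable (at x)"
  shows "(u has_derivative (\<lambda>h. \<Sum>j\<in>UNIV. (h $ j) *\<^sub>R partial j u x)) (at x)"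
proof -
  let ?D = "frechet_derivative u (at x)"
  have D: "(u has_derivative ?D) (at x)" using assms frechet_derivative_works by blast
  then interpret bounded_linear ?D by (rule has_derivative_bounded_linear)
  have "?D h = (\<Sum>j\<in>UNIV. (h $ j) *\<^sub>R partial j u x)" for h :: "real^2"
  proof -
    have "h = (\<Sum>j\<in>UNIV. (h $ j) *\<^sub>R axis j 1)"
      using basis_expansion[of h] by (simp add: scalar_mult_eq_scaleR)
    then have "?D h = ?D (\<Sum>j\<in>UNIV. (h $ j) *\<^sub>R axis j 1)" by simp
    also have "\<dots> = (\<Sum>j\<in>UNIV. (h $ j) *\<^sub>R partial j u x)" by (simp add: sum scale partial_def)
    finally show ?thesis .
  qed
  then have "?D = (\<lambda>h. \<Sum>j\<in>UNIV. (h $ j) *\<^sub>R partial j u x)" by (rule ext)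
  then show ?thesis using D by simp
qed

lemma test_function_has_derivative:
  assumes "u \<in> test_functions"
  shows "(u has_derivative (\<lambda>h. \<Sum>j\<in>UNIV. (h $ j) *\<^sub>R partial j u x)) (at x)"
  using assms by (intro has_derivative_partial test_function_differentiable)

lemma test_function_continuous:
  assumes "u \<in> test_functions"
  shows "continuous_on S u"
  using test_function_differentiable[OF assms]
  by (intro continuous_at_imp_continuous_on) (auto intro: differentiable_imp_continuous_within)

lemma test_function_measurable: "u \<in> test_functions \<Longrightarrow> u \<in> borel_measurable borel"
  by (intro borel_measurable_continuous_onI test_function_continuous)

lemma test_function_support:
  assumes "u \<in> test_functions"
  obtains R where "0 < R" "\<And>x::real^2. x \<notin> cball 0 R \<Longrightarrow> u x = 0"
proof -
  have "bounded (closure {x. u x \<noteq> 0})" using assms by (auto simp: test_functions_def compact_imp_bounded)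
  then obtain R where R: "0 < R" "\<And>x. x \<in> closure {x. u x \<noteq> 0} \<Longrightarrow> norm x \<le> R"
    unfolding bounded_pos by blast
  show ?thesis
  proof (rule that[OF R(1)])
    fix x :: "real^2" assume "x \<notin> cball 0 R"
    then show "u x = 0" using R(2)[of x] closure_subset[of "{x. u x \<noteq> 0}"] by auto
  qed
qed

lemma partial_eq_0:
  assumes "\<And>x. x \<notin> cball 0 R \<Longrightarrow> u x = 0" "x \<notin> cball 0 R"
  shows "partial j u x = 0"
proof -
  have "((\<lambda>_. 0) has_derivative (\<lambda>_. 0)) (at x)" by simp
  then have "(u has_derivative (\<lambda>_. 0)) (at x)"
    by (rule has_derivative_transform_within_open[OF _ open_Compl[OF closed_cball[of 0 R]]]) (use assms in auto)
  then have "frechet_derivative u (at x) = (\<lambda>_. 0)" by (rule frechet_derivative_at[symmetric])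
  then show ?thesis by (simp add: partial_def)
qed

lemma partial_test_function:
  assumes u: "u \<in> test_functions"
  shows "partial j u \<in> test_functions"
proof -
  obtain R where R: "\<And>x. x \<notin> cball 0 R \<Longrightarrow> u x = 0" using test_function_support[OF u] by blast
  have "partial j u x = 0" if "x \<notin> cball 0 R" for x using R that by (rule partial_eq_0)
  then have "{x. partial j u x \<noteq> 0} \<subseteq> cball 0 R" by blast
  then have "closure {x. partial j u x \<noteq> 0} \<subseteq> cball 0 R" by (simp add: closure_minimal)
  then have "compact (closure {x. partial j u x \<noteq> 0})"
    by (metis bounded_cball bounded_subset closed_closure compact_eq_bounded_closed)
  moreover have all: "foldr partial js u differentiable (at x)" for js x
    using u unfolding test_functions_def by blast
  \<comment> \<open>Appending \<open>j\<close> at the end of the list applies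
    \<open>partial j\<close> first.\<close>
  have "foldr partial js (partial j u) differentiable (at x)" for js x
    using all[of "js @ [j]" x] by simp
  ultimately show ?thesis unfolding test_functions_def by blast
qed

lemma partial_lincomb:
  assumes "u differentiable (at x)" "v differentiable (at x)"
  shows "partial j (\<lambda>x. a * u x + b * v x) x = a * partial j u x + b * partial j v x"
proof -
  have u: "(u has_derivative frechet_derivative u (at x)) (at x)" and v: "(v has_derivative frechet_derivative v (at x)) (at x)"
    using assms frechet_derivative_works by blast+
  have "((\<lambda>x. a * u x + b * v x) has_derivative (\<lambda>h. a * frechet_derivative u (at x) h + b * frechet_derivative v (at x) h)) (at x)"
    by (intro has_derivative_add has_derivative_mult_right u v)
  then have "frechet_derivative (\<lambda>x. a * u x + b * v x) (at x) = (\<lambda>h. a * frechet_derivative u (at x) h + b * frechet_derivative v (at x) h)"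
    by (rule frechet_derivative_at[symmetric])
  then show ?thesis by (simp add: partial_def)
qed

lemma foldr_partial_lincomb:
  assumes "\<And>js x. foldr partial js u differentiable (at x)" "\<And>js x. foldr partial js v differentiable (at x)"
  shows "foldr partial js (\<lambda>x. a * u x + b * v x) = (\<lambda>x. a * foldr partial js u x + b * foldr partial js v x)"
proof (induction js)
  case (Cons j js)
  show ?case unfolding foldr.simps o_apply Cons.IH by (rule ext) (rule partial_lincomb[OF assms])
qed simp

lemma test_function_lincomb:
  assumes u: "u \<in> test_functions" and v: "v \<in> test_functions"
  shows "(\<lambda>x. a * u x + b * v x) \<in> test_functions"
proof -
  have d: "foldr partial js u differentiable (at x)" "foldr partial js v differentiable (at x)" for js x
    using u v by (auto simp: test_functions_def)
  have "closure {x. a * u x + b * v x \<noteq> 0} \<subseteq> closure ({x. u x \<noteq> 0} \<union> {x. v x \<noteq> 0})"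
    by (intro closure_mono) auto
  also have "\<dots> = closure {x. u x \<noteq> 0} \<union> closure {x. v x \<noteq> 0}" by simp
  finally have sub: "closure {x. a * u x + b * v x \<noteq> 0} \<subseteq> closure {x. u x \<noteq> 0} \<union> closure {x. v x \<noteq> 0}" .
  have "compact (closure {x. u x \<noteq> 0} \<union> closure {x. v x \<noteq> 0})"
    using u v by (intro compact_Un) (auto simp: test_functions_def)
  from bounded_subset[OF compact_imp_bounded[OF this] sub] have "compact (closure {x. a * u x + b * v x \<noteq> 0})"
    by (simp add: compact_eq_bounded_closed)
  moreover have "foldr partial js (\<lambda>x. a * u x + b * v x) differentiable (at x)" for js x
    unfolding foldr_partial_lincomb[OF d] by (intro derivative_intros d)
  ultimately show ?thesis by (simp add: test_functions_def)
qed

lemma zero_test_function: "(\<lambda>x. 0) \<in> test_functions"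
proof -
  have "partial j (\<lambda>x. 0) = (\<lambda>x. 0)" for j by (simp add: partial_def fun_eq_iff)
  then have "foldr partial js (\<lambda>x. 0) = (\<lambda>x. 0)" for js by (induction js) auto
  then show ?thesis by (simp add: test_functions_def)
qed

lemma bounded_support_integrable:
  fixes f :: "real^2 \<Rightarrow> 'a::{banach, second_countable_topology}"
  assumes [measurable]: "f \<in> borel_measurable borel" and b: "\<And>x. norm (f x) \<le> C" and z: "\<And>x. x \<notin> cball 0 R \<Longrightarrow> f x = 0"
  shows "integrable lborel f" "integrable lebesgue f"
proof -
  have C: "0 \<le> C" using b[of 0] norm_ge_zero order_trans by blast
  have "integrable lborel (\<lambda>x. C * indicator (cball (0::real^2) R) x)"
    using emeasure_bounded_finite[OF bounded_cball[of "0::real^2" R]]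
    by (intro integrable_mult_right integrable_real_indicator) auto
  then show i: "integrable lborel f"
    by (rule Bochner_Integration.integrable_bound) (use b z C in \<open>auto simp: indicator_def\<close>)
  then show "integrable lebesgue f" by (subst integrable_completion) auto
qed

lemma test_function_bounded:
  assumes "u \<in> test_functions"
  obtains C where "0 \<le> C" "\<And>x. norm (u x) \<le> C"
proof -
  obtain R where R: "0 < R" "\<And>x. x \<notin> cball 0 R \<Longrightarrow> u x = 0" using test_function_support[OF assms] by blast
  have "compact (u ` cball 0 R)" by (intro compact_continuous_image test_function_continuous assms compact_cball)
  from compact_imp_bounded[OF this] obtain C where C: "0 < C" "\<And>x. x \<in> cball 0 R \<Longrightarrow> norm (u x) \<le> C"
    unfolding bounded_pos by blast
  show ?thesis by (rule that[of C]) (use C R in force)+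
qed

lemma test_function_L2: "u \<in> test_functions \<Longrightarrow> u \<in> L2"
proof -
  assume u: "u \<in> test_functions"
  have [measurable]: "u \<in> borel_measurable borel" using u by (rule test_function_measurable)
  obtain R where R: "0 < R" "\<And>x. x \<notin> cball 0 R \<Longrightarrow> u x = 0" using test_function_support[OF u] by blast
  obtain C where C: "0 \<le> C" "\<And>x. norm (u x) \<le> C" using test_function_bounded[OF u] by blast
  have "integrable lebesgue (\<lambda>x. (norm (u x))\<^sup>2)"
    by (rule bounded_support_integrable(2)[where C = "C\<^sup>2" and R = R]) (use R C in \<open>auto intro!: power_mono\<close>)
  then show ?thesis by (auto simp: L2_def intro: measurable_completion)
qed

text \<open>
  The integral of a difference quotient vanishes by translation invariance; dominated convergence
  passes to the derivative.
\<close>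

lemma integral_directional_derivative:
  fixes p d :: "real^2 \<Rightarrow> complex"
  assumes der: "\<And>x s. ((\<lambda>s. p (x + s *\<^sub>R e)) has_vector_derivative d (x + s *\<^sub>R e)) (at s)"
    and e: "norm e \<le> 1"
    and p [measurable]: "p \<in> borel_measurable borel" and pb: "\<And>x. norm (p x) \<le> C"
    and d [measurable]: "d \<in> borel_measurable borel" and db: "\<And>x. norm (d x) \<le> C"
    and z: "\<And>x. x \<notin> cball 0 R \<Longrightarrow> p x = 0"
  shows "(LINT x|lborel. d x) = 0"
proof -
  define h where "h n = 1 / real (Suc n)" for n
  have h: "0 < h n" "h n \<le> 1" for n by (auto simp: h_def)
  define Q where "Q n x = (p (x + h n *\<^sub>R e) - p x) / of_real (h n)" for n x
  have [measurable]: "Q n \<in> borel_measurable borel" for n unfolding Q_def by measurable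
  have ip: "integrable lborel p" by (rule bounded_support_integrable[OF p pb z])
  have trans: "(LINT x|lborel. p (x + c)) = (LINT x|lborel. p x)" "integrable lborel (\<lambda>x. p (x + c))" for c
  proof -
    have "(LINT x|lborel. p x) = (LINT x|distr lborel borel ((+) c). p x)" by (simp add: lborel_distr_plus)
    also have "\<dots> = (LINT x|lborel. p (x + c))" by (subst integral_distr) (auto simp: add.commute)
    finally show "(LINT x|lborel. p (x + c)) = (LINT x|lborel. p x)" by simp
    have "integrable (distr lborel borel ((+) c)) p" using ip by (simp add: lborel_distr_plus)
    then show "integrable lborel (\<lambda>x. p (x + c))" by (subst (asm) integrable_distr_eq) (auto simp: add.commute)
  qed
  have Q0: "(LINT x|lborel. Q n x) = 0" for n
    unfolding Q_def using trans ip by (simp add: Bochner_Integration.integral_diff)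
  \<comment> \<open>A shift by at most one enlarges the support by at most one, and the bound on
    \<open>d\<close> limits the quotient; the dominating function is independent of
    \<open>n\<close>.\<close>
  have Qb: "norm (Q n x) \<le> C * indicator (cball 0 (R + 1)) x" for n x
  proof (cases "x \<in> cball 0 (R + 1)")
    case True
    have "((\<lambda>s. d (x + s *\<^sub>R e)) has_integral p (x + h n *\<^sub>R e) - p (x + 0 *\<^sub>R e)) {0..h n}"
      using h[of n] by (intro fundamental_theorem_of_calculus) (auto intro: has_vector_derivative_at_within der)
    then have "norm (p (x + h n *\<^sub>R e) - p (x + 0 *\<^sub>R e)) \<le> C * measure lborel (cbox 0 (h n))"
      using db order_trans[OF norm_ge_zero db[of 0]] by (intro has_integral_bound) auto
    then have "norm (p (x + h n *\<^sub>R e) - p x) \<le> C * h n" using h[of n] by simp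
    then show ?thesis using True h[of n] by (simp add: Q_def norm_divide field_simps)
  next
    case False
    then have "norm x > R + 1" by simp
    moreover have "norm (h n *\<^sub>R e) \<le> 1 * 1" unfolding norm_scaleR using h[of n] e by (intro mult_mono) auto
    moreover have "norm x \<le> norm (x + h n *\<^sub>R e) + norm (h n *\<^sub>R e)" using norm_triangle_ineq4[of "x + h n *\<^sub>R e" "h n *\<^sub>R e"] by simp
    ultimately have "p x = 0" "p (x + h n *\<^sub>R e) = 0" by (auto intro!: z)
    then show ?thesis using False by (simp add: Q_def)
  qed
  have "(\<lambda>n. LINT x|lborel. Q n x) \<longlonglongrightarrow> (LINT x|lborel. d x)"
  proof (rule integral_dominated_convergence[where w = "\<lambda>x. C * indicator (cball 0 (R + 1)) x"])
    show "integrable lborel (\<lambda>x. C * indicator (cball (0::real^2) (R + 1)) x)"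
      using emeasure_bounded_finite[OF bounded_cball[of "0::real^2" "R + 1"]]
      by (intro integrable_mult_right integrable_real_indicator) auto
    show "AE x in lborel. (\<lambda>n. Q n x) \<longlonglongrightarrow> d x"
    proof (rule AE_I2)
      fix x
      have "((\<lambda>s. p (x + s *\<^sub>R e)) has_vector_derivative d (x + 0 *\<^sub>R e)) (at 0)" by (rule der)
      then have L: "((\<lambda>s. norm (p (x + (0 + s) *\<^sub>R e) - p (x + 0 *\<^sub>R e) - s *\<^sub>R d (x + 0 *\<^sub>R e)) / norm s) \<longlongrightarrow> 0) (at 0)"
        unfolding has_vector_derivative_def has_derivative_at by blast
      have "h \<longlonglongrightarrow> 0" unfolding h_def using LIMSEQ_inverse_real_of_nat by (simp add: inverse_eq_divide)
      then have "filterlim h (at 0) sequentially"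
        using h by (intro filterlim_atI) (auto simp: less_imp_neq[symmetric] intro!: always_eventually)
      from filterlim_compose[OF L this]
      have "(\<lambda>n. norm (p (x + h n *\<^sub>R e) - p x - h n *\<^sub>R d x) / norm (h n)) \<longlonglongrightarrow> 0" by simp
      moreover have "norm (p (x + h n *\<^sub>R e) - p x - h n *\<^sub>R d x) / norm (h n) = norm (Q n x - d x)" for n
      proof -
        have "Q n x - d x = (p (x + h n *\<^sub>R e) - p x - h n *\<^sub>R d x) / of_real (h n)"
          using h(1)[of n] by (simp add: Q_def diff_divide_distrib scaleR_conv_of_real)
        then show ?thesis by (simp add: norm_divide)
      qed
      ultimately have "(\<lambda>n. norm (Q n x - d x)) \<longlonglongrightarrow> 0" by simp
      then show "(\<lambda>n. Q n x) \<longlonglongrightarrow> d x" by (rule LIM_zero_cancel[OF tendsto_norm_zero_cancel])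
    qed
  qed (use Qb in auto)
  then show ?thesis by (simp add: Q0 LIMSEQ_const_iff)
qed

text \<open>The product of \<open>cnj (f x)\<close> and \<open>g x\<close> has compact support, so
  its derivative integrates to zero.\<close>

lemma integral_by_parts_partial:
  assumes f: "f \<in> test_functions" and g: "g \<in> test_functions"
  shows "l2_inner (partial j f) g = - l2_inner f (partial j g)"
proof -
  note pf = partial_test_function[OF f, of j] and pg = partial_test_function[OF g, of j]
  have [measurable]: "f \<in> borel_measurable borel" "g \<in> borel_measurable borel"
    "partial j f \<in> borel_measurable borel" "partial j g \<in> borel_measurable borel"
    using f g pf pg by (auto intro: test_function_measurable)
  obtain R where R: "0 < R" "\<And>x. x \<notin> cball 0 R \<Longrightarrow> f x = 0" using test_function_support[OF f] by blast
  obtain C1 where C1: "0 \<le> C1" "\<And>x. norm (f x) \<le> C1" using test_function_bounded[OF f] by blast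
  obtain C2 where C2: "0 \<le> C2" "\<And>x. norm (g x) \<le> C2" using test_function_bounded[OF g] by blast
  obtain C3 where C3: "0 \<le> C3" "\<And>x. norm (partial j f x) \<le> C3" using test_function_bounded[OF pf] by blast
  obtain C4 where C4: "0 \<le> C4" "\<And>x. norm (partial j g x) \<le> C4" using test_function_bounded[OF pg] by blast
  have dir: "((\<lambda>s. u (x + s *\<^sub>R axis j 1)) has_vector_derivative partial j u (x + s *\<^sub>R axis j 1)) (at s)"
    if u: "u \<in> test_functions" for u x and s :: real
  proof -
    have "((\<lambda>s. x + s *\<^sub>R axis j 1) has_derivative (\<lambda>h. h *\<^sub>R axis j 1)) (at s)"
      by (auto intro!: derivative_eq_intros)
    from has_derivative_compose[OF this test_function_has_derivative[OF u]]
    have "((\<lambda>s. u (x + s *\<^sub>R axis j 1)) has_derivative (\<lambda>h. \<Sum>k\<in>UNIV. ((h *\<^sub>R axis j 1) $ k) *\<^sub>R partial k u (x + s *\<^sub>R axis j 1))) (at s)" .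
    moreover have "(\<Sum>k\<in>UNIV. ((h *\<^sub>R axis j 1 :: real^2) $ k) *\<^sub>R partial k u (x + s *\<^sub>R axis j 1)) = h *\<^sub>R partial j u (x + s *\<^sub>R axis j 1)" for h
      by (simp add: axis_def if_distrib[of "\<lambda>z. _ * z"] if_distrib[of "\<lambda>z. z *\<^sub>R _"] cong: if_cong)
    ultimately show ?thesis by (simp add: has_vector_derivative_def)
  qed
  let ?p = "\<lambda>x. cnj (f x) * g x" and ?d = "\<lambda>x. cnj (partial j f x) * g x + cnj (f x) * partial j g x"
  let ?C = "C1 * C2 + (C3 * C2 + C1 * C4)"
  have C: "C1 * C2 \<le> ?C" "C3 * C2 + C1 * C4 \<le> ?C" using C1 C2 C3 C4 by auto
  have "(LINT x|lborel. ?d x) = 0"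
  proof (rule integral_directional_derivative[where e = "axis j 1" and p = ?p and C = ?C and R = R])
    fix x and s :: real
    have "((\<lambda>s. cnj (f (x + s *\<^sub>R axis j 1))) has_vector_derivative cnj (partial j f (x + s *\<^sub>R axis j 1))) (at s)"
      by (rule bounded_linear.has_vector_derivative[OF bounded_linear_cnj dir[OF f]])
    from has_vector_derivative_mult[OF this dir[OF g]]
    show "((\<lambda>s. ?p (x + s *\<^sub>R axis j 1)) has_vector_derivative ?d (x + s *\<^sub>R axis j 1)) (at s)"
      by (simp add: add.commute)
    show "norm (?p x) \<le> ?C"
      unfolding norm_mult by (rule order_trans[OF mult_mono C(1)]) (use C1 C2 in auto)
    have "norm (?d x) \<le> norm (partial j f x) * norm (g x) + norm (f x) * norm (partial j g x)"
      by (rule order_trans[OF norm_triangle_ineq]) (simp add: norm_mult)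
    also have "\<dots> \<le> C3 * C2 + C1 * C4" using C1 C2 C3 C4 by (intro add_mono mult_mono) auto
    finally show "norm (?d x) \<le> ?C" using C(2) by linarith
    show "x \<notin> cball 0 R \<Longrightarrow> ?p x = 0" using R by simp
  qed simp_all
  then have "(LINT x|lebesgue. ?d x) = 0" by (subst integral_completion) auto
  moreover have "(LINT x|lebesgue. ?d x) = l2_inner (partial j f) g + l2_inner f (partial j g)"
    unfolding l2_inner_def
    by (intro Bochner_Integration.integral_add integrable_l2_inner test_function_L2 f g pf pg)
  ultimately show ?thesis by (simp add: add_eq_0_iff2)
qed

text \<open>Integration by parts moves the derivative off \<open>U m\<close> onto the fixed test
  function \<open>partial j (U n)\<close>. As \<open>m\<close> grows, the resulting term tends to
  zero with \<open>U m\<close>.\<close>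

lemma partial_closability:
  assumes U: "\<And>n. U n \<in> test_functions" and L: "(\<lambda>n. l2_norm (U n)) \<longlonglongrightarrow> 0"
    and C: "\<And>e. e > 0 \<Longrightarrow> \<exists>M. \<forall>m\<ge>M. \<forall>n\<ge>M. l2_norm (\<lambda>x. partial j (U m) x - partial j (U n) x) < e"
  shows "(\<lambda>n. l2_norm (partial j (U n))) \<longlonglongrightarrow> 0"
proof (rule LIMSEQ_I)
  fix e :: real assume e: "e > 0"
  let ?G = "\<lambda>n. partial j (U n)"
  have G: "?G n \<in> test_functions" for n by (intro partial_test_function U)
  have G2: "?G n \<in> L2" "U n \<in> L2" for n by (intro test_function_L2 G U)+
  have nn: "0 \<le> l2_norm u" if "u \<in> L2" for u using l2.nrm_nonneg[OF that] by simp
  obtain M where M: "\<And>m n. m \<ge> M \<Longrightarrow> n \<ge> M \<Longrightarrow> l2_norm (\<lambda>x. ?G m x - ?G n x) < e / 2"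
    using C[of "e / 2"] e by auto
  have "norm (l2_norm (?G n) - 0) < e" if n: "n \<ge> M" for n
  proof -
    \<comment> \<open>One factor of the square is split as the difference to
      \<open>partial j (U m)\<close>, small by the Cauchy property, plus
      \<open>partial j (U m)\<close> itself, which is integrated by parts.\<close>
    have le: "(l2_norm (?G n))\<^sup>2 \<le> l2_norm (?G n) * (e / 2) + l2_norm (partial j (?G n)) * l2_norm (U m)" if m: "m \<ge> M" for m
    proof -
      have "l2_inner (?G n) (?G n) = l2_inner (?G n) (\<lambda>x. ?G n x - ?G m x) + l2_inner (?G n) (?G m)"
        using G2 by (simp add: l2.diff_right)
      also have "l2_inner (?G n) (?G m) = - l2_inner (partial j (?G n)) (U m)"
        using integral_by_parts_partial[OF G U, of j n m] by simp
      finally have "norm (l2_inner (?G n) (?G n)) \<le> norm (l2_inner (?G n) (\<lambda>x. ?G n x - ?G m x)) + norm (l2_inner (partial j (?G n)) (U m))"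
        using norm_triangle_ineq4[of "l2_inner (?G n) (\<lambda>x. ?G n x - ?G m x)" "l2_inner (partial j (?G n)) (U m)"] by simp
      also have "\<dots> \<le> l2_norm (?G n) * l2_norm (\<lambda>x. ?G n x - ?G m x) + l2_norm (partial j (?G n)) * l2_norm (U m)"
        using l2.cauchy_schwarz[of "?G n" "\<lambda>x. ?G n x - ?G m x"] l2.cauchy_schwarz[of "partial j (?G n)" "U m"]
          G2 l2.diff_mem[OF G2(1) G2(1)] test_function_L2[OF partial_test_function[OF G]]
        by (intro add_mono) simp_all
      also have "\<dots> \<le> l2_norm (?G n) * (e / 2) + l2_norm (partial j (?G n)) * l2_norm (U m)"
        using M[OF n m] G2 by (intro add_right_mono mult_left_mono nn) auto
      finally show ?thesis using l2.norm_diag[OF G2(1), of n] by simp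
    qed
    have lim: "(\<lambda>m. l2_norm (?G n) * (e / 2) + l2_norm (partial j (?G n)) * l2_norm (U m)) \<longlonglongrightarrow>
        l2_norm (?G n) * (e / 2) + l2_norm (partial j (?G n)) * 0"
      by (intro tendsto_intros L)
    have "(l2_norm (?G n))\<^sup>2 \<le> l2_norm (?G n) * (e / 2) + l2_norm (partial j (?G n)) * 0"
      by (rule LIMSEQ_le_const[OF lim]) (use le in blast)
    then have "l2_norm (?G n) * l2_norm (?G n) \<le> l2_norm (?G n) * (e / 2)" by (simp add: power2_eq_square)
    then have "l2_norm (?G n) \<le> e / 2"
      using nn[OF G2(1), of n] e by (cases "l2_norm (?G n) = 0") (auto simp: mult_le_cancel_left)
    then show ?thesis using nn[OF G2(1), of n] e by simp
  qed
  then show "\<exists>M. \<forall>n\<ge>M. norm (l2_norm (?G n) - 0) < e" by blast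
qed

section \<open>Angular modes of test functions\<close>

definition mode :: "wavefun \<Rightarrow> real \<Rightarrow> int \<Rightarrow> complex" where
  "mode u t m = fourier (\<lambda>\<theta>. u (polar (exp t) \<theta>)) m"

text \<open>\<open>r\<close> times the derivative in \<open>r\<close>, since the variable is
  \<open>t = ln r\<close>.\<close>

definition radial_deriv :: "wavefun \<Rightarrow> real \<Rightarrow> real \<Rightarrow> complex" where
  "radial_deriv u t \<theta> = (\<Sum>j\<in>UNIV. (polar (exp t) \<theta> $ j) *\<^sub>R partial j u (polar (exp t) \<theta>))"

definition angular_deriv :: "wavefun \<Rightarrow> real \<Rightarrow> real \<Rightarrow> complex" where
  "angular_deriv u t \<theta> = (- (exp t * sin \<theta>)) *\<^sub>R partial 1 u (polar (exp t) \<theta>) + (exp t * cos \<theta>) *\<^sub>R partial 2 u (polar (exp t) \<theta>)"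

definition mode_deriv :: "wavefun \<Rightarrow> real \<Rightarrow> int \<Rightarrow> complex" where
  "mode_deriv u t m = fourier (radial_deriv u t) m"

lemma test_function_polar_continuous:
  assumes "u \<in> test_functions" "continuous_on S f" "continuous_on S g"
  shows "continuous_on S (\<lambda>x. u (polar (f x) (g (x :: 'a::t2_space))))"
  by (rule continuous_on_compose2[OF test_function_continuous[OF assms(1), of UNIV]])
     (auto intro!: continuous_on_polar assms)

lemma radial_deriv_continuous:
  assumes u: "u \<in> test_functions" and "continuous_on S f" "continuous_on S g"
  shows "continuous_on S (\<lambda>x. radial_deriv u (f x) (g (x :: 'a::t2_space)))"
  unfolding radial_deriv_def sum_2 polar_nth
  by (intro continuous_on_add continuous_on_scaleR continuous_on_mult continuous_on_cos continuous_on_sin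
    continuous_on_exp test_function_polar_continuous partial_test_function assms)

lemma angular_deriv_continuous:
  assumes u: "u \<in> test_functions" and "continuous_on S f" "continuous_on S g"
  shows "continuous_on S (\<lambda>x. angular_deriv u (f x) (g (x :: 'a::t2_space)))"
  unfolding angular_deriv_def
  by (intro continuous_on_add continuous_on_scaleR continuous_on_mult continuous_on_minus continuous_on_cos continuous_on_sin
    continuous_on_exp test_function_polar_continuous partial_test_function assms)

lemma radial_deriv:
  assumes u: "u \<in> test_functions"
  shows "((\<lambda>t. u (polar (exp t) \<theta>)) has_vector_derivative radial_deriv u t \<theta>) (at t within S)"
proof -
  have "((\<lambda>t. polar (exp t) \<theta>) has_derivative (\<lambda>h. h *\<^sub>R polar (exp t) \<theta>)) (at t within S)"
    unfolding polar_eq_axis by (auto intro!: derivative_eq_intros simp: algebra_simps)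
  from has_derivative_compose[OF this test_function_has_derivative[OF u]]
  show ?thesis
    by (simp add: has_vector_derivative_def radial_deriv_def sum_2 scaleR_add_right)
qed

lemma angular_deriv:
  assumes u: "u \<in> test_functions"
  shows "((\<lambda>\<theta>. u (polar (exp t) \<theta>)) has_vector_derivative angular_deriv u t \<theta>) (at \<theta> within S)"
proof -
  have "((\<lambda>\<theta>. polar (exp t) \<theta>) has_derivative (\<lambda>h. h *\<^sub>R ((- (exp t * sin \<theta>)) *\<^sub>R axis 1 1 + (exp t * cos \<theta>) *\<^sub>R axis 2 1))) (at \<theta> within S)"
    unfolding polar_eq_axis by (auto intro!: derivative_eq_intros simp: algebra_simps)
  from has_derivative_compose[OF this test_function_has_derivative[OF u]]
  show ?thesis
    by (simp add: has_vector_derivative_def angular_deriv_def sum_2 scaleR_add_right scaleR_diff_right axis_def)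
qed

lemma mode_c1_pair:
  assumes u: "u \<in> test_functions"
  shows "c1_pair (\<lambda>t. mode u t m) (\<lambda>t. mode_deriv u t m)"
  unfolding c1_pair_def
proof (intro conjI allI)
  have cont: "continuous_on (UNIV \<times> cbox 0 (2 * pi)) (\<lambda>(t, \<theta>). radial_deriv u t \<theta> * cis (- of_int m * \<theta>))"
    unfolding case_prod_beta
    by (intro continuous_on_mult radial_deriv_continuous[OF u] continuous_on_fst continuous_on_snd continuous_on_id
      continuous_on_compose2[OF continuous_on_cis_mult[of UNIV]]) auto
  show "continuous_on UNIV (\<lambda>t. mode_deriv u t m)"
    using integral_continuous_on_param[OF cont] by (simp add: mode_deriv_def fourier_def)
  fix t
  have "((\<lambda>t. integral (cbox 0 (2 * pi)) (\<lambda>\<theta>. u (polar (exp t) \<theta>) * cis (- of_int m * \<theta>))) has_vector_derivative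
      integral (cbox 0 (2 * pi)) (\<lambda>\<theta>. radial_deriv u t \<theta> * cis (- of_int m * \<theta>))) (at t within UNIV)"
  proof (rule leibniz_rule_vector_derivative[OF _ _ cont])
    fix x \<theta> :: real
    show "((\<lambda>x. u (polar (exp x) \<theta>) * cis (- of_int m * \<theta>)) has_vector_derivative radial_deriv u x \<theta> * cis (- of_int m * \<theta>)) (at x within UNIV)"
      by (rule has_vector_derivative_mult_left[OF radial_deriv[OF u]])
    show "(\<lambda>\<theta>. u (polar (exp x) \<theta>) * cis (- of_int m * \<theta>)) integrable_on cbox 0 (2 * pi)"
      unfolding cbox_interval
      by (intro integrable_fourier test_function_polar_continuous[OF u] continuous_intros)
  qed auto
  then show "((\<lambda>t. mode u t m) has_vector_derivative mode_deriv u t m) (at t)"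
    by (simp add: mode_def mode_deriv_def fourier_def)
qed

text \<open>Integration by parts over a period; the boundary terms cancel.\<close>

lemma fourier_angular_deriv:
  assumes u: "u \<in> test_functions"
  shows "fourier (angular_deriv u t) m = \<i> * of_int m * mode u t m"
proof -
  let ?g = "\<lambda>\<theta>. u (polar (exp t) \<theta>)" and ?e = "\<lambda>\<theta>. cis (- of_int m * \<theta>)"
  have e: "(?e has_vector_derivative - (\<i> * of_int m) * ?e \<theta>) (at \<theta> within S)" for \<theta> S
  proof -
    have "((\<lambda>\<theta>. exp (\<i> * of_real (- of_int m * \<theta>))) has_vector_derivative - (\<i> * of_int m) * exp (\<i> * of_real (- of_int m * \<theta>))) (at \<theta> within S)"
      by (auto intro!: derivative_eq_intros has_vector_derivative_real_field)
    then show ?thesis by (simp add: cis_conv_exp)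
  qed
  have ci: "continuous_on {0..2*pi} (angular_deriv u t)" "continuous_on {0..2*pi} ?g"
    by (intro angular_deriv_continuous test_function_polar_continuous u continuous_intros)+
  have "((\<lambda>\<theta>. ?g \<theta> * (- (\<i> * of_int m) * ?e \<theta>) + angular_deriv u t \<theta> * ?e \<theta>) has_integral ?g (2 * pi) * ?e (2 * pi) - ?g 0 * ?e 0) {0..2*pi}"
    by (intro fundamental_theorem_of_calculus has_vector_derivative_mult angular_deriv u e) auto
  moreover have "?e (2 * pi) = 1" using cis_of_int_mult_periodic[of "- m"] by simp
  moreover have "polar (exp t) (2 * pi) = polar (exp t) 0" by (simp add: vec_eq_iff forall_2)
  ultimately have "integral {0..2*pi} (\<lambda>\<theta>. (- (\<i> * of_int m)) * (?g \<theta> * ?e \<theta>) + angular_deriv u t \<theta> * ?e \<theta>) = 0"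
    by (simp add: integral_unique mult_ac)
  also have "integral {0..2*pi} (\<lambda>\<theta>. (- (\<i> * of_int m)) * (?g \<theta> * ?e \<theta>) + angular_deriv u t \<theta> * ?e \<theta>) =
     (- (\<i> * of_int m)) * fourier ?g m + fourier (angular_deriv u t) m"
    unfolding fourier_def
    by (subst Henstock_Kurzweil_Integration.integral_add)
       (simp_all only: Henstock_Kurzweil_Integration.integral_mult_right integrable_on_mult_right integrable_fourier ci)
  finally show ?thesis by (simp add: mode_def add_eq_0_iff2)
qed

lemma bessel_nn_integral:
  assumes M: "finite M" and g: "continuous_on {0..2*pi} g"
  shows "(\<Sum>m\<in>M. sq (fourier g m)) \<le> ennreal (2 * pi) * (\<integral>\<^sup>+\<theta>\<in>{0..2*pi}. sq (g \<theta>) \<partial>lborel)"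
proof -
  have "(\<Sum>m\<in>M. sq (fourier g m)) = ennreal (\<Sum>m\<in>M. (norm (fourier g m))\<^sup>2)" by (simp add: sq_def)
  also have "\<dots> \<le> ennreal (2 * pi * integral {0..2*pi} (\<lambda>\<theta>. (norm (g \<theta>))\<^sup>2))" by (intro ennreal_leI bessel M g)
  also have "\<dots> = ennreal (2 * pi) * ennreal (integral {0..2*pi} (\<lambda>\<theta>. (norm (g \<theta>))\<^sup>2))"
    using g by (intro ennreal_mult Henstock_Kurzweil_Integration.integral_nonneg integrable_norm_sq) auto
  also have "ennreal (integral {0..2*pi} (\<lambda>\<theta>. (norm (g \<theta>))\<^sup>2)) = (\<integral>\<^sup>+\<theta>\<in>{0..2*pi}. sq (g \<theta>) \<partial>lborel)"
    unfolding sq_def using g by (intro nn_integral_interval_continuous[symmetric] continuous_intros) auto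
  finally show ?thesis .
qed

section \<open>Kinetic energy of the angular modes\<close>

definition energy_density :: "(real^2 \<Rightarrow> real) \<Rightarrow> wavefun \<Rightarrow> real^2 \<Rightarrow> ennreal" where
  "energy_density B u x = (\<Sum>j\<in>UNIV. sq (magnetic_grad (vector_potential B) j u x))"

lemma vector_potential_measurable [measurable]:
  assumes [measurable]: "flux B \<in> borel_measurable borel"
  shows "vector_potential B \<in> borel_measurable borel"
proof -
  have "vector_potential B = (\<lambda>x. (flux B (norm x) / norm x * (- (x $ 2) / norm x)) *\<^sub>R axis 1 1 + (flux B (norm x) / norm x * (x $ 1 / norm x)) *\<^sub>R axis 2 1)"
    by (auto simp: vector_potential_def fun_eq_iff vec_eq_iff forall_2 axis_def)
  then show ?thesis by simp
qed

lemma magnetic_grad_measurable: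
  assumes [measurable]: "flux B \<in> borel_measurable borel" and u: "u \<in> test_functions"
  shows "magnetic_grad (vector_potential B) j u \<in> borel_measurable borel"
proof -
  have [measurable]: "u \<in> borel_measurable borel" "partial j u \<in> borel_measurable borel"
    using u by (auto intro: test_function_measurable partial_test_function)
  have [measurable]: "(\<lambda>x. vector_potential B x $ j) \<in> borel_measurable borel"
    by (rule measurable_compose[OF vector_potential_measurable[OF assms(1)]])
       (intro borel_measurable_continuous_onI continuous_intros)
  show ?thesis unfolding magnetic_grad_def by measurable
qed

text \<open>In the radial and tangential frame the vector potential is purely tangential, of size
  \<open>flux B r / r\<close>; the Jacobian \<open>exp (2 * t)\<close> cancels the factor
  \<open>1 / r^2\<close> of the squared gradient.\<close>

lemma energy_density_polar:
  "ennreal (exp (2 * t)) * energy_density B u (polar (exp t) \<theta>) =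
    sq (radial_deriv u t \<theta>) + sq (\<i> * angular_deriv u t \<theta> + of_real (flux B (exp t)) * u (polar (exp t) \<theta>))"
proof -
  define r where "r = exp t"
  have r: "r > 0" by (simp add: r_def)
  let ?x = "polar r \<theta>"
  define a b where "a = magnetic_grad (vector_potential B) 1 u ?x" and "b = magnetic_grad (vector_potential B) 2 u ?x"
  have A: "vector_potential B ?x $ 1 = flux B r / r * (- sin \<theta>)" "vector_potential B ?x $ 2 = flux B r / r * cos \<theta>"
    using r by (simp_all add: vector_potential_def)
  have rd: "\<i> * radial_deriv u t \<theta> = of_real r * (of_real (cos \<theta>) * a + of_real (sin \<theta>) * b)"
    unfolding a_def b_def magnetic_grad_def A radial_deriv_def r_def[symmetric] sum_2 polar_nth
    by (simp add: scaleR_conv_of_real algebra_simps)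
  have "of_real r * (- of_real (sin \<theta>) * a + of_real (cos \<theta>) * b) =
      \<i> * angular_deriv u t \<theta> + of_real (flux B r * ((sin \<theta>)\<^sup>2 + (cos \<theta>)\<^sup>2)) * u ?x"
    unfolding a_def b_def magnetic_grad_def A angular_deriv_def r_def[symmetric] power2_eq_square
    using r by (simp add: scaleR_conv_of_real algebra_simps del: sin_cos_squared_add3 sin_cos_squared_add sin_cos_squared_add2)
  then have ad: "\<i> * angular_deriv u t \<theta> + of_real (flux B r) * u ?x = of_real r * (- of_real (sin \<theta>) * a + of_real (cos \<theta>) * b)"
    by simp
  \<comment> \<open>Rotating the frame multiplies the squared length by \<open>C^2 + S^2\<close>,
    which is one for cosine and sine.\<close>
  have rot: "(norm (of_real C * a + of_real S * b))\<^sup>2 + (norm (- of_real S * a + of_real C * b))\<^sup>2 = (C\<^sup>2 + S\<^sup>2) * ((norm a)\<^sup>2 + (norm b)\<^sup>2)" for C S :: real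
    unfolding cmod_power2 by (simp add: power2_eq_square algebra_simps)
  have "(norm (\<i> * radial_deriv u t \<theta>))\<^sup>2 + (norm (\<i> * angular_deriv u t \<theta> + of_real (flux B r) * u ?x))\<^sup>2 = r\<^sup>2 * ((norm a)\<^sup>2 + (norm b)\<^sup>2)"
    unfolding rd ad norm_mult power_mult_distrib distrib_left[symmetric] rot by simp
  then have "ennreal ((norm (radial_deriv u t \<theta>))\<^sup>2 + (norm (\<i> * angular_deriv u t \<theta> + of_real (flux B r) * u ?x))\<^sup>2) = ennreal (r\<^sup>2 * ((norm a)\<^sup>2 + (norm b)\<^sup>2))"
    by (simp add: norm_mult)
  moreover have "r\<^sup>2 = exp (2 * t)" by (simp add: r_def exp_double)
  ultimately show ?thesis
    unfolding energy_density_def sum_2 sq_def r_def[symmetric] a_def[symmetric] b_def[symmetric]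
    by (simp add: ennreal_mult)
qed

text \<open>Bessel's inequality on each circle, for both components of the gradient. The angular
  derivative multiplies mode \<open>m\<close> by \<open>\<i> * m\<close>, so the tangential
  component has the coefficients \<open>flux - m\<close> times the mode.\<close>

lemma energy_modes:
  assumes [measurable]: "flux B \<in> borel_measurable borel" and u: "u \<in> test_functions" and M: "finite M"
  shows "(\<Sum>m\<in>M. (\<integral>\<^sup>+t. sq (mode_deriv u t m) \<partial>lborel) + (\<integral>\<^sup>+t. ennreal ((flux B (exp t) - of_int m)\<^sup>2) * sq (mode u t m) \<partial>lborel))
    \<le> ennreal (2 * pi) * (\<integral>\<^sup>+x. energy_density B u x \<partial>lborel)"
proof -
  have [measurable]: "(\<lambda>t. mode u t m) \<in> borel_measurable borel" "(\<lambda>t. mode_deriv u t m) \<in> borel_measurable borel" for m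
    using c1_pair_measurable[OF mode_c1_pair[OF u]] by auto
  have [measurable]: "energy_density B u \<in> borel_measurable borel"
    unfolding energy_density_def using magnetic_grad_measurable[OF assms(1) u] by measurable
  let ?g = "\<lambda>t \<theta>. \<i> * angular_deriv u t \<theta> + of_real (flux B (exp t)) * u (polar (exp t) \<theta>)"
  have c: "continuous_on {0..2*pi} (radial_deriv u t)" "continuous_on {0..2*pi} (?g t)"
    "continuous_on {0..2*pi} (angular_deriv u t)" "continuous_on {0..2*pi} (\<lambda>\<theta>. u (polar (exp t) \<theta>))" for t
    by (intro radial_deriv_continuous angular_deriv_continuous test_function_polar_continuous continuous_intros u)+
  have fg: "sq (fourier (?g t) m) = ennreal ((flux B (exp t) - of_int m)\<^sup>2) * sq (mode u t m)" for t m
  proof -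
    have "fourier (?g t) m = integral {0..2*pi} (\<lambda>\<theta>. \<i> * (angular_deriv u t \<theta> * cis (- of_int m * \<theta>)) + of_real (flux B (exp t)) * (u (polar (exp t) \<theta>) * cis (- of_int m * \<theta>)))"
      unfolding fourier_def by (simp only: distrib_right mult.assoc)
    also have "\<dots> = \<i> * fourier (angular_deriv u t) m + of_real (flux B (exp t)) * mode u t m"
      unfolding fourier_def mode_def
      by (subst Henstock_Kurzweil_Integration.integral_add)
         (simp_all only: Henstock_Kurzweil_Integration.integral_mult_right integrable_on_mult_right integrable_fourier c)
    also have "\<dots> = of_real (flux B (exp t) - of_int m) * mode u t m"
      unfolding fourier_angular_deriv[OF u] by (simp add: algebra_simps flip: mult.assoc)
    finally show ?thesis by (simp add: sq_def norm_mult power_mult_distrib ennreal_mult del: of_real_diff)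
  qed
  have pt: "(\<Sum>m\<in>M. sq (mode_deriv u t m) + ennreal ((flux B (exp t) - of_int m)\<^sup>2) * sq (mode u t m)) \<le>
      ennreal (2 * pi) * (ennreal (exp (2 * t)) * (\<integral>\<^sup>+\<theta>\<in>{0..2*pi}. energy_density B u (polar (exp t) \<theta>) \<partial>lborel))" for t
  proof -
    have m1: "(\<lambda>\<theta>. sq (radial_deriv u t \<theta>)) \<in> borel_measurable borel" "(\<lambda>\<theta>. sq (?g t \<theta>)) \<in> borel_measurable borel"
      by (intro measurable_compose[OF _ sq_measurable] borel_measurable_continuous_onI radial_deriv_continuous angular_deriv_continuous
         test_function_polar_continuous continuous_intros u)+
    have "(\<Sum>m\<in>M. sq (mode_deriv u t m) + ennreal ((flux B (exp t) - of_int m)\<^sup>2) * sq (mode u t m)) =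
        (\<Sum>m\<in>M. sq (fourier (radial_deriv u t) m)) + (\<Sum>m\<in>M. sq (fourier (?g t) m))"
      by (simp add: sum.distrib fg mode_deriv_def)
    also have "\<dots> \<le> ennreal (2 * pi) * (\<integral>\<^sup>+\<theta>\<in>{0..2*pi}. sq (radial_deriv u t \<theta>) \<partial>lborel) + ennreal (2 * pi) * (\<integral>\<^sup>+\<theta>\<in>{0..2*pi}. sq (?g t \<theta>) \<partial>lborel)"
      by (intro add_mono bessel_nn_integral M c)
    also have "\<dots> = ennreal (2 * pi) * (\<integral>\<^sup>+\<theta>\<in>{0..2*pi}. (sq (radial_deriv u t \<theta>) + sq (?g t \<theta>)) \<partial>lborel)"
      using m1 by (simp add: distrib_left distrib_right nn_integral_add)
    also have "(\<integral>\<^sup>+\<theta>\<in>{0..2*pi}. (sq (radial_deriv u t \<theta>) + sq (?g t \<theta>)) \<partial>lborel) =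
        (\<integral>\<^sup>+\<theta>. ennreal (exp (2 * t)) * (energy_density B u (polar (exp t) \<theta>) * indicator {0..2*pi} \<theta>) \<partial>lborel)"
      unfolding energy_density_polar[symmetric] by (simp only: mult.assoc)
    also have "\<dots> = ennreal (exp (2 * t)) * (\<integral>\<^sup>+\<theta>\<in>{0..2*pi}. energy_density B u (polar (exp t) \<theta>) \<partial>lborel)"
      by (rule nn_integral_cmult) measurable
    finally show ?thesis .
  qed
  have "(\<Sum>m\<in>M. (\<integral>\<^sup>+t. sq (mode_deriv u t m) \<partial>lborel) + (\<integral>\<^sup>+t. ennreal ((flux B (exp t) - of_int m)\<^sup>2) * sq (mode u t m) \<partial>lborel))
     = (\<integral>\<^sup>+t. (\<Sum>m\<in>M. sq (mode_deriv u t m) + ennreal ((flux B (exp t) - of_int m)\<^sup>2) * sq (mode u t m)) \<partial>lborel)"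
    by (subst nn_integral_sum) (auto intro!: sum.cong simp: nn_integral_add)
  also have "\<dots> \<le> (\<integral>\<^sup>+t. ennreal (2 * pi) * (ennreal (exp (2 * t)) * (\<integral>\<^sup>+\<theta>\<in>{0..2*pi}. energy_density B u (polar (exp t) \<theta>) \<partial>lborel)) \<partial>lborel)"
    by (intro nn_integral_mono pt)
  also have "\<dots> = ennreal (2 * pi) * (\<integral>\<^sup>+x. energy_density B u x \<partial>lborel)"
    unfolding nn_integral_log_polar[OF \<open>energy_density B u \<in> borel_measurable borel\<close>]
    by (rule nn_integral_cmult) measurable
  finally show ?thesis .
qed

section \<open>The potential in angular modes\<close>

text \<open>The integers outside \<open>L\<close> are enumerated by \<open>int_decode\<close>, which
  makes \<open>suminf\<close> and its exchange with integrals available; in \<open>ennreal\<close>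
  the order is immaterial.\<close>

definition tail :: "int set \<Rightarrow> (int \<Rightarrow> ennreal) \<Rightarrow> ennreal" where
  "tail L f = (\<Sum>k. if int_decode k \<in> L then 0 else f (int_decode k))"

lemma sum_le_tail:
  assumes "finite N" "N \<inter> L = {}"
  shows "(\<Sum>m\<in>N. f m) \<le> tail L f"
proof -
  let ?g = "\<lambda>k. if int_decode k \<in> L then 0 else f (int_decode k)"
  have "(\<Sum>m\<in>N. f m) = (\<Sum>k\<in>int_encode ` N. ?g k)"
    using assms by (subst sum.reindex) (auto intro!: sum.cong simp: inj_int_encode)
  also have "\<dots> \<le> (\<Sum>k. ?g k)" using assms by (intro sum_le_suminf) auto
  finally show ?thesis by (simp add: tail_def)
qed

lemma tail_le:
  assumes "\<And>N. finite N \<Longrightarrow> N \<inter> L = {} \<Longrightarrow> (\<Sum>m\<in>N. f m) \<le> C"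
  shows "tail L f \<le> C"
  unfolding tail_def
proof (rule suminf_le_const)
  fix n
  let ?N = "int_decode ` {..<n} - L"
  have "(\<Sum>k<n. if int_decode k \<in> L then 0 else f (int_decode k)) = (\<Sum>m\<in>int_decode ` {..<n}. if m \<in> L then 0 else f m)"
    by (subst sum.reindex) (auto simp: inj_int_decode)
  also have "\<dots> = (\<Sum>m\<in>?N. f m)" by (rule sum.mono_neutral_cong_right) auto
  also have "\<dots> \<le> C" by (rule assms) auto
  finally show "(\<Sum>k<n. if int_decode k \<in> L then 0 else f (int_decode k)) \<le> C" .
qed simp

text \<open>By Parseval, subtracting the modes in \<open>L\<close> leaves the sum over the remaining
  ones. Only finite sums are compared with \<open>tail\<close>, and the error \<open>e\<close> is
  removed at the end.\<close>

lemma tail_mode_bound: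
  assumes u: "u \<in> test_functions" and L: "finite L"
  shows "ennreal (2 * pi) * (\<integral>\<^sup>+\<theta>\<in>{0..2*pi}. sq (u (polar (exp t) \<theta>) - trig_sum L (\<lambda>m. mode u t m / of_real (2 * pi)) \<theta>) \<partial>lborel)
    \<le> tail L (\<lambda>m. sq (mode u t m))"
proof -
  \<comment> \<open>Transfers \<open>u\<close> on the circle of radius \<open>exp t\<close> to the
    unit circle in \<open>complex\<close>, where \<open>parseval\<close> applies and periodicity is
    built in.\<close>
  define w where "w = (\<lambda>z::complex. u ((exp t * Re z) *\<^sub>R axis 1 1 + (exp t * Im z) *\<^sub>R axis 2 1))"
  have wc: "continuous_on (sphere 0 1) w"
    unfolding w_def by (rule continuous_on_compose2[OF test_function_continuous[OF u, of UNIV]]) (auto intro!: continuous_intros)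
  have wu: "w (cis \<theta>) = u (polar (exp t) \<theta>)" for \<theta> by (simp add: w_def polar_eq_axis)
  let ?g = "\<lambda>\<theta>. u (polar (exp t) \<theta>)" and ?c = "\<lambda>m. mode u t m / of_real (2 * pi)"
  let ?I = "\<lambda>f::real \<Rightarrow> real. integral {0..2*pi} f"
  have g: "continuous_on {0..2*pi} ?g" by (intro test_function_polar_continuous u continuous_intros)
  have I: "?I (\<lambda>\<theta>. (norm (?g \<theta> - trig_sum L ?c \<theta>))\<^sup>2) = ?I (\<lambda>\<theta>. (norm (?g \<theta>))\<^sup>2) - (\<Sum>m\<in>L. (norm (mode u t m))\<^sup>2) / (2 * pi)"
    using integral_norm_sq_diff_trig_sum[OF L g, of ?c] by (simp add: mode_def)
  have nn: "0 \<le> ?I (\<lambda>\<theta>. (norm (?g \<theta> - trig_sum L ?c \<theta>))\<^sup>2)"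
    using g by (intro Henstock_Kurzweil_Integration.integral_nonneg integrable_norm_sq continuous_intros) auto
  have eq: "ennreal (2 * pi) * (\<integral>\<^sup>+\<theta>\<in>{0..2*pi}. sq (?g \<theta> - trig_sum L ?c \<theta>) \<partial>lborel) =
      ennreal (2 * pi * ?I (\<lambda>\<theta>. (norm (?g \<theta> - trig_sum L ?c \<theta>))\<^sup>2))"
    unfolding sq_def using g nn
    by (subst nn_integral_interval_continuous) (auto intro!: continuous_intros simp: ennreal_mult)
  show ?thesis unfolding eq
  proof (rule ennreal_le_epsilon)
    fix e :: real assume e: "0 < e"
    obtain M where M: "finite M" "\<And>N. finite N \<Longrightarrow> M \<subseteq> N \<Longrightarrow> 2 * pi * ?I (\<lambda>\<theta>. (norm (?g \<theta>))\<^sup>2) \<le> (\<Sum>m\<in>N. (norm (mode u t m))\<^sup>2) + e"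
      using parseval[OF wc e] unfolding wu mode_def by blast
    have "2 * pi * ?I (\<lambda>\<theta>. (norm (?g \<theta>))\<^sup>2) \<le> (\<Sum>m\<in>M \<union> L. (norm (mode u t m))\<^sup>2) + e"
      using M L by auto
    also have "(\<Sum>m\<in>M \<union> L. (norm (mode u t m))\<^sup>2) = (\<Sum>m\<in>M - L. (norm (mode u t m))\<^sup>2) + (\<Sum>m\<in>L. (norm (mode u t m))\<^sup>2)"
      using M L by (subst sum.union_disjoint[symmetric]) (auto simp: Un_Diff_cancel2)
    finally have "2 * pi * ?I (\<lambda>\<theta>. (norm (?g \<theta> - trig_sum L ?c \<theta>))\<^sup>2) \<le> (\<Sum>m\<in>M - L. (norm (mode u t m))\<^sup>2) + e"
      unfolding I by (simp add: right_diff_distrib)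
    then have "ennreal (2 * pi * ?I (\<lambda>\<theta>. (norm (?g \<theta> - trig_sum L ?c \<theta>))\<^sup>2)) \<le> ennreal ((\<Sum>m\<in>M - L. (norm (mode u t m))\<^sup>2) + e)"
      by (rule ennreal_leI)
    also have "\<dots> = (\<Sum>m\<in>M - L. sq (mode u t m)) + ennreal e"
      using e by (simp add: sq_def sum_nonneg)
    also have "\<dots> \<le> tail L (\<lambda>m. sq (mode u t m)) + ennreal e"
      using M by (intro add_right_mono sum_le_tail) auto
    finally show "ennreal (2 * pi * ?I (\<lambda>\<theta>. (norm (?g \<theta> - trig_sum L ?c \<theta>))\<^sup>2)) \<le> tail L (\<lambda>m. sq (mode u t m)) + ennreal e" .
  qed
qed

text \<open>Cauchy-Schwarz. The bound is uniform in the angle, which is why a finite number of modes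
  sees only the angular integral of the potential.\<close>

lemma sq_trig_sum_le:
  assumes L: "finite L"
  shows "sq (trig_sum L c \<theta>) \<le> of_nat (card L) * (\<Sum>m\<in>L. sq (c m))"
proof -
  have "norm (trig_sum L c \<theta>) \<le> (\<Sum>m\<in>L. norm (c m))"
    unfolding trig_sum_def by (rule order_trans[OF norm_sum]) (simp add: norm_mult)
  then have "(norm (trig_sum L c \<theta>))\<^sup>2 \<le> (\<Sum>m\<in>L. norm (c m))\<^sup>2" by (intro power_mono) auto
  also have "\<dots> \<le> real (card L) * (\<Sum>m\<in>L. (norm (c m))\<^sup>2)"
    using sum_squared_le_sum_of_squares[of "\<lambda>m. norm (c m)" L] by (simp add: mult.commute)
  finally have "sq (trig_sum L c \<theta>) \<le> ennreal (real (card L) * (\<Sum>m\<in>L. (norm (c m))\<^sup>2))"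
    unfolding sq_def by (rule ennreal_leI)
  also have "\<dots> = of_nat (card L) * (\<Sum>m\<in>L. sq (c m))"
    by (simp add: sq_def ennreal_mult sum_nonneg ennreal_of_nat_eq_real_of_nat)
  finally show ?thesis .
qed

text \<open>Let \<open>P\<close> collect the modes in \<open>L\<close>, and use
  \<open>|u|^2 \<le> 2 |P|^2 + 2 |u - P|^2\<close>; this separates low from high modes although
  \<open>V\<close> couples them. The first term is bounded pointwise and meets the angular integral
  of \<open>V\<close>, the second is known in mean square and meets the bound
  \<open>W\<close>.\<close>

lemma potential_modes:
  fixes V :: "real^2 \<Rightarrow> ennreal"
  assumes [measurable]: "V \<in> borel_measurable borel" and u: "u \<in> test_functions" and L: "finite L"
    and W: "AE \<theta> in lborel. \<theta> \<in> {0..2*pi} \<longrightarrow> V (polar (exp t) \<theta>) \<le> W"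
  shows "(\<integral>\<^sup>+\<theta>\<in>{0..2*pi}. V (polar (exp t) \<theta>) * sq (u (polar (exp t) \<theta>)) \<partial>lborel) \<le>
    ennreal (real (card L) / (2 * pi\<^sup>2)) * (\<integral>\<^sup>+\<theta>\<in>{0..2*pi}. V (polar (exp t) \<theta>) \<partial>lborel) * (\<Sum>m\<in>L. sq (mode u t m))
    + ennreal (1 / pi) * W * tail L (\<lambda>m. sq (mode u t m))"
proof -
  let ?g = "\<lambda>\<theta>. u (polar (exp t) \<theta>)" and ?c = "\<lambda>m. mode u t m / of_real (2 * pi)" and ?V = "\<lambda>\<theta>. V (polar (exp t) \<theta>)"
  let ?P = "trig_sum L ?c" and ?J = "{0..2*pi}" and ?S = "\<Sum>m\<in>L. sq (mode u t m)"
  have [measurable]: "u \<in> borel_measurable borel" using u by (rule test_function_measurable)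
  have [measurable]: "?P \<in> borel_measurable borel" by (intro borel_measurable_continuous_onI continuous_intros)
  have P: "2 * sq (?P \<theta>) \<le> ennreal (real (card L) / (2 * pi\<^sup>2)) * ?S" for \<theta>
  proof -
    have "2 * sq (?P \<theta>) \<le> 2 * (of_nat (card L) * (\<Sum>m\<in>L. sq (?c m)))" by (intro mult_left_mono sq_trig_sum_le L) auto
    also have "(\<Sum>m\<in>L. sq (?c m)) = ennreal (1 / (4 * pi\<^sup>2)) * ?S"
      unfolding sum_distrib_left
      by (intro sum.cong refl) (simp add: sq_def norm_divide norm_mult power_divide power_mult_distrib flip: ennreal_mult)
    also have "2 * (of_nat (card L) * (ennreal (1 / (4 * pi\<^sup>2)) * ?S)) = (2 * ennreal (real (card L)) * ennreal (1 / (4 * pi\<^sup>2))) * ?S"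
      by (simp add: ac_simps ennreal_of_nat_eq_real_of_nat)
    also have "2 * ennreal (real (card L)) * ennreal (1 / (4 * pi\<^sup>2)) = ennreal (real (card L) / (2 * pi\<^sup>2))"
      by (simp flip: ennreal_mult ennreal_numeral)
    finally show ?thesis .
  qed
  have "(\<integral>\<^sup>+\<theta>\<in>?J. ?V \<theta> * sq (?g \<theta>) \<partial>lborel) \<le>
    (\<integral>\<^sup>+\<theta>. (ennreal (real (card L) / (2 * pi\<^sup>2)) * ?S) * (?V \<theta> * indicator ?J \<theta>) + (2 * W) * (sq (?g \<theta> - ?P \<theta>) * indicator ?J \<theta>) \<partial>lborel)"
  proof (rule nn_integral_mono_AE)
    show "AE \<theta> in lborel. ?V \<theta> * sq (?g \<theta>) * indicator ?J \<theta> \<le>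
      (ennreal (real (card L) / (2 * pi\<^sup>2)) * ?S) * (?V \<theta> * indicator ?J \<theta>) + (2 * W) * (sq (?g \<theta> - ?P \<theta>) * indicator ?J \<theta>)"
      using W
    proof eventually_elim
      case (elim \<theta>)
      show ?case
      proof (cases "\<theta> \<in> ?J")
        case True
        then have VW: "?V \<theta> \<le> W" using elim by simp
        have "?V \<theta> * sq (?g \<theta>) \<le> ?V \<theta> * (2 * sq (?P \<theta>) + 2 * sq (?g \<theta> - ?P \<theta>))"
          using sq_add_le[of "?P \<theta>" "?g \<theta> - ?P \<theta>"] by (intro mult_left_mono) auto
        also have "\<dots> = ?V \<theta> * (2 * sq (?P \<theta>)) + ?V \<theta> * (2 * sq (?g \<theta> - ?P \<theta>))" by (rule distrib_left)
        also have "\<dots> \<le> ?V \<theta> * (ennreal (real (card L) / (2 * pi\<^sup>2)) * ?S) + W * (2 * sq (?g \<theta> - ?P \<theta>))"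
          by (intro add_mono mult_left_mono mult_right_mono P VW) auto
        finally show ?thesis using True by (simp add: ac_simps)
      qed simp
    qed
  qed
  also have "\<dots> = (ennreal (real (card L) / (2 * pi\<^sup>2)) * ?S) * (\<integral>\<^sup>+\<theta>\<in>?J. ?V \<theta> \<partial>lborel) + (2 * W) * (\<integral>\<^sup>+\<theta>\<in>?J. sq (?g \<theta> - ?P \<theta>) \<partial>lborel)"
    by (subst nn_integral_add; (subst nn_integral_cmult)?; (subst nn_integral_cmult)?; measurable)
  also have "2 * W * (\<integral>\<^sup>+\<theta>\<in>?J. sq (?g \<theta> - ?P \<theta>) \<partial>lborel) = ennreal (1 / pi) * W * (ennreal (2 * pi) * (\<integral>\<^sup>+\<theta>\<in>?J. sq (?g \<theta> - ?P \<theta>) \<partial>lborel))"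
  proof -
    have "(2::ennreal) = ennreal (1 / pi) * ennreal (2 * pi)" by (simp flip: ennreal_mult)
    then show ?thesis by (simp only: ac_simps)
  qed
  also have "\<dots> \<le> ennreal (1 / pi) * W * tail L (\<lambda>m. sq (mode u t m))"
    by (intro mult_left_mono tail_mode_bound u L) auto
  finally show ?thesis by (simp add: ac_simps add_left_mono)
qed

lemma nn_integral_tail:
  assumes [measurable]: "\<And>m. f m \<in> borel_measurable M"
  shows "(\<integral>\<^sup>+t. tail L (\<lambda>m. f m t) \<partial>M) = tail L (\<lambda>m. \<integral>\<^sup>+t. f m t \<partial>M)"
  unfolding tail_def by (subst nn_integral_suminf) (auto intro!: arg_cong[where f = suminf] simp: fun_eq_iff)

lemma tail_measurable [measurable]:
  assumes [measurable]: "\<And>m. f m \<in> borel_measurable M"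
  shows "(\<lambda>t. tail L (\<lambda>m. f m t)) \<in> borel_measurable M"
  unfolding tail_def by measurable

lemma tail_cmult: "tail L (\<lambda>m. c * f m) = c * tail L f"
proof -
  have "(\<lambda>k. if int_decode k \<in> L then 0 else c * f (int_decode k)) = (\<lambda>k. c * (if int_decode k \<in> L then 0 else f (int_decode k)))"
    by auto
  then show ?thesis unfolding tail_def by (simp only: ennreal_suminf_cmult)
qed

lemma tail_add: "tail L (\<lambda>m. f m + g m) = tail L f + tail L g"
  unfolding tail_def by (subst suminf_add) (auto intro!: arg_cong[where f = suminf] simp: fun_eq_iff)

lemma tail_mono: "(\<And>m. m \<notin> L \<Longrightarrow> f m \<le> g m) \<Longrightarrow> tail L f \<le> tail L g"
  unfolding tail_def by (intro suminf_le) auto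

lemma sum_plus_tail_le:
  assumes L: "finite L" and C: "\<And>N. finite N \<Longrightarrow> (\<Sum>m\<in>N. f m) \<le> C"
  shows "(\<Sum>m\<in>L. f m) + tail L f \<le> C"
proof -
  let ?g = "\<lambda>k. if int_decode k \<in> L then f (int_decode k) else 0"
  have "(\<Sum>m\<in>L. f m) = (\<Sum>k\<in>int_encode ` L. ?g k)"
    using L by (subst sum.reindex) (auto intro!: sum.cong simp: inj_int_encode)
  also have "\<dots> \<le> (\<Sum>k. ?g k)" using L by (intro sum_le_suminf) auto
  finally have "(\<Sum>m\<in>L. f m) + tail L f \<le> (\<Sum>k. ?g k) + tail L f" by (rule add_right_mono)
  also have "\<dots> = tail {} f"
    unfolding tail_def by (subst suminf_add) (auto intro!: arg_cong[where f = suminf] simp: fun_eq_iff)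
  also have "\<dots> \<le> C" by (intro tail_le C)
  finally show ?thesis .
qed

text \<open>Each pair in \<open>S\<close> belongs to one mode, so it is counted at most
  once.\<close>

lemma tail_point_sum_le:
  assumes S: "finite S"
  shows "tail L (\<lambda>m. point_sum S m (F m)) \<le> (\<Sum>p\<in>S. sq (F (snd p) (fst p)))"
proof (rule tail_le)
  fix N :: "int set" assume N: "finite N" "N \<inter> L = {}"
  have "(\<Sum>m\<in>N. point_sum S m (F m)) = (\<Sum>p\<in>S. \<Sum>m\<in>N. if m = snd p then sq (F (snd p) (fst p)) else 0)"
    unfolding point_sum_def by (subst sum.swap) (auto intro!: sum.cong)
  also have "\<dots> \<le> (\<Sum>p\<in>S. sq (F (snd p) (fst p)))"
    using N by (intro sum_mono) auto
  finally show "(\<Sum>m\<in>N. point_sum S m (F m)) \<le> (\<Sum>p\<in>S. sq (F (snd p) (fst p)))" .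
qed

definition functional_bound :: "(real^2 \<Rightarrow> real) \<Rightarrow> (real^2 \<Rightarrow> ennreal) \<Rightarrow> (real \<times> int) set \<Rightarrow> real \<Rightarrow> bool" where
  "functional_bound B V S K \<longleftrightarrow> finite S \<and> 0 \<le> K \<and> (\<forall>u\<in>test_functions.
     (\<integral>\<^sup>+x. V x * sq (u x) \<partial>lborel) \<le> (\<integral>\<^sup>+x. energy_density B u x \<partial>lborel) + ennreal K * (\<Sum>p\<in>S. sq (mode u (fst p) (snd p))))"

text \<open>
  For \<open>\<bar>m\<bar> > N\<close> the centrifugal barrier is at least \<open>m\<^sup>2 / 4\<close>; for the finitely many
  other modes it is nonzero somewhere since the flux is not constant.
\<close>

theorem functional_bound_ex:
  assumes meas [measurable]: "flux B \<in> borel_measurable borel"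
    and cont: "continuous_on UNIV (\<lambda>t. flux B (exp t))"
    and bound: "\<And>r. 0 < r \<Longrightarrow> \<bar>flux B r\<bar> \<le> M"
    and nonconst: "\<And>m::int. \<exists>t. flux B (exp t) \<noteq> of_int m"
  shows "\<exists>C\<ge>0. \<forall>V W. V \<in> borel_measurable borel \<longrightarrow> W \<in> borel_measurable borel \<longrightarrow>
     (\<forall>t. AE \<theta> in lborel. \<theta> \<in> {0..2*pi} \<longrightarrow> V (polar (exp t) \<theta>) \<le> W t) \<longrightarrow>
     (\<integral>\<^sup>+x. V x * ennreal (1 + \<bar>ln (norm x)\<bar>) \<partial>lborel) < \<infinity> \<longrightarrow> (\<integral>\<^sup>+t. ennreal (exp (2 * t)) * W t \<partial>lborel) < \<infinity> \<longrightarrow>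
     (\<exists>S K. functional_bound B V S K \<and> ennreal (real (card S)) \<le> ennreal C *
       ((\<integral>\<^sup>+x. V x * ennreal (1 + \<bar>ln (norm x)\<bar>) \<partial>lborel) + (\<integral>\<^sup>+t. ennreal (exp (2 * t)) * W t \<partial>lborel)))"
proof -
  have M0: "0 \<le> M" using bound[of 1] by simp
  \<comment> \<open>Twice the flux bound: for \<open>|m| \<ge> 2 * M\<close>, subtracting the flux
    loses at most half of \<open>|m|\<close>.\<close>
  define N where "N = nat \<lceil>2 * M\<rceil>"
  have N: "2 * M \<le> real N" unfolding N_def by (rule of_nat_ceiling)
  define L where "L = {- int N..int N}"
  have L: "finite L" "card L > 0" by (auto simp: L_def)
  \<comment> \<open>With the factor \<open>card L / (2 * pi^2)\<close> of
    \<open>potential_modes\<close>, each low mode is charged \<open>1 / (2 * pi)\<close> of its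
    energy. This is also the share of a high mode, \<open>1 / pi\<close> times one half.\<close>
  define \<kappa> where "\<kappa> = pi / card L"
  have \<kappa>: "0 < \<kappa>" using L by (simp add: \<kappa>_def)
  define p where "p m t = (flux B (exp t) - of_int m)\<^sup>2" for m :: int and t
  have p [measurable]: "p m \<in> borel_measurable borel" for m unfolding p_def by measurable
  have high: "(real_of_int m)\<^sup>2 / 4 \<le> p m t" if "m \<notin> L" for m t
  proof -
    have "real N \<le> \<bar>real_of_int m\<bar>" using that by (auto simp: L_def)
    moreover have "\<bar>real_of_int m\<bar> \<le> \<bar>flux B (exp t) - of_int m\<bar> + \<bar>flux B (exp t)\<bar>" by linarith
    moreover have "\<bar>flux B (exp t)\<bar> \<le> M" by (rule bound) simp
    ultimately have "\<bar>real_of_int m\<bar> / 2 \<le> \<bar>flux B (exp t) - of_int m\<bar>" using N by linarith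
    then have "(\<bar>real_of_int m\<bar> / 2)\<^sup>2 \<le> \<bar>flux B (exp t) - of_int m\<bar>\<^sup>2" by (intro power_mono) auto
    then show ?thesis by (simp add: p_def power_divide)
  qed
  define E where "E u m = (\<integral>\<^sup>+t. sq (mode_deriv u t m) \<partial>lborel) + (\<integral>\<^sup>+t. ennreal (p m t) * sq (mode u t m) \<partial>lborel)" for u m
  define admissible where "admissible m C \<longleftrightarrow> (\<forall>W. W \<in> borel_measurable borel \<longrightarrow> (\<integral>\<^sup>+x. W x * ennreal (1 + \<bar>x\<bar>) \<partial>lborel) < \<infinity> \<longrightarrow>
    (\<exists>S K. finite S \<and> 0 \<le> K \<and> ennreal (real (card S)) \<le> ennreal C * (\<integral>\<^sup>+x. W x * ennreal (1 + \<bar>x\<bar>) \<partial>lborel) \<and>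
      (\<forall>F F'. c1_pair F F' \<longrightarrow> (\<integral>\<^sup>+x. W x * sq (F x) \<partial>lborel) \<le>
        ennreal \<kappa> * ((\<integral>\<^sup>+x. sq (F' x) \<partial>lborel) + (\<integral>\<^sup>+x. ennreal (p m x) * sq (F x) \<partial>lborel)) + ennreal K * (\<Sum>s\<in>S. sq (F s)))))" for m C
  have ex: "\<exists>C. 0 \<le> C \<and> admissible m C" for m
  proof -
    obtain t0 where t0: "flux B (exp t0) \<noteq> of_int m" using nonconst by blast
    define \<epsilon> where "\<epsilon> = p m t0 / 2"
    have \<epsilon>: "0 < \<epsilon>" using t0 by (simp add: \<epsilon>_def p_def)
    have "continuous_on UNIV (p m)" unfolding p_def by (intro continuous_intros cont)
    then have "isCont (p m) t0" by (simp add: continuous_on_eq_continuous_at)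
    then obtain d where d: "0 < d" "\<And>t. dist t t0 < d \<Longrightarrow> dist (p m t) (p m t0) < \<epsilon>"
      using \<epsilon> unfolding continuous_at_eps_delta by blast
    have "\<epsilon> \<le> p m t" if "t \<in> {t0 - d / 2..t0 + d / 2}" for t
    proof -
      have "dist t t0 < d" using that d(1) by (auto simp: dist_real_def abs_if)
      from d(2)[OF this] show ?thesis by (auto simp: dist_real_def \<epsilon>_def abs_if split: if_splits)
    qed
    then show ?thesis unfolding admissible_def using d(1) by (intro low_modes[OF p _ \<epsilon> _ \<kappa>, of "d / 2" t0]) auto
  qed
  obtain Cm where Cm: "\<And>m. 0 \<le> Cm m" "\<And>m. admissible m (Cm m)"
  proof -
    have "\<forall>m. \<exists>C. 0 \<le> C \<and> admissible m C" using ex by blast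
    from choice[OF this] show ?thesis using that by blast
  qed
  define C where "C = (\<Sum>m\<in>L. Cm m) + 384"
  have C0: "0 \<le> (\<Sum>m\<in>L. Cm m)" by (intro sum_nonneg Cm)
  show ?thesis
  proof (intro exI[of _ C] conjI allI impI)
    show "0 \<le> C" using C0 by (simp add: C_def)
    fix V :: "real^2 \<Rightarrow> ennreal" and W :: "real \<Rightarrow> ennreal"
    assume V [measurable]: "V \<in> borel_measurable borel" and W [measurable]: "W \<in> borel_measurable borel"
      and VW: "\<forall>t. AE \<theta> in lborel. \<theta> \<in> {0..2*pi} \<longrightarrow> V (polar (exp t) \<theta>) \<le> W t"
      and finV: "(\<integral>\<^sup>+x. V x * ennreal (1 + \<bar>ln (norm x)\<bar>) \<partial>lborel) < \<infinity>"
      and finW: "(\<integral>\<^sup>+t. ennreal (exp (2 * t)) * W t \<partial>lborel) < \<infinity>"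
    let ?J = "\<integral>\<^sup>+x. V x * ennreal (1 + \<bar>ln (norm x)\<bar>) \<partial>lborel" and ?I = "\<integral>\<^sup>+t. ennreal (exp (2 * t)) * W t \<partial>lborel"
    \<comment> \<open>Low modes will meet \<open>Vb\<close>, high modes \<open>W2\<close>; both
      carry the area factor of the logarithmic coordinates.\<close>
    define Vb where "Vb t = ennreal (exp (2 * t)) * (\<integral>\<^sup>+\<theta>\<in>{0..2*pi}. V (polar (exp t) \<theta>) \<partial>lborel)" for t
    define W2 where "W2 t = ennreal (exp (2 * t)) * W t" for t
    have Vb [measurable]: "Vb \<in> borel_measurable borel" unfolding Vb_def by measurable
    have W2 [measurable]: "W2 \<in> borel_measurable borel" unfolding W2_def by measurable
    have J: "(\<integral>\<^sup>+t. Vb t * ennreal (1 + \<bar>t\<bar>) \<partial>lborel) = ?J"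
    proof -
      have "?J = (\<integral>\<^sup>+t. ennreal (exp (2 * t)) * (\<integral>\<^sup>+\<theta>. (V (polar (exp t) \<theta>) * indicator {0..2*pi} \<theta>) * ennreal (1 + \<bar>t\<bar>) \<partial>lborel) \<partial>lborel)"
        by (subst nn_integral_log_polar) (simp_all add: mult.commute mult.left_commute)
      also have "\<dots> = (\<integral>\<^sup>+t. Vb t * ennreal (1 + \<bar>t\<bar>) \<partial>lborel)"
        unfolding Vb_def by (intro nn_integral_cong) (subst nn_integral_multc, simp_all add: mult.assoc)
      finally show ?thesis by simp
    qed
    have "\<forall>m. \<exists>S K. finite S \<and> 0 \<le> K \<and> ennreal (real (card S)) \<le> ennreal (Cm m) * ?J \<and>
      (\<forall>F F'. c1_pair F F' \<longrightarrow> (\<integral>\<^sup>+x. Vb x * sq (F x) \<partial>lborel) \<le>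
        ennreal \<kappa> * ((\<integral>\<^sup>+x. sq (F' x) \<partial>lborel) + (\<integral>\<^sup>+x. ennreal (p m x) * sq (F x) \<partial>lborel)) + ennreal K * (\<Sum>s\<in>S. sq (F s)))"
      using Cm(2)[unfolded admissible_def, rule_format, OF Vb] finV unfolding J by blast
    from choice[OF this] obtain Sm where "\<forall>m. \<exists>K. finite (Sm m) \<and> 0 \<le> K \<and> ennreal (real (card (Sm m))) \<le> ennreal (Cm m) * ?J \<and>
      (\<forall>F F'. c1_pair F F' \<longrightarrow> (\<integral>\<^sup>+x. Vb x * sq (F x) \<partial>lborel) \<le>
        ennreal \<kappa> * ((\<integral>\<^sup>+x. sq (F' x) \<partial>lborel) + (\<integral>\<^sup>+x. ennreal (p m x) * sq (F x) \<partial>lborel)) + ennreal K * (\<Sum>s\<in>Sm m. sq (F s)))"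
      by blast
    from choice[OF this] obtain Km where SK: "\<And>m. finite (Sm m)" "\<And>m. 0 \<le> Km m"
      "\<And>m. ennreal (real (card (Sm m))) \<le> ennreal (Cm m) * ?J"
      "\<And>m F F'. c1_pair F F' \<Longrightarrow> (\<integral>\<^sup>+x. Vb x * sq (F x) \<partial>lborel) \<le>
        ennreal \<kappa> * ((\<integral>\<^sup>+x. sq (F' x) \<partial>lborel) + (\<integral>\<^sup>+x. ennreal (p m x) * sq (F x) \<partial>lborel)) + ennreal (Km m) * (\<Sum>s\<in>Sm m. sq (F s))"
      by blast
    obtain Sh Kh where hi: "controls W2 UNIV Sh Kh" "ennreal (real (card Sh)) \<le> 384 * ?I"
      using high_modes[OF W2] finW unfolding W2_def by blast
    have Sh: "finite Sh" "0 \<le> Kh" using hi(1) by (auto simp: controls_def)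
    define c where "c = real (card L) / (2 * pi\<^sup>2)"
    have c: "0 \<le> c" "c * \<kappa> = 1 / (2 * pi)" using L by (auto simp: c_def \<kappa>_def power2_eq_square)
    \<comment> \<open>Points for the low modes are tagged with their mode; those from
      \<open>high_modes\<close> carry it already.\<close>
    define S where "S = (\<Union>m\<in>L. Sm m \<times> {m}) \<union> Sh"
    have S: "finite S" using L SK Sh by (auto simp: S_def)
    define K where "K = (\<Sum>m\<in>L. c * Km m) + Kh / pi"
    have cK: "0 \<le> c * Km m" for m using c SK by simp
    have K: "0 \<le> K" unfolding K_def using cK Sh by (intro add_nonneg_nonneg sum_nonneg) auto
    have "functional_bound B V S K"
      unfolding functional_bound_def
    proof (intro conjI ballI S K)
      fix u assume u: "u \<in> test_functions"
      have cp: "c1_pair (\<lambda>t. mode u t m) (\<lambda>t. mode_deriv u t m)" for m by (rule mode_c1_pair[OF u])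
      have [measurable]: "(\<lambda>t. mode u t m) \<in> borel_measurable borel" "(\<lambda>t. mode_deriv u t m) \<in> borel_measurable borel" for m
        using c1_pair_measurable[OF cp] by auto
      have [measurable]: "u \<in> borel_measurable borel" using u by (rule test_function_measurable)
      let ?Q = "\<Sum>p\<in>S. sq (mode u (fst p) (snd p))" and ?E = "\<integral>\<^sup>+x. energy_density B u x \<partial>lborel"
      have "(\<integral>\<^sup>+x. V x * sq (u x) \<partial>lborel) =
        (\<integral>\<^sup>+t. ennreal (exp (2 * t)) * (\<integral>\<^sup>+\<theta>\<in>{0..2*pi}. V (polar (exp t) \<theta>) * sq (u (polar (exp t) \<theta>)) \<partial>lborel) \<partial>lborel)"
        by (rule nn_integral_log_polar) measurable
      also have "\<dots> \<le> (\<integral>\<^sup>+t. (\<Sum>m\<in>L. ennreal c * (Vb t * sq (mode u t m))) + ennreal (1 / pi) * tail L (\<lambda>m. W2 t * sq (mode u t m)) \<partial>lborel)"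
      proof (rule nn_integral_mono)
        fix t
        have "ennreal (exp (2 * t)) * (\<integral>\<^sup>+\<theta>\<in>{0..2*pi}. V (polar (exp t) \<theta>) * sq (u (polar (exp t) \<theta>)) \<partial>lborel)
          \<le> ennreal (exp (2 * t)) * (ennreal c * (\<integral>\<^sup>+\<theta>\<in>{0..2*pi}. V (polar (exp t) \<theta>) \<partial>lborel) * (\<Sum>m\<in>L. sq (mode u t m))
            + ennreal (1 / pi) * W t * tail L (\<lambda>m. sq (mode u t m)))"
          unfolding c_def using VW by (intro mult_left_mono potential_modes[OF V u L(1)]) auto
        also have "\<dots> = ennreal c * Vb t * (\<Sum>m\<in>L. sq (mode u t m)) + ennreal (1 / pi) * W2 t * tail L (\<lambda>m. sq (mode u t m))"
          by (simp only: distrib_left Vb_def W2_def ac_simps)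
        also have "\<dots> = (\<Sum>m\<in>L. ennreal c * (Vb t * sq (mode u t m))) + ennreal (1 / pi) * tail L (\<lambda>m. W2 t * sq (mode u t m))"
          by (simp only: sum_distrib_left tail_cmult mult.assoc)
        finally show "ennreal (exp (2 * t)) * (\<integral>\<^sup>+\<theta>\<in>{0..2*pi}. V (polar (exp t) \<theta>) * sq (u (polar (exp t) \<theta>)) \<partial>lborel)
          \<le> (\<Sum>m\<in>L. ennreal c * (Vb t * sq (mode u t m))) + ennreal (1 / pi) * tail L (\<lambda>m. W2 t * sq (mode u t m))" .
      qed
      also have "\<dots> = (\<Sum>m\<in>L. ennreal c * (\<integral>\<^sup>+t. Vb t * sq (mode u t m) \<partial>lborel)) + ennreal (1 / pi) * tail L (\<lambda>m. \<integral>\<^sup>+t. W2 t * sq (mode u t m) \<partial>lborel)"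
      proof -
        have "(\<integral>\<^sup>+t. (\<Sum>m\<in>L. ennreal c * (Vb t * sq (mode u t m))) + ennreal (1 / pi) * tail L (\<lambda>m. W2 t * sq (mode u t m)) \<partial>lborel) =
          (\<integral>\<^sup>+t. (\<Sum>m\<in>L. ennreal c * (Vb t * sq (mode u t m))) \<partial>lborel) + (\<integral>\<^sup>+t. ennreal (1 / pi) * tail L (\<lambda>m. W2 t * sq (mode u t m)) \<partial>lborel)"
          by (rule nn_integral_add) measurable
        also have "(\<integral>\<^sup>+t. (\<Sum>m\<in>L. ennreal c * (Vb t * sq (mode u t m))) \<partial>lborel) = (\<Sum>m\<in>L. ennreal c * (\<integral>\<^sup>+t. Vb t * sq (mode u t m) \<partial>lborel))"
          by (subst nn_integral_sum) (auto intro!: sum.cong nn_integral_cmult)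
        also have "(\<integral>\<^sup>+t. ennreal (1 / pi) * tail L (\<lambda>m. W2 t * sq (mode u t m)) \<partial>lborel) = ennreal (1 / pi) * (\<integral>\<^sup>+t. tail L (\<lambda>m. W2 t * sq (mode u t m)) \<partial>lborel)"
          by (rule nn_integral_cmult) measurable
        also have "(\<integral>\<^sup>+t. tail L (\<lambda>m. W2 t * sq (mode u t m)) \<partial>lborel) = tail L (\<lambda>m. \<integral>\<^sup>+t. W2 t * sq (mode u t m) \<partial>lborel)"
          by (rule nn_integral_tail) measurable
        finally show ?thesis .
      qed
      also have "\<dots> \<le> (\<Sum>m\<in>L. ennreal (1 / (2 * pi)) * E u m + ennreal (c * Km m) * ?Q) +
          (ennreal (1 / (2 * pi)) * tail L (E u) + ennreal (Kh / pi) * ?Q)"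
      proof (intro add_mono sum_mono)
        fix m assume m: "m \<in> L"
        have "(\<Sum>s\<in>Sm m. sq (mode u s m)) = (\<Sum>p\<in>Sm m \<times> {m}. sq (mode u (fst p) (snd p)))"
          by (rule sum.reindex_bij_witness[where i = fst and j = "\<lambda>s. (s, m)"]) auto
        also have "\<dots> \<le> ?Q" using m S by (intro sum_mono2) (auto simp: S_def)
        finally have Q: "(\<Sum>s\<in>Sm m. sq (mode u s m)) \<le> ?Q" .
        have "ennreal c * (\<integral>\<^sup>+t. Vb t * sq (mode u t m) \<partial>lborel) \<le> ennreal c * (ennreal \<kappa> * E u m + ennreal (Km m) * (\<Sum>s\<in>Sm m. sq (mode u s m)))"
          unfolding E_def using SK(4)[OF cp] by (intro mult_left_mono) auto
        also have "\<dots> \<le> ennreal c * (ennreal \<kappa> * E u m + ennreal (Km m) * ?Q)"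
          by (intro mult_left_mono add_left_mono Q) auto
        also have "\<dots> = ennreal (1 / (2 * pi)) * E u m + ennreal (c * Km m) * ?Q"
          unfolding c(2)[symmetric] using c(1) \<kappa> SK(2)[of m] by (simp add: distrib_left ennreal_mult mult.assoc)
        finally show "ennreal c * (\<integral>\<^sup>+t. Vb t * sq (mode u t m) \<partial>lborel) \<le> ennreal (1 / (2 * pi)) * E u m + ennreal (c * Km m) * ?Q" .
      next
        have hm: "(\<integral>\<^sup>+t. W2 t * sq (mode u t m) \<partial>lborel) \<le> ennreal (1/2) * E u m + ennreal Kh * point_sum Sh m (\<lambda>t. mode u t m)"
          if m: "m \<notin> L" for m
        proof -
          have "m \<noteq> 0" using m by (auto simp: L_def)
          then have "(\<integral>\<^sup>+t. W2 t * sq (mode u t m) \<partial>lborel) \<le> ennreal (1/2) * energy \<bar>real_of_int m\<bar> (\<lambda>t. mode u t m) (\<lambda>t. mode_deriv u t m) UNIV + ennreal Kh * point_sum Sh m (\<lambda>t. mode u t m)"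
            using hi(1) cp[of m] unfolding controls_def by fastforce
          also have "energy \<bar>real_of_int m\<bar> (\<lambda>t. mode u t m) (\<lambda>t. mode_deriv u t m) UNIV \<le> E u m"
          proof -
            have "ennreal (\<bar>real_of_int m\<bar>\<^sup>2 / 4) * (\<integral>\<^sup>+t. sq (mode u t m) \<partial>lborel) = (\<integral>\<^sup>+t. ennreal (\<bar>real_of_int m\<bar>\<^sup>2 / 4) * sq (mode u t m) \<partial>lborel)"
              by (rule nn_integral_cmult[symmetric]) measurable
            also have "\<dots> \<le> (\<integral>\<^sup>+t. ennreal (p m t) * sq (mode u t m) \<partial>lborel)"
              using high[OF m] by (intro nn_integral_mono mult_right_mono ennreal_leI) auto
            finally show ?thesis by (simp add: energy_def E_def add_left_mono)
          qed
          finally show ?thesis by (simp add: add_right_mono mult_left_mono)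
        qed
        have "ennreal (1 / pi) * tail L (\<lambda>m. \<integral>\<^sup>+t. W2 t * sq (mode u t m) \<partial>lborel) \<le>
            ennreal (1 / pi) * tail L (\<lambda>m. ennreal (1/2) * E u m + ennreal Kh * point_sum Sh m (\<lambda>t. mode u t m))"
          by (intro mult_left_mono tail_mono hm) auto
        also have "\<dots> = ennreal (1 / pi) * (ennreal (1/2) * tail L (E u)) + ennreal (1 / pi) * (ennreal Kh * tail L (\<lambda>m. point_sum Sh m (\<lambda>t. mode u t m)))"
          by (simp only: tail_add tail_cmult distrib_left)
        also have "tail L (\<lambda>m. point_sum Sh m (\<lambda>t. mode u t m)) \<le> (\<Sum>p\<in>Sh. sq (mode u (fst p) (snd p)))"
          by (rule tail_point_sum_le[OF Sh(1), of L "\<lambda>m t. mode u t m"])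
        also have "\<dots> \<le> ?Q" using S by (intro sum_mono2) (auto simp: S_def)
        also have "ennreal (1 / pi) * (ennreal (1/2) * tail L (E u)) = ennreal (1 / (2 * pi)) * tail L (E u)"
        proof -
          have "ennreal (1 / pi) * ennreal (1/2) = ennreal (1 / (2 * pi))" by (subst ennreal_mult[symmetric]) auto
          then show ?thesis by (simp only: mult.assoc[symmetric])
        qed
        also have "ennreal (1 / pi) * (ennreal Kh * ?Q) = ennreal (Kh / pi) * ?Q"
          using Sh by (simp add: mult.assoc[symmetric] flip: ennreal_mult)
        finally show "ennreal (1 / pi) * tail L (\<lambda>m. \<integral>\<^sup>+t. W2 t * sq (mode u t m) \<partial>lborel) \<le> ennreal (1 / (2 * pi)) * tail L (E u) + ennreal (Kh / pi) * ?Q"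
          by (simp add: add_left_mono mult_left_mono)
      qed
      also have "\<dots> = ennreal (1 / (2 * pi)) * ((\<Sum>m\<in>L. E u m) + tail L (E u)) + ennreal K * ?Q"
      proof -
        have "ennreal K = (\<Sum>m\<in>L. ennreal (c * Km m)) + ennreal (Kh / pi)"
          unfolding K_def using cK Sh by (simp add: sum_nonneg)
        moreover have "c1 * A + k1 * Q + (c1 * T + k2 * Q) = c1 * (A + T) + (k1 + k2) * Q" for c1 A k1 Q T k2 :: ennreal
          by (simp only: distrib_left distrib_right ac_simps)
        ultimately show ?thesis
          by (simp only: sum.distrib sum_distrib_left[symmetric] sum_distrib_right[symmetric])
      qed
      \<comment> \<open>Every mode has been charged \<open>1 / (2 * pi)\<close> of its energy, and
        the mode energies add up to at most \<open>2 * pi\<close> times the total.\<close>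
      also have "(\<Sum>m\<in>L. E u m) + tail L (E u) \<le> ennreal (2 * pi) * ?E"
        unfolding E_def p_def by (intro sum_plus_tail_le L energy_modes[OF meas u])
      also have "ennreal (1 / (2 * pi)) * (ennreal (2 * pi) * ?E) = ?E"
        by (simp add: mult.assoc[symmetric] flip: ennreal_mult)
      finally show "(\<integral>\<^sup>+x. V x * sq (u x) \<partial>lborel) \<le> ?E + ennreal K * ?Q"
        by (simp add: add_right_mono mult_left_mono)
    qed
    moreover have "ennreal (real (card S)) \<le> ennreal C * (?J + ?I)"
    proof -
      have "card S \<le> (\<Sum>m\<in>L. card (Sm m \<times> {m})) + card Sh"
        unfolding S_def by (rule order_trans[OF card_Un_le]) (intro add_right_mono card_UN_le L)
      then have "real (card S) \<le> (\<Sum>m\<in>L. real (card (Sm m))) + real (card Sh)"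
        by (simp add: card_cartesian_product flip: of_nat_sum of_nat_add)
      then have "ennreal (real (card S)) \<le> ennreal ((\<Sum>m\<in>L. real (card (Sm m))) + real (card Sh))" by (rule ennreal_leI)
      also have "\<dots> = (\<Sum>m\<in>L. ennreal (real (card (Sm m)))) + ennreal (real (card Sh))" by (simp add: sum_nonneg)
      also have "\<dots> \<le> (\<Sum>m\<in>L. ennreal (Cm m) * ?J) + 384 * ?I" by (intro add_mono sum_mono SK hi)
      also have "\<dots> = ennreal (\<Sum>m\<in>L. Cm m) * ?J + ennreal 384 * ?I"
        using Cm(1) by (simp add: sum_distrib_right[symmetric])
      also have "\<dots> \<le> ennreal C * ?J + ennreal C * ?I"
        using C0 by (intro add_mono mult_right_mono ennreal_leI) (auto simp: C_def)
      finally show ?thesis by (simp add: distrib_left)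
    qed
    ultimately show "\<exists>S K. functional_bound B V S K \<and> ennreal (real (card S)) \<le> ennreal C * (?J + ?I)" by blast
  qed
qed

section \<open>The magnetic form on test functions\<close>

lemma mode_lincomb:
  assumes u: "u \<in> test_functions" and v: "v \<in> test_functions"
  shows "mode (\<lambda>x. \<alpha> * u x + \<beta> * v x) t m = \<alpha> * mode u t m + \<beta> * mode v t m"
proof -
  let ?u = "\<lambda>\<theta>. u (polar (exp t) \<theta>)" and ?v = "\<lambda>\<theta>. v (polar (exp t) \<theta>)" and ?e = "\<lambda>\<theta>. cis (- of_int m * \<theta>)"
  have c: "continuous_on {0..2*pi} ?u" "continuous_on {0..2*pi} ?v"
    by (intro test_function_polar_continuous u v continuous_intros)+
  have "mode (\<lambda>x. \<alpha> * u x + \<beta> * v x) t m = integral {0..2*pi} (\<lambda>\<theta>. \<alpha> * (?u \<theta> * ?e \<theta>) + \<beta> * (?v \<theta> * ?e \<theta>))"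
    unfolding mode_def fourier_def by (simp only: distrib_right mult.assoc)
  also have "\<dots> = \<alpha> * mode u t m + \<beta> * mode v t m"
    unfolding mode_def fourier_def
    by (subst Henstock_Kurzweil_Integration.integral_add)
       (simp_all only: Henstock_Kurzweil_Integration.integral_mult_right integrable_on_mult_right integrable_fourier c)
  finally show ?thesis .
qed

lemma nn_integral_sq_L2:
  assumes "u \<in> L2" "u \<in> borel_measurable borel"
  shows "(\<integral>\<^sup>+x. sq (u x) \<partial>lborel) = ennreal ((l2_norm u)\<^sup>2)"
proof -
  have i: "integrable lebesgue (\<lambda>x. (norm (u x))\<^sup>2)" using assms by (simp add: L2_def)
  have "(\<integral>\<^sup>+x. sq (u x) \<partial>lborel) = (\<integral>\<^sup>+x. sq (u x) \<partial>lebesgue)"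
    using assms by (simp add: nn_integral_completion)
  also have "\<dots> = ennreal (LINT x|lebesgue. (norm (u x))\<^sup>2)"
    unfolding sq_def using i by (intro nn_integral_eq_integral) auto
  also have "(LINT x|lebesgue. (norm (u x))\<^sup>2) = (l2_norm u)\<^sup>2" by (simp add: l2_norm_def)
  finally show ?thesis .
qed

text \<open>The bound \<open>flux_le\<close> makes the vector potential bounded, so that magnetic
  and ordinary gradients differ by a bounded multiplication.\<close>

locale magnetic_field =
  fixes B :: "real^2 \<Rightarrow> real" and M :: real
  assumes flux_measurable [measurable]: "flux B \<in> borel_measurable borel"
    and flux_le: "0 < r \<Longrightarrow> \<bar>flux B r\<bar> \<le> M * r"
begin

lemma M_nonneg: "0 \<le> M" using flux_le[of 1] by simp

lemma vector_potential_le: "\<bar>vector_potential B x $ j\<bar> \<le> M"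
proof (cases "x = 0")
  case False
  then have r: "0 < norm x" by simp
  define y where "y = (if j = 1 then - (x $ 2) else x $ 1)"
  have y: "\<bar>y\<bar> / norm x \<le> 1"
    using component_le_norm_cart[of x 1] component_le_norm_cart[of x 2] r by (auto simp: y_def divide_le_eq)
  have "vector_potential B x $ j = flux B (norm x) / norm x * (y / norm x)"
    using exhaust_2[of j] by (auto simp: vector_potential_def y_def)
  then have "\<bar>vector_potential B x $ j\<bar> = \<bar>flux B (norm x)\<bar> / norm x * (\<bar>y\<bar> / norm x)"
    by (simp only: abs_mult abs_divide abs_norm_cancel)
  also have "\<dots> \<le> \<bar>flux B (norm x)\<bar> / norm x * 1" by (intro mult_left_mono y) auto
  also have "\<dots> \<le> M" using flux_le[OF r] r by (simp add: field_simps)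
  finally show ?thesis .
next
  case True
  have "vector_potential B x $ j = 0" unfolding vector_potential_def True by simp
  then show ?thesis using M_nonneg by simp
qed

abbreviation grad :: "2 \<Rightarrow> wavefun \<Rightarrow> wavefun" where
  "grad \<equiv> magnetic_grad (vector_potential B)"

lemma grad_measurable: "u \<in> test_functions \<Longrightarrow> grad j u \<in> borel_measurable borel"
  by (rule magnetic_grad_measurable[OF flux_measurable])

lemma norm_grad_le: "norm (grad j u x) \<le> norm (partial j u x) + M * norm (u x)"
proof -
  have "norm (grad j u x) \<le> norm (\<i> * partial j u x) + norm (of_real (vector_potential B x $ j) * u x)"
    unfolding magnetic_grad_def by (rule norm_triangle_ineq)
  also have "\<dots> \<le> norm (partial j u x) + M * norm (u x)"
    using vector_potential_le[of x j] by (auto simp: norm_mult intro!: mult_right_mono)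
  finally show ?thesis .
qed

lemma grad_L2:
  assumes u: "u \<in> test_functions"
  shows "grad j u \<in> L2"
proof -
  note [measurable] = grad_measurable[OF u]
  obtain R where R: "0 < R" "\<And>x. x \<notin> cball 0 R \<Longrightarrow> u x = 0" using test_function_support[OF u] by blast
  obtain C where C: "0 \<le> C" "\<And>x. norm (u x) \<le> C" using test_function_bounded[OF u] by blast
  obtain C' where C': "0 \<le> C'" "\<And>x. norm (partial j u x) \<le> C'" using test_function_bounded[OF partial_test_function[OF u]] by blast
  have b: "norm (grad j u x) \<le> C' + M * C" for x
    using norm_grad_le[of j u x] C'(2)[of x] mult_left_mono[OF C(2)[of x] M_nonneg] by linarith
  have "norm ((norm (grad j u x))\<^sup>2) \<le> (C' + M * C)\<^sup>2" for x using b[of x] by (simp add: power_mono)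
  moreover have "(norm (grad j u x))\<^sup>2 = 0" if "x \<notin> cball 0 R" for x
    using R(2)[OF that] partial_eq_0[OF R(2) that] by (simp add: magnetic_grad_def)
  ultimately have "integrable lebesgue (\<lambda>x. (norm (grad j u x))\<^sup>2)"
    by (intro bounded_support_integrable(2)[where C = "(C' + M * C)\<^sup>2" and R = R]) auto
  then show ?thesis by (auto simp: L2_def intro: measurable_completion)
qed

lemma grad_lincomb:
  assumes "u \<in> test_functions" "v \<in> test_functions"
  shows "grad j (\<lambda>x. \<alpha> * u x + \<beta> * v x) = (\<lambda>x. \<alpha> * grad j u x + \<beta> * grad j v x)"
  using assms by (simp add: magnetic_grad_def fun_eq_iff partial_lincomb test_function_differentiable algebra_simps)

definition kinetic :: "wavefun \<Rightarrow> wavefun \<Rightarrow> complex" where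
  "kinetic u v = (\<Sum>j\<in>UNIV. l2_inner (grad j u) (grad j v))"

definition kinetic_sq :: "wavefun \<Rightarrow> real" where
  "kinetic_sq u = (\<Sum>j\<in>UNIV. (l2_norm (grad j u))\<^sup>2)"

lemma kinetic_self: "u \<in> test_functions \<Longrightarrow> kinetic u u = of_real (kinetic_sq u)"
  by (simp add: kinetic_def kinetic_sq_def l2_inner_self grad_L2)

lemma kinetic_sq_nonneg: "0 \<le> kinetic_sq u"
  by (simp add: kinetic_sq_def sum_nonneg)

lemma nn_integral_energy: "u \<in> test_functions \<Longrightarrow> (\<integral>\<^sup>+x. energy_density B u x \<partial>lborel) = ennreal (kinetic_sq u)"
  unfolding energy_density_def kinetic_sq_def
  using grad_measurable by (subst nn_integral_sum) (auto simp: nn_integral_sq_L2 grad_L2)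

text \<open>The value of a mode at one radius is form bounded with arbitrarily small relative bound:
  it is averaged over a short window. The factor \<open>exp (- 2 * s)\<close> compares the area
  element on the window with one.\<close>

lemma mode_bound:
  assumes \<epsilon>: "0 < \<epsilon>"
  shows "\<exists>C\<ge>0. \<forall>u\<in>test_functions. (norm (mode u s m))\<^sup>2 \<le> \<epsilon> * kinetic_sq u + C * (l2_norm u)\<^sup>2"
proof -
  \<comment> \<open>Chosen so that the factor \<open>2 * h\<close> of \<open>sq_average\<close>
    times the \<open>2 * pi\<close> of \<open>energy_modes\<close> is
    \<open>\<epsilon>\<close>.\<close>
  define h where "h = \<epsilon> / (4 * pi)"
  have h: "0 < h" "2 * h * (2 * pi) = \<epsilon>" using \<epsilon> by (auto simp: h_def)
  define C where "C = 2 / h * (2 * pi * exp (- 2 * s))"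
  have C: "0 \<le> C" using h by (simp add: C_def)
  show ?thesis
  proof (intro exI[of _ C] conjI ballI C)
    fix u assume u: "u \<in> test_functions"
    note cp = mode_c1_pair[OF u, of m]
    have [measurable]: "(\<lambda>t. mode u t m) \<in> borel_measurable borel" "(\<lambda>t. mode_deriv u t m) \<in> borel_measurable borel"
      using c1_pair_measurable[OF cp] by auto
    have ub [measurable]: "u \<in> borel_measurable borel" using u by (rule test_function_measurable)
    let ?E = "\<integral>\<^sup>+x. energy_density B u x \<partial>lborel" and ?N = "\<integral>\<^sup>+x. sq (u x) \<partial>lborel"
    have D: "(\<integral>\<^sup>+t. sq (mode_deriv u t m) \<partial>lborel) \<le> ennreal (2 * pi) * ?E"
      using energy_modes[OF flux_measurable u, of "{m}"] by (auto intro: order_trans[rotated] simp: add_increasing2)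
    have F: "(\<integral>\<^sup>+t\<in>{s..s+h}. sq (mode u t m) \<partial>lborel) \<le> ennreal (2 * pi * exp (- 2 * s)) * ?N"
    proof -
      have "(\<integral>\<^sup>+t\<in>{s..s+h}. sq (mode u t m) \<partial>lborel) \<le>
        (\<integral>\<^sup>+t. ennreal (2 * pi * exp (- 2 * s)) * (ennreal (exp (2 * t)) * (\<integral>\<^sup>+\<theta>\<in>{0..2*pi}. sq (u (polar (exp t) \<theta>)) \<partial>lborel)) \<partial>lborel)"
      proof (rule nn_integral_mono)
        fix t
        show "sq (mode u t m) * indicator {s..s+h} t \<le> ennreal (2 * pi * exp (- 2 * s)) * (ennreal (exp (2 * t)) * (\<integral>\<^sup>+\<theta>\<in>{0..2*pi}. sq (u (polar (exp t) \<theta>)) \<partial>lborel))"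
        proof (cases "t \<in> {s..s+h}")
          case True
          have "continuous_on {0..2*pi} (\<lambda>\<theta>. u (polar (exp t) \<theta>))" by (intro test_function_polar_continuous u continuous_intros)
          from bessel_nn_integral[OF _ this, of "{m}"]
          have "sq (mode u t m) \<le> ennreal (2 * pi) * (\<integral>\<^sup>+\<theta>\<in>{0..2*pi}. sq (u (polar (exp t) \<theta>)) \<partial>lborel)"
            by (simp add: mode_def)
          also have "ennreal (2 * pi) \<le> ennreal (2 * pi * exp (- 2 * s)) * ennreal (exp (2 * t))"
          proof -
            have "1 \<le> exp (- 2 * s) * exp (2 * t)" unfolding exp_add[symmetric] using True by simp
            then have "2 * pi * 1 \<le> 2 * pi * (exp (- 2 * s) * exp (2 * t))" by (intro mult_left_mono) auto
            then have "ennreal (2 * pi) \<le> ennreal (2 * pi * exp (- 2 * s) * exp (2 * t))"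
              by (intro ennreal_leI) (simp add: mult.assoc)
            then show ?thesis by (subst ennreal_mult[symmetric]) auto
          qed
          finally show ?thesis using True by (simp add: mult.assoc mult_right_mono)
        qed simp
      qed
      also have "\<dots> = ennreal (2 * pi * exp (- 2 * s)) * (\<integral>\<^sup>+t. ennreal (exp (2 * t)) * (\<integral>\<^sup>+\<theta>\<in>{0..2*pi}. sq (u (polar (exp t) \<theta>)) \<partial>lborel) \<partial>lborel)"
        by (rule nn_integral_cmult) measurable
      also have "(\<integral>\<^sup>+t. ennreal (exp (2 * t)) * (\<integral>\<^sup>+\<theta>\<in>{0..2*pi}. sq (u (polar (exp t) \<theta>)) \<partial>lborel) \<partial>lborel) = ?N"
        by (rule nn_integral_log_polar[symmetric]) measurable
      finally show ?thesis .
    qed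
    have "sq (mode u s m) \<le> ennreal (2 / h) * (\<integral>\<^sup>+t\<in>{s..s+h}. sq (mode u t m) \<partial>lborel) + ennreal (2 * h) * (\<integral>\<^sup>+t\<in>UNIV. sq (mode_deriv u t m) \<partial>lborel)"
      using h by (intro sq_average[OF cp]) auto
    also have "\<dots> \<le> ennreal (2 / h) * (ennreal (2 * pi * exp (- 2 * s)) * ?N) + ennreal (2 * h) * (ennreal (2 * pi) * ?E)"
      using D F by (intro add_mono mult_left_mono) auto
    also have "\<dots> = ennreal C * ennreal ((l2_norm u)\<^sup>2) + ennreal \<epsilon> * ennreal (kinetic_sq u)"
      unfolding h(2)[symmetric] C_def nn_integral_energy[OF u] nn_integral_sq_L2[OF test_function_L2[OF u] ub]
      using h by (simp add: mult.assoc[symmetric] flip: ennreal_mult)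
    also have "\<dots> = ennreal (\<epsilon> * kinetic_sq u + C * (l2_norm u)\<^sup>2)"
      using C \<epsilon> kinetic_sq_nonneg[of u] by (simp add: ennreal_mult add.commute)
    finally show "(norm (mode u s m))\<^sup>2 \<le> \<epsilon> * kinetic_sq u + C * (l2_norm u)\<^sup>2"
      unfolding sq_def using C \<epsilon> kinetic_sq_nonneg[of u] by (subst (asm) ennreal_le_iff) auto
  qed
qed

end

section \<open>The form with potential\<close>

locale schroedinger = magnetic_field +
  fixes V :: "real^2 \<Rightarrow> real"
  assumes V_measurable [measurable]: "V \<in> borel_measurable borel" and V_nonneg: "0 \<le> V x"
    and V_integrable: "(\<integral>\<^sup>+x. ennreal (V x) \<partial>lborel) < \<infinity>"
begin

definition potential :: "wavefun \<Rightarrow> wavefun \<Rightarrow> complex" where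
  "potential u v = (LINT x|lebesgue. of_real (V x) * (cnj (u x) * v x))"

definition potential_sq :: "wavefun \<Rightarrow> real" where
  "potential_sq u = (LINT x|lebesgue. V x * (norm (u x))\<^sup>2)"

lemma V_integrable_lebesgue: "integrable lebesgue V"
proof -
  have "integrable lborel V" using V_integrable by (intro integrableI_nonneg) (auto simp: V_nonneg)
  then show ?thesis by (subst integrable_completion) auto
qed

lemma potential_integrable:
  assumes u: "u \<in> test_functions" and v: "v \<in> test_functions"
  shows "integrable lebesgue (\<lambda>x. of_real (V x) * (cnj (u x) * v x))"
proof -
  have [measurable]: "u \<in> borel_measurable borel" "v \<in> borel_measurable borel" using u v by (auto intro: test_function_measurable)
  obtain C where C: "0 \<le> C" "\<And>x. norm (u x) \<le> C" using test_function_bounded[OF u] by blast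
  obtain D where D: "0 \<le> D" "\<And>x. norm (v x) \<le> D" using test_function_bounded[OF v] by blast
  show ?thesis
  proof (rule Bochner_Integration.integrable_bound)
    show "integrable lebesgue (\<lambda>x. V x * (C * D))" using V_integrable_lebesgue by simp
    show "(\<lambda>x. of_real (V x) * (cnj (u x) * v x)) \<in> borel_measurable lebesgue"
      by (intro measurable_completion) measurable
    have "norm (of_real (V x) * (cnj (u x) * v x)) \<le> norm (V x * (C * D))" for x
      using C D V_nonneg[of x] by (simp add: norm_mult) (intro mult_left_mono mult_mono, auto)
    then show "AE x in lebesgue. norm (of_real (V x) * (cnj (u x) * v x)) \<le> norm (V x * (C * D))" by simp
  qed
qed

lemma potential_self:
  assumes u: "u \<in> test_functions"
  shows "potential u u = of_real (potential_sq u)" "ennreal (potential_sq u) = (\<integral>\<^sup>+x. ennreal (V x) * sq (u x) \<partial>lborel)" "0 \<le> potential_sq u"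
proof -
  have [measurable]: "u \<in> borel_measurable borel" using u by (rule test_function_measurable)
  have eq: "of_real (V x) * (cnj (u x) * u x) = complex_of_real (V x * (norm (u x))\<^sup>2)" for x
    using complex_norm_square[of "u x"] by (simp add: mult.commute)
  show "potential u u = of_real (potential_sq u)" unfolding potential_def potential_sq_def eq by (rule integral_complex_of_real)
  have "integrable lebesgue (\<lambda>x. complex_of_real (V x * (norm (u x))\<^sup>2))"
    using potential_integrable[OF u u] unfolding eq .
  then have i: "integrable lebesgue (\<lambda>x. V x * (norm (u x))\<^sup>2)" by (simp only: complex_of_real_integrable_eq)
  have "(\<integral>\<^sup>+x. ennreal (V x) * sq (u x) \<partial>lborel) = (\<integral>\<^sup>+x. ennreal (V x) * sq (u x) \<partial>lebesgue)"
    by (simp add: nn_integral_completion)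
  also have "\<dots> = (\<integral>\<^sup>+x. ennreal (V x * (norm (u x))\<^sup>2) \<partial>lebesgue)" by (simp add: sq_def V_nonneg ennreal_mult)
  also have "\<dots> = ennreal (potential_sq u)"
    unfolding potential_sq_def using i by (intro nn_integral_eq_integral) (auto simp: V_nonneg)
  finally show "ennreal (potential_sq u) = (\<integral>\<^sup>+x. ennreal (V x) * sq (u x) \<partial>lborel)" by simp
  show "0 \<le> potential_sq u" unfolding potential_sq_def by (intro integral_nonneg_AE) (simp add: V_nonneg)
qed

lemma schroedinger_form_eq:
  assumes u: "u \<in> test_functions" and v: "v \<in> test_functions"
  shows "schroedinger_form B V u v = kinetic u v - potential u v"
proof -
  have i: "integrable lebesgue (\<lambda>x. cnj (grad j u x) * grad j v x)" for j
    using u v by (intro integrable_l2_inner grad_L2)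
  have "(LINT x|lebesgue. (\<Sum>j\<in>UNIV. cnj (grad j u x) * grad j v x)) = kinetic u v"
    unfolding kinetic_def l2_inner_def by (rule Bochner_Integration.integral_sum) (rule i)
  moreover have "integrable lebesgue (\<lambda>x. \<Sum>j\<in>UNIV. cnj (grad j u x) * grad j v x)"
    by (rule Bochner_Integration.integrable_sum) (rule i)
  ultimately show ?thesis
    unfolding schroedinger_form_def potential_def
    by (subst Bochner_Integration.integral_diff) (auto intro: potential_integrable[OF u v])
qed

abbreviation form :: "wavefun \<Rightarrow> wavefun \<Rightarrow> complex" where
  "form \<equiv> schroedinger_form B V"

lemma form_self: "u \<in> test_functions \<Longrightarrow> Re (form u u) = kinetic_sq u - potential_sq u"
  by (simp add: schroedinger_form_eq kinetic_self potential_self)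

lemma form_linear:
  assumes w: "w \<in> test_functions" and u: "u \<in> test_functions" and v: "v \<in> test_functions"
  shows "form w (\<lambda>x. a * u x + b * v x) = a * form w u + b * form w v"
proof -
  note L = test_function_lincomb[OF u v, of a b]
  have "kinetic w (\<lambda>x. a * u x + b * v x) = a * kinetic w u + b * kinetic w v"
    using w u v by (simp add: kinetic_def grad_lincomb l2.linear_right grad_L2 sum.distrib sum_distrib_left)
  moreover have "potential w (\<lambda>x. a * u x + b * v x) = a * potential w u + b * potential w v"
  proof -
    have "potential w (\<lambda>x. a * u x + b * v x) =
      (LINT x|lebesgue. a * (of_real (V x) * (cnj (w x) * u x)) + b * (of_real (V x) * (cnj (w x) * v x)))"
      unfolding potential_def by (simp add: algebra_simps)
    also have "\<dots> = a * potential w u + b * potential w v"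
      unfolding potential_def using w u v
      by (subst Bochner_Integration.integral_add) (auto intro!: integrable_mult_right potential_integrable)
    finally show ?thesis .
  qed
  ultimately show ?thesis using w u v L by (simp add: schroedinger_form_eq algebra_simps)
qed

lemma form_hermitian:
  assumes u: "u \<in> test_functions" and v: "v \<in> test_functions"
  shows "form v u = cnj (form u v)"
proof -
  have "kinetic v u = cnj (kinetic u v)"
    unfolding kinetic_def cnj_sum using u v by (intro sum.cong refl l2.hermitian grad_L2)
  moreover have "potential v u = cnj (potential u v)"
    unfolding potential_def Bochner_Integration.integral_cnj[symmetric] by (simp add: mult.commute)
  ultimately show ?thesis using u v by (simp add: schroedinger_form_eq)
qed

end

text \<open>A relative bound below one gives semiboundedness and lets the form control the kinetic
  energy. The value 3/4 is half of \<open>1 + 1/2\<close>: the estimate for twice the potential,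
  with half of the kinetic energy spent on the functionals.\<close>

locale relatively_bounded = schroedinger +
  fixes C :: real
  assumes potential_le: "u \<in> test_functions \<Longrightarrow> potential_sq u \<le> 3 / 4 * kinetic_sq u + C * (l2_norm u)\<^sup>2"
begin

lemma kinetic_le: "u \<in> test_functions \<Longrightarrow> kinetic_sq u \<le> 4 * (Re (form u u) + C * (l2_norm u)\<^sup>2)"
  using potential_le[of u] by (simp add: form_self)

lemma semibounded_form_test: "semibounded_form test_functions form \<and> (\<forall>u\<in>test_functions. - C * (l2_norm u)\<^sup>2 \<le> Re (form u u))"
proof -
  have lb: "- C * (l2_norm u)\<^sup>2 \<le> Re (form u u)" if "u \<in> test_functions" for u
    using kinetic_le[OF that] kinetic_sq_nonneg[of u] by simp
  have "test_functions \<subseteq> L2" using test_function_L2 by blast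
  moreover have "test_functions \<noteq> {}" using zero_test_function by blast
  ultimately show ?thesis
    unfolding semibounded_form_def
    using test_function_lincomb form_linear form_hermitian lb by blast
qed

sublocale semibounded test_functions form "- C"
  using semibounded_form_test by unfold_locales auto

lemma kinetic_le_nrm: "u \<in> test_functions \<Longrightarrow> kinetic_sq u \<le> 4 * (nrm u)\<^sup>2"
proof -
  assume u: "u \<in> test_functions"
  have "(nrm u)\<^sup>2 = Re (form u u) + (l2_norm u)\<^sup>2 + C * (l2_norm u)\<^sup>2" using u by (simp add: nrm_sq algebra_simps)
  moreover have "0 \<le> (l2_norm u)\<^sup>2" by simp
  moreover have "k \<le> 4 * n" if "n = a + b + d" "0 \<le> b" "k \<le> 4 * (a + d)" for a b d k n :: real
    using that by simp
  ultimately show ?thesis using kinetic_le[OF u] by blast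
qed

lemma l2_le_nrm_sq: "u \<in> test_functions \<Longrightarrow> (l2_norm u)\<^sup>2 \<le> (nrm u)\<^sup>2"
  using l2_norm_le_nrm[of u] l2.nrm_nonneg[OF test_function_L2, of u] by (simp add: power_mono)

lemma grad_le_nrm: "u \<in> test_functions \<Longrightarrow> l2_norm (grad j u) \<le> 2 * nrm u"
proof (rule power2_le_imp_le)
  assume u: "u \<in> test_functions"
  have "(l2_norm (grad j u))\<^sup>2 \<le> kinetic_sq u"
    unfolding kinetic_sq_def by (rule member_le_sum) auto
  then show "(l2_norm (grad j u))\<^sup>2 \<le> (2 * nrm u)\<^sup>2" using kinetic_le_nrm[OF u] by simp
  show "0 \<le> 2 * nrm u" using nrm_nonneg[OF u] by simp
qed

lemma partial_grad:
  assumes u: "u \<in> test_functions"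
  shows "l2_norm (partial j u) \<le> l2_norm (grad j u) + M * l2_norm u" "l2_norm (grad j u) \<le> l2_norm (partial j u) + M * l2_norm u"
proof -
  let ?a = "\<lambda>x. of_real (vector_potential B x $ j) * u x"
  have aM: "(\<lambda>x. of_real M * u x) \<in> L2" using l2.lincomb[OF test_function_L2[OF u] test_function_L2[OF u], of M 0] by simp
  have p: "(\<lambda>x. \<i> * partial j u x) \<in> L2"
    using l2.lincomb[of "partial j u" "partial j u" \<i> 0] test_function_L2[OF partial_test_function[OF u]] by simp
  have eq: "?a = (\<lambda>x. grad j u x - \<i> * partial j u x)" by (simp add: magnetic_grad_def)
  have a: "?a \<in> L2" unfolding eq by (intro l2.diff_mem grad_L2 u p)
  have le: "l2_norm ?a \<le> M * l2_norm u"
  proof -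
    have "l2_norm ?a \<le> l2_norm (\<lambda>x. of_real M * u x)"
      unfolding l2_norm_def
    proof (intro real_sqrt_le_mono integral_mono)
      show "integrable lebesgue (\<lambda>x. (norm (?a x))\<^sup>2)" "integrable lebesgue (\<lambda>x. (norm (of_real M * u x))\<^sup>2)"
        using a aM by (auto simp: L2_def)
      show "(norm (?a x))\<^sup>2 \<le> (norm (of_real M * u x))\<^sup>2" for x
        using vector_potential_le[of x j] M_nonneg by (intro power_mono) (auto simp: norm_mult intro!: mult_right_mono)
    qed
    also have "\<dots> = M * l2_norm u" using l2.nrm_scale[OF test_function_L2[OF u], of M] M_nonneg by simp
    finally show ?thesis .
  qed
  have pn: "l2_norm (\<lambda>x. \<i> * partial j u x) = l2_norm (partial j u)"
    using l2.nrm_scale[OF test_function_L2[OF partial_test_function[OF u]], of \<i> j] by simp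
  have "l2_norm (grad j u) \<le> l2_norm (\<lambda>x. \<i> * partial j u x) + l2_norm ?a"
    using l2.nrm_triangle[OF p a] by (simp add: magnetic_grad_def[abs_def])
  then show "l2_norm (grad j u) \<le> l2_norm (partial j u) + M * l2_norm u" using pn le by simp
  have "l2_norm (\<lambda>x. \<i> * partial j u x) \<le> l2_norm (grad j u) + l2_norm (\<lambda>x. \<i> * partial j u x - grad j u x)"
    using l2.nrm_le_add_diff[OF p grad_L2[OF u]] by simp
  also have "l2_norm (\<lambda>x. \<i> * partial j u x - grad j u x) = l2_norm ?a"
    unfolding eq using l2.nrm_diff_commute[OF p grad_L2[OF u]] by simp
  finally show "l2_norm (partial j u) \<le> l2_norm (grad j u) + M * l2_norm u" using pn le by simp
qed

lemma partial_diff: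
  "u \<in> test_functions \<Longrightarrow> v \<in> test_functions \<Longrightarrow> partial j (\<lambda>x. u x - v x) = (\<lambda>x. partial j u x - partial j v x)"
  using partial_lincomb[of u _ v j 1 "-1"] by (simp add: fun_eq_iff test_function_differentiable)

text \<open>A sequence that is Cauchy in the form norm has Cauchy partial derivatives in L2, since
  the form norm bounds the kinetic energy and the vector potential is bounded.
  \<open>partial_closability\<close> sends them to zero, and the magnetic gradients follow.\<close>

sublocale closable_semibounded test_functions form "- C"
proof
  fix U assume U: "cauchy_seq U" and L: "(\<lambda>n. l2_norm (U n)) \<longlonglongrightarrow> 0"
  have mem: "U n \<in> test_functions" for n using U by (rule cauchy_seqD)
  have P: "(\<lambda>n. l2_norm (partial j (U n))) \<longlonglongrightarrow> 0" for j
  proof (rule partial_closability[OF mem L])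
    fix e :: real assume e: "e > 0"
    define d where "d = e / (2 + M)"
    have d: "0 < d" "(2 + M) * d = e" using e M_nonneg by (auto simp: d_def)
    obtain K where K: "\<And>m n. m \<ge> K \<Longrightarrow> n \<ge> K \<Longrightarrow> nrm (\<lambda>x. U m x - U n x) < d"
      using U d(1) unfolding cauchy_seq_def by blast
    show "\<exists>K. \<forall>m\<ge>K. \<forall>n\<ge>K. l2_norm (\<lambda>x. partial j (U m) x - partial j (U n) x) < e"
    proof (intro exI[of _ K] allI impI)
      fix m n assume mn: "K \<le> m" "K \<le> n"
      let ?w = "\<lambda>x. U m x - U n x"
      have w: "?w \<in> test_functions" by (intro diff_mem mem)
      have "l2_norm (partial j ?w) \<le> l2_norm (grad j ?w) + M * l2_norm ?w" by (rule partial_grad[OF w])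
      also have "\<dots> \<le> 2 * nrm ?w + M * nrm ?w"
        using grad_le_nrm[OF w] mult_left_mono[OF l2_norm_le_nrm[OF w] M_nonneg] by (intro add_mono)
      also have "\<dots> = (2 + M) * nrm ?w" by (simp add: distrib_right)
      also have "\<dots> < (2 + M) * d" using K[OF mn] M_nonneg by (intro mult_strict_left_mono) auto
      finally show "l2_norm (\<lambda>x. partial j (U m) x - partial j (U n) x) < e"
        using d by (simp add: partial_diff mem)
    qed
  qed
  have G: "(\<lambda>n. l2_norm (grad j (U n))) \<longlonglongrightarrow> 0" for j
  proof (rule tendsto_sandwich[OF _ _ tendsto_const])
    show "(\<lambda>n. l2_norm (partial j (U n)) + M * l2_norm (U n)) \<longlonglongrightarrow> 0"
      using tendsto_add[OF P tendsto_mult_right_zero[OF L, of M]] by simp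
    show "\<forall>\<^sub>F n in sequentially. l2_norm (grad j (U n)) \<le> l2_norm (partial j (U n)) + M * l2_norm (U n)"
      using partial_grad(2)[OF mem] by simp
    show "\<forall>\<^sub>F n in sequentially. 0 \<le> l2_norm (grad j (U n))"
      using l2.nrm_nonneg[OF grad_L2[OF mem]] by simp
  qed
  have lim: "(\<lambda>n. kinetic_sq (U n) + (1 - - C) * (l2_norm (U n))\<^sup>2) \<longlonglongrightarrow> (\<Sum>j\<in>(UNIV::2 set). 0\<^sup>2) + (1 - - C) * 0\<^sup>2"
    unfolding kinetic_sq_def by (intro tendsto_intros G L)
  have "(\<lambda>n. (nrm (U n))\<^sup>2) \<longlonglongrightarrow> 0"
  proof (rule tendsto_sandwich[OF _ _ tendsto_const])
    show "(\<lambda>n. kinetic_sq (U n) + (1 - - C) * (l2_norm (U n))\<^sup>2) \<longlonglongrightarrow> 0" using lim by simp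
    \<comment> \<open>The potential term enters with a negative sign and can be discarded.\<close>
    have "(nrm (U n))\<^sup>2 \<le> kinetic_sq (U n) + (1 - - C) * (l2_norm (U n))\<^sup>2" for n
      using potential_self(3)[OF mem[of n]] by (simp add: nrm_sq mem form_self)
    then show "\<forall>\<^sub>F n in sequentially. (nrm (U n))\<^sup>2 \<le> kinetic_sq (U n) + (1 - - C) * (l2_norm (U n))\<^sup>2" by simp
  qed simp
  from tendsto_real_sqrt[OF this] show "(\<lambda>n. nrm (U n)) \<longlonglongrightarrow> 0"
    by (simp add: nrm_nonneg mem)
qed

text \<open>\<open>mode_bound\<close> makes the modes at the points of \<open>S\<close> continuous
  in the form norm, and \<open>functional_bound\<close> is the lower bound demanded by
  \<open>num_eigenvalues_below_le\<close>.\<close>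

lemma num_eigenvalues_le_card:
  assumes fb: "functional_bound B (\<lambda>x. ennreal (V x)) S K"
  shows "num_eigenvalues_below (magnetic_schroedinger B V) 0 \<le> of_nat (card S)"
proof -
  have S: "finite S" "0 \<le> K" using fb by (auto simp: functional_bound_def)
  have "\<forall>p. \<exists>D. 0 \<le> D \<and> (\<forall>u\<in>test_functions. (norm (mode u (fst p) (snd p)))\<^sup>2 \<le> kinetic_sq u + D * (l2_norm u)\<^sup>2)"
    using mode_bound[of 1] by simp
  from choice[OF this] obtain D where D: "\<And>p. 0 \<le> D p"
    "\<And>p u. u \<in> test_functions \<Longrightarrow> (norm (mode u (fst p) (snd p)))\<^sup>2 \<le> kinetic_sq u + D p * (l2_norm u)\<^sup>2"
    by blast
  define K1 where "K1 = sqrt (4 + (\<Sum>p\<in>S. D p))"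
  have K1: "0 \<le> K1" "K1\<^sup>2 = 4 + (\<Sum>p\<in>S. D p)" using D by (auto simp: K1_def sum_nonneg add_nonneg_nonneg)
  show ?thesis
    unfolding magnetic_schroedinger_def
  proof (rule num_eigenvalues_below_le[OF S(1), where l = "\<lambda>p u. mode u (fst p) (snd p)" and ?K1.0 = K1 and ?K2.0 = K])
    show "mode (\<lambda>x. \<alpha> * u x + \<beta> * v x) (fst p) (snd p) = \<alpha> * mode u (fst p) (snd p) + \<beta> * mode v (fst p) (snd p)"
      if "u \<in> test_functions" "v \<in> test_functions" for p u v \<alpha> \<beta>
      using that by (rule mode_lincomb)
    show "norm (mode u (fst p) (snd p)) \<le> K1 * nrm u" if p: "p \<in> S" and u: "u \<in> test_functions" for p u
    proof (rule power2_le_imp_le)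
      have "(norm (mode u (fst p) (snd p)))\<^sup>2 \<le> kinetic_sq u + D p * (l2_norm u)\<^sup>2" by (rule D(2)[OF u])
      also have "\<dots> \<le> 4 * (nrm u)\<^sup>2 + (\<Sum>p\<in>S. D p) * (nrm u)\<^sup>2"
        using D(1) p S by (intro add_mono mult_mono kinetic_le_nrm l2_le_nrm_sq u member_le_sum sum_nonneg) auto
      also have "\<dots> = (K1 * nrm u)\<^sup>2" by (simp add: power_mult_distrib K1 distrib_right)
      finally show "(norm (mode u (fst p) (snd p)))\<^sup>2 \<le> (K1 * nrm u)\<^sup>2" .
      show "0 \<le> K1 * nrm u" using K1 nrm_nonneg[OF u] by simp
    qed
    show "- K * (\<Sum>p\<in>S. (norm (mode u (fst p) (snd p)))\<^sup>2) \<le> Re (form u u)" if u: "u \<in> test_functions" for u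
    proof -
      let ?Q = "\<Sum>p\<in>S. (norm (mode u (fst p) (snd p)))\<^sup>2"
      have Q: "0 \<le> ?Q" by (intro sum_nonneg) simp
      have "ennreal (potential_sq u) \<le> ennreal (kinetic_sq u) + ennreal K * (\<Sum>p\<in>S. sq (mode u (fst p) (snd p)))"
        using fb u unfolding functional_bound_def potential_self(2)[OF u] nn_integral_energy[OF u, symmetric] by blast
      also have "\<dots> = ennreal (kinetic_sq u + K * ?Q)"
        using S Q kinetic_sq_nonneg[of u] by (simp add: sq_def ennreal_mult)
      finally have "potential_sq u \<le> kinetic_sq u + K * ?Q"
        using S Q kinetic_sq_nonneg[of u] by (subst (asm) ennreal_le_iff) auto
      then show ?thesis by (simp add: form_self u)
    qed
  qed
qed

end

context schroedinger
begin

text \<open>Doubling the potential leaves kinetic energy to spare; the functionals are absorbed into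
  it by \<open>mode_bound\<close>, at the price of a large multiple of the L2 norm.\<close>

lemma relatively_bounded_ex:
  assumes fb: "functional_bound B (\<lambda>x. ennreal (2 * V x)) S K"
  shows "\<exists>C. relatively_bounded B M V C"
proof -
  have S: "finite S" "0 \<le> K" using fb by (auto simp: functional_bound_def)
  \<comment> \<open>Makes all functionals together cost at most half of the kinetic energy; the
    added one covers \<open>K * card S = 0\<close>.\<close>
  define \<epsilon> where "\<epsilon> = 1 / (2 * (K * card S + 1))"
  have \<epsilon>: "0 < \<epsilon>" using S by (simp add: \<epsilon>_def add_nonneg_pos)
  have \<epsilon>': "K * card S * \<epsilon> \<le> 1 / 2"
  proof -
    have "K * card S * \<epsilon> \<le> (K * card S + 1) * \<epsilon>" using \<epsilon> by (intro mult_right_mono) auto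
    also have "\<dots> = 1 / 2"
    proof -
      have "K * card S + 1 \<noteq> 0" using S by (smt (verit) mult_nonneg_nonneg of_nat_0_le_iff)
      then show ?thesis by (simp add: \<epsilon>_def)
    qed
    finally show ?thesis .
  qed
  have "\<forall>p. \<exists>D. 0 \<le> D \<and> (\<forall>u\<in>test_functions. (norm (mode u (fst p) (snd p)))\<^sup>2 \<le> \<epsilon> * kinetic_sq u + D * (l2_norm u)\<^sup>2)"
    using mode_bound[OF \<epsilon>] by simp
  from choice[OF this] obtain D where D: "\<And>p. 0 \<le> D p"
    "\<And>p u. u \<in> test_functions \<Longrightarrow> (norm (mode u (fst p) (snd p)))\<^sup>2 \<le> \<epsilon> * kinetic_sq u + D p * (l2_norm u)\<^sup>2"
    by blast
  define C where "C = K * (\<Sum>p\<in>S. D p) / 2"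
  have "potential_sq u \<le> 3 / 4 * kinetic_sq u + C * (l2_norm u)\<^sup>2" if u: "u \<in> test_functions" for u
  proof -
    let ?Q = "\<Sum>p\<in>S. (norm (mode u (fst p) (snd p)))\<^sup>2"
    have [measurable]: "u \<in> borel_measurable borel" using u by (rule test_function_measurable)
    have Q: "0 \<le> ?Q" by (intro sum_nonneg) simp
    have "ennreal (2 * potential_sq u) = 2 * ennreal (potential_sq u)" using potential_self(3)[OF u] by (simp add: ennreal_mult)
    also have "\<dots> = (\<integral>\<^sup>+x. 2 * (ennreal (V x) * sq (u x)) \<partial>lborel)"
      unfolding potential_self(2)[OF u] by (rule nn_integral_cmult[symmetric]) measurable
    also have "\<dots> = (\<integral>\<^sup>+x. ennreal (2 * V x) * sq (u x) \<partial>lborel)"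
      by (simp add: ennreal_mult V_nonneg mult.assoc)
    also have "\<dots> \<le> ennreal (kinetic_sq u) + ennreal K * (\<Sum>p\<in>S. sq (mode u (fst p) (snd p)))"
      using fb u unfolding functional_bound_def nn_integral_energy[OF u, symmetric] by blast
    also have "\<dots> = ennreal (kinetic_sq u + K * ?Q)"
      using S Q kinetic_sq_nonneg[of u] by (simp add: sq_def ennreal_mult)
    finally have "2 * potential_sq u \<le> kinetic_sq u + K * ?Q"
      using S Q kinetic_sq_nonneg[of u] by (subst (asm) ennreal_le_iff) auto
    also have "K * ?Q \<le> K * (\<Sum>p\<in>S. \<epsilon> * kinetic_sq u + D p * (l2_norm u)\<^sup>2)"
      using S by (intro mult_left_mono sum_mono D u) auto
    also have "\<dots> = (K * card S * \<epsilon>) * kinetic_sq u + 2 * C * (l2_norm u)\<^sup>2"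
      by (simp add: sum.distrib sum_distrib_right[symmetric] C_def algebra_simps)
    also have "(K * card S * \<epsilon>) * kinetic_sq u \<le> 1 / 2 * kinetic_sq u"
      by (intro mult_right_mono \<epsilon>' kinetic_sq_nonneg)
    finally show ?thesis by simp
  qed
  then show ?thesis by (intro exI[of _ C]) unfold_locales
qed

end

section \<open>Radial integration\<close>

lemma nn_integral_polar:
  fixes f :: "real^2 \<Rightarrow> ennreal"
  assumes [measurable]: "f \<in> borel_measurable borel"
  shows "(\<integral>\<^sup>+x. f x \<partial>lborel) = (\<integral>\<^sup>+r\<in>{0<..}. (ennreal r * (\<integral>\<^sup>+\<theta>\<in>{0..2*pi}. f (polar r \<theta>) \<partial>lborel)) \<partial>lborel)"
proof -
  have "(\<integral>\<^sup>+r\<in>{0<..}. (ennreal r * (\<integral>\<^sup>+\<theta>\<in>{0..2*pi}. f (polar r \<theta>) \<partial>lborel)) \<partial>lborel) =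
    (\<integral>\<^sup>+t. ennreal (exp t) * (\<integral>\<^sup>+\<theta>\<in>{0..2*pi}. f (polar (exp t) \<theta>) \<partial>lborel) * ennreal (exp t) \<partial>lborel)"
    by (rule nn_integral_exp_substitution) measurable
  also have "\<dots> = (\<integral>\<^sup>+t. ennreal (exp (2 * t)) * (\<integral>\<^sup>+\<theta>\<in>{0..2*pi}. f (polar (exp t) \<theta>) \<partial>lborel) \<partial>lborel)"
  proof (rule nn_integral_cong)
    fix t :: real
    have "ennreal (exp (2 * t)) = ennreal (exp t) * ennreal (exp t)"
      by (simp add: exp_double power2_eq_square ennreal_mult)
    then show "ennreal (exp t) * (\<integral>\<^sup>+\<theta>\<in>{0..2*pi}. f (polar (exp t) \<theta>) \<partial>lborel) * ennreal (exp t) =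
      ennreal (exp (2 * t)) * (\<integral>\<^sup>+\<theta>\<in>{0..2*pi}. f (polar (exp t) \<theta>) \<partial>lborel)"
      by (simp only: ac_simps)
  qed
  finally show ?thesis unfolding nn_integral_log_polar[OF assms] by simp
qed

text \<open>Fubini in polar coordinates: a null set meets almost every circle in a null set.\<close>

lemma AE_polar:
  assumes "AE x in lborel. P (x :: real^2)"
  shows "AE r in lborel. 0 < r \<longrightarrow> (AE \<theta> in lborel. \<theta> \<in> {0..2*pi} \<longrightarrow> P (polar r \<theta>))"
proof -
  obtain N where N': "{x \<in> space lborel. \<not> P x} \<subseteq> N" "emeasure lborel N = 0" "N \<in> sets lborel"
    using assms by (rule AE_E)
  have N: "{x. \<not> P x} \<subseteq> N" "N \<in> null_sets lborel" using N' by (simp_all add: null_setsI)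
  have [measurable]: "N \<in> sets borel" using N' by simp
  have "(\<integral>\<^sup>+x. indicator N x \<partial>lborel) = 0" using N(2) by (simp add: null_setsD1)
  then have "AE r in lborel. ennreal r * (\<integral>\<^sup>+\<theta>\<in>{0..2*pi}. indicator N (polar r \<theta>) \<partial>lborel) * indicator {0<..} r = 0"
    by (subst (asm) nn_integral_polar) (auto simp: nn_integral_0_iff_AE)
  then show ?thesis
  proof eventually_elim
    case (elim r)
    show ?case
    proof
      assume "0 < r"
      then have "(\<integral>\<^sup>+\<theta>\<in>{0..2*pi}. indicator N (polar r \<theta>) \<partial>lborel) = 0" using elim by simp
      then have "AE \<theta> in lborel. indicator N (polar r \<theta>) * indicator {0..2*pi} \<theta> = (0::ennreal)"
        by (subst (asm) nn_integral_0_iff_AE) auto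
      then show "AE \<theta> in lborel. \<theta> \<in> {0..2*pi} \<longrightarrow> P (polar r \<theta>)"
        by eventually_elim (use N(1) in \<open>auto simp: indicator_def split: if_splits\<close>)
    qed
  qed
qed

lemma nn_integral_radial:
  fixes h :: "real \<Rightarrow> ennreal"
  assumes [measurable]: "h \<in> borel_measurable borel"
  shows "(\<integral>\<^sup>+x. h (norm (x :: real^2)) \<partial>lborel) = ennreal (2 * pi) * (\<integral>\<^sup>+r\<in>{0<..}. (ennreal r * h r) \<partial>lborel)"
proof -
  have inner: "(\<integral>\<^sup>+\<theta>\<in>{0..2*pi}. c \<partial>lborel) = c * ennreal (2 * pi)" for c
    by (simp add: nn_integral_cmult_indicator)
  have "(\<integral>\<^sup>+x. h (norm (x :: real^2)) \<partial>lborel) = (\<integral>\<^sup>+r. ennreal r * (h \<bar>r\<bar> * ennreal (2 * pi)) * indicator {0<..} r \<partial>lborel)"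
    by (subst nn_integral_polar) (simp_all only: norm_polar inner, measurable)
  also have "\<dots> = (\<integral>\<^sup>+r. ennreal (2 * pi) * (ennreal r * h r * indicator {0<..} r) \<partial>lborel)"
    by (intro nn_integral_cong) (auto simp: indicator_def ac_simps)
  also have "\<dots> = ennreal (2 * pi) * (\<integral>\<^sup>+r. ennreal r * h r * indicator {0<..} r \<partial>lborel)"
    by (rule nn_integral_cmult) measurable
  finally show ?thesis .
qed

lemma AE_norm:

  assumes "AE r in lborel. 0 < r \<longrightarrow> P r"
  shows "AE x in lborel. x \<noteq> 0 \<longrightarrow> P (norm (x :: real^2))"
proof -
  obtain N where N': "{r \<in> space lborel. \<not> (0 < r \<longrightarrow> P r)} \<subseteq> N" "emeasure lborel N = 0" "N \<in> sets lborel"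
    using assms by (rule AE_E)
  have N: "{r. \<not> (0 < r \<longrightarrow> P r)} \<subseteq> N" "N \<in> null_sets lborel" using N' by (simp_all add: null_setsI)
  have [measurable]: "N \<in> sets borel" using N' by simp
  have "AE r in lborel. ennreal r * indicator N r * indicator {0<..} r = 0"
    using AE_not_in[OF N(2)] by eventually_elim (auto simp: indicator_def)
  then have "(\<integral>\<^sup>+x. indicator N (norm (x :: real^2)) \<partial>lborel) = 0"
    by (subst nn_integral_radial) (auto simp: nn_integral_0_iff_AE)
  then have "AE x in lborel. indicator N (norm (x :: real^2)) = (0::ennreal)"
    by (subst (asm) nn_integral_0_iff_AE) auto
  then show ?thesis
  proof eventually_elim
    case (elim x)
    then have "norm x \<notin> N" by (auto simp: indicator_def split: if_splits)
    then show ?case using N(1) zero_less_norm_iff[of x] by blast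
  qed
qed

lemma integral_radial:
  fixes h :: "real \<Rightarrow> real"
  assumes [measurable]: "h \<in> borel_measurable borel" and i: "integrable lborel (\<lambda>r. r * h r)" and z: "\<And>r. r \<le> 0 \<Longrightarrow> h r = 0"
  shows "integrable lborel (\<lambda>x::real^2. h (norm x))" "(LINT x|lborel. h (norm (x :: real^2))) = 2 * pi * (LINT r|lborel. r * h r)"
proof -
  have eq: "(\<integral>\<^sup>+x. ennreal (g (norm (x :: real^2))) \<partial>lborel) = ennreal (2 * pi) * (\<integral>\<^sup>+r. ennreal (r * g r) \<partial>lborel)"
    if [measurable]: "g \<in> borel_measurable borel" and g: "\<And>r. r \<le> 0 \<Longrightarrow> g r = 0" for g :: "real \<Rightarrow> real"
  proof -
    have "ennreal r * ennreal (g r) * indicator {0<..} r = ennreal (r * g r)" for r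
      using g[of r] by (auto simp: indicator_def ennreal_mult')
    then show ?thesis by (subst nn_integral_radial) simp_all
  qed
  have E: "(\<integral>\<^sup>+x. ennreal (norm (h (norm (x :: real^2)))) \<partial>lborel) = ennreal (2 * pi) * (\<integral>\<^sup>+r. ennreal (r * \<bar>h r\<bar>) \<partial>lborel)"
    using eq[of "\<lambda>r. \<bar>h r\<bar>"] z by simp

  have "(\<integral>\<^sup>+r. ennreal (r * \<bar>h r\<bar>) \<partial>lborel) \<le> (\<integral>\<^sup>+r. ennreal (norm (r * h r)) \<partial>lborel)"
    by (intro nn_integral_mono ennreal_leI) (simp add: abs_mult mult_right_mono)
  also have "\<dots> < \<infinity>" using i by (simp add: integrable_iff_bounded)
  finally have "(\<integral>\<^sup>+x. ennreal (norm (h (norm (x :: real^2)))) \<partial>lborel) < \<infinity>"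
    unfolding E by (simp add: ennreal_mult_less_top)
  then show ih: "integrable lborel (\<lambda>x::real^2. h (norm x))"
    by (intro integrableI_bounded) simp_all
  have "(\<integral>\<^sup>+x. ennreal (- h (norm (x :: real^2))) \<partial>lborel) = ennreal (2 * pi) * (\<integral>\<^sup>+r. ennreal (- (r * h r)) \<partial>lborel)"
    using eq[of "\<lambda>r. - h r"] z by simp
  then show "(LINT x|lborel. h (norm (x :: real^2))) = 2 * pi * (LINT r|lborel. r * h r)"
    unfolding real_lebesgue_integral_def[OF ih] real_lebesgue_integral_def[OF i]
    by (simp add: eq z enn2real_mult right_diff_distrib)
qed

lemma borel_measurable_lebesgue_AE:
  fixes f g :: "'a::euclidean_space \<Rightarrow> 'b::topological_space"
  assumes ae: "AE x in lebesgue. f x = g x" and f: "f \<in> borel_measurable lebesgue"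
  shows "g \<in> borel_measurable lebesgue"
proof (rule measurableI)
  fix A :: "'b set" assume A: "A \<in> sets borel"

  show "g -` A \<inter> space lebesgue \<in> sets lebesgue"
  proof (rule completion.in_sets_AE)
    show "AE x in lebesgue. x \<in> f -` A \<inter> space lebesgue \<longleftrightarrow> x \<in> g -` A \<inter> space lebesgue"
      using ae by eventually_elim auto
    show "f -` A \<inter> space lebesgue \<in> sets lebesgue" using f A by (rule measurable_sets)
  qed auto
qed simp

text \<open>In a complete measure, measurability is invariant under equality almost everywhere, and
  if it fails both integrals are zero by convention. Hence forms can be compared on arbitrary
  arguments.\<close>

lemma integral_lebesgue_AE_cong:
  fixes f g :: "'a::euclidean_space \<Rightarrow> 'b::{banach, second_countable_topology}"
  assumes ae: "AE x in lebesgue. f x = g x"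
  shows "(LINT x|lebesgue. f x) = (LINT x|lebesgue. g x)"
proof (cases "f \<in> borel_measurable lebesgue")
  case True
  then show ?thesis using borel_measurable_lebesgue_AE[OF ae True] ae by (intro integral_cong_AE)
next
  case False
  have "AE x in lebesgue. g x = f x" using ae by eventually_elim simp
  then have "g \<notin> borel_measurable lebesgue" using borel_measurable_lebesgue_AE False by blast
  then have "\<not> integrable lebesgue f" "\<not> integrable lebesgue g"
    using False borel_measurable_integrable by blast+
  then show ?thesis by (simp add: not_integrable_integral_eq)
qed

section \<open>The flux\<close>

text \<open>\<open>b\<close> is a Borel version of the radial profile, set to zero on the
  nonpositive half-line so that integrals over the whole line can be used.\<close>

locale radial_field =
  fixes B :: "real^2 \<Rightarrow> real" and b :: "real \<Rightarrow> real"
  assumes b_measurable [measurable]: "b \<in> borel_measurable borel"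
    and b_neg: "r \<le> 0 \<Longrightarrow> b r = 0"
    and b_integrable: "integrable lborel (\<lambda>r. (1 + r) * b r)"
    and B_eq: "AE x in lebesgue. B x = b (norm x)"
begin

definition \<beta> :: "real \<Rightarrow> real" where "\<beta> r = r * b r"

lemma b_int: "integrable lborel b" and \<beta>_int: "integrable lborel \<beta>"
proof -
  have "norm (b r) \<le> norm ((1 + r) * b r)" "norm (r * b r) \<le> norm ((1 + r) * b r)" for r
    using b_neg[of r] by (cases "r \<le> 0"; simp add: abs_mult mult_le_cancel_right1 mult_right_mono)+
  then show "integrable lborel b" "integrable lborel \<beta>"
    unfolding \<beta>_def[abs_def] by (auto intro!: Bochner_Integration.integrable_bound[OF b_integrable] AE_I2)
qed

lemma \<beta>_measurable [measurable]: "\<beta> \<in> borel_measurable borel"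
  unfolding \<beta>_def[abs_def] by measurable

lemma flux_eq: "flux B r = (LINT s|lborel. indicator {..r} s * \<beta> s)"
proof -
  let ?h = "\<lambda>s. indicator {..r} s * b s"
  have i: "integrable lborel (\<lambda>s. s * ?h s)"
    by (rule Bochner_Integration.integrable_bound[OF \<beta>_int]) (auto simp: \<beta>_def indicator_def)
  have "(LINT x:cball 0 r|lebesgue. B x) = (LINT x|lebesgue. ?h (norm (x :: real^2)))"
    unfolding set_lebesgue_integral_def
  proof (rule integral_lebesgue_AE_cong)
    show "AE x in lebesgue. indicator (cball 0 r) x *\<^sub>R B x = ?h (norm x)"
      using B_eq by eventually_elim (auto simp: indicator_def)
  qed
  also have "\<dots> = (LINT x|lborel. ?h (norm (x :: real^2)))" by (rule integral_completion) measurable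
  also have "\<dots> = 2 * pi * (LINT s|lborel. s * ?h s)" by (rule integral_radial(2)[OF _ i]) (auto simp: b_neg)
  finally show ?thesis by (simp add: flux_def \<beta>_def mult.left_commute)
qed

lemma flux_continuous: "continuous_on UNIV (flux B)"
proof (rule continuous_at_imp_continuous_on, rule ballI)
  fix r
  show "isCont (flux B) r"
    unfolding continuous_at_sequentially o_def
  proof (intro allI impI)
    fix x assume x: "x \<longlonglongrightarrow> r"
    show "(\<lambda>n. flux B (x n)) \<longlonglongrightarrow> flux B r"
      unfolding flux_eq
    proof (rule integral_dominated_convergence[where w = "\<lambda>s. \<bar>\<beta> s\<bar>"])
      show "integrable lborel (\<lambda>s. \<bar>\<beta> s\<bar>)" using \<beta>_int by simp
      show "AE s in lborel. (\<lambda>n. indicator {..x n} s * \<beta> s) \<longlonglongrightarrow> indicator {..r} s * \<beta> s"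
        using AE_lborel_singleton[of r]
      proof eventually_elim
        case (elim s)
        have "\<forall>\<^sub>F n in sequentially. indicator {..x n} s = (indicator {..r} s :: real)"
        proof (cases "s < r")
          case True
          from order_tendstoD(1)[OF x True] show ?thesis by eventually_elim (use True in auto)
        next
          case False
          then have "r < s" using elim by simp
          from order_tendstoD(2)[OF x this] show ?thesis by eventually_elim (use \<open>r < s\<close> in auto)
        qed
        then have "\<forall>\<^sub>F n in sequentially. indicator {..x n} s * \<beta> s = indicator {..r} s * \<beta> s"
          by eventually_elim simp
        then show ?case by (rule tendsto_eventually)
      qed
      show "AE s in lborel. norm (indicator {..x n} s * \<beta> s) \<le> \<bar>\<beta> s\<bar>" for n
        by (auto simp: indicator_def)
    qed measurable
  qed
qed

text \<open>The first integral bounds \<open>flux B r / r\<close>, the second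
  \<open>flux B r\<close>; the sum serves both estimates.\<close>

definition M :: real where "M = (LINT s|lborel. \<bar>b s\<bar>) + (LINT s|lborel. \<bar>\<beta> s\<bar>)"

lemma flux_le: "0 < r \<Longrightarrow> \<bar>flux B r\<bar> \<le> M * r" and flux_bounded: "\<bar>flux B r\<bar> \<le> M"
proof -
  have i: "integrable lborel (\<lambda>s. indicator {..r} s * \<beta> s)" for r
    by (rule Bochner_Integration.integrable_bound[OF \<beta>_int]) (auto simp: indicator_def)
  have nn: "0 \<le> (LINT s|lborel. \<bar>b s\<bar>)" "0 \<le> (LINT s|lborel. \<bar>\<beta> s\<bar>)" by (auto intro!: integral_nonneg_AE)
  have "\<bar>flux B r\<bar> \<le> (LINT s|lborel. \<bar>indicator {..r} s * \<beta> s\<bar>)"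
    unfolding flux_eq by (rule integral_abs_bound)
  also have "\<dots> \<le> (LINT s|lborel. \<bar>\<beta> s\<bar>)"
    using i[of r] \<beta>_int by (intro integral_mono) (auto simp: indicator_def)
  finally show "\<bar>flux B r\<bar> \<le> M" unfolding M_def using nn by linarith
  assume r: "0 < r"
  have "\<bar>flux B r\<bar> \<le> (LINT s|lborel. \<bar>indicator {..r} s * \<beta> s\<bar>)"
    unfolding flux_eq by (rule integral_abs_bound)
  also have "\<dots> \<le> (LINT s|lborel. r * \<bar>b s\<bar>)"
  proof (intro integral_mono)
    show "\<bar>indicator {..r} s * \<beta> s\<bar> \<le> r * \<bar>b s\<bar>" for s
      using r b_neg[of s] by (cases "s \<le> 0") (auto simp: indicator_def \<beta>_def abs_mult intro!: mult_right_mono)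
  qed (use i[of r] b_int in auto)
  also have "\<dots> = r * (LINT s|lborel. \<bar>b s\<bar>)" by simp
  also have "\<dots> \<le> M * r" using nn r by (simp add: M_def distrib_left mult.commute)
  finally show "\<bar>flux B r\<bar> \<le> M * r" .
qed

text \<open>The flux is at most \<open>M * r\<close>, so a constant value must be zero. Then all
  integrals of \<open>\<beta>\<close> over \<open>{..r}\<close> vanish, which forces
  \<open>\<beta> = 0\<close> almost everywhere.\<close>

lemma flux_not_constant:
  assumes nz: "\<not> (AE x in lebesgue. B x = 0)"
  shows "\<exists>t. flux B (exp t) \<noteq> c"
proof (rule ccontr)
  assume "\<not> ?thesis"
  then have const: "flux B (exp t) = c" for t by simp
  have const': "flux B r = c" if "0 < r" for r using const[of "ln r"] that by simp
  have M0: "0 \<le> M" using flux_bounded[of 0] by linarith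
  have "c = 0"
  proof (rule ccontr)
    assume c: "c \<noteq> 0"
    define r where "r = \<bar>c\<bar> / 2 / (M + 1)"
    have M1: "M + 1 > 0" using M0 by linarith
    have r: "0 < r" using c M1 by (simp add: r_def)
    have "\<bar>c\<bar> \<le> M * r" using flux_le[OF r] const'[OF r] by simp
    also have "\<dots> \<le> (M + 1) * r" using r by simp
    also have "\<dots> = \<bar>c\<bar> / 2"
    proof -
      have "k * (x / k) = x" if "0 < k" for k x :: real using that by simp
      from this[OF M1] show ?thesis unfolding r_def .
    qed
    finally show False using c by simp
  qed
  have zero: "(LINT s|lborel. indicator {..r} s * \<beta> s) = 0" for r
  proof (cases "0 < r")
    case True
    then show ?thesis using const' \<open>c = 0\<close> by (simp add: flux_eq)
  next
    case False
    then have "indicator {..r} s * \<beta> s = 0" for s by (auto simp: indicator_def \<beta>_def b_neg)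
    then have "(LINT s|lborel. indicator {..r} s * \<beta> s) = (LINT (s::real)|lborel. 0)"
      by (intro Bochner_Integration.integral_cong refl)
    then show ?thesis by simp
  qed
  \<comment> \<open>\<open>ennreal\<close> truncates negative numbers, so the densities are the
    positive and the negative part of \<open>\<beta>\<close>. The vanishing integrals say that
    \<open>P\<close> and \<open>N\<close> have the same distribution function.\<close>
  define P N where "P = density lborel (\<lambda>s. ennreal (\<beta> s))" and "N = density lborel (\<lambda>s. ennreal (- \<beta> s))"
  have fin: "(\<integral>\<^sup>+s. ennreal (\<beta> s) \<partial>lborel) \<noteq> \<infinity>" "(\<integral>\<^sup>+s. ennreal (- \<beta> s) \<partial>lborel) \<noteq> \<infinity>"
    using \<beta>_int by (auto simp: real_integrable_def)
  interpret P: finite_borel_measure P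
  proof (intro finite_borel_measure.intro finite_borel_measure_axioms.intro finite_measureI)
    show "emeasure P (space P) \<noteq> \<infinity>" using fin by (simp add: P_def emeasure_density)
  qed (simp add: P_def)
  interpret N: finite_borel_measure N
  proof (intro finite_borel_measure.intro finite_borel_measure_axioms.intro finite_measureI)
    show "emeasure N (space N) \<noteq> \<infinity>" using fin by (simp add: N_def emeasure_density)
  qed (simp add: N_def)
  have "cdf P = cdf N"
  proof
    fix r
    have i: "integrable lborel (\<lambda>s. indicator {..r} s * \<beta> s)"
      by (rule Bochner_Integration.integrable_bound[OF \<beta>_int]) (auto simp: indicator_def)
    have "emeasure P {..r} = (\<integral>\<^sup>+s. ennreal (indicator {..r} s * \<beta> s) \<partial>lborel)"
      "emeasure N {..r} = (\<integral>\<^sup>+s. ennreal (- (indicator {..r} s * \<beta> s)) \<partial>lborel)"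
      unfolding P_def N_def by (subst emeasure_density; auto intro!: nn_integral_cong simp: indicator_def)+
    moreover have "enn2real (\<integral>\<^sup>+s. ennreal (indicator {..r} s * \<beta> s) \<partial>lborel) = enn2real (\<integral>\<^sup>+s. ennreal (- (indicator {..r} s * \<beta> s)) \<partial>lborel)"
      using zero[of r] real_lebesgue_integral_def[OF i] by simp
    ultimately show "cdf P r = cdf N r" by (simp add: cdf_def2 measure_def)
  qed
  then have "P = N" using cdf_unique'[OF P.finite_borel_measure_axioms N.finite_borel_measure_axioms] by simp
  then have "density lborel (\<lambda>s. ennreal (\<beta> s)) = density lborel (\<lambda>s. ennreal (- \<beta> s))" by (simp add: P_def N_def)
  then have "AE s in lborel. ennreal (\<beta> s) = ennreal (- \<beta> s)"
    by (rule sigma_finite_measure.density_unique[OF sigma_finite_lborel, rotated 2]) measurable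
  then have "AE s in lborel. 0 < s \<longrightarrow> b s = 0"
  proof eventually_elim
    case (elim s)
    \<comment> \<open>One of the two sides is zero by truncation, hence both are.\<close>
    then have "\<beta> s = 0" by (cases "0 \<le> \<beta> s") (auto simp: ennreal_neg ennreal_eq_0_iff dest: sym)
    then show ?case by (auto simp: \<beta>_def)
  qed
  then have "AE x in lborel. x \<noteq> 0 \<longrightarrow> b (norm (x :: real^2)) = 0" by (rule AE_norm)
  then have "AE x in lebesgue. x \<noteq> 0 \<longrightarrow> b (norm (x :: real^2)) = 0" by (rule AE_completion)
  then have "AE x in lebesgue. B x = 0"
    using B_eq by eventually_elim (auto simp: b_neg)
  then show False using nz by simp
qed

end

lemma radial_eq_profile: "radial F \<Longrightarrow> F x = profile F (norm x)"
  unfolding radial_def profile_def by (metis abs_norm_cancel norm_polar)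

text \<open>A Borel version of the weighted profile is divided by the positive weight
  \<open>1 + r\<close>; \<open>AE_norm\<close> carries the exceptional null set of radii to the
  plane.\<close>

lemma radial_field_ex:
  assumes rad: "radial B" and int: "set_integrable lebesgue {0<..} (\<lambda>r. (1 + r) * profile B r)"
  shows "\<exists>b. radial_field B b"
proof -
  have i: "integrable lebesgue (\<lambda>r. indicator {0<..} r * ((1 + r) * profile B r))"
    using int by (simp add: set_integrable_def)
  obtain g where g [measurable]: "g \<in> borel_measurable lborel"
    and ae: "AE r in lborel. indicator {0<..} r * ((1 + r) * profile B r) = g r"
    using completion_ex_borel_measurable_real[OF borel_measurable_integrable[OF i]] by blast
  define b where "b r = (if 0 < r then g r / (1 + r) else 0)" for r
  have [measurable]: "b \<in> borel_measurable borel" unfolding b_def[abs_def] using g by measurable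
  have ae1: "AE r in lborel. indicator {0<..} r * ((1 + r) * profile B r) = (1 + r) * b r"
    using ae by eventually_elim (auto simp: b_def indicator_def)
  have "integrable lebesgue (\<lambda>r. (1 + r) * b r)"
  proof (rule integrable_cong_AE_imp[OF i])
    show "(\<lambda>r. (1 + r) * b r) \<in> borel_measurable lebesgue" by (rule measurable_completion) measurable
    show "AE r in lebesgue. indicator {0<..} r * ((1 + r) * profile B r) = (1 + r) * b r" by (rule AE_completion[OF ae1])
  qed
  then have "integrable lborel (\<lambda>r. (1 + r) * b r)" by (subst (asm) integrable_completion) auto
  moreover have "AE x in lebesgue. B x = b (norm x)"
  proof -
    have "AE r in lborel. 0 < r \<longrightarrow> profile B r = b r"
      using ae1 by eventually_elim auto
    from AE_completion[OF AE_norm[OF this]] AE_completion[OF AE_lborel_singleton[of "0::real^2"]]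
    show ?thesis by eventually_elim (simp add: radial_eq_profile[OF rad])
  qed
  ultimately have "radial_field B b" by unfold_locales (auto simp: b_def)
  then show ?thesis by blast
qed

section \<open>The angular supremum of the potential\<close>

definition angular_sup :: "(real^2 \<Rightarrow> real) \<Rightarrow> real \<Rightarrow> ennreal" where
  "angular_sup V r = esssup (lebesgue_on {0..2*pi}) (\<lambda>\<theta>. ennreal \<bar>V (polar r \<theta>)\<bar>)"

lemma AE_lebesgue_on_circle:
  "(AE \<theta> in lebesgue_on {0..2*pi}. P \<theta>) \<longleftrightarrow> (AE \<theta> in lborel. \<theta> \<in> {0..2*pi} \<longrightarrow> P \<theta>)"
  by (subst AE_restrict_space_iff) (auto simp: AE_completion_iff)

lemma angular_section_measurable:
  assumes [measurable]: "V \<in> borel_measurable borel"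
  shows "(\<lambda>\<theta>. ennreal \<bar>V (polar r \<theta>)\<bar>) \<in> borel_measurable (lebesgue_on {0..2*pi})"
  by (intro measurable_restrict_space1 measurable_completion) measurable

lemma angular_sup_le_iff:
  assumes V: "V \<in> borel_measurable borel"
  shows "angular_sup V r \<le> c \<longleftrightarrow> (AE \<theta> in lborel. \<theta> \<in> {0..2*pi} \<longrightarrow> ennreal \<bar>V (polar r \<theta>)\<bar> \<le> c)"
proof
  assume le: "angular_sup V r \<le> c"
  have "AE \<theta> in lebesgue_on {0..2*pi}. ennreal \<bar>V (polar r \<theta>)\<bar> \<le> angular_sup V r"
    unfolding angular_sup_def by (rule esssup_AE)
  then have "AE \<theta> in lebesgue_on {0..2*pi}. ennreal \<bar>V (polar r \<theta>)\<bar> \<le> c"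
    by eventually_elim (use le in \<open>auto intro: order_trans\<close>)
  then show "AE \<theta> in lborel. \<theta> \<in> {0..2*pi} \<longrightarrow> ennreal \<bar>V (polar r \<theta>)\<bar> \<le> c"
    by (simp only: AE_lebesgue_on_circle)
next
  assume "AE \<theta> in lborel. \<theta> \<in> {0..2*pi} \<longrightarrow> ennreal \<bar>V (polar r \<theta>)\<bar> \<le> c"
  then have "AE \<theta> in lebesgue_on {0..2*pi}. ennreal \<bar>V (polar r \<theta>)\<bar> \<le> c"
    by (simp only: AE_lebesgue_on_circle)
  then show "angular_sup V r \<le> c"
    unfolding angular_sup_def by (intro esssup_I angular_section_measurable V)
qed

text \<open>A sublevel set is the set of radii at which a parameter integral vanishes, and such
  integrals depend measurably on the parameter.\<close>

lemma angular_sup_measurable [measurable]: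
  assumes V [measurable]: "V \<in> borel_measurable borel"
  shows "angular_sup V \<in> borel_measurable borel"
proof (rule borel_measurableI_le)
  fix c
  have "angular_sup V r \<le> c \<longleftrightarrow> (\<integral>\<^sup>+\<theta>. (if c < ennreal \<bar>V (polar r \<theta>)\<bar> then indicator {0..2*pi} \<theta> else 0) \<partial>lborel) = 0" for r
    unfolding angular_sup_le_iff[OF V]
    by (subst nn_integral_0_iff_AE) (auto intro!: arg_cong[where f = "\<lambda>P. AE x in lborel. P x"] simp: fun_eq_iff indicator_def not_less)
  then have "{r \<in> space borel. angular_sup V r \<le> c} =
    {r \<in> space borel. (\<integral>\<^sup>+\<theta>. (if c < ennreal \<bar>V (polar r \<theta>)\<bar> then indicator {0..2*pi} \<theta> else 0) \<partial>lborel) = 0}"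
    by simp
  also have "\<dots> \<in> sets borel" by measurable
  finally show "{r \<in> space borel. angular_sup V r \<le> c} \<in> sets borel" .
qed

text \<open>Only an inequality is claimed: if the section of \<open>V\<close> is not measurable, its
  \<open>esssup\<close> is infinite by convention while that of the Borel version need not
  be.\<close>

lemma angular_sup_AE_le:
  assumes V': "V' \<in> borel_measurable borel"
    and eq: "AE \<theta> in lborel. \<theta> \<in> {0..2*pi} \<longrightarrow> V (polar r \<theta>) = V' (polar r \<theta>)"
  shows "angular_sup V' r \<le> angular_sup V r"
proof (cases "(\<lambda>\<theta>. ennreal \<bar>V (polar r \<theta>)\<bar>) \<in> borel_measurable (lebesgue_on {0..2*pi})")
  case True
  have "AE \<theta> in lebesgue_on {0..2*pi}. ennreal \<bar>V' (polar r \<theta>)\<bar> \<le> ennreal \<bar>V (polar r \<theta>)\<bar>"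
    unfolding AE_lebesgue_on_circle using eq by eventually_elim simp
  then show ?thesis unfolding angular_sup_def by (intro esssup_AE_mono angular_section_measurable V')
next
  case False
  then show ?thesis by (simp add: angular_sup_def esssup_non_measurable)
qed

lemma borel_version:
  assumes V: "V \<in> borel_measurable lebesgue" and nn: "AE x in lebesgue. 0 \<le> V x"
  obtains V' :: "real^2 \<Rightarrow> real" where "V' \<in> borel_measurable borel" "\<And>x. 0 \<le> V' x" "AE x in lborel. V x = V' x"
proof -
  obtain g where g: "g \<in> borel_measurable lborel" "AE x in lborel. V x = g x"
    using completion_ex_borel_measurable_real[OF V] by blast
  have "AE x in lborel. 0 \<le> V x" using nn by (simp only: AE_completion_iff)
  then have "AE x in lborel. V x = max 0 (g x)" using g(2) by eventually_elim simp
  moreover have "(\<lambda>x. max 0 (g x)) \<in> borel_measurable borel" using g(1) by simp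
  ultimately show ?thesis by (intro that[of "\<lambda>x. max 0 (g x)"]) auto
qed

text \<open>For Borel \<open>V\<close> this is \<open>L1_Linfty_norm\<close> in the variable
  \<open>t = ln r\<close>.\<close>

definition radial_mass :: "(real^2 \<Rightarrow> real) \<Rightarrow> ennreal" where
  "radial_mass V = (\<integral>\<^sup>+t. ennreal (exp (2 * t)) * angular_sup V (exp t) \<partial>lborel)"

lemma radial_mass_eq:
  assumes [measurable]: "V \<in> borel_measurable borel"
  shows "radial_mass V = (\<integral>\<^sup>+r\<in>{0<..}. (angular_sup V r * ennreal r) \<partial>lborel)"
proof -
  have "(\<integral>\<^sup>+r\<in>{0<..}. (angular_sup V r * ennreal r) \<partial>lborel) = (\<integral>\<^sup>+t. angular_sup V (exp t) * ennreal (exp t) * ennreal (exp t) \<partial>lborel)"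
    by (rule nn_integral_exp_substitution) measurable
  also have "\<dots> = radial_mass V"
    unfolding radial_mass_def
  proof (rule nn_integral_cong)
    fix t :: real
    have "ennreal (exp (2 * t)) = ennreal (exp t) * ennreal (exp t)"
      by (simp add: exp_double power2_eq_square ennreal_mult)
    then show "angular_sup V (exp t) * ennreal (exp t) * ennreal (exp t) = ennreal (exp (2 * t)) * angular_sup V (exp t)"
      by (simp only: ac_simps)
  qed
  finally show ?thesis by simp
qed

lemma radial_mass_le_L1_Linfty:
  assumes V' [measurable]: "V' \<in> borel_measurable borel" and eq: "AE x in lborel. V x = V' x"
  shows "radial_mass V' \<le> L1_Linfty_norm V"
proof -
  have "AE r in lborel. angular_sup V' r * ennreal r * indicator {0<..} r \<le> angular_sup V r * ennreal r * indicator {0<..} r"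
    using AE_polar[OF eq]
  proof eventually_elim
    case (elim r)
    then show ?case using angular_sup_AE_le[OF V', of V r] by (auto simp: indicator_def intro!: mult_right_mono)
  qed
  then have "(\<integral>\<^sup>+r\<in>{0<..}. (angular_sup V' r * ennreal r) \<partial>lborel) \<le> (\<integral>\<^sup>+r\<in>{0<..}. (angular_sup V r * ennreal r) \<partial>lborel)"
    by (rule nn_integral_mono_AE)
  then show ?thesis
    by (simp add: radial_mass_eq L1_Linfty_norm_def angular_sup_def nn_integral_completion)
qed

text \<open>The logarithmic weight vanishes on the unit circle; this supplies the constant in the
  weight \<open>1 + |ln |x||\<close>.\<close>

lemma nn_integral_le_radial_mass:
  assumes V [measurable]: "V \<in> borel_measurable borel" and nn: "\<And>x. 0 \<le> V x"
  shows "(\<integral>\<^sup>+x. ennreal (V x) \<partial>lborel) \<le> ennreal (2 * pi) * radial_mass V"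
proof -
  have "(\<integral>\<^sup>+\<theta>\<in>{0..2*pi}. ennreal (V (polar r \<theta>)) \<partial>lborel) \<le> ennreal (2 * pi) * angular_sup V r" for r
  proof -
    have "AE \<theta> in lborel. \<theta> \<in> {0..2*pi} \<longrightarrow> ennreal \<bar>V (polar r \<theta>)\<bar> \<le> angular_sup V r"
      using angular_sup_le_iff[OF V, of r "angular_sup V r"] by simp
    then have "AE \<theta> in lborel. ennreal (V (polar r \<theta>)) * indicator {0..2*pi} \<theta> \<le> angular_sup V r * indicator {0..2*pi} \<theta>"
      by eventually_elim (auto simp: indicator_def nn)
    then have "(\<integral>\<^sup>+\<theta>\<in>{0..2*pi}. ennreal (V (polar r \<theta>)) \<partial>lborel) \<le> (\<integral>\<^sup>+\<theta>. angular_sup V r * indicator {0..2*pi} \<theta> \<partial>lborel)"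
      by (rule nn_integral_mono_AE)
    also have "\<dots> = ennreal (2 * pi) * angular_sup V r" by (simp add: nn_integral_cmult_indicator mult.commute)
    finally show ?thesis .
  qed
  then have "(\<integral>\<^sup>+x. ennreal (V x) \<partial>lborel) \<le> (\<integral>\<^sup>+r. ennreal (2 * pi) * (angular_sup V r * ennreal r * indicator {0<..} r) \<partial>lborel)"
    by (subst nn_integral_polar, measurable) (intro nn_integral_mono, simp add: ac_simps indicator_def mult_left_mono)
  also have "\<dots> = ennreal (2 * pi) * radial_mass V"
    unfolding radial_mass_eq[OF V] by (rule nn_integral_cmult) measurable
  finally show ?thesis .
qed

text \<open>On almost every circle \<open>V'\<close> agrees almost everywhere with a constant, which
  is at most its integral over the angle because \<open>2 * pi \<ge> 1\<close>.\<close>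

lemma radial_mass_le_L1:
  assumes V' [measurable]: "V' \<in> borel_measurable borel" and nn: "\<And>x. 0 \<le> V' x" and eq: "AE x in lborel. V x = V' x"
    and rad: "radial V"
  shows "radial_mass V' \<le> L1_norm V"
proof -
  have "AE r in lborel. angular_sup V' r * ennreal r * indicator {0<..} r \<le>
      ennreal r * (\<integral>\<^sup>+\<theta>\<in>{0..2*pi}. ennreal (V' (polar r \<theta>)) \<partial>lborel) * indicator {0<..} r"
    using AE_polar[OF eq]
  proof eventually_elim
    case (elim r)
    show ?case
    proof (cases "0 < r")
      case True
      define v where "v = profile V r"
      have ae: "AE \<theta> in lborel. \<theta> \<in> {0..2*pi} \<longrightarrow> V' (polar r \<theta>) = v"
      proof -
        have "V (polar r \<theta>) = v" for \<theta> using radial_eq_profile[OF rad, of "polar r \<theta>"] True by (simp add: v_def)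
        moreover have "AE \<theta> in lborel. \<theta> \<in> {0..2*pi} \<longrightarrow> V (polar r \<theta>) = V' (polar r \<theta>)" using elim True by simp
        ultimately show ?thesis by simp (erule eventually_mono, simp)
      qed
      have "angular_sup V' r \<le> ennreal v"
        unfolding angular_sup_le_iff[OF V'] using ae by eventually_elim (metis abs_of_nonneg nn order_refl)
      also have "ennreal v \<le> ennreal v * ennreal (2 * pi)"
      proof -
        have "1 \<le> ennreal (2 * pi)" using pi_gt3 by (simp add: ennreal_1[symmetric] del: ennreal_1)
        from mult_left_mono[OF this, of "ennreal v"] show ?thesis by simp
      qed
      also have "\<dots> = (\<integral>\<^sup>+\<theta>. ennreal v * indicator {0..2*pi} \<theta> \<partial>lborel)" by (simp add: nn_integral_cmult_indicator)
      also have "\<dots> = (\<integral>\<^sup>+\<theta>\<in>{0..2*pi}. ennreal (V' (polar r \<theta>)) \<partial>lborel)"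
      proof (rule nn_integral_cong_AE)
        show "AE \<theta> in lborel. ennreal v * indicator {0..2*pi} \<theta> = ennreal (V' (polar r \<theta>)) * indicator {0..2*pi} \<theta>"
          using ae by eventually_elim (auto simp: indicator_def)
      qed
      finally show ?thesis using True by (simp add: mult.commute mult_left_mono)
    qed simp
  qed
  then have "radial_mass V' \<le> (\<integral>\<^sup>+r\<in>{0<..}. (ennreal r * (\<integral>\<^sup>+\<theta>\<in>{0..2*pi}. ennreal (V' (polar r \<theta>)) \<partial>lborel)) \<partial>lborel)"
    unfolding radial_mass_eq[OF V'] by (rule nn_integral_mono_AE)
  also have "\<dots> = (\<integral>\<^sup>+x. ennreal (V' x) \<partial>lborel)" by (rule nn_integral_polar[symmetric]) measurable
  also have "\<dots> = L1_norm V"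
    unfolding L1_norm_def nn_integral_completion
  proof (rule nn_integral_cong_AE)
    show "AE x in lborel. ennreal (V' x) = ennreal \<bar>V x\<bar>" using eq by eventually_elim (simp add: nn)
  qed
  finally show ?thesis .
qed

lemma schroedinger_form_cong_AE:
  assumes "AE x in lborel. V x = V' x"
  shows "schroedinger_form B V = schroedinger_form B V'"
proof (intro ext)
  fix u v
  show "schroedinger_form B V u v = schroedinger_form B V' u v"
    unfolding schroedinger_form_def
  proof (rule integral_lebesgue_AE_cong)
    show "AE x in lebesgue. (\<Sum>j\<in>UNIV. cnj (magnetic_grad (vector_potential B) j u x) * magnetic_grad (vector_potential B) j v x)
          - of_real (V x) * (cnj (u x) * v x) =
        (\<Sum>j\<in>UNIV. cnj (magnetic_grad (vector_potential B) j u x) * magnetic_grad (vector_potential B) j v x)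
          - of_real (V' x) * (cnj (u x) * v x)"
      using AE_completion[OF assms] by eventually_elim simp
  qed
qed

section \<open>The eigenvalue bound\<close>

theorem theorem3p9:
  fixes B :: "real^2 \<Rightarrow> real"
  assumes "radial B"
    and "\<not> (AE x in lebesgue. B x = 0)"
    and "set_integrable lebesgue {0<..} (\<lambda>r. (1 + r) * profile B r)"
    and "total_flux B \<in> \<int>"
  shows "\<exists>C\<^sub>2::real. 0 \<le> C\<^sub>2 \<and>
    (\<forall>V :: real^2 \<Rightarrow> real.
       V \<in> borel_measurable lebesgue \<and> (AE x in lebesgue. 0 \<le> V x) \<and>
       L1_norm (\<lambda>x. V x * ln (norm x)) < \<infinity> \<and> L1_Linfty_norm V < \<infinity> \<longrightarrow>
         closable_form test_functions (schroedinger_form B V) \<and>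
         num_eigenvalues_below (magnetic_schroedinger B V) 0
           \<le> ennreal C\<^sub>2 * (L1_norm (\<lambda>x. V x * ln (norm x)) + L1_Linfty_norm V) \<and>
         (radial V \<longrightarrow>
            num_eigenvalues_below (magnetic_schroedinger B V) 0
              \<le> ennreal C\<^sub>2 * (L1_norm (\<lambda>x. V x * ln (norm x)) + L1_norm V)))"
proof -
  obtain b where "radial_field B b" using radial_field_ex assms by blast
  then interpret rf: radial_field B b .
  have fm: "flux B \<in> borel_measurable borel" by (rule borel_measurable_continuous_onI[OF rf.flux_continuous])
  interpret magnetic_field B rf.M
    by unfold_locales (auto intro: fm rf.flux_le)
  have fc: "continuous_on UNIV (\<lambda>t. flux B (exp t))"
    by (rule continuous_on_compose2[OF rf.flux_continuous]) (auto intro!: continuous_intros)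
  obtain C where C: "0 \<le> C" and fb: "\<And>V W. V \<in> borel_measurable borel \<Longrightarrow> W \<in> borel_measurable borel \<Longrightarrow>
     (\<forall>t. AE \<theta> in lborel. \<theta> \<in> {0..2*pi} \<longrightarrow> V (polar (exp t) \<theta>) \<le> W t) \<Longrightarrow>
     (\<integral>\<^sup>+x. V x * ennreal (1 + \<bar>ln (norm x)\<bar>) \<partial>lborel) < \<infinity> \<Longrightarrow> (\<integral>\<^sup>+t. ennreal (exp (2 * t)) * W t \<partial>lborel) < \<infinity> \<Longrightarrow>
     (\<exists>S K. functional_bound B V S K \<and> ennreal (real (card S)) \<le> ennreal C *
       ((\<integral>\<^sup>+x. V x * ennreal (1 + \<bar>ln (norm x)\<bar>) \<partial>lborel) + (\<integral>\<^sup>+t. ennreal (exp (2 * t)) * W t \<partial>lborel)))"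
    using functional_bound_ex[OF fm fc rf.flux_bounded rf.flux_not_constant[OF assms(2)]] by blast
  \<comment> \<open>The integral with weight \<open>1 + |ln |x||\<close> contributes
    \<open>2 * pi\<close> times the radial mass, the angular supremum one more.\<close>
  define C2 where "C2 = C * (2 * pi + 1)"
  have C2: "0 \<le> C2" using C by (simp add: C2_def)
  have main: "closable_form test_functions (schroedinger_form B V) \<and>
      num_eigenvalues_below (magnetic_schroedinger B V) 0 \<le> ennreal C2 * (L1_norm (\<lambda>x. V x * ln (norm x)) + L1_Linfty_norm V) \<and>
      (radial V \<longrightarrow> num_eigenvalues_below (magnetic_schroedinger B V) 0 \<le> ennreal C2 * (L1_norm (\<lambda>x. V x * ln (norm x)) + L1_norm V))"
    if V: "V \<in> borel_measurable lebesgue" "AE x in lebesgue. 0 \<le> V x"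
      and fin: "L1_norm (\<lambda>x. V x * ln (norm x)) < \<infinity>" "L1_Linfty_norm V < \<infinity>" for V :: "real^2 \<Rightarrow> real"
  proof -
    \<comment> \<open>A Borel version leaves the form, and hence the operator, unchanged.\<close>
    obtain V' where V' [measurable]: "V' \<in> borel_measurable borel" and nn: "\<And>x. 0 \<le> V' x" and eq: "AE x in lborel. V x = V' x"
      using borel_version[OF V] by blast
    let ?X = "L1_norm (\<lambda>x. V x * ln (norm x))" and ?Y = "radial_mass V'"
    have Y: "?Y \<le> L1_Linfty_norm V" by (rule radial_mass_le_L1_Linfty[OF V' eq])
    then have Yfin: "?Y < \<infinity>" using fin(2) by (rule le_less_trans)
    let ?J = "\<lambda>V. \<integral>\<^sup>+x. ennreal (V x) * ennreal (1 + \<bar>ln (norm x)\<bar>) \<partial>lborel"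
    have I: "(\<integral>\<^sup>+x. ennreal (V' x) \<partial>lborel) \<le> ennreal (2 * pi) * ?Y" by (rule nn_integral_le_radial_mass[OF V' nn])
    have Ifin: "(\<integral>\<^sup>+x. ennreal (V' x) \<partial>lborel) < \<infinity>"
      using Yfin by (intro le_less_trans[OF I]) (simp add: ennreal_mult_less_top)
    have J: "?J V' \<le> ?X + ennreal (2 * pi) * ?Y"
    proof -
      have "?J V' = (\<integral>\<^sup>+x. ennreal (V' x) + ennreal \<bar>V' x * ln (norm x)\<bar> \<partial>lborel)"
        by (intro nn_integral_cong) (simp add: nn abs_mult distrib_left flip: ennreal_mult ennreal_plus)
      also have "\<dots> = (\<integral>\<^sup>+x. ennreal (V' x) \<partial>lborel) + (\<integral>\<^sup>+x. ennreal \<bar>V' x * ln (norm x)\<bar> \<partial>lborel)"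
        by (rule nn_integral_add) measurable
      also have "(\<integral>\<^sup>+x. ennreal \<bar>V' x * ln (norm x)\<bar> \<partial>lborel) = ?X"
        unfolding L1_norm_def nn_integral_completion
      proof (rule nn_integral_cong_AE)
        show "AE x in lborel. ennreal \<bar>V' x * ln (norm x)\<bar> = ennreal \<bar>V x * ln (norm x)\<bar>"
          using eq by eventually_elim simp
      qed
      finally show ?thesis using I by (simp add: add.commute add_left_mono)
    qed
    have Jfin: "?J V' < \<infinity>"
      using Yfin fin(1) by (intro le_less_trans[OF J]) (simp add: ennreal_mult_less_top)
    have bound: "\<forall>t. AE \<theta> in lborel. \<theta> \<in> {0..2*pi} \<longrightarrow> ennreal (V' (polar (exp t) \<theta>)) \<le> angular_sup V' (exp t)"
    proof
      fix t
      show "AE \<theta> in lborel. \<theta> \<in> {0..2*pi} \<longrightarrow> ennreal (V' (polar (exp t) \<theta>)) \<le> angular_sup V' (exp t)"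
        using angular_sup_le_iff[OF V', of "exp t" "angular_sup V' (exp t)"] by (simp add: nn)
    qed
    obtain S K where S: "functional_bound B (\<lambda>x. ennreal (V' x)) S K" "ennreal (real (card S)) \<le> ennreal C * (?J V' + ?Y)"
      using fb[of "\<lambda>x. ennreal (V' x)" "\<lambda>t. angular_sup V' (exp t)", OF _ _ bound Jfin] Yfin
      unfolding radial_mass_def by auto
    \<comment> \<open>For twice the potential only the existence of some \<open>S\<close> and
      \<open>K\<close> enters, to obtain the relative form bound.\<close>
    have "\<exists>S K. functional_bound B (\<lambda>x. ennreal (2 * V' x)) S K"
    proof -
      have J2: "?J (\<lambda>x. 2 * V' x) = 2 * ?J V'"
        by (subst nn_integral_cmult[symmetric]) (auto intro!: nn_integral_cong simp: ennreal_mult nn mult.assoc)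
      have Y2: "(\<integral>\<^sup>+t. ennreal (exp (2 * t)) * (2 * angular_sup V' (exp t)) \<partial>lborel) = 2 * ?Y"
        unfolding radial_mass_def by (subst nn_integral_cmult[symmetric]) (auto intro!: nn_integral_cong simp: mult.left_commute)
      have bound2: "\<forall>t. AE \<theta> in lborel. \<theta> \<in> {0..2*pi} \<longrightarrow> ennreal (2 * V' (polar (exp t) \<theta>)) \<le> 2 * angular_sup V' (exp t)"
      proof
        fix t
        show "AE \<theta> in lborel. \<theta> \<in> {0..2*pi} \<longrightarrow> ennreal (2 * V' (polar (exp t) \<theta>)) \<le> 2 * angular_sup V' (exp t)"
          using bound[rule_format, of t] by eventually_elim (auto simp: ennreal_mult nn intro!: mult_left_mono)
      qed
      have "?J (\<lambda>x. 2 * V' x) < \<infinity>" "(\<integral>\<^sup>+t. ennreal (exp (2 * t)) * (2 * angular_sup V' (exp t)) \<partial>lborel) < \<infinity>"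
        unfolding J2 Y2 using Jfin Yfin by (simp_all add: ennreal_mult_less_top)
      then show ?thesis
        using fb[of "\<lambda>x. ennreal (2 * V' x)" "\<lambda>t. 2 * angular_sup V' (exp t)", OF _ _ bound2] by auto
    qed
    then obtain S2 K2 where S2: "functional_bound B (\<lambda>x. ennreal (2 * V' x)) S2 K2" by blast
    interpret schroedinger B rf.M V' by unfold_locales (use V' nn Ifin in auto)
    obtain C' where "relatively_bounded B rf.M V' C'" using relatively_bounded_ex[OF S2] by blast
    then interpret relatively_bounded B rf.M V' C' .
    have form: "schroedinger_form B V = schroedinger_form B V'" by (rule schroedinger_form_cong_AE[OF eq])
    have op: "magnetic_schroedinger B V = magnetic_schroedinger B V'" by (simp add: magnetic_schroedinger_def form)
    have N: "num_eigenvalues_below (magnetic_schroedinger B V) 0 \<le> ennreal C2 * (?X + ?Y)"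
    proof -
      have "num_eigenvalues_below (magnetic_schroedinger B V) 0 \<le> ennreal (real (card S))"
        unfolding op using num_eigenvalues_le_card[OF S(1)] by (simp add: ennreal_of_nat_eq_real_of_nat)
      also have "\<dots> \<le> ennreal C * (?J V' + ?Y)" by (rule S(2))
      also have "\<dots> \<le> ennreal C * ((?X + ennreal (2 * pi) * ?Y) + ?Y)"
        by (intro mult_left_mono add_right_mono J) auto
      also have "\<dots> \<le> ennreal C * (ennreal (2 * pi + 1) * (?X + ?Y))"
      proof (intro mult_left_mono)
        have "?X \<le> ennreal (2 * pi + 1) * ?X"
          using mult_right_mono[of 1 "ennreal (2 * pi + 1)" ?X] by (simp del: ennreal_plus)
        moreover have "ennreal (2 * pi) * ?Y + ?Y = ennreal (2 * pi + 1) * ?Y"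
          by (simp add: distrib_right)
        ultimately show "(?X + ennreal (2 * pi) * ?Y) + ?Y \<le> ennreal (2 * pi + 1) * (?X + ?Y)"
          by (simp only: add.assoc distrib_left add_right_mono)
      qed auto
      also have "\<dots> = ennreal C2 * (?X + ?Y)"
        using C by (simp add: C2_def ennreal_mult mult.assoc del: ennreal_plus)
      finally show ?thesis .
    qed
    show ?thesis
    proof (intro conjI impI)
      show "closable_form test_functions (schroedinger_form B V)" unfolding form by (rule closable)
      show "num_eigenvalues_below (magnetic_schroedinger B V) 0 \<le> ennreal C2 * (?X + L1_Linfty_norm V)"
        by (rule order_trans[OF N]) (intro mult_left_mono add_left_mono Y, simp)
      show "num_eigenvalues_below (magnetic_schroedinger B V) 0 \<le> ennreal C2 * (?X + L1_norm V)" if "radial V"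
        by (rule order_trans[OF N]) (intro mult_left_mono add_left_mono radial_mass_le_L1[OF V' nn eq that], simp)
    qed
  qed
  then show ?thesis using C2 by blast
qed

end
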